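(* Let $\Lambda$ be a basic and connected Nakayama algebra with Jacobson radical $r$ satisfying $r^2=0$, and suppose that $\Lambda$ is not self-injective local (i.e. not both self-injective and local). Let $n$ be the number of isomorphism classes of simple $\Lambda$-modules. Then: (1) Every indecomposable $\Lambda$-module $M$ is $\tau$-rigid. (2) Every (basic) $\tau$-tilting $\Lambda$-module $T$ is of the form $$S_1\oplus S_2\oplus\cdots\oplus S_t\oplus \bigl(\Lambda/P_0(\tau(S_1\oplus\cdots\oplus S_t))\bigr),$$ where $t$ is an integer with $0\le t\le \mathrm{int}(n/2)$ and $S_j$ is a simple $\Lambda$-module for each $1\le j\le t$.
   Context: All algebras are basic connected non-semisimple Artin algebras over a commutative Artin ring, and all modules are finitely generated left modules. $\tau$ denotes the Auslander-Reiten translation, and $P_0(X)$ denotes the projective cover of a module $X$. A $\Lambda$-module $M$ is $\tau$-rigid if $\mathrm{Hom}_\Lambda(M,\tau M)=0$. A $\Lambda$-module $N$ is $\tau$-tilting if it is $\tau$-rigid and $|N|=|\Lambda|$, where $|N|$ is the number of pairwise non-isomorphic indecomposable direct summands of $N$. $\tau$-tilting modules are considered up to isomorphism and multiplicity of summands, i.e. they are taken to be basic. For a real number $m$, $\mathrm{int}(m)$ is the largest integer less than or equal to $m$. For a projective module $P$ isomorphic to a direct summand of $\Lambda$, $\Lambda/P$ denotes the complementary summand, i.e. the module $Q$ (unique up to isomorphism) with $\Lambda\cong P\oplus Q$ as left modules; for $t=0$ the form is $T\cong\Lambda$. *)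

theory Defs
  imports Complex_Main "HOL-Algebra.Module" "HOL-Algebra.Chinese_Remainder"
begin

section \<open>Left modules over a not necessarily commutative ring\<close>

text \<open>
  The locale \<^locale>\<open>module\<close> of HOL-Algebra requires a commutative ring of scalars. The records
  \<^typ>\<open>('a, 'b) module\<close> and the locale \<^locale>\<open>submodule\<close> do not, and are reused here.
  The fields \<open>mult\<close> and \<open>one\<close> of a module record carry no information.
\<close>

locale left_module = R?: ring R + M?: abelian_group M
  for R :: "('a, 'm) ring_scheme" (structure) and M :: "('a, 'b) module" (structure) +
  assumes smult_closed [simp, intro]:
      "\<lbrakk>a \<in> carrier R; x \<in> carrier M\<rbrakk> \<Longrightarrow> a \<odot>\<^bsub>M\<^esub> x \<in> carrier M"
    and smult_l_distr:
      "\<lbrakk>a \<in> carrier R; b \<in> carrier R; x \<in> carrier M\<rbrakk> \<Longrightarrow>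
        (a \<oplus> b) \<odot>\<^bsub>M\<^esub> x = a \<odot>\<^bsub>M\<^esub> x \<oplus>\<^bsub>M\<^esub> b \<odot>\<^bsub>M\<^esub> x"
    and smult_r_distr:
      "\<lbrakk>a \<in> carrier R; x \<in> carrier M; y \<in> carrier M\<rbrakk> \<Longrightarrow>
        a \<odot>\<^bsub>M\<^esub> (x \<oplus>\<^bsub>M\<^esub> y) = a \<odot>\<^bsub>M\<^esub> x \<oplus>\<^bsub>M\<^esub> a \<odot>\<^bsub>M\<^esub> y"
    and smult_assoc1:
      "\<lbrakk>a \<in> carrier R; b \<in> carrier R; x \<in> carrier M\<rbrakk> \<Longrightarrow>
        (a \<otimes> b) \<odot>\<^bsub>M\<^esub> x = a \<odot>\<^bsub>M\<^esub> (b \<odot>\<^bsub>M\<^esub> x)"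
    and smult_one [simp]: "x \<in> carrier M \<Longrightarrow> \<one> \<odot>\<^bsub>M\<^esub> x = x"

definition mod_hom ::
    "('a, 'm) ring_scheme \<Rightarrow> ('a, 'b) module \<Rightarrow> ('a, 'c) module \<Rightarrow> ('b \<Rightarrow> 'c) set" where
  "mod_hom R M N = {f \<in> carrier M \<rightarrow> carrier N.
     (\<forall>x\<in>carrier M. \<forall>y\<in>carrier M. f (x \<oplus>\<^bsub>M\<^esub> y) = f x \<oplus>\<^bsub>N\<^esub> f y) \<and>
     (\<forall>r\<in>carrier R. \<forall>x\<in>carrier M. f (r \<odot>\<^bsub>M\<^esub> x) = r \<odot>\<^bsub>N\<^esub> f x)}"

definition mod_iso ::
    "('a, 'm) ring_scheme \<Rightarrow> ('a, 'b) module \<Rightarrow> ('a, 'c) module \<Rightarrow> bool" where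
  "mod_iso R M N \<longleftrightarrow> (\<exists>f\<in>mod_hom R M N. bij_betw f (carrier M) (carrier N))"

definition fg_module :: "('a, 'm) ring_scheme \<Rightarrow> ('a, 'b) module \<Rightarrow> bool" where
  "fg_module R M \<longleftrightarrow> left_module R M \<and>
     (\<exists>A. finite A \<and> A \<subseteq> carrier M \<and> (\<forall>N. submodule N R M \<and> A \<subseteq> N \<longrightarrow> N = carrier M))"

abbreviation sub_mod :: "('a, 'b) module \<Rightarrow> 'b set \<Rightarrow> ('a, 'b) module" where
  "sub_mod M N \<equiv> M\<lparr>carrier := N\<rparr>"

definition regular_module :: "('a, 'm) ring_scheme \<Rightarrow> ('a, 'a) module" where
  "regular_module R = \<lparr>carrier = carrier R, mult = mult R, one = \<one>\<^bsub>R\<^esub>,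
     zero = \<zero>\<^bsub>R\<^esub>, add = add R, smult = mult R\<rparr>"

definition opp_ring :: "('a, 'm) ring_scheme \<Rightarrow> ('a, 'm) ring_scheme" where
  "opp_ring R = R\<lparr>mult := (\<lambda>x y. y \<otimes>\<^bsub>R\<^esub> x)\<rparr>"

definition restrict_scalars :: "('k \<Rightarrow> 'a) \<Rightarrow> ('a, 'b) module \<Rightarrow> ('k, 'b) module" where
  "restrict_scalars \<phi> M = \<lparr>carrier = carrier M, mult = mult M, one = \<one>\<^bsub>M\<^esub>,
     zero = \<zero>\<^bsub>M\<^esub>, add = add M, smult = (\<lambda>c x. \<phi> c \<odot>\<^bsub>M\<^esub> x)\<rparr>"

definition quotient_module :: "('a, 'b) module \<Rightarrow> 'b set \<Rightarrow> ('a, 'b set) module" where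
  "quotient_module M N = \<lparr>carrier = a_rcosets\<^bsub>M\<^esub> N, mult = undefined, one = undefined,
     zero = N, add = set_add M,
     smult = (\<lambda>r X. \<Union>x\<in>X. (N +>\<^bsub>M\<^esub> (r \<odot>\<^bsub>M\<^esub> x)))\<rparr>"

definition mod_prod :: "('a, 'b) module \<Rightarrow> ('a, 'c) module \<Rightarrow> ('a, 'b \<times> 'c) module" where
  "mod_prod M N = \<lparr>carrier = carrier M \<times> carrier N, mult = undefined, one = undefined,
     zero = (\<zero>\<^bsub>M\<^esub>, \<zero>\<^bsub>N\<^esub>),
     add = (\<lambda>(x, y) (x', y'). (x \<oplus>\<^bsub>M\<^esub> x', y \<oplus>\<^bsub>N\<^esub> y')),
     smult = (\<lambda>r (x, y). (r \<odot>\<^bsub>M\<^esub> x, r \<odot>\<^bsub>N\<^esub> y))\<rparr>"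

text \<open>The direct sum of a family; it is only used for finite \<open>I\<close>.\<close>

definition mod_sum :: "'i set \<Rightarrow> ('i \<Rightarrow> ('a, 'b) module) \<Rightarrow> ('a, 'i \<Rightarrow> 'b) module" where
  "mod_sum I S = \<lparr>carrier = (\<Pi>\<^sub>E i\<in>I. carrier (S i)), mult = undefined, one = undefined,
     zero = (\<lambda>i\<in>I. \<zero>\<^bsub>S i\<^esub>),
     add = (\<lambda>x y. \<lambda>i\<in>I. x i \<oplus>\<^bsub>S i\<^esub> y i),
     smult = (\<lambda>r x. \<lambda>i\<in>I. r \<odot>\<^bsub>S i\<^esub> x i)\<rparr>"

lemma left_moduleI:
  fixes R (structure) and M (structure)
  assumes "ring R" "abelian_group M"
    and "\<And>a x. \<lbrakk>a \<in> carrier R; x \<in> carrier M\<rbrakk> \<Longrightarrow> a \<odot>\<^bsub>M\<^esub> x \<in> carrier M"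
    and "\<And>a b x. \<lbrakk>a \<in> carrier R; b \<in> carrier R; x \<in> carrier M\<rbrakk> \<Longrightarrow>
        (a \<oplus> b) \<odot>\<^bsub>M\<^esub> x = a \<odot>\<^bsub>M\<^esub> x \<oplus>\<^bsub>M\<^esub> b \<odot>\<^bsub>M\<^esub> x"
    and "\<And>a x y. \<lbrakk>a \<in> carrier R; x \<in> carrier M; y \<in> carrier M\<rbrakk> \<Longrightarrow>
        a \<odot>\<^bsub>M\<^esub> (x \<oplus>\<^bsub>M\<^esub> y) = a \<odot>\<^bsub>M\<^esub> x \<oplus>\<^bsub>M\<^esub> a \<odot>\<^bsub>M\<^esub> y"
    and "\<And>a b x. \<lbrakk>a \<in> carrier R; b \<in> carrier R; x \<in> carrier M\<rbrakk> \<Longrightarrow>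
        (a \<otimes> b) \<odot>\<^bsub>M\<^esub> x = a \<odot>\<^bsub>M\<^esub> (b \<odot>\<^bsub>M\<^esub> x)"
    and "\<And>x. x \<in> carrier M \<Longrightarrow> \<one> \<odot>\<^bsub>M\<^esub> x = x"
  shows "left_module R M"
  using assms by (intro left_module.intro left_module_axioms.intro) auto

context left_module
begin

lemma smult_l_null [simp]: "x \<in> carrier M \<Longrightarrow> \<zero> \<odot>\<^bsub>M\<^esub> x = \<zero>\<^bsub>M\<^esub>"
  using smult_l_distr[of \<zero> \<zero> x] M.add.r_cancel_one'[of "\<zero> \<odot>\<^bsub>M\<^esub> x" "\<zero> \<odot>\<^bsub>M\<^esub> x"] by simp

lemma smult_r_null [simp]: "a \<in> carrier R \<Longrightarrow> a \<odot>\<^bsub>M\<^esub> \<zero>\<^bsub>M\<^esub> = \<zero>\<^bsub>M\<^esub>"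
  using smult_r_distr[of a "\<zero>\<^bsub>M\<^esub>" "\<zero>\<^bsub>M\<^esub>"]
    M.add.r_cancel_one'[of "a \<odot>\<^bsub>M\<^esub> \<zero>\<^bsub>M\<^esub>" "a \<odot>\<^bsub>M\<^esub> \<zero>\<^bsub>M\<^esub>"] by simp

end

lemma opp_ring_simps [simp]:
  "carrier (opp_ring R) = carrier R" "add (opp_ring R) = add R"
  "\<zero>\<^bsub>opp_ring R\<^esub> = \<zero>\<^bsub>R\<^esub>" "\<one>\<^bsub>opp_ring R\<^esub> = \<one>\<^bsub>R\<^esub>"
  "x \<otimes>\<^bsub>opp_ring R\<^esub> y = y \<otimes>\<^bsub>R\<^esub> x"
  by (simp_all add: opp_ring_def)

lemma opp_opp_ring [simp]: "opp_ring (opp_ring R) = R"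
  by (simp add: opp_ring_def)

lemma ring_opp_ring:
  assumes "ring R" shows "ring (opp_ring R)"
proof -
  interpret ring R by fact
  show ?thesis
    by (rule ringI)
       (auto intro!: abelian_groupI monoidI simp: a_assoc a_comm a_lcomm m_assoc l_distr r_distr)
qed

lemma left_module_regular:
  assumes "ring R" shows "left_module R (regular_module R)"
proof -
  interpret ring R by fact
  show ?thesis
    by (rule left_moduleI)
       (auto intro!: abelian_groupI assms simp: regular_module_def a_assoc a_comm a_lcomm m_assoc l_distr r_distr)
qed

lemma left_module_quotient:
  assumes "left_module R M" "submodule N R M"
  shows "left_module R (quotient_module M N)"
proof -
  interpret left_module R M by fact
  interpret N: submodule N R M by fact
  interpret S: abelian_subgroup N M
    by (rule abelian_subgroupI3) (auto simp: additive_subgroup_def N.subgroup_axioms M.abelian_group_axioms)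
  interpret Q: comm_group "M A_Mod N" by (rule S.a_factorgroup_is_comm_group)
  have ab: "abelian_group (quotient_module M N)"
    using Q.m_closed Q.one_closed Q.m_assoc Q.m_comm Q.l_one Q.l_inv_ex
    by (intro abelian_groupI) (auto simp: A_FactGroup_def' quotient_module_def)
  have sm: "(\<Union>y\<in>N +>\<^bsub>M\<^esub> x. (N +>\<^bsub>M\<^esub> (a \<odot>\<^bsub>M\<^esub> y))) = N +>\<^bsub>M\<^esub> (a \<odot>\<^bsub>M\<^esub> x)"
    if "a \<in> carrier R" "x \<in> carrier M" for a x
  proof -
    have "N +>\<^bsub>M\<^esub> (a \<odot>\<^bsub>M\<^esub> y) = N +>\<^bsub>M\<^esub> (a \<odot>\<^bsub>M\<^esub> x)" if y: "y \<in> N +>\<^bsub>M\<^esub> x" for y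
    proof -
      obtain h where h: "h \<in> N" "y = h \<oplus>\<^bsub>M\<^esub> x"
        using y by (auto simp: a_r_coset_def')
      have hM: "h \<in> carrier M" using h N.subset by auto
      have "a \<odot>\<^bsub>M\<^esub> y = a \<odot>\<^bsub>M\<^esub> h \<oplus>\<^bsub>M\<^esub> a \<odot>\<^bsub>M\<^esub> x"
        using h hM \<open>a \<in> carrier R\<close> \<open>x \<in> carrier M\<close> by (simp add: smult_r_distr)
      then have "a \<odot>\<^bsub>M\<^esub> y \<in> N +>\<^bsub>M\<^esub> (a \<odot>\<^bsub>M\<^esub> x)"
        using h \<open>a \<in> carrier R\<close> by (auto simp: a_r_coset_def')
      then show ?thesis
        using \<open>a \<in> carrier R\<close> \<open>x \<in> carrier M\<close> S.a_repr_independence' by simp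
    qed
    moreover have "x \<in> N +>\<^bsub>M\<^esub> x" using that S.a_rcos_self by blast
    ultimately show ?thesis by blast
  qed
  have car: "carrier (quotient_module M N) = (\<lambda>x. N +>\<^bsub>M\<^esub> x) ` carrier M"
    by (auto simp: quotient_module_def A_RCOSETS_def')
  have add: "(N +>\<^bsub>M\<^esub> x) \<oplus>\<^bsub>quotient_module M N\<^esub> (N +>\<^bsub>M\<^esub> y) = N +>\<^bsub>M\<^esub> (x \<oplus>\<^bsub>M\<^esub> y)"
    if "x \<in> carrier M" "y \<in> carrier M" for x y
    using that S.a_rcos_sum by (simp add: quotient_module_def)
  have smult: "a \<odot>\<^bsub>quotient_module M N\<^esub> (N +>\<^bsub>M\<^esub> x) = N +>\<^bsub>M\<^esub> (a \<odot>\<^bsub>M\<^esub> x)"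
    if "a \<in> carrier R" "x \<in> carrier M" for a x
    using sm[OF that] by (simp add: quotient_module_def)
  show ?thesis
    by (rule left_moduleI)
       (auto simp: ab R.ring_axioms car add smult smult_l_distr smult_r_distr smult_assoc1)
qed



section \<open>Decompositions, simple modules, radical\<close>

definition internal_direct_sum ::
    "('a, 'm) ring_scheme \<Rightarrow> ('a, 'b) module \<Rightarrow> 'i set \<Rightarrow> ('i \<Rightarrow> 'b set) \<Rightarrow> bool" where
  "internal_direct_sum R M I H \<longleftrightarrow> finite I \<and> (\<forall>i\<in>I. submodule (H i) R M) \<and>
     (\<forall>x\<in>carrier M. \<exists>!c. c \<in> (\<Pi>\<^sub>E i\<in>I. H i) \<and> x = finsum M c I)"

definition complementary ::
    "('a, 'm) ring_scheme \<Rightarrow> ('a, 'b) module \<Rightarrow> 'b set \<Rightarrow> 'b set \<Rightarrow> bool" where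
  "complementary R M X Y \<longleftrightarrow> submodule X R M \<and> submodule Y R M \<and>
     X \<inter> Y = {\<zero>\<^bsub>M\<^esub>} \<and> X <+>\<^bsub>M\<^esub> Y = carrier M"

definition direct_summand ::
    "('a, 'm) ring_scheme \<Rightarrow> ('a, 'b) module \<Rightarrow> 'b set \<Rightarrow> bool" where
  "direct_summand R M X \<longleftrightarrow> (\<exists>Y. complementary R M X Y)"

definition indecomposable_module :: "('a, 'm) ring_scheme \<Rightarrow> ('a, 'b) module \<Rightarrow> bool" where
  "indecomposable_module R M \<longleftrightarrow> left_module R M \<and> carrier M \<noteq> {\<zero>\<^bsub>M\<^esub>} \<and>
     (\<forall>X Y. complementary R M X Y \<longrightarrow> X = {\<zero>\<^bsub>M\<^esub>} \<or> Y = {\<zero>\<^bsub>M\<^esub>})"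

definition simple_module :: "('a, 'm) ring_scheme \<Rightarrow> ('a, 'b) module \<Rightarrow> bool" where
  "simple_module R M \<longleftrightarrow> left_module R M \<and> carrier M \<noteq> {\<zero>\<^bsub>M\<^esub>} \<and>
     (\<forall>X. submodule X R M \<longrightarrow> X = {\<zero>\<^bsub>M\<^esub>} \<or> X = carrier M)"

definition semisimple_module :: "('a, 'm) ring_scheme \<Rightarrow> ('a, 'b) module \<Rightarrow> bool" where
  "semisimple_module R M \<longleftrightarrow> left_module R M \<and>
     (\<exists>(n::nat) H. internal_direct_sum R M {..<n} H \<and> (\<forall>i<n. simple_module R (sub_mod M (H i))))"

definition uniserial_module :: "('a, 'm) ring_scheme \<Rightarrow> ('a, 'b) module \<Rightarrow> bool" where
  "uniserial_module R M \<longleftrightarrow> left_module R M \<and>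
     (\<forall>X Y. submodule X R M \<longrightarrow> submodule Y R M \<longrightarrow> X \<subseteq> Y \<or> Y \<subseteq> X)"

definition basic_module :: "('a, 'm) ring_scheme \<Rightarrow> ('a, 'b) module \<Rightarrow> bool" where
  "basic_module R M \<longleftrightarrow> left_module R M \<and>
     (\<exists>(n::nat) H. internal_direct_sum R M {..<n} H \<and>
        (\<forall>i<n. indecomposable_module R (sub_mod M (H i))) \<and>
        (\<forall>i<n. \<forall>j<n. i \<noteq> j \<longrightarrow> \<not> mod_iso R (sub_mod M (H i)) (sub_mod M (H j))))"

definition num_summands :: "('a, 'm) ring_scheme \<Rightarrow> ('a, 'b) module \<Rightarrow> nat" where
  "num_summands R M =
     (let A = {X. direct_summand R M X \<and> indecomposable_module R (sub_mod M X)}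
      in card (A // {(X, Y). X \<in> A \<and> Y \<in> A \<and> mod_iso R (sub_mod M X) (sub_mod M Y)}))"

definition maximal_submodule :: "('a, 'm) ring_scheme \<Rightarrow> ('a, 'b) module \<Rightarrow> 'b set \<Rightarrow> bool" where
  "maximal_submodule R M N \<longleftrightarrow> submodule N R M \<and> N \<noteq> carrier M \<and>
     (\<forall>X. submodule X R M \<and> N \<subseteq> X \<longrightarrow> X = N \<or> X = carrier M)"

definition jacobson_radical :: "('a, 'm) ring_scheme \<Rightarrow> 'a set" where
  "jacobson_radical R = carrier R \<inter> \<Inter>{N. maximal_submodule R (regular_module R) N}"


section \<open>Representatives of finitely generated modules\<close>

type_synonym 'a fg_mod = "('a, nat \<Rightarrow> 'a) module"

definition image_module :: "('b \<Rightarrow> 'c) \<Rightarrow> ('a, 'b) module \<Rightarrow> ('a, 'c) module" where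
  "image_module e M = (let i = inv_into (carrier M) e in
     \<lparr>carrier = e ` carrier M, mult = undefined, one = undefined, zero = e \<zero>\<^bsub>M\<^esub>,
      add = (\<lambda>x y. e (i x \<oplus>\<^bsub>M\<^esub> i y)), smult = (\<lambda>r x. e (r \<odot>\<^bsub>M\<^esub> i x))\<rparr>)"

lemma image_module:
  assumes M: "left_module R M" and e: "inj_on e (carrier M)"
  shows "left_module R (image_module e M)" "e \<in> mod_hom R M (image_module e M)"
    "bij_betw e (carrier M) (carrier (image_module e M))"
proof -
  interpret left_module R M by fact
  note s = image_module_def Let_def inv_into_f_f[OF e]
  show bij: "bij_betw e (carrier M) (carrier (image_module e M))"
    using e by (auto simp: s bij_betw_def)
  show "e \<in> mod_hom R M (image_module e M)" by (auto simp: mod_hom_def s)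
  have "abelian_group (image_module e M)"
  proof (rule abelian_groupI)
    show "\<exists>y\<in>carrier (image_module e M). y \<oplus>\<^bsub>image_module e M\<^esub> x = \<zero>\<^bsub>image_module e M\<^esub>"
      if x: "x \<in> carrier (image_module e M)" for x
    proof -
      obtain u where u: "u \<in> carrier M" "x = e u"
        using x by (auto simp: image_module_def Let_def)
      then show ?thesis
        by (intro bexI[of _ "e (\<ominus>\<^bsub>M\<^esub> u)"]) (auto simp: s M.l_neg)
    qed
  qed (auto simp: s M.a_ac)
  then show "left_module R (image_module e M)"
    by (intro left_moduleI R.ring_axioms) (auto simp: s smult_l_distr smult_r_distr smult_assoc1)
qed

lemma fg_image_module:
  assumes M: "fg_module R M" and e: "inj_on e (carrier M)"
  shows "fg_module R (image_module e M)"
proof -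
  interpret left_module R M using M by (simp add: fg_module_def)
  note im = image_module[OF left_module_axioms e]
  interpret I: left_module R "image_module e M" by (rule im)
  obtain A where A: "finite A" "A \<subseteq> carrier M"
    "\<And>N. submodule N R M \<Longrightarrow> A \<subseteq> N \<Longrightarrow> N = carrier M"
    using M by (auto simp: fg_module_def)
  have car: "carrier (image_module e M) = e ` carrier M" by (simp add: image_module_def Let_def)
  have hom: "e (x \<oplus>\<^bsub>M\<^esub> y) = e x \<oplus>\<^bsub>image_module e M\<^esub> e y" if "x \<in> carrier M" "y \<in> carrier M" for x y
    using im(2) that by (simp add: mod_hom_def)
  have smul: "e (r \<odot>\<^bsub>M\<^esub> x) = r \<odot>\<^bsub>image_module e M\<^esub> e x" if "r \<in> carrier R" "x \<in> carrier M" for r x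
    using im(2) that by (simp add: mod_hom_def)
  have zero: "e \<zero>\<^bsub>M\<^esub> = \<zero>\<^bsub>image_module e M\<^esub>" by (simp add: image_module_def Let_def)
  have "N = carrier (image_module e M)" if N: "submodule N R (image_module e M)" and AN: "e ` A \<subseteq> N" for N
  proof -
    interpret N: submodule N R "image_module e M" by fact
    let ?N = "{x \<in> carrier M. e x \<in> N}"
    have inv: "e (\<ominus>\<^bsub>M\<^esub> x) \<in> N" if "x \<in> carrier M" "e x \<in> N" for x
    proof -
      have "e (\<ominus>\<^bsub>M\<^esub> x) \<oplus>\<^bsub>image_module e M\<^esub> e x = \<zero>\<^bsub>image_module e M\<^esub>"
        using that by (simp add: hom[symmetric] M.l_neg zero)
      then have "e (\<ominus>\<^bsub>M\<^esub> x) = \<ominus>\<^bsub>image_module e M\<^esub> e x"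
        using that by (intro I.M.minus_equality[symmetric]) (auto simp: car)
      then show ?thesis using N.m_inv_closed that by (simp add: a_inv_def)
    qed
    have "submodule ?N R M"
      using inv N.one_closed N.m_closed N.smult_closed
      by unfold_locales (auto simp: hom smul zero a_inv_def)
    then have "?N = carrier M" using A AN by blast
    then show ?thesis using N.subset car by auto
  qed
  then show ?thesis
    unfolding fg_module_def using im(1) A(1,2) car by (intro conjI exI[of _ "e ` A"]) auto
qed

lemma fg_module_representative:
  fixes M :: "('a, 'b) module"
  assumes "fg_module R M"
  shows "\<exists>N :: 'a fg_mod. fg_module R N \<and> mod_iso R M N"
proof -
  interpret left_module R M using assms by (simp add: fg_module_def)
  obtain A where A: "finite A" "A \<subseteq> carrier M"
    "\<And>N. submodule N R M \<Longrightarrow> A \<subseteq> N \<Longrightarrow> N = carrier M"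
    using assms by (auto simp: fg_module_def)
  obtain g :: "nat \<Rightarrow> 'b" and n where g: "A = g ` {..<n}"
    using finite_imp_nat_seg_image_inj_on[OF A(1)] by (auto simp: lessThan_def)
  have gM: "g i \<in> carrier M" if "i < n" for i using that g A(2) by auto
  define lc where "lc c = (\<Oplus>\<^bsub>M\<^esub>i\<in>{..<n}. c i \<odot>\<^bsub>M\<^esub> g i)" for c :: "nat \<Rightarrow> 'a"
  let ?C = "UNIV \<rightarrow> carrier R :: (nat \<Rightarrow> 'a) set"
  have Cmem: "c i \<in> carrier R" if "c \<in> ?C" for c i using that by auto
  note z = smult_l_null
  have lc_add: "lc c \<oplus>\<^bsub>M\<^esub> lc d = lc (\<lambda>i. c i \<oplus>\<^bsub>R\<^esub> d i)" if "c \<in> ?C" "d \<in> ?C" for c d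
  proof -
    have "lc (\<lambda>i. c i \<oplus>\<^bsub>R\<^esub> d i) = (\<Oplus>\<^bsub>M\<^esub>i\<in>{..<n}. c i \<odot>\<^bsub>M\<^esub> g i \<oplus>\<^bsub>M\<^esub> d i \<odot>\<^bsub>M\<^esub> g i)"
      unfolding lc_def using that gM Cmem by (intro M.finsum_cong') (auto simp: smult_l_distr)
    also have "\<dots> = lc c \<oplus>\<^bsub>M\<^esub> lc d"
      unfolding lc_def using that gM Cmem by (intro M.finsum_addf) auto
    finally show ?thesis by simp
  qed
  have lc_closed: "lc c \<in> carrier M" if "c \<in> ?C" for c
    unfolding lc_def using that gM Cmem by (intro M.finsum_closed) auto
  have lc_zero: "lc (\<lambda>i. \<zero>\<^bsub>R\<^esub>) = \<zero>\<^bsub>M\<^esub>"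
    unfolding lc_def using gM z by (intro M.add.finprod_one_eqI) auto
  have lc_smult: "r \<odot>\<^bsub>M\<^esub> lc c = lc (\<lambda>i. r \<otimes>\<^bsub>R\<^esub> c i)" if "r \<in> carrier R" "c \<in> ?C" for r c
  proof -
    have "r \<odot>\<^bsub>M\<^esub> (\<Oplus>\<^bsub>M\<^esub>i\<in>B. c i \<odot>\<^bsub>M\<^esub> g i) = (\<Oplus>\<^bsub>M\<^esub>i\<in>B. (r \<otimes>\<^bsub>R\<^esub> c i) \<odot>\<^bsub>M\<^esub> g i)"
      if "finite B" "B \<subseteq> {..<n}" for B
      using that
    proof (induction B)
      case empty
      then show ?case using \<open>r \<in> carrier R\<close> by (simp add: smult_r_null)
    next
      case (insert j B)
      have j: "c j \<in> carrier R" "g j \<in> carrier M" and B: "\<And>i. i \<in> B \<Longrightarrow> g i \<in> carrier M"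
        using insert.prems \<open>c \<in> ?C\<close> gM Cmem by auto
      have 1: "(\<Oplus>\<^bsub>M\<^esub>i\<in>insert j B. d i \<odot>\<^bsub>M\<^esub> g i) = d j \<odot>\<^bsub>M\<^esub> g j \<oplus>\<^bsub>M\<^esub> (\<Oplus>\<^bsub>M\<^esub>i\<in>B. d i \<odot>\<^bsub>M\<^esub> g i)"
        if "d \<in> ?C" for d
        using insert.hyps j(2) B Cmem[OF that] by (intro M.finsum_insert) auto
      have 2: "(\<Oplus>\<^bsub>M\<^esub>i\<in>B. c i \<odot>\<^bsub>M\<^esub> g i) \<in> carrier M"
        using B Cmem[OF \<open>c \<in> ?C\<close>] by (intro M.finsum_closed) auto
      have 3: "(\<lambda>i. r \<otimes>\<^bsub>R\<^esub> c i) \<in> ?C" using \<open>r \<in> carrier R\<close> Cmem[OF \<open>c \<in> ?C\<close>] by auto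
      have IH: "r \<odot>\<^bsub>M\<^esub> (\<Oplus>\<^bsub>M\<^esub>i\<in>B. c i \<odot>\<^bsub>M\<^esub> g i) = (\<Oplus>\<^bsub>M\<^esub>i\<in>B. (r \<otimes>\<^bsub>R\<^esub> c i) \<odot>\<^bsub>M\<^esub> g i)"
        using insert by simp
      show ?case
        unfolding 1[OF \<open>c \<in> ?C\<close>] 1[OF 3] using \<open>r \<in> carrier R\<close> j 2 IH
        by (simp only: smult_r_distr smult_assoc1 smult_closed)
    qed
    then show ?thesis by (simp add: lc_def)
  qed
  have "submodule (lc ` ?C) R M"
  proof unfold_locales
    show "lc ` ?C \<subseteq> carrier (add_monoid M)" using lc_closed by auto
    show "\<one>\<^bsub>add_monoid M\<^esub> \<in> lc ` ?C" 
      using lc_zero by (auto intro!: image_eqI[of _ _ "\<lambda>i. \<zero>\<^bsub>R\<^esub>"])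
    show "x \<otimes>\<^bsub>add_monoid M\<^esub> y \<in> lc ` ?C" if xy: "x \<in> lc ` ?C" "y \<in> lc ` ?C" for x y
    proof -
      obtain c d where "c \<in> ?C" "d \<in> ?C" "x = lc c" "y = lc d" using xy by auto
      then show ?thesis using lc_add[of c d] by (auto intro!: image_eqI[of _ _ "\<lambda>i. c i \<oplus>\<^bsub>R\<^esub> d i"])
    qed
    show "inv\<^bsub>add_monoid M\<^esub> x \<in> lc ` ?C" if x: "x \<in> lc ` ?C" for x
    proof -
      obtain c where c: "c \<in> ?C" "x = lc c" using x by auto
      let ?d = "\<lambda>i. \<ominus>\<^bsub>R\<^esub> c i"
      have d: "?d \<in> ?C" using c Cmem by auto
      have "lc ?d \<oplus>\<^bsub>M\<^esub> lc c = lc (\<lambda>i. ?d i \<oplus>\<^bsub>R\<^esub> c i)" using lc_add c d by blast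
      also have "(\<lambda>i. ?d i \<oplus>\<^bsub>R\<^esub> c i) = (\<lambda>i. \<zero>\<^bsub>R\<^esub>)" using c Cmem by (auto simp: R.l_neg)
      finally have "lc ?d \<oplus>\<^bsub>M\<^esub> lc c = \<zero>\<^bsub>M\<^esub>" using lc_zero by simp
      then have "\<ominus>\<^bsub>M\<^esub> x = lc ?d" using c d lc_closed by (intro M.minus_equality) auto
      then show ?thesis using d by (auto simp: a_inv_def)
    qed
    show "a \<odot>\<^bsub>M\<^esub> x \<in> lc ` ?C" if a: "a \<in> carrier R" and x: "x \<in> lc ` ?C" for a x
    proof -
      obtain c where c: "c \<in> ?C" "x = lc c" using x by auto
      then show ?thesis
        using lc_smult[of a c] a by (auto intro!: image_eqI[of _ _ "\<lambda>i. a \<otimes>\<^bsub>R\<^esub> c i"])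
    qed
  qed
  moreover have "A \<subseteq> lc ` ?C"
  proof
    fix x assume "x \<in> A"
    then obtain j where j: "j < n" "x = g j" using g by auto
    let ?c = "\<lambda>i. if i = j then \<one>\<^bsub>R\<^esub> else \<zero>\<^bsub>R\<^esub>"
    have "lc ?c = (\<Oplus>\<^bsub>M\<^esub>i\<in>{..<n}. if j = i then g i else \<zero>\<^bsub>M\<^esub>)"
      unfolding lc_def using gM z by (intro M.finsum_cong') auto
    also have "\<dots> = g j"
      using M.add.finprod_singleton[of j "{..<n}" g] j gM by (auto simp: Pi_iff)
    finally show "x \<in> lc ` ?C" using j by (auto intro!: image_eqI[of _ _ ?c])
  qed
  ultimately have onto: "lc ` ?C = carrier M" using A(3) by blast
  define e where "e = inv_into ?C lc"
  have "inj_on e (carrier M)"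
    unfolding e_def using onto by (intro inj_on_inv_into) simp
  then have "fg_module R (image_module e M)" "mod_iso R M (image_module e M)"
    using fg_image_module[OF assms] image_module[OF left_module_axioms]
    unfolding mod_iso_def by blast+
  then show ?thesis by blast
qed


section \<open>Projective and injective modules\<close>

text \<open>
  Modules are finitely generated throughout, so projectivity and injectivity are tested on finitely
  generated modules. A definition cannot quantify over all types, so the test modules have their
  elements in \<^typ>\<open>nat \<Rightarrow> 'a\<close>. This is no restriction: by \<open>fg_module_representative\<close>,
  every finitely generated module is isomorphic to one of this kind. The same type is used below
  wherever modules are taken up to isomorphism.
\<close>

definition projective_module :: "('a, 'm) ring_scheme \<Rightarrow> ('a, 'b) module \<Rightarrow> bool" where
  "projective_module R P \<longleftrightarrow> fg_module R P \<and>
     (\<forall>(A :: 'a fg_mod) (B :: 'a fg_mod) g f.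
        fg_module R A \<and> fg_module R B \<and> g \<in> mod_hom R A B \<and> g ` carrier A = carrier B \<and>
        f \<in> mod_hom R P B \<longrightarrow>
        (\<exists>h\<in>mod_hom R P A. \<forall>x\<in>carrier P. g (h x) = f x))"

definition injective_module :: "('a, 'm) ring_scheme \<Rightarrow> ('a, 'b) module \<Rightarrow> bool" where
  "injective_module R E \<longleftrightarrow> fg_module R E \<and>
     (\<forall>(A :: 'a fg_mod) (B :: 'a fg_mod) i f.
        fg_module R A \<and> fg_module R B \<and> i \<in> mod_hom R A B \<and> inj_on i (carrier A) \<and>
        f \<in> mod_hom R A E \<longrightarrow>
        (\<exists>h\<in>mod_hom R B E. \<forall>x\<in>carrier A. h (i x) = f x))"

definition superfluous :: "('a, 'm) ring_scheme \<Rightarrow> ('a, 'b) module \<Rightarrow> 'b set \<Rightarrow> bool" where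
  "superfluous R M K \<longleftrightarrow> submodule K R M \<and>
     (\<forall>X. submodule X R M \<and> K <+>\<^bsub>M\<^esub> X = carrier M \<longrightarrow> X = carrier M)"

definition projective_cover ::
    "('a, 'm) ring_scheme \<Rightarrow> ('a, 'b) module \<Rightarrow> ('b \<Rightarrow> 'c) \<Rightarrow> ('a, 'c) module \<Rightarrow> bool" where
  "projective_cover R P p M \<longleftrightarrow> projective_module R P \<and> left_module R M \<and> p \<in> mod_hom R P M \<and>
     p ` carrier P = carrier M \<and> superfluous R P (a_kernel P M p)"

definition injective_envelope ::
    "('a, 'm) ring_scheme \<Rightarrow> ('a, 'b) module \<Rightarrow> ('b \<Rightarrow> 'c) \<Rightarrow> ('a, 'c) module \<Rightarrow> bool" where
  "injective_envelope R M i E \<longleftrightarrow> injective_module R E \<and> left_module R M \<and> i \<in> mod_hom R M E \<and>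
     inj_on i (carrier M) \<and>
     (\<forall>X. submodule X R E \<and> X \<inter> i ` carrier M = {\<zero>\<^bsub>E\<^esub>} \<longrightarrow> X = {\<zero>\<^bsub>E\<^esub>})"

definition minimal_projective_presentation ::
    "('a, 'm) ring_scheme \<Rightarrow> ('a, 'd) module \<Rightarrow> ('d \<Rightarrow> 'c) \<Rightarrow> ('a, 'c) module \<Rightarrow> ('c \<Rightarrow> 'b) \<Rightarrow>
      ('a, 'b) module \<Rightarrow> bool" where
  "minimal_projective_presentation R P1 d P0 p M \<longleftrightarrow>
     projective_cover R P0 p M \<and> projective_cover R P1 d (sub_mod P0 (a_kernel P0 M p))"


section \<open>Classes of rings\<close>

definition artinian_ring :: "('k, 'm) ring_scheme \<Rightarrow> bool" where
  "artinian_ring k \<longleftrightarrow> (\<forall>I :: nat \<Rightarrow> 'k set.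
     (\<forall>i. ideal (I i) k \<and> I (Suc i) \<subseteq> I i) \<longrightarrow> (\<exists>N. \<forall>i\<ge>N. I i = I N))"

text \<open>The map \<open>\<phi>\<close> is the structure map from the commutative Artin ring \<open>k\<close> to the centre.\<close>

definition artin_algebra ::
    "('k, 'm) ring_scheme \<Rightarrow> ('k \<Rightarrow> 'a) \<Rightarrow> ('a, 'n) ring_scheme \<Rightarrow> bool" where
  "artin_algebra k \<phi> R \<longleftrightarrow> cring k \<and> artinian_ring k \<and> ring R \<and> \<phi> \<in> ring_hom k R \<and>
     (\<forall>c\<in>carrier k. \<forall>x\<in>carrier R. \<phi> c \<otimes>\<^bsub>R\<^esub> x = x \<otimes>\<^bsub>R\<^esub> \<phi> c) \<and>
     fg_module k (restrict_scalars \<phi> (regular_module R))"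

definition basic_ring :: "('a, 'm) ring_scheme \<Rightarrow> bool" where
  "basic_ring R \<longleftrightarrow> basic_module R (regular_module R)"

text \<open>
  Both factors of a product decomposition of \<open>R\<close> embed in \<open>R\<close> as two-sided ideals, so it is
  enough to consider factors over the same type as \<open>R\<close>.
\<close>

definition connected_ring :: "('a, 'm) ring_scheme \<Rightarrow> bool" where
  "connected_ring R \<longleftrightarrow> carrier R \<noteq> {\<zero>\<^bsub>R\<^esub>} \<and>
     \<not> (\<exists>(A :: 'a ring) (B :: 'a ring). ring A \<and> ring B \<and>
           carrier A \<noteq> {\<zero>\<^bsub>A\<^esub>} \<and> carrier B \<noteq> {\<zero>\<^bsub>B\<^esub>} \<and> R \<simeq> RDirProd A B)"

definition semisimple_ring :: "('a, 'm) ring_scheme \<Rightarrow> bool" where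
  "semisimple_ring R \<longleftrightarrow> semisimple_module R (regular_module R)"

definition local_ring :: "('a, 'm) ring_scheme \<Rightarrow> bool" where
  "local_ring R \<longleftrightarrow> (\<exists>!N. maximal_submodule R (regular_module R) N)"

definition self_injective :: "('a, 'm) ring_scheme \<Rightarrow> bool" where
  "self_injective R \<longleftrightarrow> injective_module R (regular_module R)"

definition left_serial :: "('a, 'm) ring_scheme \<Rightarrow> bool" where
  "left_serial R \<longleftrightarrow> (\<forall>P :: 'a fg_mod.
     projective_module R P \<and> indecomposable_module R P \<longrightarrow> uniserial_module R P)"

text \<open>Right modules over \<open>R\<close> are left modules over the opposite ring.\<close>

definition nakayama :: "('a, 'm) ring_scheme \<Rightarrow> bool" where
  "nakayama R \<longleftrightarrow> left_serial R \<and> left_serial (opp_ring R)"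

definition num_simple_modules :: "('a, 'm) ring_scheme \<Rightarrow> nat" where
  "num_simple_modules R =
     (let A = {S :: 'a fg_mod. simple_module R S}
      in card (A // {(S, S'). S \<in> A \<and> S' \<in> A \<and> mod_iso R S S'}))"


section \<open>The Auslander-Reiten translation\<close>

text \<open>The right \<open>R\<close>-module \<open>Hom\<^sub>R(P, R)\<close>, as a left module over the opposite ring.\<close>

definition star_module :: "('a, 'm) ring_scheme \<Rightarrow> ('a, 'b) module \<Rightarrow> ('a, 'b \<Rightarrow> 'a) module" where
  "star_module R P = \<lparr>carrier = mod_hom R P (regular_module R) \<inter> extensional (carrier P),
     mult = undefined, one = undefined,
     zero = (\<lambda>x\<in>carrier P. \<zero>\<^bsub>R\<^esub>),
     add = (\<lambda>f g. \<lambda>x\<in>carrier P. f x \<oplus>\<^bsub>R\<^esub> g x),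
     smult = (\<lambda>r f. \<lambda>x\<in>carrier P. f x \<otimes>\<^bsub>R\<^esub> r)\<rparr>"

text \<open>The cokernel of \<open>Hom\<^sub>R(d, R) : Hom\<^sub>R(P0, R) \<rightarrow> Hom\<^sub>R(P1, R)\<close> for \<open>d : P1 \<rightarrow> P0\<close>.\<close>

definition transpose_module ::
    "('a, 'm) ring_scheme \<Rightarrow> ('a, 'd) module \<Rightarrow> ('d \<Rightarrow> 'c) \<Rightarrow> ('a, 'c) module \<Rightarrow>
      ('a, ('d \<Rightarrow> 'a) set) module" where
  "transpose_module R P1 d P0 = quotient_module (star_module R P1)
     ((\<lambda>f. compose (carrier P1) f d) ` carrier (star_module R P0))"

text \<open>
  The dual \<open>Hom\<^sub>k(X, E)\<close> of a module \<open>X\<close> over the opposite of an algebra, which is a module over the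
  algebra itself. Here \<open>\<phi>\<close> is the structure map and \<open>E\<close> an injective envelope of
  \<open>k / rad k\<close>.
\<close>

definition dual_module ::
    "('k, 'm) ring_scheme \<Rightarrow> ('k \<Rightarrow> 'a) \<Rightarrow> ('k, 'e) module \<Rightarrow> ('a, 'b) module \<Rightarrow>
      ('a, 'b \<Rightarrow> 'e) module" where
  "dual_module k \<phi> E X = \<lparr>carrier = mod_hom k (restrict_scalars \<phi> X) E \<inter> extensional (carrier X),
     mult = undefined, one = undefined,
     zero = (\<lambda>x\<in>carrier X. \<zero>\<^bsub>E\<^esub>),
     add = (\<lambda>f g. \<lambda>x\<in>carrier X. f x \<oplus>\<^bsub>E\<^esub> g x),
     smult = (\<lambda>r f. \<lambda>x\<in>carrier X. f (r \<odot>\<^bsub>X\<^esub> x))\<rparr>"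

lemma (in abelian_group) abelian_group_functions:
  assumes F: "F \<subseteq> extensional D \<inter> (D \<rightarrow> carrier G)"
    and zero: "(\<lambda>x\<in>D. \<zero>) \<in> F"
    and add: "\<And>f g. f \<in> F \<Longrightarrow> g \<in> F \<Longrightarrow> (\<lambda>x\<in>D. f x \<oplus> g x) \<in> F"
    and neg: "\<And>f. f \<in> F \<Longrightarrow> (\<lambda>x\<in>D. \<ominus> f x) \<in> F"
    and N: "carrier N = F" "\<zero>\<^bsub>N\<^esub> = (\<lambda>x\<in>D. \<zero>)" "\<And>f g. f \<oplus>\<^bsub>N\<^esub> g = (\<lambda>x\<in>D. f x \<oplus> g x)"
  shows "abelian_group N"
proof (rule abelian_groupI)
  have mem: "f x \<in> carrier G" if "f \<in> F" "x \<in> D" for f x using F that by auto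
  have ext: "f = g" if "f \<in> F" "g \<in> F" "\<And>x. x \<in> D \<Longrightarrow> f x = g x" for f g
    using F that by (meson extensionalityI inf.boundedE subsetD)
  show "f \<oplus>\<^bsub>N\<^esub> g \<in> carrier N" if "f \<in> carrier N" "g \<in> carrier N" for f g
    using add that by (simp add: N)
  show "\<zero>\<^bsub>N\<^esub> \<in> carrier N" using zero by (simp add: N)
  show "f \<oplus>\<^bsub>N\<^esub> g \<oplus>\<^bsub>N\<^esub> h = f \<oplus>\<^bsub>N\<^esub> (g \<oplus>\<^bsub>N\<^esub> h)"
    if "f \<in> carrier N" "g \<in> carrier N" "h \<in> carrier N" for f g h
    using that mem by (auto simp: N a_assoc intro!: restrict_ext)
  show "f \<oplus>\<^bsub>N\<^esub> g = g \<oplus>\<^bsub>N\<^esub> f" if "f \<in> carrier N" "g \<in> carrier N" for f g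
    using that mem by (auto simp: N a_comm intro!: restrict_ext)
  show "\<zero>\<^bsub>N\<^esub> \<oplus>\<^bsub>N\<^esub> f = f" if "f \<in> carrier N" for f
    using that mem add[OF zero, of f] by (intro ext) (auto simp: N zero)
  show "\<exists>g\<in>carrier N. g \<oplus>\<^bsub>N\<^esub> f = \<zero>\<^bsub>N\<^esub>" if "f \<in> carrier N" for f
    using that mem neg by (intro bexI[of _ "\<lambda>x\<in>D. \<ominus> f x"]) (auto simp: N l_neg intro!: restrict_ext)
qed

lemma left_module_star:
  assumes "left_module R P"
  shows "left_module (opp_ring R) (star_module R P)"
proof -
  interpret left_module R P by fact
  have "abelian_group (star_module R P)"
    by (rule R.abelian_group_functions[where D = "carrier P" and F = "carrier (star_module R P)"])
       (auto simp: star_module_def mod_hom_def regular_module_def Pi_iff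
          R.minus_add R.r_minus R.a_ac R.r_distr)
  then show ?thesis
    by (intro left_moduleI ring_opp_ring R.ring_axioms)
       (auto simp: star_module_def mod_hom_def regular_module_def Pi_iff
          R.r_distr R.l_distr R.m_assoc intro!: restrict_ext extensionalityI[of _ "carrier P"])
qed

lemma left_module_dual:
  assumes A: "artin_algebra k \<phi> R" and E: "left_module k E" and X: "left_module (opp_ring R) X"
  shows "left_module R (dual_module k \<phi> E X)"
proof -
  interpret E: left_module k E by fact
  interpret X: left_module "opp_ring R" X by fact
  interpret R: ring R using A by (simp add: artin_algebra_def)
  have phi: "\<phi> c \<in> carrier R" if "c \<in> carrier k" for c
    using A that by (auto simp: artin_algebra_def ring_hom_def)
  have comm: "\<phi> c \<odot>\<^bsub>X\<^esub> (r \<odot>\<^bsub>X\<^esub> x) = r \<odot>\<^bsub>X\<^esub> (\<phi> c \<odot>\<^bsub>X\<^esub> x)"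
    if "c \<in> carrier k" "r \<in> carrier R" "x \<in> carrier X" for c r x
    using A that phi[of c] X.smult_assoc1[of "\<phi> c" r x] X.smult_assoc1[of r "\<phi> c" x]
    by (simp add: artin_algebra_def)
  have neg: "\<ominus>\<^bsub>E\<^esub> (c \<odot>\<^bsub>E\<^esub> y) = c \<odot>\<^bsub>E\<^esub> (\<ominus>\<^bsub>E\<^esub> y)" if "c \<in> carrier k" "y \<in> carrier E" for c y
  proof -
    have "c \<odot>\<^bsub>E\<^esub> (\<ominus>\<^bsub>E\<^esub> y) \<oplus>\<^bsub>E\<^esub> c \<odot>\<^bsub>E\<^esub> y = \<zero>\<^bsub>E\<^esub>"
      using that by (simp add: E.smult_r_distr[symmetric] E.M.l_neg)
    then show ?thesis using that by (intro E.M.minus_equality) auto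
  qed
  note xs = X.smult_closed[simplified] X.smult_l_distr[simplified] X.smult_r_distr[simplified]
    X.smult_assoc1[simplified] X.smult_one[simplified]
  have "abelian_group (dual_module k \<phi> E X)"
    by (rule E.M.abelian_group_functions[where D = "carrier X" and F = "carrier (dual_module k \<phi> E X)"])
       (auto simp: dual_module_def mod_hom_def restrict_scalars_def Pi_iff phi xs neg
          E.M.minus_add E.M.a_ac E.smult_r_distr)
  then show ?thesis
    by (intro left_moduleI R.ring_axioms)
       (auto simp: dual_module_def mod_hom_def restrict_scalars_def Pi_iff phi xs comm[symmetric]
          intro!: restrict_ext extensionalityI[of _ "carrier X"])
qed

text \<open>The dual of the transpose, computed from a chosen minimal projective presentation.\<close>

type_synonym ('a, 'b) presentation =
  "'a fg_mod \<times> ((nat \<Rightarrow> 'a) \<Rightarrow> (nat \<Rightarrow> 'a)) \<times> 'a fg_mod \<times> ((nat \<Rightarrow> 'a) \<Rightarrow> 'b)"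

definition tau ::
    "('k, 'm) ring_scheme \<Rightarrow> ('k \<Rightarrow> 'a) \<Rightarrow> ('k, 'e) module \<Rightarrow> ('a, 'n) ring_scheme \<Rightarrow>
      ('a, 'b) module \<Rightarrow> ('a, ((nat \<Rightarrow> 'a) \<Rightarrow> 'a) set \<Rightarrow> 'e) module" where
  "tau k \<phi> E R M =
     (let (P1, d, P0, p) = (SOME z :: ('a, 'b) presentation.
            case z of (P1, d, P0, p) \<Rightarrow> minimal_projective_presentation R P1 d P0 p M)
      in dual_module k \<phi> E (transpose_module R P1 d P0))"

definition tau_rigid ::
    "('k, 'm) ring_scheme \<Rightarrow> ('k \<Rightarrow> 'a) \<Rightarrow> ('k, 'e) module \<Rightarrow> ('a, 'n) ring_scheme \<Rightarrow>
      ('a, 'b) module \<Rightarrow> bool" where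
  "tau_rigid k \<phi> E R M \<longleftrightarrow> fg_module R M \<and>
     (\<forall>f\<in>mod_hom R M (tau k \<phi> E R M). \<forall>x\<in>carrier M. f x = \<zero>\<^bsub>tau k \<phi> E R M\<^esub>)"

definition tau_tilting ::
    "('k, 'm) ring_scheme \<Rightarrow> ('k \<Rightarrow> 'a) \<Rightarrow> ('k, 'e) module \<Rightarrow> ('a, 'n) ring_scheme \<Rightarrow>
      ('a, 'b) module \<Rightarrow> bool" where
  "tau_tilting k \<phi> E R N \<longleftrightarrow>
     tau_rigid k \<phi> E R N \<and> num_summands R N = num_summands R (regular_module R)"

end

theory Submission
  imports Defs
begin

text \<open>
  Since \<open>r\<^sup>2 = 0\<close>, every \<open>\<Lambda>e\<^sub>i\<close> has length at most two. A non-simple \<open>\<Lambda>e\<^sub>i\<close> splits off every module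
  in which its radical survives, so an indecomposable module is either simple or some \<open>\<Lambda>e\<^sub>i\<close>. If
  \<open>S\<^sub>a\<close> is simple and not projective and \<open>r e\<^sub>a = \<Lambda>u\<close> with \<open>e\<^sub>c u = u\<close>, then \<open>\<tau> S\<^sub>a\<close> is the simple module \<open>S\<^sub>c\<close>.
  There are no loops (\<open>c \<noteq> a\<close>): a loop at \<open>a\<close> would cut off a block, so that \<open>\<Lambda> = \<Lambda>e\<^sub>a\<close> would be local
  and self-injective. Hence indecomposable modules are \<open>\<tau>\<close>-rigid.

  Let \<open>T\<close> be basic and \<open>\<tau>\<close>-rigid with \<open>n\<close> indecomposable summands, of which \<open>S\<^sub>1, \<dots>, S\<^sub>t\<close> are those that are
  simple and not projective. No summand of \<open>T\<close> has a top isomorphic to one of the \<open>t\<close> distinct simple modules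
  \<open>\<tau> S\<^sub>j\<close>. The \<open>n - t\<close> projective summands have distinct tops, so these are exactly the remaining
  \<open>n - t\<close> simple modules, that is, the projective part of \<open>T\<close> is \<open>\<Lambda> / P\<^sub>0(\<tau>(S\<^sub>1 \<oplus> \<dots> \<oplus> S\<^sub>t))\<close>. The \<open>S\<^sub>j\<close>
  are themselves among these tops, so \<open>2t \<le> n\<close>.
\<close>

section \<open>Modules and homomorphisms\<close>

text \<open>What carries the argument is an injectivity statement: if J e_i is nonzero,
  homomorphisms from submodules of finitely generated modules into Lambda e_i extend. Left
  uniseriality makes all relations on a new generator multiples of one radical element u, and right
  uniseriality solves w = u c for the prescribed value w, so both halves of the Nakayama condition
  enter. The same statement turns every map from P1 into J into a boundary, so J annihilates tau M.
  That tau S_a is one copy of S_c and not a power of it involves the base ring: the k-dual of the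
  division ring e_c Lambda e_c / e_c J e_c is one-dimensional over it, because the part of E killed
  by the corresponding maximal ideal of k is cyclic. As \<open>tau\<close> is computed from a
  minimal presentation picked by choice, everything about it is proved for an arbitrary minimal
  presentation. Composition length never appears; the inductions adjoin one generator b = e_i b at a
  time.\<close>

context left_module
begin

lemma smult_l_minus: "\<lbrakk>a \<in> carrier R; x \<in> carrier M\<rbrakk> \<Longrightarrow> (\<ominus> a) \<odot>\<^bsub>M\<^esub> x = \<ominus>\<^bsub>M\<^esub> (a \<odot>\<^bsub>M\<^esub> x)"
  using smult_l_distr[of "\<ominus> a" a x] by (intro M.minus_equality[symmetric]) (auto simp: R.l_neg)

lemma submoduleI:
  assumes "H \<subseteq> carrier M" "\<zero>\<^bsub>M\<^esub> \<in> H" "\<And>x y. \<lbrakk>x \<in> H; y \<in> H\<rbrakk> \<Longrightarrow> x \<oplus>\<^bsub>M\<^esub> y \<in> H"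
    "\<And>a x. \<lbrakk>a \<in> carrier R; x \<in> H\<rbrakk> \<Longrightarrow> a \<odot>\<^bsub>M\<^esub> x \<in> H"
  shows "submodule H R M"
proof unfold_locales
  show "inv\<^bsub>add_monoid M\<^esub> x \<in> H" if "x \<in> H" for x
  proof -
    have "x \<in> carrier M" using that assms(1) by auto
    then have "\<ominus>\<^bsub>M\<^esub> x = (\<ominus> \<one>) \<odot>\<^bsub>M\<^esub> x" by (simp add: smult_l_minus)
    then show ?thesis using assms(4)[OF _ that, of "\<ominus> \<one>"] by (simp add: a_inv_def)
  qed
qed (use assms in auto)

lemma submoduleD:
  assumes "submodule H R M"
  shows "H \<subseteq> carrier M" "\<zero>\<^bsub>M\<^esub> \<in> H" "\<And>x. x \<in> H \<Longrightarrow> x \<in> carrier M"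
    "\<And>x y. \<lbrakk>x \<in> H; y \<in> H\<rbrakk> \<Longrightarrow> x \<oplus>\<^bsub>M\<^esub> y \<in> H"
    "\<And>a x. \<lbrakk>a \<in> carrier R; x \<in> H\<rbrakk> \<Longrightarrow> a \<odot>\<^bsub>M\<^esub> x \<in> H"
    "\<And>x. x \<in> H \<Longrightarrow> \<ominus>\<^bsub>M\<^esub> x \<in> H" "\<And>x y. \<lbrakk>x \<in> H; y \<in> H\<rbrakk> \<Longrightarrow> x \<ominus>\<^bsub>M\<^esub> y \<in> H"
proof -
  interpret submodule H R M by fact
  show "H \<subseteq> carrier M" "\<zero>\<^bsub>M\<^esub> \<in> H" "\<And>x. x \<in> H \<Longrightarrow> x \<in> carrier M"
    "\<And>x y. \<lbrakk>x \<in> H; y \<in> H\<rbrakk> \<Longrightarrow> x \<oplus>\<^bsub>M\<^esub> y \<in> H"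
    "\<And>a x. \<lbrakk>a \<in> carrier R; x \<in> H\<rbrakk> \<Longrightarrow> a \<odot>\<^bsub>M\<^esub> x \<in> H"
    "\<And>x. x \<in> H \<Longrightarrow> \<ominus>\<^bsub>M\<^esub> x \<in> H" "\<And>x y. \<lbrakk>x \<in> H; y \<in> H\<rbrakk> \<Longrightarrow> x \<ominus>\<^bsub>M\<^esub> y \<in> H"
    using subset one_closed m_closed m_inv_closed by (auto simp: a_inv_def a_minus_def)
qed

lemma submodule_finsum:
  assumes "submodule H R M" "f \<in> A \<rightarrow> H" shows "finsum M f A \<in> H"
proof (cases "finite A")
  case True
  then show ?thesis using assms(2)
  proof induction
    case empty then show ?case using submoduleD(2)[OF assms(1)] by simp
  next
    case (insert a A)
    have "finsum M f (insert a A) = f a \<oplus>\<^bsub>M\<^esub> finsum M f A"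
      using insert submoduleD(3)[OF assms(1)] by (intro M.finsum_insert) auto
    then show ?case using insert submoduleD(4)[OF assms(1)] by auto
  qed
qed (use submoduleD(2)[OF assms(1)] in simp)

lemma submodule_carrier: "submodule (carrier M) R M"
  by (rule submoduleI) auto

lemma submodule_zero: "submodule {\<zero>\<^bsub>M\<^esub>} R M"
  by (rule submoduleI) auto

lemma submodule_Int: "\<lbrakk>submodule A R M; submodule B R M\<rbrakk> \<Longrightarrow> submodule (A \<inter> B) R M"
  using submoduleD[of A] submoduleD[of B] by (intro submoduleI) auto

lemma left_module_sub_mod:
  assumes "submodule H R M" shows "left_module R (sub_mod M H)"
proof -
  note D = submoduleD[OF assms]
  have "abelian_group (sub_mod M H)"
  proof (rule abelian_groupI)
    show "\<exists>y\<in>carrier (sub_mod M H). y \<oplus>\<^bsub>sub_mod M H\<^esub> x = \<zero>\<^bsub>sub_mod M H\<^esub>" if "x \<in> carrier (sub_mod M H)" for x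
      using D(3,6) that by (intro bexI[of _ "\<ominus>\<^bsub>M\<^esub> x"]) (auto intro: M.l_neg)
  qed (use D(3,4) in \<open>auto simp: M.a_ac D(2)\<close>)
  then show ?thesis
    by (rule left_moduleI[OF R.ring_axioms])
       (use D(3,5) in \<open>auto simp: smult_l_distr smult_r_distr smult_assoc1\<close>)
qed

lemma submodule_sub_mod_iff:
  assumes "submodule H R M"
  shows "submodule X R (sub_mod M H) \<longleftrightarrow> submodule X R M \<and> X \<subseteq> H"
proof
  interpret S: left_module R "sub_mod M H" by (rule left_module_sub_mod[OF assms])
  note D = submoduleD[OF assms]
  show "submodule X R M \<and> X \<subseteq> H" if "submodule X R (sub_mod M H)"
    using S.submoduleD[OF that] D by (intro conjI submoduleI) auto
  show "submodule X R (sub_mod M H)" if "submodule X R M \<and> X \<subseteq> H"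
    using submoduleD[of X] that by (intro S.submoduleI) auto
qed

lemma finsum_smult_r:
  assumes "a \<in> carrier R" "f \<in> A \<rightarrow> carrier M"
  shows "a \<odot>\<^bsub>M\<^esub> finsum M f A = (\<Oplus>\<^bsub>M\<^esub>i\<in>A. a \<odot>\<^bsub>M\<^esub> f i)"
proof (cases "finite A")
  case True
  then show ?thesis using assms(2)
  proof induction
    case (insert i A)
    then have "a \<odot>\<^bsub>M\<^esub> finsum M f (insert i A) = a \<odot>\<^bsub>M\<^esub> f i \<oplus>\<^bsub>M\<^esub> a \<odot>\<^bsub>M\<^esub> finsum M f A"
      using assms(1) by (subst M.finsum_insert) (auto simp: smult_r_distr)
    also have "\<dots> = (\<Oplus>\<^bsub>M\<^esub>i\<in>insert i A. a \<odot>\<^bsub>M\<^esub> f i)"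
      using insert assms(1) by (subst M.finsum_insert) auto
    finally show ?case .
  qed (use assms(1) in simp)
qed (use assms(1) in simp)

lemma finsum_smult_l:
  assumes "x \<in> carrier M" "f \<in> A \<rightarrow> carrier R"
  shows "finsum R f A \<odot>\<^bsub>M\<^esub> x = (\<Oplus>\<^bsub>M\<^esub>i\<in>A. f i \<odot>\<^bsub>M\<^esub> x)"
proof (cases "finite A")
  case True
  then show ?thesis using assms(2)
  proof induction
    case (insert i A)
    then have "finsum R f (insert i A) \<odot>\<^bsub>M\<^esub> x = f i \<odot>\<^bsub>M\<^esub> x \<oplus>\<^bsub>M\<^esub> finsum R f A \<odot>\<^bsub>M\<^esub> x"
      using assms(1) by (subst R.finsum_insert) (auto simp: smult_l_distr)
    also have "\<dots> = (\<Oplus>\<^bsub>M\<^esub>i\<in>insert i A. f i \<odot>\<^bsub>M\<^esub> x)"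
      using insert assms(1) by (subst M.finsum_insert) auto
    finally show ?case .
  qed (use assms(1) in simp)
qed (use assms(1) in simp)

definition adjoin :: "'b set \<Rightarrow> 'b \<Rightarrow> 'b set" where
  "adjoin A b = {x \<oplus>\<^bsub>M\<^esub> a \<odot>\<^bsub>M\<^esub> b |x a. x \<in> A \<and> a \<in> carrier R}"

lemma submodule_adjoin:
  assumes "submodule A R M" "b \<in> carrier M" shows "submodule (adjoin A b) R M"
proof (rule submoduleI)
  note D = submoduleD[OF assms(1)]
  show "adjoin A b \<subseteq> carrier M" using D(3) assms(2) by (auto simp: adjoin_def)
  show "\<zero>\<^bsub>M\<^esub> \<in> adjoin A b"
    using D(2) assms(2) by (auto simp: adjoin_def intro!: exI[of _ "\<zero>\<^bsub>M\<^esub>"] exI[of _ "\<zero>"])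
  show "x \<oplus>\<^bsub>M\<^esub> y \<in> adjoin A b" if xy: "x \<in> adjoin A b" "y \<in> adjoin A b" for x y
  proof -
    obtain u s v t where *: "x = u \<oplus>\<^bsub>M\<^esub> s \<odot>\<^bsub>M\<^esub> b" "y = v \<oplus>\<^bsub>M\<^esub> t \<odot>\<^bsub>M\<^esub> b" "u \<in> A" "v \<in> A"
      "s \<in> carrier R" "t \<in> carrier R" using xy by (auto simp: adjoin_def)
    then have "x \<oplus>\<^bsub>M\<^esub> y = (u \<oplus>\<^bsub>M\<^esub> v) \<oplus>\<^bsub>M\<^esub> (s \<oplus> t) \<odot>\<^bsub>M\<^esub> b"
      using D(3) assms(2) by (simp add: smult_l_distr M.a_ac)
    then show ?thesis using * D(4) by (auto simp: adjoin_def)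
  qed
  show "a \<odot>\<^bsub>M\<^esub> x \<in> adjoin A b" if ax: "a \<in> carrier R" "x \<in> adjoin A b" for a x
  proof -
    obtain u s where *: "x = u \<oplus>\<^bsub>M\<^esub> s \<odot>\<^bsub>M\<^esub> b" "u \<in> A" "s \<in> carrier R"
      using ax by (auto simp: adjoin_def)
    then have "a \<odot>\<^bsub>M\<^esub> x = a \<odot>\<^bsub>M\<^esub> u \<oplus>\<^bsub>M\<^esub> (a \<otimes> s) \<odot>\<^bsub>M\<^esub> b"
      using D(3) assms(2) ax by (simp add: smult_r_distr smult_assoc1)
    then show ?thesis using * D(5) ax by (auto simp: adjoin_def)
  qed
qed

lemma adjoin_subset:
  assumes "submodule A R M" "b \<in> carrier M" shows "A \<subseteq> adjoin A b" "b \<in> adjoin A b"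
proof -
  note D = submoduleD[OF assms(1)]
  show "A \<subseteq> adjoin A b"
  proof
    fix x assume "x \<in> A"
    then show "x \<in> adjoin A b" using D(3) assms(2)
      by (auto simp: adjoin_def intro!: exI[of _ x] exI[of _ "\<zero>"])
  qed
  show "b \<in> adjoin A b" using D(2) assms(2) 
    by (auto simp: adjoin_def intro!: exI[of _ "\<zero>\<^bsub>M\<^esub>"] exI[of _ "\<one>"])
qed

text \<open>Takes the place of induction on length. The step may return any larger submodule that
  contains \<open>b\<close>, which later allows one generator to be replaced by its components under
  the idempotents.\<close>

lemma fg_induct:
  assumes fg: "fg_module R M" and A0: "submodule A0 R M" "P A0"
    and step: "\<And>A b. \<lbrakk>submodule A R M; A0 \<subseteq> A; P A; b \<in> carrier M\<rbrakk> \<Longrightarrow> \<exists>B. submodule B R M \<and> A \<subseteq> B \<and> b \<in> B \<and> P B"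
  shows "P (carrier M)"
proof -
  obtain F where F: "finite F" "F \<subseteq> carrier M" "\<And>N. submodule N R M \<Longrightarrow> F \<subseteq> N \<Longrightarrow> N = carrier M"
    using fg by (auto simp: fg_module_def)
  have "\<exists>B. submodule B R M \<and> A0 \<subseteq> B \<and> F \<subseteq> B \<and> P B"
    using F(1,2)
  proof (induction F)
    case empty
    then show ?case using A0 by auto
  next
    case (insert b F)
    then obtain B where B: "submodule B R M" "A0 \<subseteq> B" "F \<subseteq> B" "P B" by auto
    then obtain C where "submodule C R M" "B \<subseteq> C" "b \<in> C" "P C"
      using step[of B b] insert.prems by auto
    then show ?case using B by (intro exI[of _ C]) auto
  qed
  then show ?thesis using F(3) by blast
qed

lemma cyclic_submodule:
  assumes "x \<in> carrier M" shows "submodule ((\<lambda>a. a \<odot>\<^bsub>M\<^esub> x) ` carrier R) R M"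
proof (rule submoduleI)
  show "\<zero>\<^bsub>M\<^esub> \<in> (\<lambda>a. a \<odot>\<^bsub>M\<^esub> x) ` carrier R" using assms by (auto intro!: image_eqI[of _ _ "\<zero>"])
  show "u \<oplus>\<^bsub>M\<^esub> v \<in> (\<lambda>a. a \<odot>\<^bsub>M\<^esub> x) ` carrier R"
    if "u \<in> (\<lambda>a. a \<odot>\<^bsub>M\<^esub> x) ` carrier R" "v \<in> (\<lambda>a. a \<odot>\<^bsub>M\<^esub> x) ` carrier R" for u v
    using that assms by (auto simp: smult_l_distr[symmetric])
  show "a \<odot>\<^bsub>M\<^esub> u \<in> (\<lambda>a. a \<odot>\<^bsub>M\<^esub> x) ` carrier R"
    if "a \<in> carrier R" "u \<in> (\<lambda>a. a \<odot>\<^bsub>M\<^esub> x) ` carrier R" for a u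
    using that assms by (auto simp: smult_assoc1[symmetric])
qed (use assms in auto)

lemma fg_cyclic:
  assumes "x \<in> carrier M" "\<And>y. y \<in> carrier M \<Longrightarrow> \<exists>a\<in>carrier R. y = a \<odot>\<^bsub>M\<^esub> x"
  shows "fg_module R M"
  unfolding fg_module_def
proof (intro conjI exI[of _ "{x}"] allI impI)
  fix N assume N: "submodule N R M \<and> {x} \<subseteq> N"
  then have "y \<in> N" if "y \<in> carrier M" for y
    using assms(2)[OF that] submoduleD(5)[of N] by auto
  then show "N = carrier M" using N submoduleD(1)[of N] by auto
qed (use assms left_module_axioms in auto)

end

section \<open>Homomorphisms and the transport of properties along isomorphisms\<close>

lemma mod_homD:
  assumes "f \<in> mod_hom R M N"
  shows "x \<in> carrier M \<Longrightarrow> f x \<in> carrier N"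
    "\<lbrakk>x \<in> carrier M; y \<in> carrier M\<rbrakk> \<Longrightarrow> f (x \<oplus>\<^bsub>M\<^esub> y) = f x \<oplus>\<^bsub>N\<^esub> f y"
    "\<lbrakk>a \<in> carrier R; x \<in> carrier M\<rbrakk> \<Longrightarrow> f (a \<odot>\<^bsub>M\<^esub> x) = a \<odot>\<^bsub>N\<^esub> f x"
  using assms by (auto simp: mod_hom_def)

lemma mod_homI:
  assumes "\<And>x. x \<in> carrier M \<Longrightarrow> f x \<in> carrier N"
    "\<And>x y. \<lbrakk>x \<in> carrier M; y \<in> carrier M\<rbrakk> \<Longrightarrow> f (x \<oplus>\<^bsub>M\<^esub> y) = f x \<oplus>\<^bsub>N\<^esub> f y"
    "\<And>a x. \<lbrakk>a \<in> carrier R; x \<in> carrier M\<rbrakk> \<Longrightarrow> f (a \<odot>\<^bsub>M\<^esub> x) = a \<odot>\<^bsub>N\<^esub> f x"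
  shows "f \<in> mod_hom R M N"
  using assms by (auto simp: mod_hom_def)

lemma mod_hom_zero:
  assumes "left_module R M" "left_module R N" "f \<in> mod_hom R M N"
  shows "f \<zero>\<^bsub>M\<^esub> = \<zero>\<^bsub>N\<^esub>"
proof -
  interpret M: left_module R M by fact
  interpret N: left_module R N by fact
  have "f (\<zero>\<^bsub>R\<^esub> \<odot>\<^bsub>M\<^esub> \<zero>\<^bsub>M\<^esub>) = \<zero>\<^bsub>R\<^esub> \<odot>\<^bsub>N\<^esub> f \<zero>\<^bsub>M\<^esub>"
    by (rule mod_homD(3)[OF assms(3)]) auto
  then show ?thesis using mod_homD(1)[OF assms(3), of "\<zero>\<^bsub>M\<^esub>"] by simp
qed

lemma mod_hom_minus:
  assumes "left_module R M" "left_module R N" "f \<in> mod_hom R M N" "x \<in> carrier M"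
  shows "f (\<ominus>\<^bsub>M\<^esub> x) = \<ominus>\<^bsub>N\<^esub> f x"
proof -
  interpret M: left_module R M by fact
  interpret N: left_module R N by fact
  have "f (\<ominus>\<^bsub>M\<^esub> x) \<oplus>\<^bsub>N\<^esub> f x = \<zero>\<^bsub>N\<^esub>"
    using assms(4) mod_homD(2)[OF assms(3), of "\<ominus>\<^bsub>M\<^esub> x" x] mod_hom_zero[OF assms(1-3)]
    by (simp add: M.M.l_neg)
  then show ?thesis using mod_homD(1)[OF assms(3)] assms(4)
    by (intro N.M.minus_equality[symmetric]) auto
qed

lemma mod_hom_diff:
  assumes "left_module R M" "left_module R N" "f \<in> mod_hom R M N" "x \<in> carrier M" "y \<in> carrier M"
  shows "f (x \<ominus>\<^bsub>M\<^esub> y) = f x \<ominus>\<^bsub>N\<^esub> f y"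
proof -
  interpret M: left_module R M by fact
  show ?thesis
    using mod_hom_minus[OF assms(1-3,5)] mod_homD(2)[OF assms(3,4), of "\<ominus>\<^bsub>M\<^esub> y"] assms(5)
    by (simp add: a_minus_def)
qed

lemma mod_hom_finsum:
  assumes "left_module R M" "left_module R N" "f \<in> mod_hom R M N" "g \<in> A \<rightarrow> carrier M"
  shows "f (finsum M g A) = (\<Oplus>\<^bsub>N\<^esub>i\<in>A. f (g i))"
proof -
  interpret M: left_module R M by fact
  interpret N: left_module R N by fact
  note z = mod_hom_zero[OF assms(1-3)]
  show ?thesis
  proof (cases "finite A")
    case True
    then show ?thesis using assms(4)
    proof induction
      case (insert i A)
      then have "f (finsum M g (insert i A)) = f (g i) \<oplus>\<^bsub>N\<^esub> f (finsum M g A)"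
        using mod_homD(2)[OF assms(3), of "g i" "finsum M g A"]
        by (subst M.M.finsum_insert) (auto simp: Pi_iff)
      also have "\<dots> = (\<Oplus>\<^bsub>N\<^esub>i\<in>insert i A. f (g i))"
        using insert mod_homD(1)[OF assms(3)] by (subst N.M.finsum_insert) auto
      finally show ?case .
    qed (simp add: z)
  qed (simp add: z)
qed

lemma mod_hom_compose:
  "\<lbrakk>f \<in> mod_hom R M N; g \<in> mod_hom R N K\<rbrakk> \<Longrightarrow> (\<lambda>x. g (f x)) \<in> mod_hom R M K"
  by (auto simp: mod_hom_def Pi_iff)

lemma mod_hom_into_sub:
  "\<lbrakk>f \<in> mod_hom R M N; \<And>x. x \<in> carrier M \<Longrightarrow> f x \<in> H\<rbrakk> \<Longrightarrow> f \<in> mod_hom R M (sub_mod N H)"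
  by (auto simp: mod_hom_def)

lemma mod_hom_restrict:
  "\<lbrakk>f \<in> mod_hom R M N; H \<subseteq> carrier M\<rbrakk> \<Longrightarrow> f \<in> mod_hom R (sub_mod M H) N"
  by (auto simp: mod_hom_def subset_iff Pi_iff)

lemma mod_hom_cong:
  assumes "left_module R M" "f \<in> mod_hom R M N" "\<And>x. x \<in> carrier M \<Longrightarrow> f x = g x"
  shows "g \<in> mod_hom R M N"
proof -
  interpret left_module R M by fact
  show ?thesis
  proof (rule mod_homI)
    show "g x \<in> carrier N" if "x \<in> carrier M" for x
      using mod_homD(1)[OF assms(2) that] assms(3)[OF that] by simp
    show "g (x \<oplus>\<^bsub>M\<^esub> y) = g x \<oplus>\<^bsub>N\<^esub> g y" if "x \<in> carrier M" "y \<in> carrier M" for x y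
      using mod_homD(2)[OF assms(2) that] assms(3)[symmetric] that by simp
    show "g (a \<odot>\<^bsub>M\<^esub> x) = a \<odot>\<^bsub>N\<^esub> g x" if "a \<in> carrier R" "x \<in> carrier M" for a x
      using mod_homD(3)[OF assms(2) that] assms(3)[symmetric] that by simp
  qed
qed

lemma submodule_image:
  assumes "left_module R M" "left_module R N" "f \<in> mod_hom R M N" "submodule X R M"
  shows "submodule (f ` X) R N"
proof -
  interpret M: left_module R M by fact
  interpret N: left_module R N by fact
  note D = M.submoduleD[OF assms(4)]
  show ?thesis
  proof (rule N.submoduleI)
    show "\<zero>\<^bsub>N\<^esub> \<in> f ` X" using D(2) mod_hom_zero[OF assms(1-3)] by force
    show "u \<oplus>\<^bsub>N\<^esub> v \<in> f ` X" if "u \<in> f ` X" "v \<in> f ` X" for u v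
      using that D(3,4) mod_homD(2)[OF assms(3), symmetric] by auto
    show "a \<odot>\<^bsub>N\<^esub> u \<in> f ` X" if "a \<in> carrier R" "u \<in> f ` X" for a u
      using that D(3,5) mod_homD(3)[OF assms(3), symmetric] by auto
  qed (use D(3) mod_homD(1)[OF assms(3)] in auto)
qed

lemma submodule_preimage:
  assumes "left_module R M" "left_module R N" "f \<in> mod_hom R M N" "submodule X R N"
  shows "submodule {x \<in> carrier M. f x \<in> X} R M"
proof -
  interpret M: left_module R M by fact
  interpret N: left_module R N by fact
  note D = N.submoduleD[OF assms(4)]
  show ?thesis
    by (rule M.submoduleI) (use D(2,4,5) mod_homD[OF assms(3)] mod_hom_zero[OF assms(1-3)] in auto)
qed

lemma a_kernel_eq: "a_kernel M N f = {x \<in> carrier M. f x = \<zero>\<^bsub>N\<^esub>}"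
  by (simp add: a_kernel_def' )

lemma submodule_kernel:
  assumes "left_module R M" "left_module R N" "f \<in> mod_hom R M N"
  shows "submodule (a_kernel M N f) R M"
proof -
  interpret N: left_module R N by fact
  have "submodule {x \<in> carrier M. f x \<in> {\<zero>\<^bsub>N\<^esub>}} R M"
    using N.submodule_zero by (intro submodule_preimage[OF assms]) auto
  then show ?thesis by (simp add: a_kernel_eq)
qed

lemma mod_hom_inj_onI:
  assumes "left_module R M" "left_module R N" "f \<in> mod_hom R M N"
    "\<And>x. \<lbrakk>x \<in> carrier M; f x = \<zero>\<^bsub>N\<^esub>\<rbrakk> \<Longrightarrow> x = \<zero>\<^bsub>M\<^esub>"
  shows "inj_on f (carrier M)"
proof (rule inj_onI)
  interpret M: left_module R M by fact
  interpret N: left_module R N by fact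
  fix x y assume xy: "x \<in> carrier M" "y \<in> carrier M" "f x = f y"
  then have "f (x \<ominus>\<^bsub>M\<^esub> y) = \<zero>\<^bsub>N\<^esub>"
    using mod_hom_diff[OF assms(1-3)] mod_homD(1)[OF assms(3)] by (simp add: N.M.r_neg a_minus_def)
  then have "x \<ominus>\<^bsub>M\<^esub> y \<oplus>\<^bsub>M\<^esub> y = y" using assms(4)[of "x \<ominus>\<^bsub>M\<^esub> y"] xy by simp
  then show "x = y" using xy by (simp add: a_minus_def M.M.a_assoc M.M.l_neg)
qed

lemma inv_into_mod_hom:
  assumes "left_module R M" "f \<in> mod_hom R M N" "bij_betw f (carrier M) (carrier N)"
  shows "inv_into (carrier M) f \<in> mod_hom R N M"
proof -
  interpret left_module R M by fact
  let ?g = "inv_into (carrier M) f"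
  have g: "?g y \<in> carrier M" "f (?g y) = y" if "y \<in> carrier N" for y
    using assms(3) that by (auto simp: bij_betw_def inv_into_into f_inv_into_f)
  have gf: "?g (f x) = x" if "x \<in> carrier M" for x
    using assms(3) that by (auto simp: bij_betw_def)
  show ?thesis
  proof (rule mod_homI)
    show "?g (x \<oplus>\<^bsub>N\<^esub> y) = ?g x \<oplus>\<^bsub>M\<^esub> ?g y" if "x \<in> carrier N" "y \<in> carrier N" for x y
      using gf[of "?g x \<oplus>\<^bsub>M\<^esub> ?g y"] mod_homD(2)[OF assms(2), of "?g x" "?g y"] g that by simp
    show "?g (a \<odot>\<^bsub>N\<^esub> x) = a \<odot>\<^bsub>M\<^esub> ?g x" if "a \<in> carrier R" "x \<in> carrier N" for a x
      using gf[of "a \<odot>\<^bsub>M\<^esub> ?g x"] mod_homD(3)[OF assms(2), of a "?g x"] g that by simp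
  qed (use g in auto)
qed

lemma mod_iso_refl: "mod_iso R M M"
  unfolding mod_iso_def by (intro bexI[of _ "\<lambda>x. x"]) (auto simp: mod_hom_def bij_betw_def)

lemma mod_iso_sym:
  assumes "left_module R M" "mod_iso R M N" shows "mod_iso R N M"
  using assms inv_into_mod_hom[OF assms(1)] unfolding mod_iso_def by (meson bij_betw_inv_into)

lemma mod_iso_trans:
  assumes "mod_iso R M N" "mod_iso R N K" shows "mod_iso R M K"
proof -
  obtain f g where "f \<in> mod_hom R M N" "bij_betw f (carrier M) (carrier N)"
    "g \<in> mod_hom R N K" "bij_betw g (carrier N) (carrier K)"
    using assms by (auto simp: mod_iso_def)
  then show ?thesis
    unfolding mod_iso_def
    using mod_hom_compose[of f R M N g K] bij_betw_trans[of f "carrier M" "carrier N" g "carrier K"]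
    by (auto simp: comp_def)
qed

lemma mod_iso_subsets:
  assumes "left_module R M" "left_module R N" "f \<in> mod_hom R M N" "bij_betw f (carrier M) (carrier N)"
    "submodule X R N"
  shows "submodule {x \<in> carrier M. f x \<in> X} R M" "f ` {x \<in> carrier M. f x \<in> X} = X"
proof -
  interpret N: left_module R N by fact
  show "submodule {x \<in> carrier M. f x \<in> X} R M" by (rule submodule_preimage) fact+
  show "f ` {x \<in> carrier M. f x \<in> X} = X"
    using assms(4) N.submoduleD(1)[OF assms(5)] by (auto simp: bij_betw_def image_iff)
qed

lemma uniserial_iso:
  assumes "left_module R N" "mod_iso R M N" "uniserial_module R M"
  shows "uniserial_module R N"
proof -
  have M: "left_module R M" using assms(3) by (simp add: uniserial_module_def)
  obtain f where f: "f \<in> mod_hom R M N" "bij_betw f (carrier M) (carrier N)"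
    using assms(2) by (auto simp: mod_iso_def)
  note * = mod_iso_subsets[OF M assms(1) f]
  show ?thesis
    unfolding uniserial_module_def
  proof (intro conjI allI impI)
    fix X Y assume XY: "submodule X R N" "submodule Y R N"
    then have "{x \<in> carrier M. f x \<in> X} \<subseteq> {x \<in> carrier M. f x \<in> Y} \<or>
      {x \<in> carrier M. f x \<in> Y} \<subseteq> {x \<in> carrier M. f x \<in> X}"
      using assms(3) *(1) by (auto simp: uniserial_module_def)
    then show "X \<subseteq> Y \<or> Y \<subseteq> X"
    proof
      assume "{x \<in> carrier M. f x \<in> X} \<subseteq> {x \<in> carrier M. f x \<in> Y}"
      from image_mono[OF this, of f] show ?thesis unfolding *(2)[OF XY(1)] *(2)[OF XY(2)] by blast
    next
      assume "{x \<in> carrier M. f x \<in> Y} \<subseteq> {x \<in> carrier M. f x \<in> X}"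
      from image_mono[OF this, of f] show ?thesis unfolding *(2)[OF XY(1)] *(2)[OF XY(2)] by blast
    qed
  qed (use assms in auto)
qed

lemma complementaryD:
  assumes "left_module R M" "complementary R M X Y"
  shows "submodule X R M" "submodule Y R M" "X \<inter> Y = {\<zero>\<^bsub>M\<^esub>}"
    "\<And>z. z \<in> carrier M \<Longrightarrow> \<exists>x\<in>X. \<exists>y\<in>Y. z = x \<oplus>\<^bsub>M\<^esub> y"
proof -
  show "submodule X R M" "submodule Y R M" "X \<inter> Y = {\<zero>\<^bsub>M\<^esub>}"
    using assms by (auto simp: complementary_def)
  show "\<exists>x\<in>X. \<exists>y\<in>Y. z = x \<oplus>\<^bsub>M\<^esub> y" if "z \<in> carrier M" for z
  proof -
    have "z \<in> X <+>\<^bsub>M\<^esub> Y" using assms(2) that by (auto simp: complementary_def)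
    then show ?thesis by (auto simp: set_add_def')
  qed
qed

lemma complementaryI:
  assumes "left_module R M" "submodule X R M" "submodule Y R M"
    "\<And>x. \<lbrakk>x \<in> X; x \<in> Y\<rbrakk> \<Longrightarrow> x = \<zero>\<^bsub>M\<^esub>"
    "\<And>z. z \<in> carrier M \<Longrightarrow> \<exists>x\<in>X. \<exists>y\<in>Y. z = x \<oplus>\<^bsub>M\<^esub> y"
  shows "complementary R M X Y"
proof -
  interpret left_module R M by fact
  note D = submoduleD[OF assms(2)] submoduleD[OF assms(3)]
  have "X <+>\<^bsub>M\<^esub> Y = carrier M"
  proof
    show "X <+>\<^bsub>M\<^esub> Y \<subseteq> carrier M" using D(3,10) by (auto simp: set_add_def')
    show "carrier M \<subseteq> X <+>\<^bsub>M\<^esub> Y" using assms(5) by (fastforce simp: set_add_def')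
  qed
  moreover have "X \<inter> Y = {\<zero>\<^bsub>M\<^esub>}" using assms(4) D(2,9) by blast
  ultimately show ?thesis using assms(2,3) by (simp add: complementary_def)
qed

lemma indecomposable_iso:
  assumes "left_module R N" "mod_iso R M N" "indecomposable_module R M"
  shows "indecomposable_module R N"
proof -
  have M: "left_module R M" using assms(3) by (simp add: indecomposable_module_def)
  interpret M: left_module R M by fact
  interpret N: left_module R N by fact
  obtain f where f: "f \<in> mod_hom R M N" "bij_betw f (carrier M) (carrier N)"
    using assms(2) by (auto simp: mod_iso_def)
  have inj: "x = y" if "x \<in> carrier M" "y \<in> carrier M" "f x = f y" for x y
    using f(2) that by (auto simp: bij_betw_def inj_on_def)
  note * = mod_iso_subsets[OF M assms(1) f]
  note z = mod_hom_zero[OF M assms(1) f(1)]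
  show ?thesis
    unfolding indecomposable_module_def
  proof (intro conjI allI impI)
    show "carrier N \<noteq> {\<zero>\<^bsub>N\<^esub>}"
    proof
      assume N0: "carrier N = {\<zero>\<^bsub>N\<^esub>}"
      then have "x = \<zero>\<^bsub>M\<^esub>" if "x \<in> carrier M" for x
        using inj[of x "\<zero>\<^bsub>M\<^esub>"] that z mod_homD(1)[OF f(1) that] by auto
      then show False using assms(3) by (auto simp: indecomposable_module_def)
    qed
    fix X Y assume XY: "complementary R N X Y"
    note D = complementaryD[OF assms(1) XY]
    let ?X = "{x \<in> carrier M. f x \<in> X}" and ?Y = "{x \<in> carrier M. f x \<in> Y}"
    have "complementary R M ?X ?Y"
    proof (rule complementaryI[OF M])
      show "x = \<zero>\<^bsub>M\<^esub>" if "x \<in> ?X" "x \<in> ?Y" for x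
        using that D(3) z inj[of x "\<zero>\<^bsub>M\<^esub>"] by auto
      fix w assume w: "w \<in> carrier M"
      then obtain x y where xy: "x \<in> X" "y \<in> Y" "f w = x \<oplus>\<^bsub>N\<^esub> y"
        using D(4) mod_homD(1)[OF f(1)] by blast
      obtain x' y' where "x' \<in> ?X" "y' \<in> ?Y" "f x' = x" "f y' = y"
        using *(2)[OF D(1)] *(2)[OF D(2)] xy by (metis (no_types, lifting) imageE)
      moreover from this have "w = x' \<oplus>\<^bsub>M\<^esub> y'"
        using xy(3) w by (intro inj) (auto simp: mod_homD(2)[OF f(1)])
      ultimately show "\<exists>x\<in>?X. \<exists>y\<in>?Y. w = x \<oplus>\<^bsub>M\<^esub> y" by blast
    qed (use *(1) D in auto)
    then have "?X = {\<zero>\<^bsub>M\<^esub>} \<or> ?Y = {\<zero>\<^bsub>M\<^esub>}"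
      using assms(3) by (auto simp: indecomposable_module_def)
    then show "X = {\<zero>\<^bsub>N\<^esub>} \<or> Y = {\<zero>\<^bsub>N\<^esub>}"
    proof
      assume "?X = {\<zero>\<^bsub>M\<^esub>}" then have "X = f ` {\<zero>\<^bsub>M\<^esub>}" using *(2)[OF D(1)] by simp
      then show ?thesis using z by simp
    next
      assume "?Y = {\<zero>\<^bsub>M\<^esub>}" then have "Y = f ` {\<zero>\<^bsub>M\<^esub>}" using *(2)[OF D(2)] by simp
      then show ?thesis using z by simp
    qed
  qed (use assms in auto)
qed

lemma fg_surj:
  assumes "left_module R N" "fg_module R M" "f \<in> mod_hom R M N" "f ` carrier M = carrier N"
  shows "fg_module R N"
proof -
  have M: "left_module R M" using assms(2) by (simp add: fg_module_def)
  interpret M: left_module R M by fact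
  interpret N: left_module R N by fact
  obtain A where A: "finite A" "A \<subseteq> carrier M" "\<And>N. submodule N R M \<Longrightarrow> A \<subseteq> N \<Longrightarrow> N = carrier M"
    using assms(2) by (auto simp: fg_module_def)
  show ?thesis
    unfolding fg_module_def
  proof (intro conjI exI[of _ "f ` A"] allI impI)
    fix X assume X: "submodule X R N \<and> f ` A \<subseteq> X"
    then have "{x \<in> carrier M. f x \<in> X} = carrier M"
      using A submodule_preimage[OF M assms(1,3)] by blast
    then have "f x \<in> X" if "x \<in> carrier M" for x using that by auto
    then have "f ` carrier M \<subseteq> X" by blast
    then have "carrier N \<subseteq> X" by (simp only: assms(4))
    then show "X = carrier N" using N.submoduleD(1)[of X] X by auto
  qed (use A assms mod_homD(1)[OF assms(3)] in auto)
qed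

lemma projective_lift:
  fixes A B :: "'a fg_mod"
  assumes "projective_module R P" "fg_module R A" "fg_module R B" "g \<in> mod_hom R A B"
    "g ` carrier A = carrier B" "f \<in> mod_hom R P B"
  obtains h where "h \<in> mod_hom R P A" "\<And>x. x \<in> carrier P \<Longrightarrow> g (h x) = f x"
proof -
  have "\<exists>h\<in>mod_hom R P A. \<forall>x\<in>carrier P. g (h x) = f x"
    by (rule assms(1)[unfolded projective_module_def, THEN conjunct2, THEN spec, of A, THEN spec, of B,
          THEN spec, of g, THEN spec, of f, THEN mp]) (intro conjI assms(2-))
  then show ?thesis using that by blast
qed

lemma projectiveI:
  assumes "fg_module R P"
    "\<And>(A :: 'a fg_mod) (B :: 'a fg_mod) g f. \<lbrakk>fg_module R A; fg_module R B; g \<in> mod_hom R A B;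
      g ` carrier A = carrier B; f \<in> mod_hom R P B\<rbrakk> \<Longrightarrow> \<exists>h\<in>mod_hom R P A. \<forall>x\<in>carrier P. g (h x) = f x"
  shows "projective_module R P"
  unfolding projective_module_def
  by (intro conjI allI impI assms(1), elim conjE) (rule assms(2))

lemma projective_iso:
  assumes "left_module R N" "mod_iso R M N" "projective_module R M"
  shows "projective_module R N"
proof -
  have fgM: "fg_module R M" and M: "left_module R M"
    using assms(3) by (auto simp: projective_module_def fg_module_def)
  obtain f where f: "f \<in> mod_hom R M N" "bij_betw f (carrier M) (carrier N)"
    using assms(2) by (auto simp: mod_iso_def)
  note fi = inv_into_mod_hom[OF M f]
  show ?thesis
  proof (rule projectiveI)
    show "fg_module R N" using fg_surj[OF assms(1) fgM f(1)] f(2) by (simp add: bij_betw_def)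
    fix A B :: "'a fg_mod" and g h
    assume *: "fg_module R A" "fg_module R B" "g \<in> mod_hom R A B" "g ` carrier A = carrier B"
       "h \<in> mod_hom R N B"
    then obtain k where k: "k \<in> mod_hom R M A" "\<And>x. x \<in> carrier M \<Longrightarrow> g (k x) = h (f x)"
      using projective_lift[OF assms(3) *(1-4) mod_hom_compose[OF f(1) *(5)]] by blast
    have "inv_into (carrier M) f y \<in> carrier M \<and> f (inv_into (carrier M) f y) = y" if "y \<in> carrier N" for y
      using f(2) that by (auto simp: bij_betw_def inv_into_into f_inv_into_f)
    then show "\<exists>h'\<in>mod_hom R N A. \<forall>x\<in>carrier N. g (h' x) = h x"
      using k mod_hom_compose[OF fi k(1)] by (intro bexI[of _ "\<lambda>x. k (inv_into (carrier M) f x)"]) auto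
  qed
qed

lemma regular_module_simps [simp]:
  "carrier (regular_module R) = carrier R" "\<zero>\<^bsub>regular_module R\<^esub> = \<zero>\<^bsub>R\<^esub>"
  "add (regular_module R) = add R" "smult (regular_module R) = mult R"
  by (simp_all add: regular_module_def)

lemma finsum_regular_module [simp]: "finsum (regular_module R) f A = finsum R f A"
  by (simp add: finsum_def finprod_def)

lemma a_inv_regular_module [simp]: "\<ominus>\<^bsub>regular_module R\<^esub> x = \<ominus>\<^bsub>R\<^esub> x"
  by (simp add: a_inv_def m_inv_def)

lemma (in ring) fg_regular: "fg_module R (regular_module R)"
proof -
  interpret left_module R "regular_module R" by (rule left_module_regular[OF ring_axioms])
  show ?thesis by (rule fg_cyclic[of \<one>]) auto
qed

text \<open>\<open>F\<close> is an idempotent endomorphism with image \<open>X\<close>, so M is the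
  direct sum of \<open>X\<close> and the kernel of \<open>F\<close>, and the kernel has to
  vanish.\<close>

lemma retract_indecomposable:
  assumes "indecomposable_module R M" "submodule X R M" "F \<in> mod_hom R M M"
    "\<And>y. y \<in> carrier M \<Longrightarrow> F y \<in> X" "\<And>y. y \<in> X \<Longrightarrow> F y = y" "X \<noteq> {\<zero>\<^bsub>M\<^esub>}"
  shows "X = carrier M"
proof -
  interpret left_module R M using assms(1) by (simp add: indecomposable_module_def)
  note lm = left_module_axioms
  note D = submoduleD[OF assms(2)] and h = mod_homD[OF assms(3)]
  have split: "F y \<in> X" "y \<ominus>\<^bsub>M\<^esub> F y \<in> a_kernel M M F" "y = F y \<oplus>\<^bsub>M\<^esub> (y \<ominus>\<^bsub>M\<^esub> F y)" if y: "y \<in> carrier M" for y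
  proof -
    show X: "F y \<in> X" using assms(4) y .
    have "F (y \<ominus>\<^bsub>M\<^esub> F y) = \<zero>\<^bsub>M\<^esub>"
      using mod_hom_diff[OF lm lm assms(3) y] assms(5)[OF X] D(3)[OF X] by (simp add: a_minus_def M.r_neg)
    then show "y \<ominus>\<^bsub>M\<^esub> F y \<in> a_kernel M M F" using y D(3)[OF X] by (simp add: a_kernel_eq)
    show "y = F y \<oplus>\<^bsub>M\<^esub> (y \<ominus>\<^bsub>M\<^esub> F y)"
      using y D(3)[OF X] by (simp add: a_minus_def M.a_lcomm M.r_neg)
  qed
  have "complementary R M X (a_kernel M M F)"
    using split assms(5) submodule_kernel[OF lm lm assms(3)]
    by (intro complementaryI[OF lm assms(2)]) (force simp: a_kernel_eq)+
  then have "a_kernel M M F = {\<zero>\<^bsub>M\<^esub>}" using assms(1,6) by (auto simp: indecomposable_module_def)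
  then have "y = F y" if "y \<in> carrier M" for y
    using split[OF that] h(1)[OF that] by auto
  then show ?thesis using D(1) assms(4) by force
qed

context left_module
begin

text \<open>The issue is well-definedness: \<open>F\<close> reads off some representation x + a b by
  choice. Two representations differ by a multiple (a' - a) b that lies in \<open>A\<close>, and
  there hypothesis \<open>c\<close> forces the two values to agree.\<close>

lemma adjoin_extend:
  assumes K: "left_module R K" and A: "submodule A R M" "b \<in> carrier M"
    and f: "f \<in> mod_hom R (sub_mod M A) K" and y: "y \<in> carrier K"
    and c: "\<And>a. \<lbrakk>a \<in> carrier R; a \<odot>\<^bsub>M\<^esub> b \<in> A\<rbrakk> \<Longrightarrow> f (a \<odot>\<^bsub>M\<^esub> b) = a \<odot>\<^bsub>K\<^esub> y"
  shows "\<exists>F\<in>mod_hom R (sub_mod M (adjoin A b)) K. (\<forall>x\<in>A. F x = f x) \<and> F b = y"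
proof -
  interpret K: left_module R K by fact
  note D = submoduleD[OF A(1)]
  have SA: "left_module R (sub_mod M A)" by (rule left_module_sub_mod[OF A(1)])
  note h = mod_homD[OF f, simplified]
  have fz: "f \<zero>\<^bsub>M\<^esub> = \<zero>\<^bsub>K\<^esub>" using mod_hom_zero[OF SA K f] by simp
  have fneg: "f (\<ominus>\<^bsub>M\<^esub> x) = \<ominus>\<^bsub>K\<^esub> f x" if "x \<in> A" for x
  proof -
    have "f (\<ominus>\<^bsub>M\<^esub> x) \<oplus>\<^bsub>K\<^esub> f x = \<zero>\<^bsub>K\<^esub>"
      using h(2)[OF D(6)[OF that] that] D(3)[OF that] fz by (simp add: M.l_neg)
    then show ?thesis using h(1) that D(6)[OF that] by (intro K.M.minus_equality[symmetric]) auto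
  qed
  define F where "F z = (let (x, a) = (SOME (x, a). x \<in> A \<and> a \<in> carrier R \<and> z = x \<oplus>\<^bsub>M\<^esub> a \<odot>\<^bsub>M\<^esub> b)
    in f x \<oplus>\<^bsub>K\<^esub> a \<odot>\<^bsub>K\<^esub> y)" for z
  have F: "F (x \<oplus>\<^bsub>M\<^esub> a \<odot>\<^bsub>M\<^esub> b) = f x \<oplus>\<^bsub>K\<^esub> a \<odot>\<^bsub>K\<^esub> y" if xa: "x \<in> A" "a \<in> carrier R" for x a
  proof -
    let ?z = "x \<oplus>\<^bsub>M\<^esub> a \<odot>\<^bsub>M\<^esub> b"
    obtain x' a' where s: "(SOME (x, a). x \<in> A \<and> a \<in> carrier R \<and> ?z = x \<oplus>\<^bsub>M\<^esub> a \<odot>\<^bsub>M\<^esub> b) = (x', a')"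
      by fastforce
    have *: "x' \<in> A \<and> a' \<in> carrier R \<and> ?z = x' \<oplus>\<^bsub>M\<^esub> a' \<odot>\<^bsub>M\<^esub> b"
      using someI[of "\<lambda>(x, a). x \<in> A \<and> a \<in> carrier R \<and> ?z = x \<oplus>\<^bsub>M\<^esub> a \<odot>\<^bsub>M\<^esub> b" "(x, a)"] xa s by simp
    have M: "x \<in> carrier M" "x' \<in> carrier M" using D(3) xa * by auto
    have "(a' \<oplus> \<ominus> a) \<odot>\<^bsub>M\<^esub> b \<oplus>\<^bsub>M\<^esub> x' = (a' \<odot>\<^bsub>M\<^esub> b \<oplus>\<^bsub>M\<^esub> x') \<oplus>\<^bsub>M\<^esub> \<ominus>\<^bsub>M\<^esub> (a \<odot>\<^bsub>M\<^esub> b)"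
      using M * xa A(2) by (simp add: smult_l_distr smult_l_minus M.a_ac)
    also have "\<dots> = (x \<oplus>\<^bsub>M\<^esub> a \<odot>\<^bsub>M\<^esub> b) \<oplus>\<^bsub>M\<^esub> \<ominus>\<^bsub>M\<^esub> (a \<odot>\<^bsub>M\<^esub> b)"
      using M * xa A(2) by (simp add: M.a_ac)
    also have "\<dots> = x" using M xa A(2) by (simp add: M.a_assoc M.r_neg)
    finally have x: "x = (a' \<oplus> \<ominus> a) \<odot>\<^bsub>M\<^esub> b \<oplus>\<^bsub>M\<^esub> x'" by simp
    then have e: "(a' \<oplus> \<ominus> a) \<odot>\<^bsub>M\<^esub> b = x \<oplus>\<^bsub>M\<^esub> \<ominus>\<^bsub>M\<^esub> x'"
      using M * xa A(2) by (simp add: M.a_assoc M.r_neg)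
    then have A': "(a' \<oplus> \<ominus> a) \<odot>\<^bsub>M\<^esub> b \<in> A" using D(4,6) xa * by simp
    have "f x = f ((a' \<oplus> \<ominus> a) \<odot>\<^bsub>M\<^esub> b) \<oplus>\<^bsub>K\<^esub> f x'"
      using h(2)[OF A', of x'] * x by simp
    also have "f ((a' \<oplus> \<ominus> a) \<odot>\<^bsub>M\<^esub> b) = (a' \<oplus> \<ominus> a) \<odot>\<^bsub>K\<^esub> y" using c[OF _ A'] * xa by simp
    finally have fx: "f x = (a' \<oplus> \<ominus> a) \<odot>\<^bsub>K\<^esub> y \<oplus>\<^bsub>K\<^esub> f x'" .
    have "f x \<oplus>\<^bsub>K\<^esub> a \<odot>\<^bsub>K\<^esub> y = f x' \<oplus>\<^bsub>K\<^esub> (a' \<odot>\<^bsub>K\<^esub> y \<oplus>\<^bsub>K\<^esub> (\<ominus>\<^bsub>K\<^esub> (a \<odot>\<^bsub>K\<^esub> y) \<oplus>\<^bsub>K\<^esub> a \<odot>\<^bsub>K\<^esub> y))"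
      unfolding fx using * xa y h(1)[of x'] by (simp add: K.smult_l_distr K.smult_l_minus K.M.a_ac)
    also have "\<dots> = f x' \<oplus>\<^bsub>K\<^esub> a' \<odot>\<^bsub>K\<^esub> y" using * xa y by (simp add: K.M.l_neg)
    finally show ?thesis by (simp add: F_def s)
  qed
  have "F \<in> mod_hom R (sub_mod M (adjoin A b)) K"
  proof (rule mod_homI)
    show "F z \<in> carrier K" if "z \<in> carrier (sub_mod M (adjoin A b))" for z
      using that F h(1) y by (auto simp: adjoin_def)
    show "F (z \<oplus>\<^bsub>sub_mod M (adjoin A b)\<^esub> w) = F z \<oplus>\<^bsub>K\<^esub> F w"
      if zw: "z \<in> carrier (sub_mod M (adjoin A b))" "w \<in> carrier (sub_mod M (adjoin A b))" for z w
    proof -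
      obtain u s v t where *: "z = u \<oplus>\<^bsub>M\<^esub> s \<odot>\<^bsub>M\<^esub> b" "w = v \<oplus>\<^bsub>M\<^esub> t \<odot>\<^bsub>M\<^esub> b" "u \<in> A" "v \<in> A"
        "s \<in> carrier R" "t \<in> carrier R" using zw by (auto simp: adjoin_def)
      then have "z \<oplus>\<^bsub>M\<^esub> w = (u \<oplus>\<^bsub>M\<^esub> v) \<oplus>\<^bsub>M\<^esub> (s \<oplus> t) \<odot>\<^bsub>M\<^esub> b"
        using D(3) A(2) by (simp add: smult_l_distr M.a_ac)
      then have "F (z \<oplus>\<^bsub>M\<^esub> w) = (f u \<oplus>\<^bsub>K\<^esub> f v) \<oplus>\<^bsub>K\<^esub> (s \<oplus> t) \<odot>\<^bsub>K\<^esub> y"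
        using F[of "u \<oplus>\<^bsub>M\<^esub> v" "s \<oplus> t"] * D(4) h(2) by simp
      also have "\<dots> = F z \<oplus>\<^bsub>K\<^esub> F w" using * F h(1) y by (simp add: K.smult_l_distr K.M.a_ac)
      finally show ?thesis by simp
    qed
    show "F (a \<odot>\<^bsub>sub_mod M (adjoin A b)\<^esub> z) = a \<odot>\<^bsub>K\<^esub> F z"
      if az: "a \<in> carrier R" "z \<in> carrier (sub_mod M (adjoin A b))" for a z
    proof -
      obtain u s where *: "z = u \<oplus>\<^bsub>M\<^esub> s \<odot>\<^bsub>M\<^esub> b" "u \<in> A" "s \<in> carrier R"
        using az by (auto simp: adjoin_def)
      then have "a \<odot>\<^bsub>M\<^esub> z = a \<odot>\<^bsub>M\<^esub> u \<oplus>\<^bsub>M\<^esub> (a \<otimes> s) \<odot>\<^bsub>M\<^esub> b"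
        using D(3) A(2) az by (simp add: smult_r_distr smult_assoc1)
      then have "F (a \<odot>\<^bsub>M\<^esub> z) = a \<odot>\<^bsub>K\<^esub> f u \<oplus>\<^bsub>K\<^esub> (a \<otimes> s) \<odot>\<^bsub>K\<^esub> y"
        using F[of "a \<odot>\<^bsub>M\<^esub> u" "a \<otimes> s"] * D(5) h(3) az by simp
      also have "\<dots> = a \<odot>\<^bsub>K\<^esub> F z" using * F h(1) y az by (simp add: K.smult_r_distr K.smult_assoc1)
      finally show ?thesis by simp
    qed
  qed
  moreover have "F x = f x" if "x \<in> A" for x
    using F[OF that, of \<zero>] that D(3)[OF that] A(2) y h(1)[OF that] by simp
  moreover have "F b = y"
    using F[OF D(2), of \<one>] A(2) y fz by simp
  ultimately show ?thesis by blast
qed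

end

text \<open>For idempotent a and an ideal I this describes the quotient of R a by its intersection
  with I: with I = 0 the projective module R e_i, with I = J its top. Recording a generator and its
  annihilator makes maps between modules over different element types a matter of comparing
  ideals.\<close>

definition cyclic_gen :: "('a, 'm) ring_scheme \<Rightarrow> 'a \<Rightarrow> 'a set \<Rightarrow> ('a, 'b) module \<Rightarrow> 'b \<Rightarrow> bool" where
  "cyclic_gen R a I M x \<longleftrightarrow> left_module R M \<and> a \<in> carrier R \<and> x \<in> carrier M \<and> a \<odot>\<^bsub>M\<^esub> x = x \<and>
     (\<forall>y\<in>carrier M. \<exists>l\<in>carrier R. y = l \<odot>\<^bsub>M\<^esub> x) \<and>
     (\<forall>l\<in>carrier R. l \<odot>\<^bsub>M\<^esub> x = \<zero>\<^bsub>M\<^esub> \<longleftrightarrow> l \<otimes>\<^bsub>R\<^esub> a \<in> I)"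

lemma cyclic_genD:
  assumes "cyclic_gen R a I M x"
  shows "left_module R M" "x \<in> carrier M" "a \<odot>\<^bsub>M\<^esub> x = x" "a \<in> carrier R"
    "\<And>y. y \<in> carrier M \<Longrightarrow> \<exists>l\<in>carrier R. y = l \<odot>\<^bsub>M\<^esub> x"
    "\<And>l. l \<in> carrier R \<Longrightarrow> l \<odot>\<^bsub>M\<^esub> x = \<zero>\<^bsub>M\<^esub> \<longleftrightarrow> l \<otimes>\<^bsub>R\<^esub> a \<in> I"
  using assms by (auto simp: cyclic_gen_def)

text \<open>The assignment l x to l x' respects all relations because l a in \<open>I\<close>
  implies l a in \<open>I'\<close>. If the ideals agree, the same comparison read backwards makes
  the kernel zero.\<close>

lemma cyclic_gen_hom:
  assumes M: "cyclic_gen R a I M x" and K: "cyclic_gen R a I' K x'" and "I \<subseteq> I'"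
  shows "\<exists>f\<in>mod_hom R M K. f x = x' \<and> f ` carrier M = carrier K \<and> (I = I' \<longrightarrow> bij_betw f (carrier M) (carrier K))"
proof -
  note d = cyclic_genD[OF M] and d' = cyclic_genD[OF K]
  interpret M: left_module R M by (rule d)
  interpret K: left_module R K by (rule d')
  have eq: "l \<odot>\<^bsub>K\<^esub> x' = m \<odot>\<^bsub>K\<^esub> x'" if "l \<in> carrier R" "m \<in> carrier R" "l \<odot>\<^bsub>M\<^esub> x = m \<odot>\<^bsub>M\<^esub> x" for l m
  proof -
    have "(l \<oplus>\<^bsub>R\<^esub> \<ominus>\<^bsub>R\<^esub> m) \<odot>\<^bsub>M\<^esub> x = \<zero>\<^bsub>M\<^esub>"
      using that d(2) by (simp add: M.smult_l_distr M.smult_l_minus M.M.r_neg)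
    then have "(l \<oplus>\<^bsub>R\<^esub> \<ominus>\<^bsub>R\<^esub> m) \<odot>\<^bsub>K\<^esub> x' = \<zero>\<^bsub>K\<^esub>" using that d(6) d'(6) assms(3) by auto
    then have "l \<odot>\<^bsub>K\<^esub> x' \<oplus>\<^bsub>K\<^esub> \<ominus>\<^bsub>K\<^esub> (m \<odot>\<^bsub>K\<^esub> x') = \<zero>\<^bsub>K\<^esub>"
      using that d'(2) by (simp add: K.smult_l_distr K.smult_l_minus)
    then show ?thesis using that d'(2) K.M.minus_equality[of "l \<odot>\<^bsub>K\<^esub> x'" "\<ominus>\<^bsub>K\<^esub> (m \<odot>\<^bsub>K\<^esub> x')"] by simp
  qed
  define f where "f y = (SOME l. l \<in> carrier R \<and> y = l \<odot>\<^bsub>M\<^esub> x) \<odot>\<^bsub>K\<^esub> x'" for y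
  have f: "f (l \<odot>\<^bsub>M\<^esub> x) = l \<odot>\<^bsub>K\<^esub> x'" if "l \<in> carrier R" for l
  proof -
    define m where "m = (SOME m. m \<in> carrier R \<and> l \<odot>\<^bsub>M\<^esub> x = m \<odot>\<^bsub>M\<^esub> x)"
    have "m \<in> carrier R \<and> l \<odot>\<^bsub>M\<^esub> x = m \<odot>\<^bsub>M\<^esub> x"
      unfolding m_def using that by (intro someI[of "\<lambda>m. m \<in> carrier R \<and> l \<odot>\<^bsub>M\<^esub> x = m \<odot>\<^bsub>M\<^esub> x" l]) auto
    then have "m \<odot>\<^bsub>K\<^esub> x' = l \<odot>\<^bsub>K\<^esub> x'" using that by (intro eq) auto
    then show ?thesis unfolding f_def m_def[symmetric] .
  qed
  have hom: "f \<in> mod_hom R M K"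
  proof (rule mod_homI)
    fix y assume "y \<in> carrier M"
    then obtain l where l: "l \<in> carrier R" "y = l \<odot>\<^bsub>M\<^esub> x" using d(5) by blast
    then show "f y \<in> carrier K" using f d'(2) by simp
    show "f (c \<odot>\<^bsub>M\<^esub> y) = c \<odot>\<^bsub>K\<^esub> f y" if "c \<in> carrier R" for c
      using f[of "c \<otimes>\<^bsub>R\<^esub> l"] f l that d(2) d'(2) by (simp add: M.smult_assoc1 K.smult_assoc1)
    fix z assume "z \<in> carrier M"
    then obtain m where m: "m \<in> carrier R" "z = m \<odot>\<^bsub>M\<^esub> x" using d(5) by blast
    show "f (y \<oplus>\<^bsub>M\<^esub> z) = f y \<oplus>\<^bsub>K\<^esub> f z"
      using f[of "l \<oplus>\<^bsub>R\<^esub> m"] f l m d(2) d'(2) by (simp add: M.smult_l_distr K.smult_l_distr)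
  qed
  have fx: "f x = x'" using f[of "\<one>\<^bsub>R\<^esub>"] d(2) d'(2) by simp
  have sur: "f ` carrier M = carrier K"
  proof
    show "carrier K \<subseteq> f ` carrier M"
    proof
      fix y assume "y \<in> carrier K"
      then obtain l where l: "l \<in> carrier R" "y = l \<odot>\<^bsub>K\<^esub> x'" using d'(5) by blast
      then show "y \<in> f ` carrier M" using f[of l] d(2) by (intro image_eqI[of _ _ "l \<odot>\<^bsub>M\<^esub> x"]) auto
    qed
  qed (use mod_homD(1)[OF hom] in auto)
  have "inj_on f (carrier M)" if "I = I'"
  proof (rule mod_hom_inj_onI[OF d(1) d'(1) hom])
    fix y assume y: "y \<in> carrier M" "f y = \<zero>\<^bsub>K\<^esub>"
    then obtain l where l: "l \<in> carrier R" "y = l \<odot>\<^bsub>M\<^esub> x" using d(5) by blast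
    then show "y = \<zero>\<^bsub>M\<^esub>" using f y(2) d(6) d'(6) that by auto
  qed
  then show ?thesis using hom fx sur by (auto simp: bij_betw_def)
qed

lemma cyclic_gen_iso:
  assumes "cyclic_gen R a I M x" "left_module R K" "f \<in> mod_hom R M K" "bij_betw f (carrier M) (carrier K)"
  shows "cyclic_gen R a I K (f x)"
proof -
  note d = cyclic_genD[OF assms(1)]
  interpret M: left_module R M by (rule d)
  interpret K: left_module R K by fact
  note h = mod_homD[OF assms(3)]
  have inj: "l \<odot>\<^bsub>K\<^esub> f x = \<zero>\<^bsub>K\<^esub> \<longleftrightarrow> l \<odot>\<^bsub>M\<^esub> x = \<zero>\<^bsub>M\<^esub>" if "l \<in> carrier R" for l
    using h(3)[OF that d(2)] mod_hom_zero[OF d(1) assms(2,3)] assms(4) d(2) that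
    by (metis M.M.zero_closed M.smult_closed bij_betw_def inj_on_eq_iff)
  show ?thesis
    unfolding cyclic_gen_def
  proof (intro conjI ballI)
    show "a \<odot>\<^bsub>K\<^esub> f x = f x" using h(3)[of a x] d by simp
    fix y assume "y \<in> carrier K"
    then obtain z where "z \<in> carrier M" "y = f z" using assms(4) by (auto simp: bij_betw_def)
    then show "\<exists>l\<in>carrier R. y = l \<odot>\<^bsub>K\<^esub> f x" using d(2,5) h(3) by metis
  qed (use d h inj assms in auto)
qed

section \<open>Radical square zero Nakayama rings\<close>

text \<open>Abstract form of a basic ring with square zero radical \<open>J\<close>.
  \<open>unit_or_J\<close> says at once that every corner e_i R e_i is local and that the corners
  e_i R e_l with distinct i, l lie in J, that is, that the R e_i are pairwise non-isomorphic. All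
  axioms are symmetric, so they pass to the opposite ring.\<close>

locale idem_ring = ring R for R :: "('a, 'm) ring_scheme" (structure) +
  fixes N :: nat and e :: "nat \<Rightarrow> 'a" and J :: "'a set"
  assumes e_closed [simp, intro]: "i < N \<Longrightarrow> e i \<in> carrier R"
    and e_idem [simp]: "i < N \<Longrightarrow> e i \<otimes> e i = e i"
    and e_orth: "\<lbrakk>i < N; j < N; i \<noteq> j\<rbrakk> \<Longrightarrow> e i \<otimes> e j = \<zero>"
    and e_sum: "(\<Oplus>i\<in>{..<N}. e i) = \<one>"
    and J_ideal: "ideal J R"
    and JJ: "\<lbrakk>x \<in> J; y \<in> J\<rbrakk> \<Longrightarrow> x \<otimes> y = \<zero>"
    and e_notin: "i < N \<Longrightarrow> e i \<notin> J"
    and unit_or_J: "\<lbrakk>x \<in> carrier R; i < N; l < N; e i \<otimes> x \<otimes> e l = x; x \<notin> J\<rbrakk> \<Longrightarrow>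
      i = l \<and> (\<exists>y\<in>carrier R. y \<otimes> x = e i \<and> x \<otimes> y = e i)"

text \<open>What uniseriality leaves when J J = 0: every nonzero element of J e_i generates it on
  the left, and every nonzero element of e_i J generates it on the right. So each of these is zero
  or simple.\<close>

locale nak_ring = idem_ring +
  assumes left_uni: "\<lbrakk>i < N; u \<in> J; v \<in> J; u \<otimes> e i = u; v \<otimes> e i = v; u \<noteq> \<zero>\<rbrakk> \<Longrightarrow> \<exists>a\<in>carrier R. v = a \<otimes> u"
    and right_uni: "\<lbrakk>i < N; u \<in> J; v \<in> J; e i \<otimes> u = u; e i \<otimes> v = v; u \<noteq> \<zero>\<rbrakk> \<Longrightarrow> \<exists>a\<in>carrier R. v = u \<otimes> a"

locale idem_module = idem_ring R N e J + left_module R M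
  for R :: "('a, 'm) ring_scheme" (structure) and N e J and M :: "('a, 'b) module" (structure)

locale nak_module = nak_ring R N e J + left_module R M
  for R :: "('a, 'm) ring_scheme" (structure) and N e J and M :: "('a, 'b) module" (structure)

sublocale nak_module \<subseteq> idem_module ..

context idem_ring
begin

lemma J_D:
  shows "x \<in> J \<Longrightarrow> x \<in> carrier R" "\<zero> \<in> J" "\<lbrakk>x \<in> J; y \<in> J\<rbrakk> \<Longrightarrow> x \<oplus> y \<in> J"
    "\<lbrakk>x \<in> J; a \<in> carrier R\<rbrakk> \<Longrightarrow> a \<otimes> x \<in> J" "\<lbrakk>x \<in> J; a \<in> carrier R\<rbrakk> \<Longrightarrow> x \<otimes> a \<in> J"
    "x \<in> J \<Longrightarrow> \<ominus> x \<in> J"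
proof -
  interpret J: ideal J R by (rule J_ideal)
  show "x \<in> J \<Longrightarrow> x \<in> carrier R" "\<zero> \<in> J" "\<lbrakk>x \<in> J; y \<in> J\<rbrakk> \<Longrightarrow> x \<oplus> y \<in> J"
    "\<lbrakk>x \<in> J; a \<in> carrier R\<rbrakk> \<Longrightarrow> a \<otimes> x \<in> J" "\<lbrakk>x \<in> J; a \<in> carrier R\<rbrakk> \<Longrightarrow> x \<otimes> a \<in> J"
    "x \<in> J \<Longrightarrow> \<ominus> x \<in> J"
    by (auto simp: J.I_l_closed J.I_r_closed)
qed

lemma e_decomp_right: "x \<in> carrier R \<Longrightarrow> x = (\<Oplus>i\<in>{..<N}. x \<otimes> e i)"
  using finsum_rdistr[of "{..<N}" x e] by (simp add: e_sum Pi_iff)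

lemma e_decomp_left: "x \<in> carrier R \<Longrightarrow> x = (\<Oplus>i\<in>{..<N}. e i \<otimes> x)"
  using finsum_ldistr[of "{..<N}" x e] by (simp add: e_sum Pi_iff)

lemma J_finsum: "f \<in> A \<rightarrow> J \<Longrightarrow> finsum R f A \<in> J"
proof -
  interpret left_module R "regular_module R" by (rule left_module_regular[OF ring_axioms])
  have "submodule J R (regular_module R)"
    by (rule submoduleI) (auto simp: J_D)
  from submodule_finsum[OF this] show "f \<in> A \<rightarrow> J \<Longrightarrow> finsum R f A \<in> J" by simp
qed

lemma not_J_right: "\<lbrakk>x \<in> carrier R; x \<notin> J\<rbrakk> \<Longrightarrow> \<exists>i<N. x \<otimes> e i \<notin> J"
  using e_decomp_right[of x] J_finsum[of "\<lambda>i. x \<otimes> e i" "{..<N}"] by (auto simp: Pi_iff)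

lemma not_J_left: "\<lbrakk>x \<in> carrier R; x \<notin> J\<rbrakk> \<Longrightarrow> \<exists>i<N. e i \<otimes> x \<notin> J"
  using e_decomp_left[of x] J_finsum[of "\<lambda>i. e i \<otimes> x" "{..<N}"] by (auto simp: Pi_iff)

lemma nonzero_right:
  assumes "x \<in> carrier R" "x \<noteq> \<zero>" shows "\<exists>i<N. x \<otimes> e i \<noteq> \<zero>"
proof (rule ccontr)
  assume "\<not> ?thesis"
  then have "(\<Oplus>i\<in>{..<N}. x \<otimes> e i) = \<zero>" by (intro add.finprod_one_eqI) auto
  then show False using e_decomp_right assms by simp
qed

lemma nonzero_left:
  assumes "x \<in> carrier R" "x \<noteq> \<zero>" shows "\<exists>i<N. e i \<otimes> x \<noteq> \<zero>"
proof (rule ccontr)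
  assume "\<not> ?thesis"
  then have "(\<Oplus>i\<in>{..<N}. e i \<otimes> x) = \<zero>" by (intro add.finprod_one_eqI) auto
  then show False using e_decomp_left assms by simp
qed

lemma e_ne_0: "i < N \<Longrightarrow> e i \<noteq> \<zero>"
  using e_notin J_D(2) by force

lemma offdiag:
  assumes "x \<in> carrier R" "i < N" "l < N" "i \<noteq> l" shows "e i \<otimes> x \<otimes> e l \<in> J"
proof (rule ccontr)
  assume n: "e i \<otimes> x \<otimes> e l \<notin> J"
  have "e i \<otimes> (e i \<otimes> x \<otimes> e l) \<otimes> e l = e i \<otimes> e i \<otimes> x \<otimes> (e l \<otimes> e l)"
    using assms by (simp only: m_assoc e_closed m_closed)
  also have "\<dots> = e i \<otimes> x \<otimes> e l" using assms by simp
  finally show False using unit_or_J[of "e i \<otimes> x \<otimes> e l" i l] assms n by simp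
qed

lemma diag_unit:
  assumes "x \<in> carrier R" "l < N" "e l \<otimes> x \<otimes> e l \<notin> J"
  shows "\<exists>y\<in>carrier R. e l \<otimes> y = y \<and> y \<otimes> e l = y \<and> y \<otimes> x \<otimes> e l = e l \<and> e l \<otimes> x \<otimes> y = e l"
proof -
  have "e l \<otimes> (e l \<otimes> x \<otimes> e l) \<otimes> e l = e l \<otimes> e l \<otimes> x \<otimes> (e l \<otimes> e l)"
    using assms by (simp only: m_assoc e_closed m_closed)
  also have "\<dots> = e l \<otimes> x \<otimes> e l" using assms by simp
  finally obtain z where z: "z \<in> carrier R" "z \<otimes> (e l \<otimes> x \<otimes> e l) = e l" "(e l \<otimes> x \<otimes> e l) \<otimes> z = e l"
    using unit_or_J[of "e l \<otimes> x \<otimes> e l" l l] assms by auto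
  have "e l \<otimes> z \<otimes> e l \<otimes> x \<otimes> e l = e l \<otimes> (z \<otimes> (e l \<otimes> x \<otimes> e l))"
    using assms(1,2) z(1) by (simp only: m_assoc e_closed m_closed)
  moreover have "e l \<otimes> x \<otimes> (e l \<otimes> z \<otimes> e l) = ((e l \<otimes> x \<otimes> e l) \<otimes> z) \<otimes> e l"
    using assms(1,2) z(1) by (simp only: m_assoc e_closed m_closed)
  moreover have "e l \<otimes> (e l \<otimes> z \<otimes> e l) = (e l \<otimes> e l) \<otimes> z \<otimes> e l" "e l \<otimes> z \<otimes> e l \<otimes> e l = e l \<otimes> z \<otimes> (e l \<otimes> e l)"
    using assms(1,2) z(1) by (simp_all only: m_assoc e_closed m_closed)
  ultimately show ?thesis using z assms by (intro bexI[of _ "e l \<otimes> z \<otimes> e l"]) auto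
qed

text \<open>Some component e_i x e_l lies outside J. By \<open>offdiag\<close> it is the diagonal
  one, and that one is invertible in the local corner ring.\<close>

lemma left_unit:
  assumes "x \<in> carrier R" "l < N" "x \<otimes> e l \<notin> J"
  shows "\<exists>y\<in>carrier R. e l \<otimes> y = y \<and> y \<otimes> e l = y \<and> y \<otimes> x \<otimes> e l = e l \<and> e l \<otimes> x \<otimes> y = e l"
proof -
  obtain i where i: "i < N" "e i \<otimes> (x \<otimes> e l) \<notin> J" using not_J_left[of "x \<otimes> e l"] assms by auto
  then have "i = l" using offdiag[of x i l] assms by (auto simp: m_assoc)
  then show ?thesis using diag_unit[of x l] i assms by (simp add: m_assoc)
qed

lemma right_unit:
  assumes "x \<in> carrier R" "l < N" "e l \<otimes> x \<notin> J"
  shows "\<exists>y\<in>carrier R. e l \<otimes> y = y \<and> y \<otimes> e l = y \<and> y \<otimes> x \<otimes> e l = e l \<and> e l \<otimes> x \<otimes> y = e l"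
proof -
  obtain i where i: "i < N" "(e l \<otimes> x) \<otimes> e i \<notin> J" using not_J_right[of "e l \<otimes> x"] assms by auto
  then have "i = l" using offdiag[of x l i] assms by auto
  then show ?thesis using diag_unit[of x l] i assms by simp
qed

end

context idem_module
begin

lemma module_decomp: "x \<in> carrier M \<Longrightarrow> x = (\<Oplus>\<^bsub>M\<^esub>i\<in>{..<N}. e i \<odot>\<^bsub>M\<^esub> x)"
  using finsum_smult_l[of x e "{..<N}"] by (simp add: e_sum Pi_iff)

lemma nonzero_component:
  assumes "x \<in> carrier M" "x \<noteq> \<zero>\<^bsub>M\<^esub>" shows "\<exists>i<N. e i \<odot>\<^bsub>M\<^esub> x \<noteq> \<zero>\<^bsub>M\<^esub>"
proof (rule ccontr)
  assume "\<not> ?thesis"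
  then have "(\<Oplus>\<^bsub>M\<^esub>i\<in>{..<N}. e i \<odot>\<^bsub>M\<^esub> x) = \<zero>\<^bsub>M\<^esub>" by (intro M.add.finprod_one_eqI) auto
  then show False using module_decomp assms by simp
qed

lemma e_e_smult [simp]: "\<lbrakk>i < N; x \<in> carrier M\<rbrakk> \<Longrightarrow> e i \<odot>\<^bsub>M\<^esub> (e i \<odot>\<^bsub>M\<^esub> x) = e i \<odot>\<^bsub>M\<^esub> x"
  by (simp add: smult_assoc1[symmetric])

text \<open>A generator is the sum of its components e_i b, so these are adjoined one after the
  other. Each new generator is then fixed by a single idempotent, which makes its coefficients
  elements of R e_i.\<close>

lemma fg_induct_e:
  assumes fg: "fg_module R M" and A0: "submodule A0 R M" "P A0"
    and step: "\<And>A b i. \<lbrakk>submodule A R M; A0 \<subseteq> A; P A; i < N; b \<in> carrier M; e i \<odot>\<^bsub>M\<^esub> b = b; b \<notin> A\<rbrakk> \<Longrightarrow> P (adjoin A b)"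
  shows "P (carrier M)"
proof (rule fg_induct[of A0 P, OF fg A0])
  fix A b assume A: "submodule A R M" "A0 \<subseteq> A" "P A" and b: "b \<in> carrier M"
  have "\<exists>B. submodule B R M \<and> A \<subseteq> B \<and> (\<forall>i<k. e i \<odot>\<^bsub>M\<^esub> b \<in> B) \<and> P B" if "k \<le> N" for k
    using that
  proof (induction k)
    case 0 then show ?case using A by auto
  next
    case (Suc k)
    then obtain B where B: "submodule B R M" "A \<subseteq> B" "\<forall>i<k. e i \<odot>\<^bsub>M\<^esub> b \<in> B" "P B" by auto
    have k: "k < N" using Suc by simp
    show ?case
    proof (cases "e k \<odot>\<^bsub>M\<^esub> b \<in> B")
      case True then show ?thesis using B by (intro exI[of _ B]) (auto simp: less_Suc_eq)
    next
      case False
      have "P (adjoin B (e k \<odot>\<^bsub>M\<^esub> b))"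
        using step[of B k "e k \<odot>\<^bsub>M\<^esub> b"] B A k b False by auto
      then show ?thesis
        using B adjoin_subset[of B "e k \<odot>\<^bsub>M\<^esub> b"] submodule_adjoin[of B "e k \<odot>\<^bsub>M\<^esub> b"] k b
        by (intro exI[of _ "adjoin B (e k \<odot>\<^bsub>M\<^esub> b)"]) (auto simp: less_Suc_eq)
    qed
  qed
  then obtain B where B: "submodule B R M" "A \<subseteq> B" "\<forall>i<N. e i \<odot>\<^bsub>M\<^esub> b \<in> B" "P B" by blast
  have "(\<Oplus>\<^bsub>M\<^esub>i\<in>{..<N}. e i \<odot>\<^bsub>M\<^esub> b) \<in> B" by (rule submodule_finsum[OF B(1)]) (use B in auto)
  then show "\<exists>B. submodule B R M \<and> A \<subseteq> B \<and> b \<in> B \<and> P B" using B module_decomp[OF b] by auto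
qed

text \<open>If a e_i were outside J, it would have a left inverse up to e_i, and multiplying a b by
  it would put b back into A. So the coefficients of all relations on a genuinely new generator are
  radical.\<close>

lemma mem_or_J:
  assumes "submodule A R M" "b \<in> carrier M" "i < N" "e i \<odot>\<^bsub>M\<^esub> b = b" "b \<notin> A"
    "a \<in> carrier R" "a \<odot>\<^bsub>M\<^esub> b \<in> A"
  shows "a \<otimes> e i \<in> J"
proof (rule ccontr)
  assume "a \<otimes> e i \<notin> J"
  then obtain y where y: "y \<in> carrier R" "y \<otimes> a \<otimes> e i = e i" using left_unit assms by blast
  have "b = (y \<otimes> a \<otimes> e i) \<odot>\<^bsub>M\<^esub> b" using y assms by simp
  also have "\<dots> = y \<odot>\<^bsub>M\<^esub> (a \<odot>\<^bsub>M\<^esub> b)" using y(1) assms by (simp add: smult_assoc1)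
  also have "\<dots> \<in> A" using submoduleD(5)[OF assms(1)] y assms by simp
  finally show False using assms by simp
qed

text \<open>Every new generator may be sent to zero: a multiple a b inside the old submodule has a
  e_i in J, hence is itself zero.\<close>

lemma semisimple_extend:
  assumes fg: "fg_module R M" and ss: "\<And>j x. \<lbrakk>j \<in> J; x \<in> carrier M\<rbrakk> \<Longrightarrow> j \<odot>\<^bsub>M\<^esub> x = \<zero>\<^bsub>M\<^esub>"
    and A: "submodule A R M" and K: "left_module R K" and f: "f \<in> mod_hom R (sub_mod M A) K"
  shows "\<exists>F\<in>mod_hom R M K. \<forall>x\<in>A. F x = f x"
proof -
  interpret K: left_module R K by fact
  have "\<exists>F\<in>mod_hom R (sub_mod M (carrier M)) K. \<forall>x\<in>A. F x = f x"
  proof (rule fg_induct_e[OF fg A])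
    show "\<exists>F\<in>mod_hom R (sub_mod M A) K. \<forall>x\<in>A. F x = f x" using f by blast
    fix B b i
    assume B: "submodule B R M" "A \<subseteq> B" "\<exists>F\<in>mod_hom R (sub_mod M B) K. \<forall>x\<in>A. F x = f x"
      and b: "i < N" "b \<in> carrier M" "e i \<odot>\<^bsub>M\<^esub> b = b" "b \<notin> B"
    then obtain F where F: "F \<in> mod_hom R (sub_mod M B) K" "\<forall>x\<in>A. F x = f x" by blast
    have "F (a \<odot>\<^bsub>M\<^esub> b) = a \<odot>\<^bsub>K\<^esub> \<zero>\<^bsub>K\<^esub>" if a: "a \<in> carrier R" "a \<odot>\<^bsub>M\<^esub> b \<in> B" for a
    proof -
      have "a \<otimes> e i \<in> J" using mem_or_J B b a by blast
      then have "a \<odot>\<^bsub>M\<^esub> b = \<zero>\<^bsub>M\<^esub>" using ss[of "a \<otimes> e i" b] b a by (simp add: smult_assoc1)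
      moreover have "F \<zero>\<^bsub>M\<^esub> = \<zero>\<^bsub>K\<^esub>"
        using mod_hom_zero[OF left_module_sub_mod[OF B(1)] K F(1)] by simp
      ultimately show ?thesis using a by simp
    qed
    then obtain G where G: "G \<in> mod_hom R (sub_mod M (adjoin B b)) K" "\<forall>x\<in>B. G x = F x"
      using adjoin_extend[OF K B(1) b(2) F(1) K.M.zero_closed] by blast
    then show "\<exists>F\<in>mod_hom R (sub_mod M (adjoin B b)) K. \<forall>x\<in>A. F x = f x"
      using F(2) B(2) by (intro bexI[of _ G]) auto
  qed
  then show ?thesis by simp
qed

end

context nak_module
begin

text \<open>Injectivity of R e_i when J e_i is nonzero. Functions into R with values fixed by right
  multiplication with e_i stand for maps into R e_i. In each step a value y for the new generator b
  must solve F(a b) = a y for all relations a; they reduce to a single equation w = u y, solvable by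
  \<open>right_uni\<close> once w is known to be radical.\<close>

lemma injective_extend:
  assumes fg: "fg_module R M" and i: "i < N" and v: "v \<in> J" "v \<otimes> e i \<noteq> \<zero>"
    and A: "submodule A R M" and f: "f \<in> mod_hom R (sub_mod M A) (regular_module R)"
    and fi: "\<And>x. x \<in> A \<Longrightarrow> f x \<otimes> e i = f x"
  shows "\<exists>F\<in>mod_hom R M (regular_module R). (\<forall>x\<in>carrier M. F x \<otimes> e i = F x) \<and> (\<forall>x\<in>A. F x = f x)"
proof -
  let ?K = "regular_module R"
  interpret K: left_module R ?K by (rule left_module_regular[OF ring_axioms])
  note K = K.left_module_axioms
  let ?P = "\<lambda>B. \<exists>F\<in>mod_hom R (sub_mod M B) ?K. (\<forall>x\<in>B. F x \<otimes> e i = F x) \<and> (\<forall>x\<in>A. F x = f x)"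
  have "?P (carrier M)"
  proof (rule fg_induct_e[OF fg A])
    show "?P A" using f fi by blast
    fix B b l
    assume B: "submodule B R M" "A \<subseteq> B" "?P B"
      and b: "l < N" "b \<in> carrier M" "e l \<odot>\<^bsub>M\<^esub> b = b" "b \<notin> B"
    note D = submoduleD[OF B(1)]
    obtain F where F: "F \<in> mod_hom R (sub_mod M B) ?K" "\<forall>x\<in>B. F x \<otimes> e i = F x" "\<forall>x\<in>A. F x = f x"
      using B(3) by blast
    note h = mod_homD[OF F(1), simplified]
    have F0: "F \<zero>\<^bsub>M\<^esub> = \<zero>" using mod_hom_zero[OF left_module_sub_mod[OF B(1)] K F(1)] by simp
    have aJ: "a \<otimes> e l \<in> J" if "a \<in> carrier R" "a \<odot>\<^bsub>M\<^esub> b \<in> B" for a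
      using mem_or_J B b that by blast
    have ael: "(a \<otimes> e l) \<odot>\<^bsub>M\<^esub> b = a \<odot>\<^bsub>M\<^esub> b" if "a \<in> carrier R" for a
      using that b by (simp add: smult_assoc1)
    have "\<exists>y\<in>carrier R. y \<otimes> e i = y \<and> (\<forall>a\<in>carrier R. a \<odot>\<^bsub>M\<^esub> b \<in> B \<longrightarrow> F (a \<odot>\<^bsub>M\<^esub> b) = a \<otimes> y)"
    proof (cases "\<forall>a\<in>carrier R. a \<odot>\<^bsub>M\<^esub> b \<in> B \<longrightarrow> a \<otimes> e l = \<zero>")
      case True
      have "F (a \<odot>\<^bsub>M\<^esub> b) = a \<otimes> \<zero>" if "a \<in> carrier R" "a \<odot>\<^bsub>M\<^esub> b \<in> B" for a
        using True that ael[of a] F0 b by simp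
      then show ?thesis using i by (intro bexI[of _ \<zero>]) auto
    next
      case False
      then obtain a0 where a0: "a0 \<in> carrier R" "a0 \<odot>\<^bsub>M\<^esub> b \<in> B" "a0 \<otimes> e l \<noteq> \<zero>" by blast
      then obtain m where m: "m < N" "e m \<otimes> (a0 \<otimes> e l) \<noteq> \<zero>" using nonzero_left[of "a0 \<otimes> e l"] b by auto
      \<comment> \<open>All coefficients a e_l of relations lie in J e_l, so a nonzero one generates
        the rest by \<open>left_uni\<close>. Cutting it by e_m on the left puts it into e_m J, where
        \<open>right_uni\<close> applies.\<close>
      define u where "u = e m \<otimes> (a0 \<otimes> e l)"
      have u: "u \<in> J" "u \<in> carrier R" "u \<noteq> \<zero>" "e m \<otimes> u = u" "u \<otimes> e l = u"
        using aJ[OF a0(1,2)] m J_D a0 b by (auto simp: u_def m_assoc m_assoc[symmetric, of "e m" "e m"])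
      have ub: "u \<odot>\<^bsub>M\<^esub> b = e m \<odot>\<^bsub>M\<^esub> (a0 \<odot>\<^bsub>M\<^esub> b)"
        using m a0 b by (simp add: u_def smult_assoc1)
      then have uB: "u \<odot>\<^bsub>M\<^esub> b \<in> B" using D(5) a0 m by simp
      define w where "w = F (u \<odot>\<^bsub>M\<^esub> b)"
      have w: "w \<in> carrier R" "w \<otimes> e i = w" using h(1) F(2) uB by (auto simp: w_def)
      have mw: "e m \<otimes> w = w"
        using h(3)[of "e m" "u \<odot>\<^bsub>M\<^esub> b"] uB u m b
        by (simp add: w_def smult_assoc1[symmetric])
      \<comment> \<open>Otherwise y w = e_i for some y, and v e_i = v y w = F(v y u b) = 0, because
        v and y u are both in J. This contradicts the choice of v; it is the only place where the
        nonzero radical of R e_i is used.\<close>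
      have wJ: "w \<in> J"
      proof (rule ccontr)
        assume "w \<notin> J"
        then have "w \<otimes> e i \<notin> J" using w by simp
        then obtain y where y: "y \<in> carrier R" "y \<otimes> w \<otimes> e i = e i" using left_unit w i by blast
        then have yw: "y \<otimes> w = e i" using w i by (simp add: m_assoc)
        have "v \<otimes> (y \<otimes> u) = \<zero>" using JJ[of v "y \<otimes> u"] J_D y u v by simp
        then have "(v \<otimes> y) \<otimes> u = \<zero>" using v y u J_D by (simp add: m_assoc)
        moreover have "(v \<otimes> y) \<otimes> w = F (((v \<otimes> y) \<otimes> u) \<odot>\<^bsub>M\<^esub> b)"
          using h(3)[of "v \<otimes> y" "u \<odot>\<^bsub>M\<^esub> b"] uB u v y b J_D by (simp add: w_def smult_assoc1)
        ultimately have "(v \<otimes> y) \<otimes> w = \<zero>" using F0 b by simp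
        then have "v \<otimes> e i = \<zero>" using yw v y w J_D by (simp add: m_assoc)
        then show False using v by simp
      qed
      obtain c where c: "c \<in> carrier R" "w = u \<otimes> c" using right_uni[of m u w] u wJ mw m by auto
      \<comment> \<open>With w = u c and a e_l = d u the equation for a follows from the one for u.
        The factors e_l and e_i make the value compatible with b = e_l b and with R e_i.\<close>
      have "F (a \<odot>\<^bsub>M\<^esub> b) = a \<otimes> (e l \<otimes> c \<otimes> e i)" if a: "a \<in> carrier R" "a \<odot>\<^bsub>M\<^esub> b \<in> B" for a
      proof -
        obtain d where d: "d \<in> carrier R" "a \<otimes> e l = d \<otimes> u"
          using left_uni[of l u "a \<otimes> e l"] aJ[OF a] a u b by (auto simp: m_assoc)
        have "F (a \<odot>\<^bsub>M\<^esub> b) = F (d \<odot>\<^bsub>M\<^esub> (u \<odot>\<^bsub>M\<^esub> b))"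
          using ael[OF a(1)] d u b by (simp add: smult_assoc1)
        also have "\<dots> = d \<otimes> (w \<otimes> e i)" using h(3)[OF d(1) uB] w by (simp add: w_def)
        also have "\<dots> = (d \<otimes> u) \<otimes> (c \<otimes> e i)" using c d u i by (simp add: m_assoc)
        also have "\<dots> = a \<otimes> (e l \<otimes> c \<otimes> e i)" using d(2)[symmetric] a c i b by (simp add: m_assoc)
        finally show ?thesis .
      qed
      then show ?thesis using b i c by (intro bexI[of _ "e l \<otimes> c \<otimes> e i"]) (auto simp: m_assoc)
    qed
    then obtain y where y: "y \<in> carrier R" "y \<otimes> e i = y"
      "\<And>a. a \<in> carrier R \<Longrightarrow> a \<odot>\<^bsub>M\<^esub> b \<in> B \<Longrightarrow> F (a \<odot>\<^bsub>M\<^esub> b) = a \<otimes> y" by blast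
    obtain G where G: "G \<in> mod_hom R (sub_mod M (adjoin B b)) ?K" "\<forall>x\<in>B. G x = F x" "G b = y"
      using adjoin_extend[OF K B(1) b(2) F(1), of y] y by auto
    have "G x \<otimes> e i = G x" if x: "x \<in> adjoin B b" for x
    proof -
      obtain z a where za: "z \<in> B" "a \<in> carrier R" "x = z \<oplus>\<^bsub>M\<^esub> a \<odot>\<^bsub>M\<^esub> b"
        using x by (auto simp: adjoin_def)
      have in': "z \<in> adjoin B b" "b \<in> adjoin B b" using adjoin_subset[OF B(1) b(2)] za by auto
      then have "a \<odot>\<^bsub>M\<^esub> b \<in> adjoin B b"
        using submoduleD(5)[OF submodule_adjoin[OF B(1) b(2)]] za by simp
      then have "G x = G z \<oplus> a \<otimes> y"
        using mod_homD(2,3)[OF G(1)] za in' G(3) by simp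
      then show ?thesis using G(2) F(2) h(1) za y i by (simp add: l_distr m_assoc)
    qed
    then show "?P (adjoin B b)" using G F(3) B(2) by (intro bexI[of _ G]) auto
  qed
  then show ?thesis by simp
qed

end

section \<open>Indecomposable modules and direct sum decompositions\<close>

text \<open>Uniqueness of the coordinates makes them additive and linear. The last two properties
  are uniqueness applied to families with a single nonzero member.\<close>

lemma direct_sum_projections:
  assumes M: "left_module R M" and ds: "internal_direct_sum R M I H"
  obtains \<pi> where "\<And>i. i \<in> I \<Longrightarrow> \<pi> i \<in> mod_hom R M M" "\<And>i x. \<lbrakk>i \<in> I; x \<in> carrier M\<rbrakk> \<Longrightarrow> \<pi> i x \<in> H i"
    "\<And>x. x \<in> carrier M \<Longrightarrow> x = (\<Oplus>\<^bsub>M\<^esub>i\<in>I. \<pi> i x)"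
    "\<And>c i. \<lbrakk>c \<in> (\<Pi> i\<in>I. H i); i \<in> I\<rbrakk> \<Longrightarrow> \<pi> i (finsum M c I) = c i"
    "\<And>i x. \<lbrakk>i \<in> I; x \<in> H i\<rbrakk> \<Longrightarrow> \<pi> i x = x"
    "\<And>i j x. \<lbrakk>i \<in> I; j \<in> I; i \<noteq> j; x \<in> H j\<rbrakk> \<Longrightarrow> \<pi> i x = \<zero>\<^bsub>M\<^esub>"
proof -
  interpret left_module R M by fact
  have fin: "finite I" and sub: "\<And>i. i \<in> I \<Longrightarrow> submodule (H i) R M"
    and ex1: "\<And>x. x \<in> carrier M \<Longrightarrow> \<exists>!c. c \<in> (\<Pi>\<^sub>E i\<in>I. H i) \<and> x = finsum M c I"
    using ds by (auto simp: internal_direct_sum_def)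
  note D = submoduleD[OF sub]
  define C where "C x = (THE c. c \<in> (\<Pi>\<^sub>E i\<in>I. H i) \<and> x = finsum M c I)" for x
  have C: "C x \<in> (\<Pi>\<^sub>E i\<in>I. H i)" "x = finsum M (C x) I" if "x \<in> carrier M" for x
    using theI'[OF ex1[OF that]] by (auto simp: C_def)
  have CH: "C x i \<in> H i" if "x \<in> carrier M" "i \<in> I" for x i using C(1)[OF that(1)] that(2) by auto
  have CM: "C x i \<in> carrier M" if "x \<in> carrier M" "i \<in> I" for x i using CH[OF that] D(3) that by blast
  have uniq: "C (finsum M c I) i = c i" if c: "c \<in> (\<Pi> i\<in>I. H i)" and i: "i \<in> I" for c i
  proof -
    let ?c = "restrict c I"
    have eq: "finsum M ?c I = finsum M c I"
      using c D(3) by (intro M.finsum_cong') auto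
    have cl: "finsum M c I \<in> carrier M" using c D(3) by (intro M.finsum_closed) auto
    have "C (finsum M c I) = ?c"
      using ex1[OF cl] C[OF cl] c eq by (metis restrict_PiE_iff Pi_iff)
    then show ?thesis using i by simp
  qed
  have hom: "(\<lambda>x. C x i) \<in> mod_hom R M M" if i: "i \<in> I" for i
  proof (rule mod_homI)
    show "C (x \<oplus>\<^bsub>M\<^esub> y) i = C x i \<oplus>\<^bsub>M\<^esub> C y i" if xy: "x \<in> carrier M" "y \<in> carrier M" for x y
    proof -
      have "x \<oplus>\<^bsub>M\<^esub> y = finsum M (\<lambda>i. C x i \<oplus>\<^bsub>M\<^esub> C y i) I"
        using C(2)[OF xy(1)] C(2)[OF xy(2)] CM xy M.finsum_addf[of "C x" I "C y"] by (simp add: Pi_iff)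
      then show ?thesis
        using uniq[of "\<lambda>i. C x i \<oplus>\<^bsub>M\<^esub> C y i" i] CH xy i D(4) by (simp add: Pi_iff)
    qed
    show "C (a \<odot>\<^bsub>M\<^esub> x) i = a \<odot>\<^bsub>M\<^esub> C x i" if ax: "a \<in> carrier R" "x \<in> carrier M" for a x
    proof -
      have "a \<odot>\<^bsub>M\<^esub> x = finsum M (\<lambda>i. a \<odot>\<^bsub>M\<^esub> C x i) I"
        using C(2)[OF ax(2)] CM ax finsum_smult_r[of a "C x" I] by (simp add: Pi_iff)
      then show ?thesis
        using uniq[of "\<lambda>i. a \<odot>\<^bsub>M\<^esub> C x i" i] CH ax i D(5) by (simp add: Pi_iff)
    qed
  qed (use CM i in auto)
  have single: "x = finsum M (\<lambda>j. if i = j then x else \<zero>\<^bsub>M\<^esub>) I" if "i \<in> I" "x \<in> H i" for i x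
    using M.add.finprod_singleton[of i I "\<lambda>_. x"] that fin D(3) by (simp add: Pi_iff)
  have sPi: "(\<lambda>j. if i = j then x else \<zero>\<^bsub>M\<^esub>) \<in> (\<Pi> i\<in>I. H i)" if "i \<in> I" "x \<in> H i" for i x
    using that D(2) by auto
  show ?thesis
  proof (rule that[of "\<lambda>i x. C x i"])
    show "C x i = x" if "i \<in> I" "x \<in> H i" for i x
      using uniq[OF sPi[OF that] that(1)] single[OF that] by simp
    show "C x i = \<zero>\<^bsub>M\<^esub>" if "i \<in> I" "j \<in> I" "i \<noteq> j" "x \<in> H j" for i j x
      using uniq[OF sPi[OF that(2,4)] that(1)] single[OF that(2,4)] that by simp
  qed (use hom CH C uniq in auto)
qed

lemma card_quotient_by_label:
  assumes g: "\<And>x. x \<in> A \<Longrightarrow> g x < m" "\<And>k. k < m \<Longrightarrow> \<exists>x\<in>A. g x = k"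
    and r: "\<And>x y. \<lbrakk>x \<in> A; y \<in> A\<rbrakk> \<Longrightarrow> rel x y \<longleftrightarrow> g x = g y"
  shows "card (A // {(x, y). x \<in> A \<and> y \<in> A \<and> rel x y}) = (m :: nat)"
proof -
  let ?r = "{(x, y). x \<in> A \<and> y \<in> A \<and> rel x y}"
  have im: "?r `` {x} = {y \<in> A. g y = g x}" if "x \<in> A" for x
    using r that by auto
  have "A // ?r = (\<lambda>k. {y \<in> A. g y = k}) ` {..<m}"
  proof
    show "A // ?r \<subseteq> (\<lambda>k. {y \<in> A. g y = k}) ` {..<m}"
      using g(1) im by (auto simp: quotient_def)
    show "(\<lambda>k. {y \<in> A. g y = k}) ` {..<m} \<subseteq> A // ?r"
    proof
      fix X assume "X \<in> (\<lambda>k. {y \<in> A. g y = k}) ` {..<m}"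
      then obtain k where k: "k < m" "X = {y \<in> A. g y = k}" by auto
      then obtain x where "x \<in> A" "g x = k" using g(2) by auto
      then show "X \<in> A // ?r" using im k by (auto simp: quotient_def)
    qed
  qed
  moreover have "inj_on (\<lambda>k. {y \<in> A. g y = k}) {..<m}"
  proof (rule inj_onI)
    fix k l assume kl: "k \<in> {..<m}" "l \<in> {..<m}" "{y \<in> A. g y = k} = {y \<in> A. g y = l}"
    then obtain x where "x \<in> A" "g x = k" using g(2) by auto
    then have "x \<in> {y \<in> A. g y = l}" using kl(3) by blast
    then show "k = l" using \<open>g x = k\<close> by simp
  qed
  ultimately show ?thesis by (simp add: card_image)
qed

context nak_ring
begin

text \<open>J e_i is nonzero: R e_i is then injective, and its top is a simple module different from
  R e_i.\<close>

definition good :: "nat \<Rightarrow> bool" where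
  "good i \<longleftrightarrow> (\<exists>v\<in>J. v \<otimes> e i \<noteq> \<zero>)"

lemma ring_finsum_closed: "f \<in> A \<rightarrow> carrier R \<Longrightarrow> finsum R f A \<in> carrier R"
  by (rule finsum_closed)

lemma diff_add_cancel: "\<lbrakk>x \<in> carrier R; y \<in> carrier R\<rbrakk> \<Longrightarrow> (x \<ominus> y) \<oplus> y = x"
  by (simp add: a_minus_def a_assoc l_neg)

lemma not_goodD: "\<lbrakk>\<not> good i; v \<in> J\<rbrakk> \<Longrightarrow> v \<otimes> e i = \<zero>"
  by (auto simp: good_def)

end

text \<open>If some x = e_i x is not killed by J, then R x is a copy of R e_i, which is injective,
  so it splits off and is all of M. Otherwise J kills M and every nonzero R x with x = e_i x splits
  off. The clause \<open>good i\<close> keeps the second alternative for simple modules that are not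
  projective.\<close>

lemma (in nak_module) indecomposable_cyclic_gen:
  assumes fg: "fg_module R M" and ind: "indecomposable_module R M"
  shows "\<exists>i<N. \<exists>x. cyclic_gen R (e i) {\<zero>} M x \<or> good i \<and> cyclic_gen R (e i) J M x"
proof (cases "\<exists>i<N. \<exists>x\<in>carrier M. \<exists>v\<in>J. e i \<odot>\<^bsub>M\<^esub> x = x \<and> v \<odot>\<^bsub>M\<^esub> x \<noteq> \<zero>\<^bsub>M\<^esub>")
  case True
  then obtain i x v where i: "i < N" and x: "x \<in> carrier M" "e i \<odot>\<^bsub>M\<^esub> x = x" and v: "v \<in> J" "v \<odot>\<^bsub>M\<^esub> x \<noteq> \<zero>\<^bsub>M\<^esub>"
    by blast
  interpret K: left_module R "regular_module R" by (rule left_module_regular[OF ring_axioms])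
  have vei: "(v \<otimes> e i) \<odot>\<^bsub>M\<^esub> x = v \<odot>\<^bsub>M\<^esub> x" using i x v J_D by (simp add: smult_assoc1)
  have vi: "v \<otimes> e i \<noteq> \<zero>" using vei v x by auto
  let ?X = "(\<lambda>a. a \<odot>\<^bsub>M\<^esub> x) ` carrier R"
  have X: "submodule ?X R M" by (rule cyclic_submodule[OF x(1)])
  have xX: "x \<in> ?X" using x by (intro image_eqI[of _ _ \<one>]) auto
  \<comment> \<open>A nonzero l e_i killing x would be radical and generate all of J e_i, so v e_i
    would kill x too, against the choice of v.\<close>
  have ann: "l \<odot>\<^bsub>M\<^esub> x = \<zero>\<^bsub>M\<^esub> \<longleftrightarrow> l \<otimes> e i = \<zero>" if l: "l \<in> carrier R" for l
  proof
    have lei: "(l \<otimes> e i) \<odot>\<^bsub>M\<^esub> x = l \<odot>\<^bsub>M\<^esub> x" using i x l by (simp add: smult_assoc1)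
    show "l \<odot>\<^bsub>M\<^esub> x = \<zero>\<^bsub>M\<^esub>" if "l \<otimes> e i = \<zero>" using lei x by (simp add: that)
    show "l \<otimes> e i = \<zero>" if l0: "l \<odot>\<^bsub>M\<^esub> x = \<zero>\<^bsub>M\<^esub>"
    proof (rule ccontr)
      assume n: "l \<otimes> e i \<noteq> \<zero>"
      have "x \<noteq> \<zero>\<^bsub>M\<^esub>" using v J_D(1) by auto
      then have "l \<otimes> e i \<in> J" using mem_or_J[OF submodule_zero x(1) i x(2) _ l] l0 by auto
      then obtain c where c: "c \<in> carrier R" "v \<otimes> e i = c \<otimes> (l \<otimes> e i)"
        using left_uni[of i "l \<otimes> e i" "v \<otimes> e i"] n i l v J_D by (auto simp: m_assoc)
      then have "(v \<otimes> e i) \<odot>\<^bsub>M\<^esub> x = c \<odot>\<^bsub>M\<^esub> (l \<odot>\<^bsub>M\<^esub> x)" using i l x by (simp add: smult_assoc1)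
      then show False using vei v c l0 by simp
    qed
  qed
  have gX: "cyclic_gen R (e i) {\<zero>} (sub_mod M ?X) x"
    unfolding cyclic_gen_def using left_module_sub_mod[OF X] i x xX ann by auto
  let ?E = "(\<lambda>a. a \<odot>\<^bsub>regular_module R\<^esub> e i) ` carrier R"
  have E: "submodule ?E R (regular_module R)" by (rule K.cyclic_submodule) (use i in simp)
  have gE: "cyclic_gen R (e i) {\<zero>} (sub_mod (regular_module R) ?E) (e i)"
    unfolding cyclic_gen_def using K.left_module_sub_mod[OF E] i by (auto intro!: image_eqI[of _ _ \<one>])
  obtain f where f: "f \<in> mod_hom R (sub_mod M ?X) (sub_mod (regular_module R) ?E)" "f x = e i"
    using cyclic_gen_hom[OF gX gE] by auto
  have f': "f \<in> mod_hom R (sub_mod M ?X) (regular_module R)"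
    using f(1) i by (auto simp: mod_hom_def Pi_iff)
  have fi: "f y \<otimes> e i = f y" if "y \<in> ?X" for y
  proof -
    obtain a where "a \<in> carrier R" "f y = a \<otimes> e i" using mod_homD(1)[OF f(1), of y] \<open>y \<in> ?X\<close> by auto
    then show ?thesis using i by (simp add: m_assoc)
  qed
  obtain F where F: "F \<in> mod_hom R M (regular_module R)" "\<forall>y\<in>?X. F y = f y" "\<forall>y\<in>carrier M. F y \<otimes> e i = F y"
    using injective_extend[OF fg i v(1) vi X f' fi] by blast
  note h = mod_homD[OF F(1), simplified]
  have Fx: "F x = e i" using bspec[OF F(2) xX] f(2) by simp
  \<comment> \<open>As F x = e_i, the map y to F(y) x fixes x and therefore R x: it is a retraction
    of M onto R x.\<close>
  have hom: "(\<lambda>y. F y \<odot>\<^bsub>M\<^esub> x) \<in> mod_hom R M M"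
    by (rule mod_homI) (use h x in \<open>auto simp: smult_l_distr smult_assoc1\<close>)
  have "x \<noteq> \<zero>\<^bsub>M\<^esub>" using v J_D by auto
  then have "?X = carrier M"
    using i h x Fx xX by (intro retract_indecomposable[OF ind X hom]) (auto simp: smult_assoc1)
  then show ?thesis using gX i by auto
next
  case False
  have JM: "j \<odot>\<^bsub>M\<^esub> x = \<zero>\<^bsub>M\<^esub>" if "j \<in> J" "x \<in> carrier M" for j x
  proof -
    have "j \<odot>\<^bsub>M\<^esub> (e i \<odot>\<^bsub>M\<^esub> x) = \<zero>\<^bsub>M\<^esub>" if "i < N" for i
      using False that \<open>j \<in> J\<close> \<open>x \<in> carrier M\<close> by simp
    moreover have "j \<odot>\<^bsub>M\<^esub> x = j \<odot>\<^bsub>M\<^esub> (\<Oplus>\<^bsub>M\<^esub>i\<in>{..<N}. e i \<odot>\<^bsub>M\<^esub> x)" using module_decomp[OF that(2)] by simp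
    moreover have "\<dots> = (\<Oplus>\<^bsub>M\<^esub>i\<in>{..<N}. j \<odot>\<^bsub>M\<^esub> (e i \<odot>\<^bsub>M\<^esub> x))"
      using that J_D by (intro finsum_smult_r) auto
    ultimately show ?thesis by (auto intro!: M.add.finprod_one_eqI)
  qed
  have "\<exists>y\<in>carrier M. y \<noteq> \<zero>\<^bsub>M\<^esub>"
    using ind M.zero_closed unfolding indecomposable_module_def by blast
  then obtain y i where yi: "y \<in> carrier M" "i < N" "e i \<odot>\<^bsub>M\<^esub> y \<noteq> \<zero>\<^bsub>M\<^esub>"
    using nonzero_component by blast
  define x where "x = e i \<odot>\<^bsub>M\<^esub> y"
  have x: "x \<in> carrier M" "e i \<odot>\<^bsub>M\<^esub> x = x" "x \<noteq> \<zero>\<^bsub>M\<^esub>" using yi by (auto simp: x_def)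
  let ?X = "(\<lambda>a. a \<odot>\<^bsub>M\<^esub> x) ` carrier R"
  have X: "submodule ?X R M" by (rule cyclic_submodule[OF x(1)])
  have xX: "x \<in> ?X" using x by (intro image_eqI[of _ _ \<one>]) auto
  have "(\<lambda>y. y) \<in> mod_hom R (sub_mod M ?X) (sub_mod M ?X)" by (auto simp: mod_hom_def)
  then obtain F where F: "F \<in> mod_hom R M (sub_mod M ?X)" "\<forall>y\<in>?X. F y = y"
    using semisimple_extend[OF fg JM X left_module_sub_mod[OF X]] by blast
  have FM: "F \<in> mod_hom R M M" using F(1) submoduleD(1)[OF X] by (auto simp: mod_hom_def Pi_iff)
  have XM: "?X = carrier M"
    using F(2) mod_homD(1)[OF F(1)] xX x(3) by (intro retract_indecomposable[OF ind X FM]) auto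
  have ann: "l \<odot>\<^bsub>M\<^esub> x = \<zero>\<^bsub>M\<^esub> \<longleftrightarrow> l \<otimes> e i \<in> J" if l: "l \<in> carrier R" for l
  proof
    show "l \<otimes> e i \<in> J" if "l \<odot>\<^bsub>M\<^esub> x = \<zero>\<^bsub>M\<^esub>"
      using mem_or_J[OF submodule_zero x(1) yi(2) x(2) _ l] that x(3) by auto
    have "(l \<otimes> e i) \<odot>\<^bsub>M\<^esub> x = l \<odot>\<^bsub>M\<^esub> x" using yi x l by (simp add: smult_assoc1)
    then show "l \<odot>\<^bsub>M\<^esub> x = \<zero>\<^bsub>M\<^esub>" if "l \<otimes> e i \<in> J" using JM[OF that x(1)] by simp
  qed
  have g: "cyclic_gen R (e i) J M x"
    unfolding cyclic_gen_def using left_module_axioms yi x ann XM by blast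
  show ?thesis
  \<comment> \<open>If J e_i = 0, then l e_i in J means l e_i = 0, so the simple module is R e_i and
    is filed under the first alternative.\<close>
  proof (cases "good i")
    case True then show ?thesis using g yi by blast
  next
    case False
    then have "l \<otimes> e i \<in> J \<longleftrightarrow> l \<otimes> e i = \<zero>" if "l \<in> carrier R" for l
      using not_goodD[of i "l \<otimes> e i"] that yi J_D(2) by (auto simp: m_assoc)
    then have "cyclic_gen R (e i) {\<zero>} M x" using g by (auto simp: cyclic_gen_def)
    then show ?thesis using yi by blast
  qed
qed

text \<open>The exchange argument of Krull-Schmidt. The generator x of X is the sum of the \<rho>
  (\<pi>_k x) over the summands H_k; since R e_i has a local top, one term alone has an invertible
  coefficient. Then \<rho> \<pi>_k is an automorphism of X, and X embeds into H_k as a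
  retract.\<close>

lemma (in nak_module) summand_iso:
  fixes m :: nat
  assumes fg: "fg_module R M" and ds: "internal_direct_sum R M {..<m} H"
    and ind: "\<And>k. k < m \<Longrightarrow> indecomposable_module R (sub_mod M (H k))"
    and X: "direct_summand R M X" "indecomposable_module R (sub_mod M X)"
  shows "\<exists>k<m. mod_iso R (sub_mod M X) (sub_mod M (H k))"
proof -
  note lm = left_module_axioms
  obtain Y where XY: "complementary R M X Y" using X by (auto simp: direct_summand_def)
  note c = complementaryD[OF lm XY]
  note DX = submoduleD[OF c(1)] and DY = submoduleD[OF c(2)]
  have subH: "submodule (H k) R M" if "k < m" for k using ds that by (auto simp: internal_direct_sum_def)
  obtain \<pi> where \<pi>: "\<And>k. k \<in> {..<m} \<Longrightarrow> \<pi> k \<in> mod_hom R M M" "\<And>k x. \<lbrakk>k \<in> {..<m}; x \<in> carrier M\<rbrakk> \<Longrightarrow> \<pi> k x \<in> H k"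
    "\<And>x. x \<in> carrier M \<Longrightarrow> x = (\<Oplus>\<^bsub>M\<^esub>k\<in>{..<m}. \<pi> k x)"
    using direct_sum_projections[OF lm ds] by metis
  have "internal_direct_sum R M {..<2::nat} (\<lambda>k::nat. if k = 0 then X else Y)"
    unfolding internal_direct_sum_def
  proof (intro conjI ballI)
    fix z assume z: "z \<in> carrier M"
    obtain x y where xy: "x \<in> X" "y \<in> Y" "z = x \<oplus>\<^bsub>M\<^esub> y" using c(4) z by blast
    have two: "{..<2::nat} = {0, 1::nat}" by auto
    have fs: "finsum M d {..<2::nat} = d 0 \<oplus>\<^bsub>M\<^esub> d 1" if "d 0 \<in> carrier M" "d 1 \<in> carrier M" for d :: "nat \<Rightarrow> 'b"
      unfolding two using that by (subst M.finsum_insert) auto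
    have uniq: "x' = x \<and> y' = y" if "x' \<in> X" "y' \<in> Y" "z = x' \<oplus>\<^bsub>M\<^esub> y'" for x' y'
    proof -
      have M: "x \<in> carrier M" "x' \<in> carrier M" "y \<in> carrier M" "y' \<in> carrier M" using xy that DX(3) DY(3) by auto
      have "x \<ominus>\<^bsub>M\<^esub> x' = (x \<oplus>\<^bsub>M\<^esub> y) \<oplus>\<^bsub>M\<^esub> \<ominus>\<^bsub>M\<^esub> y \<ominus>\<^bsub>M\<^esub> x'" using M by (simp add: a_minus_def M.a_assoc M.r_neg)
      also have "\<dots> = (x' \<oplus>\<^bsub>M\<^esub> y') \<oplus>\<^bsub>M\<^esub> \<ominus>\<^bsub>M\<^esub> y \<ominus>\<^bsub>M\<^esub> x'" using xy(3) that(3) by simp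
      also have "\<dots> = y' \<ominus>\<^bsub>M\<^esub> y \<oplus>\<^bsub>M\<^esub> (x' \<ominus>\<^bsub>M\<^esub> x')" using M by (simp add: a_minus_def M.a_ac)
      also have "\<dots> = y' \<ominus>\<^bsub>M\<^esub> y" using M by (simp add: a_minus_def M.r_neg)
      finally have "x \<ominus>\<^bsub>M\<^esub> x' \<in> X \<inter> Y" using DX(7) DY(7) xy that by (metis IntI)
      then have 0: "x \<ominus>\<^bsub>M\<^esub> x' = \<zero>\<^bsub>M\<^esub>" using c(3) by auto
      have "x = x \<ominus>\<^bsub>M\<^esub> x' \<oplus>\<^bsub>M\<^esub> x'" using M by (simp add: a_minus_def M.a_assoc M.l_neg)
      then have "x = x'" using 0 M by simp
      then show ?thesis using xy(3) that(3) M by simp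
    qed
    show "\<exists>!d. d \<in> (\<Pi>\<^sub>E k\<in>{..<2::nat}. if k = 0 then X else Y) \<and> z = finsum M d {..<2::nat}"
    proof (rule ex1I[of _ "\<lambda>k\<in>{..<2::nat}. if k = 0 then x else y"])
      show "(\<lambda>k\<in>{..<2::nat}. if k = 0 then x else y) \<in> (\<Pi>\<^sub>E k\<in>{..<2::nat}. if k = 0 then X else Y) \<and>
        z = finsum M (\<lambda>k\<in>{..<2::nat}. if k = 0 then x else y) {..<2::nat}"
        using xy DX(3) DY(3) by (subst fs) auto
      fix d assume d: "d \<in> (\<Pi>\<^sub>E k\<in>{..<2::nat}. if k = 0 then X else Y) \<and> z = finsum M d {..<2::nat}"
      then have *: "d j \<in> (if j = 0 then X else Y)" if "j < 2" for j
        using that unfolding PiE_iff by blast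
      have "d 0 \<in> X" "d 1 \<in> Y" using *[of 0] *[of 1] by auto
      moreover from this have "z = d 0 \<oplus>\<^bsub>M\<^esub> d 1" using d fs DX(3) DY(3) by simp
      ultimately have "d 0 = x" "d 1 = y" using uniq by auto
      then show "d = (\<lambda>k\<in>{..<2::nat}. if k = 0 then x else y)"
        using d by (intro extensionalityI[of _ "{..<2::nat}"]) (auto simp: PiE_iff less_2_cases_iff)
    qed
  qed (use c in auto)
  then have "\<exists>\<rho>\<in>mod_hom R M M. (\<forall>x\<in>carrier M. \<rho> x \<in> X) \<and> (\<forall>x\<in>X. \<rho> x = x)"
  proof (rule direct_sum_projections[OF lm])
    fix \<rho> :: "nat \<Rightarrow> 'b \<Rightarrow> 'b"
    assume "\<And>k. k \<in> {..<2::nat} \<Longrightarrow> \<rho> k \<in> mod_hom R M M"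
      "\<And>k x. \<lbrakk>k \<in> {..<2::nat}; x \<in> carrier M\<rbrakk> \<Longrightarrow> \<rho> k x \<in> (if k = 0 then X else Y)"
      "\<And>k x. \<lbrakk>k \<in> {..<2::nat}; x \<in> (if k = 0 then X else Y)\<rbrakk> \<Longrightarrow> \<rho> k x = x"
    from this(1)[of 0] this(2)[of 0] this(3)[of 0] show ?thesis
      by (intro bexI[of _ "\<rho> 0"]) auto
  qed
  then obtain \<rho> where \<rho>: "\<rho> \<in> mod_hom R M M" "\<And>x. x \<in> carrier M \<Longrightarrow> \<rho> x \<in> X" "\<And>x. x \<in> X \<Longrightarrow> \<rho> x = x" by blast
  interpret SX: nak_module R N e J "sub_mod M X"
    by (intro nak_module.intro nak_ring_axioms left_module_sub_mod c)
  have \<rho>': "\<rho> \<in> mod_hom R M (sub_mod M X)" by (rule mod_hom_into_sub) (use \<rho> in auto)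
  have "x \<in> \<rho> ` carrier M" if "x \<in> X" for x using \<rho>(3)[OF that] DX(3)[OF that] by (metis imageI)
  then have "\<rho> ` carrier M = carrier (sub_mod M X)" using \<rho>(2) by auto
  then have fgX: "fg_module R (sub_mod M X)" by (rule fg_surj[OF SX.left_module_axioms fg \<rho>'])
  obtain i x I where i: "i < N" and g: "cyclic_gen R (e i) I (sub_mod M X) x" and I: "I = {\<zero>} \<or> I = J"
    using SX.indecomposable_cyclic_gen[OF fgX X(2)] by blast
  have IJ: "I \<subseteq> J" and Ir: "\<And>a b. \<lbrakk>a \<in> I; b \<in> carrier R\<rbrakk> \<Longrightarrow> a \<otimes> b \<in> I"
    using I J_D by auto
  note gx = cyclic_genD[OF g, simplified]
  have xM: "x \<in> carrier M" using gx DX by auto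
  have th: "\<exists>l\<in>carrier R. \<rho> (\<pi> k x) = l \<odot>\<^bsub>M\<^esub> x" if "k < m" for k
    using gx(5) \<rho>(2) mod_homD(1)[OF \<pi>(1)] xM that by simp
  \<comment> \<open>If every coefficient L_k e_i were radical, then so would be their sum s e_i; but
    (1 - s) x = 0 puts (1 - s) e_i into J as well, and e_i would lie in J.\<close>
  have "\<exists>k<m. \<exists>l\<in>carrier R. \<rho> (\<pi> k x) = l \<odot>\<^bsub>M\<^esub> x \<and> l \<otimes> e i \<notin> J"
  proof (rule ccontr)
    assume n: "\<not> ?thesis"
    from th have "\<forall>k. \<exists>l. k < m \<longrightarrow> l \<in> carrier R \<and> \<rho> (\<pi> k x) = l \<odot>\<^bsub>M\<^esub> x" by blast
    then obtain L where L: "\<And>k. k < m \<Longrightarrow> L k \<in> carrier R \<and> \<rho> (\<pi> k x) = L k \<odot>\<^bsub>M\<^esub> x" by metis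
    have LJ: "L k \<otimes> e i \<in> J" if "k < m" for k using n L that by blast
    have "x = \<rho> (\<Oplus>\<^bsub>M\<^esub>k\<in>{..<m}. \<pi> k x)" using \<pi>(3)[OF xM] \<rho>(3) gx by simp
    also have "\<dots> = (\<Oplus>\<^bsub>M\<^esub>k\<in>{..<m}. \<rho> (\<pi> k x))"
      using mod_homD(1)[OF \<pi>(1)] xM by (intro mod_hom_finsum[OF lm lm \<rho>(1)]) auto
    also have "\<dots> = (\<Oplus>\<^bsub>M\<^esub>k\<in>{..<m}. L k \<odot>\<^bsub>M\<^esub> x)" using L xM by (intro M.finsum_cong') auto
    also have "\<dots> = finsum R L {..<m} \<odot>\<^bsub>M\<^esub> x" using L xM by (intro finsum_smult_l[symmetric]) auto
    finally have x: "x = finsum R L {..<m} \<odot>\<^bsub>M\<^esub> x" .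
    have SL: "finsum R L {..<m} \<in> carrier R" using L by (intro ring_finsum_closed) auto
    have "(\<one> \<ominus> finsum R L {..<m}) \<odot>\<^bsub>M\<^esub> x = x \<ominus>\<^bsub>M\<^esub> finsum R L {..<m} \<odot>\<^bsub>M\<^esub> x"
      using SL xM by (simp add: a_minus_def smult_l_distr smult_l_minus)
    also have "\<dots> = \<zero>\<^bsub>M\<^esub>" using x xM by (simp add: a_minus_def M.r_neg)
    finally have "(\<one> \<ominus> finsum R L {..<m}) \<otimes> e i \<in> J" using gx(6)[of "\<one> \<ominus> finsum R L {..<m}"] SL IJ by auto
    moreover have "finsum R L {..<m} \<otimes> e i \<in> J"
      using finsum_ldistr[of "{..<m}" "e i" L] L i LJ J_finsum[of "\<lambda>k. L k \<otimes> e i" "{..<m}"] by (simp add: Pi_iff)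
    ultimately have "(\<one> \<ominus> finsum R L {..<m}) \<otimes> e i \<oplus> finsum R L {..<m} \<otimes> e i \<in> J" by (rule J_D(3))
    moreover have "(\<one> \<ominus> finsum R L {..<m}) \<otimes> e i \<oplus> finsum R L {..<m} \<otimes> e i = e i"
      using SL i by (simp add: l_distr[symmetric] diff_add_cancel)
    ultimately show False using e_notin i by simp
  qed
  then obtain k l where k: "k < m" and l: "l \<in> carrier R" "\<rho> (\<pi> k x) = l \<odot>\<^bsub>M\<^esub> x" "l \<otimes> e i \<notin> J" by blast
  note hk = mod_homD[OF \<pi>(1)[of k]] and h\<rho> = mod_homD[OF \<rho>(1)]
  obtain y where y: "y \<in> carrier R" "y \<otimes> l \<otimes> e i = e i" "e i \<otimes> l \<otimes> y = e i" "y \<otimes> e i = y" "e i \<otimes> y = y"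
    using left_unit[OF l(1) i l(3)] by blast
  have lx: "l \<odot>\<^bsub>M\<^esub> x = (e i \<otimes> l \<otimes> e i) \<odot>\<^bsub>M\<^esub> x"
  proof -
    have "l \<odot>\<^bsub>M\<^esub> x = \<rho> (\<pi> k (e i \<odot>\<^bsub>M\<^esub> x))" using gx l by simp
    also have "\<dots> = e i \<odot>\<^bsub>M\<^esub> (l \<odot>\<^bsub>M\<^esub> x)" using hk h\<rho> k i xM l by simp
    finally have "l \<odot>\<^bsub>M\<^esub> x = e i \<odot>\<^bsub>M\<^esub> (l \<odot>\<^bsub>M\<^esub> (e i \<odot>\<^bsub>M\<^esub> x))" using gx by simp
    then show ?thesis using l i xM by (simp add: smult_assoc1)
  qed
  have yl: "y \<odot>\<^bsub>M\<^esub> (l \<odot>\<^bsub>M\<^esub> x) = x"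
  proof -
    have "x = (y \<otimes> l \<otimes> e i) \<odot>\<^bsub>M\<^esub> x" using y gx by simp
    also have "\<dots> = y \<odot>\<^bsub>M\<^esub> (l \<odot>\<^bsub>M\<^esub> (e i \<odot>\<^bsub>M\<^esub> x))" using y(1) l(1) i xM by (simp add: smult_assoc1)
    finally show ?thesis using gx by simp
  qed
  \<comment> \<open>On the generator this endomorphism of X is multiplication by l. The corner
    inverse \<open>y\<close> makes it bijective, for both possible annihilating ideals
    \<open>I\<close>. Its inverse is called \<open>\<tau>\<close> below and has nothing to do with
    the translate.\<close>
  define \<theta> where "\<theta> z = \<rho> (\<pi> k z)" for z
  have \<theta>: "\<theta> (a \<odot>\<^bsub>M\<^esub> x) = (a \<otimes> l) \<odot>\<^bsub>M\<^esub> x" if "a \<in> carrier R" for a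
    using that hk k h\<rho> xM l by (simp add: \<theta>_def smult_assoc1)
  have hom\<theta>: "\<theta> \<in> mod_hom R (sub_mod M X) (sub_mod M X)"
    unfolding \<theta>_def using mod_hom_compose[OF \<pi>(1)[of k] \<rho>'] k DX(1) by (auto intro: mod_hom_restrict)
  have "inj_on \<theta> (carrier (sub_mod M X))"
  proof (rule mod_hom_inj_onI[OF SX.left_module_axioms SX.left_module_axioms hom\<theta>])
    fix z assume z: "z \<in> carrier (sub_mod M X)" "\<theta> z = \<zero>\<^bsub>sub_mod M X\<^esub>"
    then obtain a where a: "a \<in> carrier R" "z = a \<odot>\<^bsub>M\<^esub> x" using gx(5) by auto
    then have "\<zero>\<^bsub>M\<^esub> = a \<odot>\<^bsub>M\<^esub> (l \<odot>\<^bsub>M\<^esub> x)" using z \<theta> l xM by (simp add: smult_assoc1)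
    also have "\<dots> = (a \<otimes> (e i \<otimes> l \<otimes> e i)) \<odot>\<^bsub>M\<^esub> x" using lx a l i xM by (simp add: smult_assoc1)
    finally have "(a \<otimes> (e i \<otimes> l \<otimes> e i)) \<otimes> e i \<in> I" using gx(6)[of "a \<otimes> (e i \<otimes> l \<otimes> e i)"] a i l by simp
    then have "(a \<otimes> (e i \<otimes> l \<otimes> e i)) \<otimes> e i \<otimes> y \<in> I" using Ir y by simp
    also have "(a \<otimes> (e i \<otimes> l \<otimes> e i)) \<otimes> e i \<otimes> y = a \<otimes> (e i \<otimes> l \<otimes> (e i \<otimes> (e i \<otimes> y)))"
      using a i l y(1) by (simp only: m_assoc e_closed m_closed)
    also have "\<dots> = a \<otimes> e i" using y(3,5) by simp
    finally show "z = \<zero>\<^bsub>sub_mod M X\<^esub>" using gx(6) a by simp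
  qed
  moreover have "\<theta> ` carrier (sub_mod M X) = carrier (sub_mod M X)"
  proof
    show "carrier (sub_mod M X) \<subseteq> \<theta> ` carrier (sub_mod M X)"
    proof
      fix z assume "z \<in> carrier (sub_mod M X)"
      then obtain a where a: "a \<in> carrier R" "z = a \<odot>\<^bsub>M\<^esub> x" using gx(5) by auto
      have "\<theta> ((a \<otimes> y) \<odot>\<^bsub>M\<^esub> x) = a \<odot>\<^bsub>M\<^esub> (y \<odot>\<^bsub>M\<^esub> (l \<odot>\<^bsub>M\<^esub> x))"
        using \<theta>[of "a \<otimes> y"] a y(1) l xM by (simp add: smult_assoc1)
      then have "z = \<theta> ((a \<otimes> y) \<odot>\<^bsub>M\<^esub> x)" using a yl by simp
      moreover have "(a \<otimes> y) \<odot>\<^bsub>M\<^esub> x \<in> X" using DX(5) gx a y by simp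
      ultimately show "z \<in> \<theta> ` carrier (sub_mod M X)" by auto
    qed
  qed (use mod_homD(1)[OF hom\<theta>] in auto)
  ultimately have bij: "bij_betw \<theta> X X" by (simp add: bij_betw_def)
  define \<tau> where "\<tau> = inv_into X \<theta>"
  have \<tau>: "\<tau> \<in> mod_hom R (sub_mod M X) (sub_mod M X)"
    using inv_into_mod_hom[OF SX.left_module_axioms hom\<theta>] bij by (simp add: \<tau>_def)
  have \<tau>\<theta>: "\<tau> (\<theta> z) = z" if "z \<in> X" for z using bij that by (simp add: \<tau>_def bij_betw_def)
  note h\<tau> = mod_homD[OF \<tau>, simplified] and DH = submoduleD[OF subH[OF k]]
  have \<alpha>X: "submodule (\<pi> k ` X) R M" by (rule submodule_image[OF lm lm \<pi>(1)]) (use k c in auto)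
  have "\<pi> k ` X = carrier (sub_mod M (H k))"
  \<comment> \<open>The composite \<pi>_k \<theta>^(-1) \<rho> maps H_k onto the image of X and is
    the identity there.\<close>
  proof (rule retract_indecomposable[OF ind[OF k]])
    show "submodule (\<pi> k ` X) R (sub_mod M (H k))"
      using \<alpha>X \<pi>(2) k DX by (auto simp: submodule_sub_mod_iff[OF subH[OF k]])
    show "(\<lambda>z. \<pi> k (\<tau> (\<rho> z))) \<in> mod_hom R (sub_mod M (H k)) (sub_mod M (H k))"
      using hk h\<tau> h\<rho> \<pi>(2) \<rho>(2) k DH(3) DX(3) by (intro mod_homI) auto
    show "\<pi> k (\<tau> (\<rho> z)) \<in> \<pi> k ` X" if "z \<in> carrier (sub_mod M (H k))" for z
      using that h\<tau> \<rho>(2) DH(3) by auto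
    show "\<pi> k (\<tau> (\<rho> z)) = z" if "z \<in> \<pi> k ` X" for z
      using that \<tau>\<theta> by (auto simp: \<theta>_def)
    show "\<pi> k ` X \<noteq> {\<zero>\<^bsub>sub_mod M (H k)\<^esub>}"
    proof
      assume "\<pi> k ` X = {\<zero>\<^bsub>sub_mod M (H k)\<^esub>}"
      then have "\<pi> k x = \<zero>\<^bsub>M\<^esub>" using gx by auto
      then have "\<theta> x = \<zero>\<^bsub>M\<^esub>" using mod_hom_zero[OF lm lm \<rho>(1)] by (simp add: \<theta>_def)
      then have "l \<odot>\<^bsub>M\<^esub> x = \<zero>\<^bsub>M\<^esub>" using l by (simp add: \<theta>_def)
      then show False using gx(6) l IJ by auto
    qed
  qed
  moreover have "inj_on (\<pi> k) X"
    using bij unfolding \<theta>_def bij_betw_def inj_on_def by metis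
  moreover have "\<pi> k \<in> mod_hom R (sub_mod M X) (sub_mod M (H k))"
    using hk \<pi>(2) k DX(3) by (intro mod_homI) auto
  ultimately show ?thesis
    using k by (auto simp: mod_iso_def bij_betw_def)
qed

text \<open>Each indecomposable summand is labelled by the index k of the H_k isomorphic to it; the
  label exists by the exchange argument and is unique because the H_k are pairwise non-isomorphic.
  So the isomorphism classes are counted by the labels.\<close>

lemma (in nak_module) num_summands_eq:
  fixes m :: nat
  assumes fg: "fg_module R M" and ds: "internal_direct_sum R M {..<m} H"
    and ind: "\<And>k. k < m \<Longrightarrow> indecomposable_module R (sub_mod M (H k))"
    and ni: "\<And>k l. \<lbrakk>k < m; l < m; k \<noteq> l\<rbrakk> \<Longrightarrow> \<not> mod_iso R (sub_mod M (H k)) (sub_mod M (H l))"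
  shows "num_summands R M = m"
proof -
  note lm = left_module_axioms
  define A where "A = {X. direct_summand R M X \<and> indecomposable_module R (sub_mod M X)}"
  have subH: "submodule (H k) R M" if "k < m" for k using ds that by (auto simp: internal_direct_sum_def)
  obtain \<pi> where \<pi>: "\<And>k. k \<in> {..<m} \<Longrightarrow> \<pi> k \<in> mod_hom R M M" "\<And>k x. \<lbrakk>k \<in> {..<m}; x \<in> carrier M\<rbrakk> \<Longrightarrow> \<pi> k x \<in> H k"
    "\<And>k x. \<lbrakk>k \<in> {..<m}; x \<in> H k\<rbrakk> \<Longrightarrow> \<pi> k x = x"
    using direct_sum_projections[OF lm ds] by metis
  have HA: "H k \<in> A" if k: "k < m" for k
  proof -
    note DH = submoduleD[OF subH[OF k]]
    have h: "\<pi> k \<in> mod_hom R M M" using \<pi>(1) k by simp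
    have "complementary R M (H k) (a_kernel M M (\<pi> k))"
    proof (rule complementaryI[OF lm subH[OF k] submodule_kernel[OF lm lm h]])
      fix z assume z: "z \<in> carrier M"
      have pz: "\<pi> k z \<in> H k" "\<pi> k z \<in> carrier M" using \<pi>(2) DH(3) z k by auto
      have "\<pi> k (z \<ominus>\<^bsub>M\<^esub> \<pi> k z) = \<zero>\<^bsub>M\<^esub>"
        using mod_hom_diff[OF lm lm h z pz(2)] \<pi>(3)[of k "\<pi> k z"] pz k by (simp add: a_minus_def M.r_neg)
      then have "z \<ominus>\<^bsub>M\<^esub> \<pi> k z \<in> a_kernel M M (\<pi> k)" using z pz by (simp add: a_kernel_eq)
      moreover have "z = \<pi> k z \<oplus>\<^bsub>M\<^esub> (z \<ominus>\<^bsub>M\<^esub> \<pi> k z)" using z pz by (simp add: a_minus_def M.a_lcomm M.r_neg)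
      ultimately show "\<exists>x\<in>H k. \<exists>y\<in>a_kernel M M (\<pi> k). z = x \<oplus>\<^bsub>M\<^esub> y" using pz by blast
    qed (use \<pi>(3) k in \<open>auto simp: a_kernel_eq\<close>)
    then show ?thesis using ind k by (auto simp: A_def direct_summand_def)
  qed
  define g where "g X = (SOME k. k < m \<and> mod_iso R (sub_mod M X) (sub_mod M (H k)))" for X
  have g: "g X < m \<and> mod_iso R (sub_mod M X) (sub_mod M (H (g X)))" if "X \<in> A" for X
  proof -
    have "\<exists>k<m. mod_iso R (sub_mod M X) (sub_mod M (H k))"
      by (rule summand_iso[OF fg ds ind]) (use that in \<open>auto simp: A_def\<close>)
    then show ?thesis unfolding g_def by (rule someI_ex)
  qed
  have lA: "left_module R (sub_mod M X)" if "X \<in> A" for X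
    using that by (auto simp: A_def indecomposable_module_def)
  have gu: "g X = k" if "X \<in> A" "k < m" "mod_iso R (sub_mod M X) (sub_mod M (H k))" for X k
  proof (rule ccontr)
    assume "g X \<noteq> k"
    moreover have "mod_iso R (sub_mod M (H (g X))) (sub_mod M (H k))"
      using g[OF that(1)] by (intro mod_iso_trans[OF mod_iso_sym[OF lA[OF that(1)]] that(3)]) simp
    ultimately show False using ni[of "g X" k] g[OF that(1)] that(2) by simp
  qed
  have "card (A // {(X, Y). X \<in> A \<and> Y \<in> A \<and> mod_iso R (sub_mod M X) (sub_mod M Y)}) = m"
  proof (rule card_quotient_by_label[of _ g])
    show "\<exists>X\<in>A. g X = k" if "k < m" for k
      by (rule bexI[of _ "H k"]) (use HA[OF that] gu[OF HA[OF that] that mod_iso_refl] in auto)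
    show "mod_iso R (sub_mod M X) (sub_mod M Y) \<longleftrightarrow> g X = g Y" if "X \<in> A" "Y \<in> A" for X Y
    proof
      show "g X = g Y" if "mod_iso R (sub_mod M X) (sub_mod M Y)"
        using g[OF \<open>Y \<in> A\<close>] by (intro gu[OF \<open>X \<in> A\<close>] mod_iso_trans[OF that]) auto
      show "mod_iso R (sub_mod M X) (sub_mod M Y)" if "g X = g Y"
      proof (rule mod_iso_trans)
        show "mod_iso R (sub_mod M X) (sub_mod M (H (g X)))" using g[OF \<open>X \<in> A\<close>] by simp
        show "mod_iso R (sub_mod M (H (g X))) (sub_mod M Y)"
          using g[OF \<open>Y \<in> A\<close>] that by (intro mod_iso_sym[OF lA[OF \<open>Y \<in> A\<close>]]) simp
      qed
    qed
  qed (use g in auto)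
  then show ?thesis by (simp add: num_summands_def A_def Let_def)
qed

section \<open>Projective covers\<close>

lemma mod_sum_simps:
  "carrier (mod_sum I S) = (\<Pi>\<^sub>E i\<in>I. carrier (S i))" "\<zero>\<^bsub>mod_sum I S\<^esub> = (\<lambda>i\<in>I. \<zero>\<^bsub>S i\<^esub>)"
  "x \<oplus>\<^bsub>mod_sum I S\<^esub> y = (\<lambda>i\<in>I. x i \<oplus>\<^bsub>S i\<^esub> y i)" "r \<odot>\<^bsub>mod_sum I S\<^esub> x = (\<lambda>i\<in>I. r \<odot>\<^bsub>S i\<^esub> x i)"
  by (simp_all add: mod_sum_def)

lemma left_module_mod_sum:
  assumes "ring R" "\<And>i. i \<in> I \<Longrightarrow> left_module R (S i)"
  shows "left_module R (mod_sum I S)"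
proof -
  interpret R: ring R by fact
  note ag = left_module.axioms(2)[OF assms(2)]
  have ag': "abelian_monoid (S i)" if "i \<in> I" for i using ag[OF that] by (simp add: abelian_group_def)
  note sc = left_module.smult_closed[OF assms(2)]
  have "abelian_group (mod_sum I S)"
  proof (rule abelian_groupI)
    show "\<exists>y\<in>carrier (mod_sum I S). y \<oplus>\<^bsub>mod_sum I S\<^esub> x = \<zero>\<^bsub>mod_sum I S\<^esub>" if x: "x \<in> carrier (mod_sum I S)" for x
      using x abelian_group.a_inv_closed[OF ag] abelian_group.l_neg[OF ag]
      by (intro bexI[of _ "\<lambda>i\<in>I. \<ominus>\<^bsub>S i\<^esub> x i"]) (auto simp: mod_sum_simps PiE_iff intro!: restrict_ext)
    show "x \<oplus>\<^bsub>mod_sum I S\<^esub> y = y \<oplus>\<^bsub>mod_sum I S\<^esub> x"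
      if "x \<in> carrier (mod_sum I S)" "y \<in> carrier (mod_sum I S)" for x y
      using that abelian_monoid.a_comm[OF ag'] by (auto simp: mod_sum_simps PiE_iff intro!: restrict_ext)
  qed (auto simp: mod_sum_simps PiE_iff abelian_monoid.a_closed[OF ag'] abelian_monoid.a_assoc[OF ag']
      abelian_monoid.l_zero[OF ag'] abelian_monoid.zero_closed[OF ag']
      intro!: restrict_ext extensionalityI[of _ I])
  then show ?thesis
    by (rule left_moduleI[OF assms(1)])
       (auto simp: mod_sum_simps PiE_iff sc left_module.smult_l_distr[OF assms(2)]
          left_module.smult_r_distr[OF assms(2)] left_module.smult_assoc1[OF assms(2)]
          left_module.smult_one[OF assms(2)] intro!: restrict_ext extensionalityI[of _ I])
qed

lemma mod_sum_coord: "i \<in> I \<Longrightarrow> (\<lambda>c. c i) \<in> mod_hom R (mod_sum I S) (S i)"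
  by (rule mod_homI) (auto simp: mod_sum_simps)

lemma mod_sum_map:
  assumes "finite I" "left_module R M" "\<And>i. i \<in> I \<Longrightarrow> f i \<in> mod_hom R (S i) M"
  shows "(\<lambda>c. \<Oplus>\<^bsub>M\<^esub>i\<in>I. f i (c i)) \<in> mod_hom R (mod_sum I S) M"
proof -
  interpret M: left_module R M by fact
  note h = mod_homD[OF assms(3)]
  show ?thesis
  proof (rule mod_homI)
    fix x assume x: "x \<in> carrier (mod_sum I S)"
    then have fx: "(\<lambda>i. f i (x i)) \<in> I \<rightarrow> carrier M" using h(1) by (auto simp: mod_sum_simps)
    then show "(\<Oplus>\<^bsub>M\<^esub>i\<in>I. f i (x i)) \<in> carrier M" by (rule M.M.finsum_closed)
    show "(\<Oplus>\<^bsub>M\<^esub>i\<in>I. f i ((a \<odot>\<^bsub>mod_sum I S\<^esub> x) i)) = a \<odot>\<^bsub>M\<^esub> (\<Oplus>\<^bsub>M\<^esub>i\<in>I. f i (x i))" if "a \<in> carrier R" for a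
      unfolding M.finsum_smult_r[OF that fx]
      using x fx that h(3) by (intro M.M.finsum_cong') (auto simp: mod_sum_simps PiE_iff)
    fix y assume y: "y \<in> carrier (mod_sum I S)"
    then have fy: "(\<lambda>i. f i (y i)) \<in> I \<rightarrow> carrier M" using h(1) by (auto simp: mod_sum_simps)
    show "(\<Oplus>\<^bsub>M\<^esub>i\<in>I. f i ((x \<oplus>\<^bsub>mod_sum I S\<^esub> y) i)) = (\<Oplus>\<^bsub>M\<^esub>i\<in>I. f i (x i)) \<oplus>\<^bsub>M\<^esub> (\<Oplus>\<^bsub>M\<^esub>i\<in>I. f i (y i))"
      unfolding M.M.finsum_addf[OF fx fy, symmetric]
      using x y fx fy h(2) by (intro M.M.finsum_cong') (auto simp: mod_sum_simps PiE_iff)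
  qed
qed

definition mod_delta :: "'i set \<Rightarrow> ('i \<Rightarrow> ('a, 'b) module) \<Rightarrow> 'i \<Rightarrow> 'b \<Rightarrow> 'i \<Rightarrow> 'b" where
  "mod_delta I S i x = (\<lambda>j\<in>I. if j = i then x else \<zero>\<^bsub>S j\<^esub>)"

lemma mod_delta_closed:
  assumes "\<And>i. i \<in> I \<Longrightarrow> left_module R (S i)" "i \<in> I" "x \<in> carrier (S i)"
  shows "mod_delta I S i x \<in> carrier (mod_sum I S)"
proof -
  have "\<zero>\<^bsub>S j\<^esub> \<in> carrier (S j)" if "j \<in> I" for j
    using abelian_group.axioms(1)[OF left_module.axioms(2)[OF assms(1)[OF that]]] abelian_monoid.zero_closed by blast
  then show ?thesis using assms(3) by (auto simp: mod_delta_def mod_sum_simps)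
qed

lemma mod_sum_decomp:
  assumes "ring R" "finite I" "\<And>i. i \<in> I \<Longrightarrow> left_module R (S i)" "\<And>i. i \<in> I \<Longrightarrow> x i \<in> carrier (S i)"
    "\<And>i. i \<in> I \<Longrightarrow> l i \<in> carrier R"
  shows "(\<lambda>i\<in>I. l i \<odot>\<^bsub>S i\<^esub> x i) = (\<Oplus>\<^bsub>mod_sum I S\<^esub>i\<in>I. l i \<odot>\<^bsub>mod_sum I S\<^esub> mod_delta I S i (x i))" (is "?c = ?s")
proof -
  interpret Q: left_module R "mod_sum I S" by (rule left_module_mod_sum[OF assms(1,3)])
  have dc: "l i \<odot>\<^bsub>mod_sum I S\<^esub> mod_delta I S i (x i) \<in> carrier (mod_sum I S)" if "i \<in> I" for i
    using mod_delta_closed[where I = I and S = S, OF assms(3) that assms(4)[OF that]] assms(5)[OF that] by simp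
  then have sc: "?s \<in> carrier (mod_sum I S)" by (intro Q.M.finsum_closed) auto
  show ?thesis
  proof (rule extensionalityI[of _ I])
    show "?s \<in> extensional I" using sc by (auto simp: mod_sum_simps PiE_iff)
    fix j assume j: "j \<in> I"
    interpret Sj: left_module R "S j" by (rule assms(3)[OF j])
    have "?s j = (\<Oplus>\<^bsub>S j\<^esub>i\<in>I. (l i \<odot>\<^bsub>mod_sum I S\<^esub> mod_delta I S i (x i)) j)"
      using dc by (intro mod_hom_finsum[OF Q.left_module_axioms Sj.left_module_axioms mod_sum_coord[OF j]]) auto
    also have "\<dots> = (\<Oplus>\<^bsub>S j\<^esub>i\<in>I. if j = i then l j \<odot>\<^bsub>S j\<^esub> x j else \<zero>\<^bsub>S j\<^esub>)"
      using j assms(4,5) by (intro Sj.M.finsum_cong') (auto simp: mod_sum_simps mod_delta_def)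
    also have "\<dots> = l j \<odot>\<^bsub>S j\<^esub> x j"
      using Sj.M.add.finprod_singleton[of j I "\<lambda>i. l j \<odot>\<^bsub>S j\<^esub> x j"] j assms(2,4,5) by (simp add: Pi_iff)
    finally show "?c j = ?s j" using j by simp
  qed simp
qed

lemma fg_mod_sum:
  assumes "ring R" "finite I" "\<And>i. i \<in> I \<Longrightarrow> left_module R (S i)" "\<And>i. i \<in> I \<Longrightarrow> x i \<in> carrier (S i)"
    "\<And>i y. \<lbrakk>i \<in> I; y \<in> carrier (S i)\<rbrakk> \<Longrightarrow> \<exists>l\<in>carrier R. y = l \<odot>\<^bsub>S i\<^esub> x i"
  shows "fg_module R (mod_sum I S)"
proof -
  interpret Q: left_module R "mod_sum I S" by (rule left_module_mod_sum[OF assms(1,3)])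
  let ?G = "(\<lambda>i. mod_delta I S i (x i)) ` I"
  have dc: "mod_delta I S i (x i) \<in> carrier (mod_sum I S)" if "i \<in> I" for i
    by (rule mod_delta_closed[where I = I and S = S, OF assms(3) that assms(4)[OF that]])
  have "X = carrier (mod_sum I S)" if X: "submodule X R (mod_sum I S)" "?G \<subseteq> X" for X
  proof
    show "X \<subseteq> carrier (mod_sum I S)" by (rule Q.submoduleD(1)[OF X(1)])
    show "carrier (mod_sum I S) \<subseteq> X"
    proof
      fix c assume c: "c \<in> carrier (mod_sum I S)"
      then have "\<forall>i\<in>I. \<exists>l. l \<in> carrier R \<and> c i = l \<odot>\<^bsub>S i\<^esub> x i" using assms(5) by (simp add: mod_sum_simps PiE_iff Bex_def)
      then obtain l where l: "\<And>i. i \<in> I \<Longrightarrow> l i \<in> carrier R" "\<And>i. i \<in> I \<Longrightarrow> c i = l i \<odot>\<^bsub>S i\<^esub> x i" by metis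
      have "c = (\<lambda>i\<in>I. l i \<odot>\<^bsub>S i\<^esub> x i)"
        using c l(2) by (intro extensionalityI[of _ I]) (auto simp: mod_sum_simps PiE_iff)
      also have "\<dots> = (\<Oplus>\<^bsub>mod_sum I S\<^esub>i\<in>I. l i \<odot>\<^bsub>mod_sum I S\<^esub> mod_delta I S i (x i))"
        by (rule mod_sum_decomp) (use assms l in auto)
      also have "\<dots> \<in> X"
        using X(2) l Q.submoduleD(5)[OF X(1)] by (intro Q.submodule_finsum[OF X(1)]) auto
      finally show "c \<in> X" .
    qed
  qed
  then show ?thesis
    unfolding fg_module_def using assms(2) dc Q.left_module_axioms
    by (intro conjI exI[of _ ?G]) auto
qed

section \<open>Finite spans, dual bases and covers\<close>

context left_module
begin

definition combos :: "'i set \<Rightarrow> ('i \<Rightarrow> 'b) \<Rightarrow> 'b set" where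
  "combos K x = {\<Oplus>\<^bsub>M\<^esub>k\<in>K. l k \<odot>\<^bsub>M\<^esub> x k |l. l \<in> K \<rightarrow> carrier R}"

lemma submodule_combos:
  assumes "finite K" "x \<in> K \<rightarrow> carrier M" shows "submodule (combos K x) R M"
proof -
  let ?F = "mod_sum K (\<lambda>_. regular_module R)"
  have F: "left_module R ?F"
    by (rule left_module_mod_sum) (auto intro: R.ring_axioms left_module_regular)
  have "(\<lambda>a. a \<odot>\<^bsub>M\<^esub> x k) \<in> mod_hom R (regular_module R) M" if "k \<in> K" for k
    using assms(2) that by (intro mod_homI) (auto simp: smult_l_distr smult_assoc1 Pi_iff)
  then have h: "(\<lambda>c. \<Oplus>\<^bsub>M\<^esub>k\<in>K. c k \<odot>\<^bsub>M\<^esub> x k) \<in> mod_hom R ?F M"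
    by (intro mod_sum_map assms left_module_axioms)
  have "combos K x = (\<lambda>c. \<Oplus>\<^bsub>M\<^esub>k\<in>K. c k \<odot>\<^bsub>M\<^esub> x k) ` carrier ?F"
  proof
    show "combos K x \<subseteq> (\<lambda>c. \<Oplus>\<^bsub>M\<^esub>k\<in>K. c k \<odot>\<^bsub>M\<^esub> x k) ` carrier ?F"
    proof
      fix y assume "y \<in> combos K x"
      then obtain l where l: "l \<in> K \<rightarrow> carrier R" "y = (\<Oplus>\<^bsub>M\<^esub>k\<in>K. l k \<odot>\<^bsub>M\<^esub> x k)" by (auto simp: combos_def)
      have "y = (\<Oplus>\<^bsub>M\<^esub>k\<in>K. restrict l K k \<odot>\<^bsub>M\<^esub> x k)"
        unfolding l(2) using l(1) assms(2) by (intro M.finsum_cong') (auto simp: Pi_iff)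
      then show "y \<in> (\<lambda>c. \<Oplus>\<^bsub>M\<^esub>k\<in>K. c k \<odot>\<^bsub>M\<^esub> x k) ` carrier ?F"
        using l(1) by (intro image_eqI[of _ _ "restrict l K"]) (auto simp: mod_sum_simps)
    qed
    show "(\<lambda>c. \<Oplus>\<^bsub>M\<^esub>k\<in>K. c k \<odot>\<^bsub>M\<^esub> x k) ` carrier ?F \<subseteq> combos K x"
      by (auto simp: combos_def mod_sum_simps)
  qed
  then show ?thesis
    using submodule_image[OF F left_module_axioms h left_module.submodule_carrier[OF F]] by simp
qed

lemma combos_base:
  assumes "finite K" "x \<in> K \<rightarrow> carrier M" "j \<in> K" shows "x j \<in> combos K x"
proof -
  have xj: "x j \<in> carrier M" using assms by auto
  have "(\<Oplus>\<^bsub>M\<^esub>k\<in>K. (if j = k then \<one> else \<zero>) \<odot>\<^bsub>M\<^esub> x k) = (\<Oplus>\<^bsub>M\<^esub>k\<in>K. if j = k then x k else \<zero>\<^bsub>M\<^esub>)"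
    using assms(2) by (intro M.finsum_cong') (auto simp: Pi_iff)
  also have "\<dots> = x j" using M.add.finprod_singleton[of j K x] assms by simp
  finally have "x j = (\<Oplus>\<^bsub>M\<^esub>k\<in>K. (if j = k then \<one> else \<zero>) \<odot>\<^bsub>M\<^esub> x k)" ..
  then show ?thesis unfolding combos_def by (intro CollectI exI[of _ "\<lambda>k. if j = k then \<one> else \<zero>"]) auto
qed

lemma combos_subset:
  assumes "submodule X R M" "x \<in> K \<rightarrow> X" shows "combos K x \<subseteq> X"
proof
  fix y assume "y \<in> combos K x"
  then obtain l where l: "l \<in> K \<rightarrow> carrier R" "y = (\<Oplus>\<^bsub>M\<^esub>k\<in>K. l k \<odot>\<^bsub>M\<^esub> x k)" by (auto simp: combos_def)
  show "y \<in> X"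
    unfolding l(2) using submoduleD(5)[OF assms(1)] assms(2) l(1)
    by (intro submodule_finsum[OF assms(1)]) (auto simp: Pi_iff)
qed

end

text \<open>The finite free module on m copies of R has elements in the same type as the test
  modules of \<open>projective_module\<close>, so the identity of P lifts along R^m onto P; the
  coordinates of the lift are the functionals \<open>\<phi> k\<close>.\<close>

lemma projective_dual_basis:
  fixes P :: "'a fg_mod"
  assumes "projective_module R P"
  obtains K :: "nat set" and p \<phi> where "finite K" "\<And>k. k \<in> K \<Longrightarrow> p k \<in> carrier P"
    "\<And>k. k \<in> K \<Longrightarrow> \<phi> k \<in> mod_hom R P (regular_module R)"
    "\<And>x. x \<in> carrier P \<Longrightarrow> x = (\<Oplus>\<^bsub>P\<^esub>k\<in>K. \<phi> k x \<odot>\<^bsub>P\<^esub> p k)"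
proof -
  have fg: "fg_module R P" using assms by (simp add: projective_module_def)
  interpret P: left_module R P using fg by (simp add: fg_module_def)
  obtain A where A: "finite A" "A \<subseteq> carrier P" "\<And>X. submodule X R P \<Longrightarrow> A \<subseteq> X \<Longrightarrow> X = carrier P"
    using fg by (auto simp: fg_module_def)
  obtain p :: "nat \<Rightarrow> _" and m where p: "A = p ` {..<m}"
    using finite_imp_nat_seg_image_inj_on[OF A(1)] by (auto simp: lessThan_def)
  let ?K = "{..<m}"
  have pP: "p k \<in> carrier P" if "k \<in> ?K" for k using A(2) p that by auto
  have gen: "P.combos ?K p = carrier P"
    using P.submodule_combos[of ?K p] P.combos_base[of ?K p] pP p by (intro A(3)) auto
  let ?F = "mod_sum ?K (\<lambda>_. regular_module R)"
  have reg: "left_module R (regular_module R)" by (rule left_module_regular[OF P.R.ring_axioms])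
  have fgF: "fg_module R ?F"
    by (rule fg_mod_sum[where x = "\<lambda>_. \<one>\<^bsub>R\<^esub>"]) (auto intro: P.R.ring_axioms reg)
  have "(\<lambda>a. a \<odot>\<^bsub>P\<^esub> p k) \<in> mod_hom R (regular_module R) P" if "k \<in> ?K" for k
    using pP[OF that] by (intro mod_homI) (auto simp: P.smult_l_distr P.smult_assoc1)
  then have s: "(\<lambda>c. \<Oplus>\<^bsub>P\<^esub>k\<in>?K. c k \<odot>\<^bsub>P\<^esub> p k) \<in> mod_hom R ?F P"
    by (intro mod_sum_map P.left_module_axioms) auto
  have "carrier P \<subseteq> (\<lambda>c. \<Oplus>\<^bsub>P\<^esub>k\<in>?K. c k \<odot>\<^bsub>P\<^esub> p k) ` carrier ?F"
  proof
    fix y assume "y \<in> carrier P"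
    then obtain l where l: "l \<in> ?K \<rightarrow> carrier R" "y = (\<Oplus>\<^bsub>P\<^esub>k\<in>?K. l k \<odot>\<^bsub>P\<^esub> p k)"
      using gen by (auto simp: P.combos_def)
    have "y = (\<Oplus>\<^bsub>P\<^esub>k\<in>?K. restrict l ?K k \<odot>\<^bsub>P\<^esub> p k)"
      unfolding l(2) using l(1) pP by (intro P.M.finsum_cong') (auto simp: Pi_iff)
    then show "y \<in> (\<lambda>c. \<Oplus>\<^bsub>P\<^esub>k\<in>?K. c k \<odot>\<^bsub>P\<^esub> p k) ` carrier ?F"
      using l(1) by (intro image_eqI[of _ _ "restrict l ?K"]) (auto simp: mod_sum_simps)
  qed
  then have sur: "(\<lambda>c. \<Oplus>\<^bsub>P\<^esub>k\<in>?K. c k \<odot>\<^bsub>P\<^esub> p k) ` carrier ?F = carrier P" using mod_homD(1)[OF s] by blast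
  have id: "(\<lambda>x. x) \<in> mod_hom R P P" by (auto simp: mod_hom_def)
  obtain h where h: "h \<in> mod_hom R P ?F" "\<And>x. x \<in> carrier P \<Longrightarrow> (\<Oplus>\<^bsub>P\<^esub>k\<in>?K. h x k \<odot>\<^bsub>P\<^esub> p k) = x"
    using projective_lift[OF assms fgF fg s sur id] by blast
  show ?thesis
  proof (rule that[of ?K p "\<lambda>k x. h x k"])
    show "(\<lambda>x. h x k) \<in> mod_hom R P (regular_module R)" if "k \<in> ?K" for k
      using mod_hom_compose[OF h(1) mod_sum_coord[OF that]] .
  qed (use pP h in auto)
qed

definition ideal_module :: "('a, 'm) ring_scheme \<Rightarrow> 'a \<Rightarrow> ('a, 'a) module" where
  "ideal_module R a = sub_mod (regular_module R) ((\<lambda>l. l \<otimes>\<^bsub>R\<^esub> a) ` carrier R)"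

lemma ideal_module_simps [simp]:
  "carrier (ideal_module R a) = (\<lambda>l. l \<otimes>\<^bsub>R\<^esub> a) ` carrier R" "\<zero>\<^bsub>ideal_module R a\<^esub> = \<zero>\<^bsub>R\<^esub>"
  "add (ideal_module R a) = add R" "smult (ideal_module R a) = mult R"
  by (simp_all add: ideal_module_def)

lemma (in ring) left_module_ideal_module:
  assumes "a \<in> carrier R" shows "left_module R (ideal_module R a)"
proof -
  interpret K: left_module R "regular_module R" by (rule left_module_regular[OF ring_axioms])
  have "submodule ((\<lambda>l. l \<otimes> a) ` carrier R) R (regular_module R)"
    using K.cyclic_submodule[of a] assms by simp
  then show ?thesis unfolding ideal_module_def by (rule K.left_module_sub_mod)
qed

lemma (in ring) ideal_module_idem:
  assumes "a \<in> carrier R" "a \<otimes> a = a" "x \<in> carrier (ideal_module R a)"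
  shows "x \<in> carrier R" "x \<otimes> a = x"
  using assms by (auto simp: m_assoc)

lemma (in ring) ideal_module_memI: "\<lbrakk>x \<in> carrier R; x \<otimes> a = x\<rbrakk> \<Longrightarrow> x \<in> carrier (ideal_module R a)"
  by (auto intro!: image_eqI[of _ _ x])

lemma (in ring) ideal_module_hom:
  assumes "a \<in> carrier R" "left_module R M" "x \<in> carrier M"
  shows "(\<lambda>l. l \<odot>\<^bsub>M\<^esub> x) \<in> mod_hom R (ideal_module R a) M"
proof -
  interpret M: left_module R M by fact
  show ?thesis using assms by (intro mod_homI) (auto simp: M.smult_l_distr M.smult_assoc1)
qed

lemma superfluousI:
  assumes "submodule K R M" "\<And>X. \<lbrakk>submodule X R M; \<And>z. z \<in> carrier M \<Longrightarrow> \<exists>k\<in>K. \<exists>x\<in>X. z = k \<oplus>\<^bsub>M\<^esub> x\<rbrakk> \<Longrightarrow> carrier M \<subseteq> X"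
    "left_module R M"
  shows "superfluous R M K"
  unfolding superfluous_def
proof (intro conjI allI impI)
  interpret left_module R M by fact
  fix X assume X: "submodule X R M \<and> K <+>\<^bsub>M\<^esub> X = carrier M"
  have "\<exists>k\<in>K. \<exists>x\<in>X. z = k \<oplus>\<^bsub>M\<^esub> x" if "z \<in> carrier M" for z
  proof -
    have "z \<in> K <+>\<^bsub>M\<^esub> X" using X that by simp
    then show ?thesis by (auto simp: set_add_def')
  qed
  then show "X = carrier M" using assms(2)[of X] X submoduleD(1)[of X] by auto
qed fact

lemma superfluousD:
  assumes "superfluous R M K" "left_module R M" "submodule X R M"
    "\<And>z. z \<in> carrier M \<Longrightarrow> \<exists>k\<in>K. \<exists>x\<in>X. z = k \<oplus>\<^bsub>M\<^esub> x"
  shows "X = carrier M"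
proof -
  interpret left_module R M by fact
  have K: "submodule K R M" using assms(1) by (simp add: superfluous_def)
  have "K <+>\<^bsub>M\<^esub> X \<subseteq> carrier M" using submoduleD(3)[OF K] submoduleD(3)[OF assms(3)] by (auto simp: set_add_def')
  moreover have "carrier M \<subseteq> K <+>\<^bsub>M\<^esub> X" using assms(4) by (fastforce simp: set_add_def')
  ultimately show ?thesis using assms(1,3) by (auto simp: superfluous_def)
qed

context idem_module
begin

text \<open>The generators are collected with each one fixed by some idempotent, and a generating
  subset of least cardinality is then taken.\<close>

lemma min_generators:
  assumes fg: "fg_module R M"
  obtains K :: "nat set" and x idx where "finite K"
    "\<And>k. k \<in> K \<Longrightarrow> x k \<in> carrier M \<and> idx k < N \<and> e (idx k) \<odot>\<^bsub>M\<^esub> x k = x k"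
    "combos K x = carrier M" "\<And>j. j \<in> K \<Longrightarrow> x j \<notin> combos (K - {j}) x"
proof -
  define ok where "ok K x idx \<longleftrightarrow> (\<forall>k\<in>K. x k \<in> carrier M \<and> idx k < N \<and> e (idx k) \<odot>\<^bsub>M\<^esub> x k = x k)"
    for K :: "nat set" and x idx
  have sub: "submodule (combos K x) R M" if "finite K" "ok K x idx" for K x idx
    using that by (intro submodule_combos) (auto simp: ok_def)
  have base: "x j \<in> combos K x" if "finite K" "ok K x idx" "j \<in> K" for K x idx j
    using that by (intro combos_base) (auto simp: ok_def)
  have "\<exists>m x idx. ok {..<m} x idx \<and> carrier M \<subseteq> combos {..<m} x"
  proof (rule fg_induct_e[OF fg submodule_zero])
    have "{\<zero>\<^bsub>M\<^esub>} \<subseteq> combos {..<0::nat} (\<lambda>_. \<zero>\<^bsub>M\<^esub>)" by (auto simp: combos_def)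
    then show "\<exists>m x idx. ok {..<m} x idx \<and> {\<zero>\<^bsub>M\<^esub>} \<subseteq> combos {..<m} x"
      by (intro exI[of _ 0] exI[of _ "\<lambda>_. \<zero>\<^bsub>M\<^esub>"]) (auto simp: ok_def)
    fix A b i
    assume "submodule A R M" "\<exists>m x idx. ok {..<m} x idx \<and> A \<subseteq> combos {..<m} x"
      and b: "i < N" "b \<in> carrier M" "e i \<odot>\<^bsub>M\<^esub> b = b"
    then obtain m x idx where m: "ok {..<m} x idx" "A \<subseteq> combos {..<m} x" by blast
    let ?x = "x(m := b)" and ?idx = "idx(m := i)"
    have ok: "ok {..<Suc m} ?x ?idx" using m b by (auto simp: ok_def less_Suc_eq)
    have s: "submodule (combos {..<Suc m} ?x) R M" by (rule sub[OF _ ok]) simp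
    have b': "?x j \<in> combos {..<Suc m} ?x" if "j < Suc m" for j by (rule base[OF _ ok]) (use that in auto)
    have "?x \<in> {..<m} \<rightarrow> combos {..<Suc m} ?x" using b' less_SucI by blast
    then have "combos {..<m} ?x \<subseteq> combos {..<Suc m} ?x" by (rule combos_subset[OF s])
    moreover have "(\<Oplus>\<^bsub>M\<^esub>k\<in>{..<m}. l k \<odot>\<^bsub>M\<^esub> ?x k) = (\<Oplus>\<^bsub>M\<^esub>k\<in>{..<m}. l k \<odot>\<^bsub>M\<^esub> x k)" if "l \<in> {..<m} \<rightarrow> carrier R" for l
      using that m(1) by (intro M.finsum_cong') (auto simp: ok_def Pi_iff)
    then have "combos {..<m} ?x = combos {..<m} x" unfolding combos_def by (intro Collect_cong) metis
    ultimately have "A \<subseteq> combos {..<Suc m} ?x" using m(2) by auto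
    moreover have "b \<in> combos {..<Suc m} ?x" using b'[of m] by simp
    ultimately have "x' \<oplus>\<^bsub>M\<^esub> a \<odot>\<^bsub>M\<^esub> b \<in> combos {..<Suc m} ?x" if "x' \<in> A" "a \<in> carrier R" for x' a
      using submoduleD(4)[OF s] submoduleD(5)[OF s] that by blast
    then have "adjoin A b \<subseteq> combos {..<Suc m} ?x" unfolding adjoin_def by blast
    then show "\<exists>m x idx. ok {..<m} x idx \<and> adjoin A b \<subseteq> combos {..<m} x" using ok by blast
  qed
  then obtain m x idx where m: "ok {..<m} x idx" "carrier M \<subseteq> combos {..<m} x" by blast
  define Q where "Q K \<longleftrightarrow> K \<subseteq> {..<m} \<and> combos K x = carrier M" for K
  have "Q {..<m}" using m submoduleD(1)[OF sub[OF _ m(1)]] by (auto simp: Q_def)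
  then obtain K where K: "Q K" "\<And>K'. Q K' \<Longrightarrow> card K \<le> card K'" using ex_has_least_nat[of Q "{..<m}" card] by blast
  have fin: "finite K" and okK: "ok K x idx" using K(1) m(1) finite_subset[of K "{..<m}"] by (auto simp: Q_def ok_def)
  have "x j \<notin> combos (K - {j}) x" if j: "j \<in> K" for j
  proof
    assume xj: "x j \<in> combos (K - {j}) x"
    have ok': "ok (K - {j}) x idx" using okK by (auto simp: ok_def)
    have s: "submodule (combos (K - {j}) x) R M" using sub[OF _ ok'] fin by simp
    have "x \<in> K \<rightarrow> combos (K - {j}) x" using xj base[OF _ ok'] fin by auto
    then have "combos K x \<subseteq> combos (K - {j}) x" by (rule combos_subset[OF s])
    then have "Q (K - {j})" using K(1) submoduleD(1)[OF s] by (auto simp: Q_def)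
    then show False using K(2)[of "K - {j}"] j fin by (metis card_Diff1_less linorder_not_less)
  qed
  then show ?thesis using that[of K x idx] fin okK K(1) by (auto simp: ok_def Q_def)
qed

text \<open>A family of generators from which no member can be dropped has all its relations in the radical.\<close>

lemma projective_cover_exists:
  assumes fg: "fg_module R M"
  shows "\<exists>(P :: 'a fg_mod) p. projective_cover R P p M"
proof -
  obtain K :: "nat set" and x idx where K: "finite K"
    and x: "\<And>k. k \<in> K \<Longrightarrow> x k \<in> carrier M \<and> idx k < N \<and> e (idx k) \<odot>\<^bsub>M\<^esub> x k = x k"
    and gen: "combos K x = carrier M" and min: "\<And>j. j \<in> K \<Longrightarrow> x j \<notin> combos (K - {j}) x"
    using min_generators[OF fg] by metis
  let ?S = "\<lambda>k. ideal_module R (e (idx k))"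
  \<comment> \<open>One summand R e_i for each generator x_k = e_i x_k, with i =
    \<open>idx k\<close>. The element \<open>D k\<close> introduced below is the generator e_i
    placed in coordinate k.\<close>
  define P where "P = mod_sum K ?S"
  define p where "p c = (\<Oplus>\<^bsub>M\<^esub>k\<in>K. c k \<odot>\<^bsub>M\<^esub> x k)" for c
  have lS: "left_module R (?S k)" if "k \<in> K" for k using x[OF that] left_module_ideal_module by simp
  have eS: "e (idx k) \<in> carrier (?S k)" if "k \<in> K" for k using x[OF that] by (intro ideal_module_memI) auto
  have gS: "\<exists>l\<in>carrier R. y = l \<odot>\<^bsub>?S k\<^esub> e (idx k)" if "k \<in> K" "y \<in> carrier (?S k)" for k y
    using that(2) by auto
  have lP: "left_module R P" unfolding P_def by (rule left_module_mod_sum[OF ring_axioms lS])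
  interpret P: left_module R P by (rule lP)
  have fgP: "fg_module R P" unfolding P_def by (rule fg_mod_sum[OF ring_axioms K lS eS gS])
  have cP: "c k \<in> carrier R" "c k \<otimes> e (idx k) = c k" if "c \<in> carrier P" "k \<in> K" for c k
    using ideal_module_idem[of "e (idx k)" "c k"] that x[OF that(2)] by (auto simp: P_def mod_sum_simps PiE_iff)
  define D where "D k = mod_delta K ?S k (e (idx k))" for k
  have DP: "D k \<in> carrier P" if "k \<in> K" for k
    unfolding D_def P_def by (rule mod_delta_closed[where I = K and S = ?S, OF lS that eS[OF that]])
  have cD: "c = (\<Oplus>\<^bsub>P\<^esub>k\<in>K. c k \<odot>\<^bsub>P\<^esub> D k)" if c: "c \<in> carrier P" for c
  proof -
    have "c = (\<lambda>k\<in>K. c k \<odot>\<^bsub>?S k\<^esub> e (idx k))"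
      using c cP(2)[OF c] by (intro extensionalityI[of _ K]) (auto simp: P_def mod_sum_simps PiE_iff)
    also have "\<dots> = (\<Oplus>\<^bsub>P\<^esub>k\<in>K. c k \<odot>\<^bsub>P\<^esub> D k)"
      unfolding P_def D_def by (rule mod_sum_decomp[OF ring_axioms K lS eS cP(1)[OF c]])
    finally show ?thesis .
  qed
  have p: "p \<in> mod_hom R P M"
    unfolding p_def P_def using x by (intro mod_sum_map[OF K left_module_axioms] ideal_module_hom left_module_axioms) auto
  have "y \<in> p ` carrier P" if y: "y \<in> carrier M" for y
  proof -
    obtain l where l: "l \<in> K \<rightarrow> carrier R" "y = (\<Oplus>\<^bsub>M\<^esub>k\<in>K. l k \<odot>\<^bsub>M\<^esub> x k)"
      using gen y by (auto simp: combos_def)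
    let ?c = "\<lambda>k\<in>K. l k \<otimes> e (idx k)"
    have "y = p ?c"
      unfolding l(2) p_def using l(1) x by (intro M.finsum_cong') (auto simp: smult_assoc1 Pi_iff)
    moreover have "?c \<in> carrier P" using l(1) by (auto simp: P_def mod_sum_simps)
    ultimately show ?thesis by simp
  qed
  then have sur: "p ` carrier P = carrier M" using mod_homD(1)[OF p] by blast
  have proj: "projective_module R P"
  proof (rule projectiveI[OF fgP])
    fix A B :: "'a fg_mod" and g f
    assume *: "fg_module R A" "fg_module R B" "g \<in> mod_hom R A B" "g ` carrier A = carrier B" "f \<in> mod_hom R P B"
    have lA: "left_module R A" "left_module R B" using * by (auto simp: fg_module_def)
    interpret A: left_module R A by (rule lA)
    interpret B: left_module R B by (rule lA)
    have "\<forall>k. \<exists>a. k \<in> K \<longrightarrow> a \<in> carrier A \<and> g a = f (D k)"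
      using mod_homD(1)[OF *(5) DP] *(4) by (metis imageE)
    then obtain a where a: "\<And>k. k \<in> K \<Longrightarrow> a k \<in> carrier A \<and> g (a k) = f (D k)" by metis
    let ?h = "\<lambda>c. \<Oplus>\<^bsub>A\<^esub>k\<in>K. c k \<odot>\<^bsub>A\<^esub> a k"
    have h: "?h \<in> mod_hom R P A"
      unfolding P_def using a x by (intro mod_sum_map[OF K lA(1)] ideal_module_hom lA) auto
    have "g (?h c) = f c" if c: "c \<in> carrier P" for c
    proof -
      have "g (?h c) = (\<Oplus>\<^bsub>B\<^esub>k\<in>K. g (c k \<odot>\<^bsub>A\<^esub> a k))"
        using a cP[OF c] by (intro mod_hom_finsum[OF lA *(3)]) auto
      also have "\<dots> = (\<Oplus>\<^bsub>B\<^esub>k\<in>K. f (c k \<odot>\<^bsub>P\<^esub> D k))"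
        using a cP[OF c] DP mod_homD[OF *(3)] mod_homD[OF *(5)] by (intro B.M.finsum_cong') auto
      also have "\<dots> = f (\<Oplus>\<^bsub>P\<^esub>k\<in>K. c k \<odot>\<^bsub>P\<^esub> D k)"
        using cP[OF c] DP by (intro mod_hom_finsum[OF lP lA(2) *(5), symmetric]) auto
      finally show ?thesis using cD[OF c] by simp
    qed
    then show "\<exists>h\<in>mod_hom R P A. \<forall>x\<in>carrier P. g (h x) = f x" by (intro bexI[OF _ h] ballI)
  qed
  \<comment> \<open>A coefficient outside J could be inverted, and the relation solved for x_j in
    terms of the other generators.\<close>
  have kerJ: "c j \<in> J" if c: "c \<in> a_kernel P M p" and j: "j \<in> K" for c j
  proof (rule ccontr)
    assume nJ: "c j \<notin> J"
    have cc: "c \<in> carrier P" "p c = \<zero>\<^bsub>M\<^esub>" using c by (auto simp: a_kernel_eq)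
    have xj: "idx j < N" "x j \<in> carrier M" "e (idx j) \<odot>\<^bsub>M\<^esub> x j = x j" using x j by auto
    obtain y where y: "y \<in> carrier R" "y \<otimes> c j \<otimes> e (idx j) = e (idx j)"
      using left_unit[of "c j" "idx j"] cP[OF cc(1) j] nJ xj by auto
    have S: "submodule (combos (K - {j}) x) R M" using K x by (intro submodule_combos) auto
    let ?t = "\<Oplus>\<^bsub>M\<^esub>k\<in>K-{j}. (y \<otimes> c k) \<odot>\<^bsub>M\<^esub> x k"
    have t: "?t \<in> combos (K - {j}) x"
      unfolding combos_def using y cP[OF cc(1)] by (intro CollectI exI[of _ "\<lambda>k. y \<otimes> c k"]) auto
    have tM: "?t \<in> carrier M" using submoduleD(3)[OF S t] .
    have "\<zero>\<^bsub>M\<^esub> = y \<odot>\<^bsub>M\<^esub> p c" using y cc by simp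
    also have "\<dots> = (\<Oplus>\<^bsub>M\<^esub>k\<in>K. y \<odot>\<^bsub>M\<^esub> (c k \<odot>\<^bsub>M\<^esub> x k))"
      unfolding p_def using y cP[OF cc(1)] x by (intro finsum_smult_r) auto
    also have "\<dots> = (\<Oplus>\<^bsub>M\<^esub>k\<in>insert j (K - {j}). (y \<otimes> c k) \<odot>\<^bsub>M\<^esub> x k)"
      using y cP[OF cc(1)] x j by (intro M.finsum_cong') (auto simp: smult_assoc1)
    also have "\<dots> = (y \<otimes> c j) \<odot>\<^bsub>M\<^esub> x j \<oplus>\<^bsub>M\<^esub> ?t"
      using y cP[OF cc(1)] x j K by (intro M.finsum_insert) auto
    also have "(y \<otimes> c j) \<odot>\<^bsub>M\<^esub> x j = (y \<otimes> c j \<otimes> e (idx j)) \<odot>\<^bsub>M\<^esub> x j"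
      using y(1) cP[OF cc(1) j] xj smult_assoc1[of "y \<otimes> c j" "e (idx j)" "x j"] by simp
    also have "\<dots> = x j" using y xj by simp
    finally have "x j = \<ominus>\<^bsub>M\<^esub> ?t" using xj tM by (intro M.minus_equality[symmetric]) auto
    then show False using submoduleD(6)[OF S t] min[OF j] by simp
  qed
  \<comment> \<open>Nakayama's lemma with J J = 0. J annihilates the kernel, so writing D_k as a
    kernel element plus an element of X shows that J D_k is inside X. Kernel elements have
    coordinates in J, so the kernel itself is inside X.\<close>
  have "superfluous R P (a_kernel P M p)"
  proof (rule superfluousI[OF submodule_kernel[OF lP left_module_axioms p] _ lP])
    fix X assume X: "submodule X R P" and all: "\<And>z. z \<in> carrier P \<Longrightarrow> \<exists>k\<in>a_kernel P M p. \<exists>x\<in>X. z = k \<oplus>\<^bsub>P\<^esub> x"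
    note DX = P.submoduleD[OF X]
    have J0: "a \<odot>\<^bsub>P\<^esub> c = \<zero>\<^bsub>P\<^esub>" if "a \<in> J" "c \<in> a_kernel P M p" for a c
    proof -
      have cc: "c \<in> carrier P" using that by (auto simp: a_kernel_eq)
      show ?thesis
        using JJ[OF that(1) kerJ[OF that(2)]] by (auto simp: P_def mod_sum_simps intro!: restrict_ext)
    qed
    have JX: "a \<odot>\<^bsub>P\<^esub> D k \<in> X" if "a \<in> J" "k \<in> K" for a k
    proof -
      obtain c z where cz: "c \<in> a_kernel P M p" "z \<in> X" "D k = c \<oplus>\<^bsub>P\<^esub> z" using all[OF DP[OF \<open>k \<in> K\<close>]] by blast
      have "a \<odot>\<^bsub>P\<^esub> D k = a \<odot>\<^bsub>P\<^esub> c \<oplus>\<^bsub>P\<^esub> a \<odot>\<^bsub>P\<^esub> z"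
        unfolding cz(3) using that(1) J_D DX(3) cz by (intro P.smult_r_distr) (auto simp: a_kernel_eq)
      then show ?thesis using J0[OF that(1) cz(1)] DX(3,5) cz J_D(1)[OF that(1)] by simp
    qed
    have kX: "c \<in> X" if c: "c \<in> a_kernel P M p" for c
    proof -
      have cc: "c \<in> carrier P" using c by (auto simp: a_kernel_eq)
      have "(\<Oplus>\<^bsub>P\<^esub>k\<in>K. c k \<odot>\<^bsub>P\<^esub> D k) \<in> X" using JX kerJ[OF c] by (intro P.submodule_finsum[OF X]) auto
      then show ?thesis using cD[OF cc] by simp
    qed
    show "carrier P \<subseteq> X"
    proof
      fix z assume "z \<in> carrier P"
      then obtain c w where "c \<in> a_kernel P M p" "w \<in> X" "z = c \<oplus>\<^bsub>P\<^esub> w" using all by blast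
      then show "z \<in> X" using kX DX(4) by simp
    qed
  qed
  then show ?thesis
    using proj p sur left_module_axioms unfolding projective_cover_def by blast
qed

end

text \<open>A noetherian property obtained from \<open>left_uni\<close> alone. Modulo A, a submodule
  X of A + R b is described by its coefficients in R e_i, and these are multiples of one
  coefficient; hence X = R x0 plus its intersection with A, which is handled by induction.\<close>

lemma (in nak_module) fg_submodule:
  assumes fg: "fg_module R M" and X: "submodule X R M"
  shows "fg_module R (sub_mod M X)"
proof -
  let ?F = "\<lambda>X. \<exists>F. finite F \<and> F \<subseteq> X \<and> (\<forall>Y. submodule Y R M \<and> F \<subseteq> Y \<longrightarrow> X \<subseteq> Y)"
  have "\<forall>X. submodule X R M \<and> X \<subseteq> carrier M \<longrightarrow> ?F X"
  proof (rule fg_induct_e[OF fg submodule_zero])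
    show "\<forall>X. submodule X R M \<and> X \<subseteq> {\<zero>\<^bsub>M\<^esub>} \<longrightarrow> ?F X"
      using submoduleD(2) by (intro allI impI exI[of _ "{}"]) auto
    fix A b i
    assume A: "submodule A R M" and IH: "\<forall>X. submodule X R M \<and> X \<subseteq> A \<longrightarrow> ?F X"
      and b: "i < N" "b \<in> carrier M" "e i \<odot>\<^bsub>M\<^esub> b = b" "b \<notin> A"
    note DA = submoduleD[OF A]
    show "\<forall>X. submodule X R M \<and> X \<subseteq> adjoin A b \<longrightarrow> ?F X"
    proof (intro allI impI, elim conjE)
      fix X assume X: "submodule X R M" "X \<subseteq> adjoin A b"
      note DX = submoduleD[OF X(1)]
      have red: "\<exists>w\<in>A. y = w \<oplus>\<^bsub>M\<^esub> (c \<otimes> e i) \<odot>\<^bsub>M\<^esub> b" if "y = z \<oplus>\<^bsub>M\<^esub> c \<odot>\<^bsub>M\<^esub> b" "z \<in> A" "c \<in> carrier R" for y z c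
        using that b by (intro bexI[of _ z]) (auto simp: smult_assoc1)
      have "\<exists>x0\<in>X. \<forall>x\<in>X. \<exists>c\<in>carrier R. x \<ominus>\<^bsub>M\<^esub> c \<odot>\<^bsub>M\<^esub> x0 \<in> A"
      proof (cases "\<exists>z\<in>A. \<exists>a\<in>carrier R. z \<oplus>\<^bsub>M\<^esub> a \<odot>\<^bsub>M\<^esub> b \<in> X \<and> a \<otimes> e i \<noteq> \<zero>")
        case False
        have "x \<ominus>\<^bsub>M\<^esub> \<zero> \<odot>\<^bsub>M\<^esub> \<zero>\<^bsub>M\<^esub> \<in> A" if x: "x \<in> X" for x
        proof -
          obtain z a where za: "x = z \<oplus>\<^bsub>M\<^esub> a \<odot>\<^bsub>M\<^esub> b" "z \<in> A" "a \<in> carrier R" using x X(2) by (auto simp: adjoin_def)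
          then have "a \<otimes> e i = \<zero>" using False x by auto
          then have "a \<odot>\<^bsub>M\<^esub> b = \<zero>\<^bsub>M\<^esub>" using za b smult_assoc1[of a "e i" b] by simp
          then have "x = z" using za DA(3) by simp
          then show ?thesis using DA(7)[OF za(2) DA(2)] by simp
        qed
        then show ?thesis using DX(2) by blast
      next
        case True
        then obtain z a where za: "z \<in> A" "a \<in> carrier R" "z \<oplus>\<^bsub>M\<^esub> a \<odot>\<^bsub>M\<^esub> b \<in> X" "a \<otimes> e i \<noteq> \<zero>" by blast
        \<comment> \<open>The generating coefficient u is e_i if some coefficient lies outside J,
          since it can then be normalised to e_i; otherwise any nonzero one will do, because it
          generates J e_i.\<close>
        have "\<exists>z\<in>A. \<exists>u\<in>carrier R. z \<oplus>\<^bsub>M\<^esub> u \<odot>\<^bsub>M\<^esub> b \<in> X \<and>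
          (\<forall>y\<in>A. \<forall>c\<in>carrier R. y \<oplus>\<^bsub>M\<^esub> c \<odot>\<^bsub>M\<^esub> b \<in> X \<longrightarrow> (\<exists>d\<in>carrier R. c \<otimes> e i = d \<otimes> u))"
        proof (cases "\<exists>z\<in>A. \<exists>a\<in>carrier R. z \<oplus>\<^bsub>M\<^esub> a \<odot>\<^bsub>M\<^esub> b \<in> X \<and> a \<otimes> e i \<notin> J")
          case True
          then obtain z a where za: "z \<in> A" "a \<in> carrier R" "z \<oplus>\<^bsub>M\<^esub> a \<odot>\<^bsub>M\<^esub> b \<in> X" "a \<otimes> e i \<notin> J" by blast
          obtain y where y: "y \<in> carrier R" "y \<otimes> a \<otimes> e i = e i" using left_unit za b by blast
          have "y \<odot>\<^bsub>M\<^esub> (z \<oplus>\<^bsub>M\<^esub> a \<odot>\<^bsub>M\<^esub> b) = y \<odot>\<^bsub>M\<^esub> z \<oplus>\<^bsub>M\<^esub> (y \<otimes> a) \<odot>\<^bsub>M\<^esub> b"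
            using y(1) za DA(3) b by (simp add: smult_r_distr smult_assoc1)
          also have "(y \<otimes> a) \<odot>\<^bsub>M\<^esub> b = (y \<otimes> a \<otimes> e i) \<odot>\<^bsub>M\<^esub> b" using y(1) za b by (simp add: smult_assoc1)
          finally have "y \<odot>\<^bsub>M\<^esub> z \<oplus>\<^bsub>M\<^esub> e i \<odot>\<^bsub>M\<^esub> b \<in> X" using y DX(5)[OF y(1) za(3)] by simp
          then show ?thesis using DA(5)[OF y(1) za(1)] b by blast
        next
          case False
          have u: "z \<oplus>\<^bsub>M\<^esub> (a \<otimes> e i) \<odot>\<^bsub>M\<^esub> b \<in> X" using za b by (simp add: smult_assoc1)
          have "\<exists>d\<in>carrier R. c \<otimes> e i = d \<otimes> (a \<otimes> e i)" if "y \<in> A" "c \<in> carrier R" "y \<oplus>\<^bsub>M\<^esub> c \<odot>\<^bsub>M\<^esub> b \<in> X" for y c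
            using left_uni[of i "a \<otimes> e i" "c \<otimes> e i"] False that za b by (auto simp: m_assoc)
          then show ?thesis using u za b by (intro bexI[of _ z] bexI[of _ "a \<otimes> e i"]) auto
        qed
        then obtain z u where zu: "z \<in> A" "u \<in> carrier R" "z \<oplus>\<^bsub>M\<^esub> u \<odot>\<^bsub>M\<^esub> b \<in> X"
          "\<And>y c. \<lbrakk>y \<in> A; c \<in> carrier R; y \<oplus>\<^bsub>M\<^esub> c \<odot>\<^bsub>M\<^esub> b \<in> X\<rbrakk> \<Longrightarrow> \<exists>d\<in>carrier R. c \<otimes> e i = d \<otimes> u" by blast
        have "\<exists>d\<in>carrier R. x \<ominus>\<^bsub>M\<^esub> d \<odot>\<^bsub>M\<^esub> (z \<oplus>\<^bsub>M\<^esub> u \<odot>\<^bsub>M\<^esub> b) \<in> A" if x: "x \<in> X" for x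
        proof -
          obtain y c where yc: "x = y \<oplus>\<^bsub>M\<^esub> c \<odot>\<^bsub>M\<^esub> b" "y \<in> A" "c \<in> carrier R" using x X(2) by (auto simp: adjoin_def)
          then obtain d where d: "d \<in> carrier R" "c \<otimes> e i = d \<otimes> u" using zu(4)[of y c] x by blast
          have "c \<odot>\<^bsub>M\<^esub> b = (d \<otimes> u) \<odot>\<^bsub>M\<^esub> b" using d(2)[symmetric] yc b by (simp add: smult_assoc1)
          then have "x \<ominus>\<^bsub>M\<^esub> d \<odot>\<^bsub>M\<^esub> (z \<oplus>\<^bsub>M\<^esub> u \<odot>\<^bsub>M\<^esub> b) =
            (y \<oplus>\<^bsub>M\<^esub> (d \<otimes> u) \<odot>\<^bsub>M\<^esub> b) \<oplus>\<^bsub>M\<^esub> (\<ominus>\<^bsub>M\<^esub> (d \<odot>\<^bsub>M\<^esub> z) \<oplus>\<^bsub>M\<^esub> \<ominus>\<^bsub>M\<^esub> ((d \<otimes> u) \<odot>\<^bsub>M\<^esub> b))"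
            using yc(1) d(1) zu(1,2) DA(3) b by (simp add: a_minus_def smult_r_distr smult_assoc1 M.minus_add)
          also have "\<dots> = y \<ominus>\<^bsub>M\<^esub> d \<odot>\<^bsub>M\<^esub> z \<oplus>\<^bsub>M\<^esub> ((d \<otimes> u) \<odot>\<^bsub>M\<^esub> b \<oplus>\<^bsub>M\<^esub> \<ominus>\<^bsub>M\<^esub> ((d \<otimes> u) \<odot>\<^bsub>M\<^esub> b))"
            using yc(2) d(1) zu(1,2) DA(3) b by (simp add: a_minus_def M.a_ac)
          also have "\<dots> = y \<ominus>\<^bsub>M\<^esub> d \<odot>\<^bsub>M\<^esub> z"
            using yc(2) d(1) zu(1,2) DA(3) b by (simp add: M.r_neg)
          also have "\<dots> \<in> A" using DA(5,7) yc(2) d(1) zu(1) by simp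
          finally show ?thesis using d by blast
        qed
        then show ?thesis using zu(3) by blast
      qed
      then obtain x0 where x0: "x0 \<in> X" "\<And>x. x \<in> X \<Longrightarrow> \<exists>c\<in>carrier R. x \<ominus>\<^bsub>M\<^esub> c \<odot>\<^bsub>M\<^esub> x0 \<in> A" by blast
      obtain F where F: "finite F" "F \<subseteq> X \<inter> A" "\<And>Y. submodule Y R M \<Longrightarrow> F \<subseteq> Y \<Longrightarrow> X \<inter> A \<subseteq> Y"
        using IH submodule_Int[OF X(1) A] by (metis inf_le2)
      have "X \<subseteq> Y" if Y: "submodule Y R M" "insert x0 F \<subseteq> Y" for Y
      proof
        fix x assume x: "x \<in> X"
        obtain c where c: "c \<in> carrier R" "x \<ominus>\<^bsub>M\<^esub> c \<odot>\<^bsub>M\<^esub> x0 \<in> A" using x0(2)[OF x] by blast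
        have cx: "c \<odot>\<^bsub>M\<^esub> x0 \<in> X" "c \<odot>\<^bsub>M\<^esub> x0 \<in> Y" using DX(5) x0 c Y submoduleD(5)[OF Y(1)] by auto
        have "x \<ominus>\<^bsub>M\<^esub> c \<odot>\<^bsub>M\<^esub> x0 \<in> Y" using F(3)[OF Y(1)] Y(2) c DX(7)[OF x cx(1)] by auto
        then have "(x \<ominus>\<^bsub>M\<^esub> c \<odot>\<^bsub>M\<^esub> x0) \<oplus>\<^bsub>M\<^esub> c \<odot>\<^bsub>M\<^esub> x0 \<in> Y" using cx submoduleD(4)[OF Y(1)] by blast
        also have "(x \<ominus>\<^bsub>M\<^esub> c \<odot>\<^bsub>M\<^esub> x0) \<oplus>\<^bsub>M\<^esub> c \<odot>\<^bsub>M\<^esub> x0 = x"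
          using DX(3) x cx by (simp add: a_minus_def M.a_assoc M.l_neg)
        finally show "x \<in> Y" .
      qed
      then show "?F X" using F x0 by (intro exI[of _ "insert x0 F"]) auto
    qed
  qed
  then have "?F X" using X submoduleD(1)[OF X] by (elim allE[of _ X]) simp
  then obtain F where F: "finite F" "F \<subseteq> X" "\<forall>Y. submodule Y R M \<and> F \<subseteq> Y \<longrightarrow> X \<subseteq> Y"
    by (elim exE conjE)
  show ?thesis
    unfolding fg_module_def
  proof (intro conjI exI[of _ F] allI impI)
    fix Y assume "submodule Y R (sub_mod M X) \<and> F \<subseteq> Y"
    then show "Y = carrier (sub_mod M X)" using F(3)[THEN spec, of Y] by (simp add: submodule_sub_mod_iff[OF X] subset_antisym)
  qed (use F left_module_sub_mod[OF X] in auto)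
qed

text \<open>The kernel of a cover of M is finitely generated by \<open>fg_submodule\<close>, so it
  has a cover of its own. This is what makes the choice in \<open>tau\<close> meaningful.\<close>

lemma (in nak_module) minimal_presentation_exists:
  assumes fg: "fg_module R M"
  shows "\<exists>(z :: ('a, 'b) presentation). case z of (P1, d, P0, p) \<Rightarrow> minimal_projective_presentation R P1 d P0 p M"
proof -
  obtain P0 :: "'a fg_mod" and p where P0: "projective_cover R P0 p M"
    using projective_cover_exists[OF fg] by blast
  have fgP: "fg_module R P0" using P0 by (simp add: projective_cover_def projective_module_def)
  then have lP: "left_module R P0" by (simp add: fg_module_def)
  interpret P: nak_module R N e J P0 by (intro nak_module.intro nak_ring_axioms lP)
  have p: "p \<in> mod_hom R P0 M" using P0 by (simp add: projective_cover_def)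
  note k = submodule_kernel[OF lP left_module_axioms p]
  interpret K: nak_module R N e J "sub_mod P0 (a_kernel P0 M p)"
    by (intro nak_module.intro nak_ring_axioms P.left_module_sub_mod k)
  obtain P1 :: "'a fg_mod" and d where "projective_cover R P1 d (sub_mod P0 (a_kernel P0 M p))"
    using K.projective_cover_exists[OF P.fg_submodule[OF fgP k]] by blast
  then show ?thesis using P0 by (intro exI[of _ "(P1, d, P0, p)"]) (simp add: minimal_projective_presentation_def)
qed

section \<open>The Auslander-Reiten translate\<close>

lemma quotient_module_proj:
  assumes M: "left_module R M" and S: "submodule S R M"
  shows "(\<lambda>x. S +>\<^bsub>M\<^esub> x) \<in> mod_hom R M (quotient_module M S)"
    "carrier (quotient_module M S) = (\<lambda>x. S +>\<^bsub>M\<^esub> x) ` carrier M"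
    "\<And>x y. \<lbrakk>x \<in> carrier M; y \<in> carrier M\<rbrakk> \<Longrightarrow> S +>\<^bsub>M\<^esub> x = S +>\<^bsub>M\<^esub> y \<longleftrightarrow> x \<ominus>\<^bsub>M\<^esub> y \<in> S"
proof -
  interpret left_module R M by fact
  interpret S: submodule S R M by fact
  interpret Q: abelian_subgroup S M
    by (rule abelian_subgroupI3) (auto simp: additive_subgroup_def S.subgroup_axioms M.abelian_group_axioms)
  note D = submoduleD[OF S]
  show car: "carrier (quotient_module M S) = (\<lambda>x. S +>\<^bsub>M\<^esub> x) ` carrier M"
    by (auto simp: quotient_module_def A_RCOSETS_def')
  have eqI: "S +>\<^bsub>M\<^esub> x = S +>\<^bsub>M\<^esub> y" if "x \<in> carrier M" "y \<in> carrier M" "x \<ominus>\<^bsub>M\<^esub> y \<in> S" for x y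
  proof -
    have "(x \<ominus>\<^bsub>M\<^esub> y) \<oplus>\<^bsub>M\<^esub> y = x" using that by (simp add: a_minus_def M.a_assoc M.l_neg)
    then have "x \<in> S +>\<^bsub>M\<^esub> y" using that(3) by (force simp: a_r_coset_def')
    then show ?thesis using Q.a_repr_independence' that by simp
  qed
  show "S +>\<^bsub>M\<^esub> x = S +>\<^bsub>M\<^esub> y \<longleftrightarrow> x \<ominus>\<^bsub>M\<^esub> y \<in> S" if xy: "x \<in> carrier M" "y \<in> carrier M" for x y
  proof
    assume "S +>\<^bsub>M\<^esub> x = S +>\<^bsub>M\<^esub> y"
    moreover have "x \<in> S +>\<^bsub>M\<^esub> x" using xy Q.a_rcos_self by blast
    ultimately obtain s where "s \<in> S" "x = s \<oplus>\<^bsub>M\<^esub> y" by (auto simp: a_r_coset_def')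
    moreover from this have "x \<ominus>\<^bsub>M\<^esub> y = s" using xy D(3) by (simp add: a_minus_def M.a_assoc M.r_neg)
    ultimately show "x \<ominus>\<^bsub>M\<^esub> y \<in> S" by simp
  qed (rule eqI[OF xy])
  show "(\<lambda>x. S +>\<^bsub>M\<^esub> x) \<in> mod_hom R M (quotient_module M S)"
  proof (rule mod_homI)
    show "S +>\<^bsub>M\<^esub> (x \<oplus>\<^bsub>M\<^esub> y) = (S +>\<^bsub>M\<^esub> x) \<oplus>\<^bsub>quotient_module M S\<^esub> (S +>\<^bsub>M\<^esub> y)"
      if "x \<in> carrier M" "y \<in> carrier M" for x y
      using that Q.a_rcos_sum by (simp add: quotient_module_def)
    show "S +>\<^bsub>M\<^esub> (a \<odot>\<^bsub>M\<^esub> x) = a \<odot>\<^bsub>quotient_module M S\<^esub> (S +>\<^bsub>M\<^esub> x)"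
      if ax: "a \<in> carrier R" "x \<in> carrier M" for a x
    proof -
      have "S +>\<^bsub>M\<^esub> (a \<odot>\<^bsub>M\<^esub> z) = S +>\<^bsub>M\<^esub> (a \<odot>\<^bsub>M\<^esub> x)" if z: "z \<in> S +>\<^bsub>M\<^esub> x" for z
      proof -
        obtain s where s: "s \<in> S" "z = s \<oplus>\<^bsub>M\<^esub> x" using z by (auto simp: a_r_coset_def')
        have zM: "z \<in> carrier M" "s \<in> carrier M" using s D(3) ax by auto
        have "a \<odot>\<^bsub>M\<^esub> z \<ominus>\<^bsub>M\<^esub> a \<odot>\<^bsub>M\<^esub> x = a \<odot>\<^bsub>M\<^esub> s"
          using s(2) zM ax by (simp add: smult_r_distr a_minus_def M.a_assoc M.r_neg)
        then show ?thesis using eqI zM ax D(5) s by simp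
      qed
      moreover have "x \<in> S +>\<^bsub>M\<^esub> x" using ax Q.a_rcos_self by blast
      ultimately have "(\<Union>z\<in>S +>\<^bsub>M\<^esub> x. S +>\<^bsub>M\<^esub> (a \<odot>\<^bsub>M\<^esub> z)) = S +>\<^bsub>M\<^esub> (a \<odot>\<^bsub>M\<^esub> x)" by blast
      then show ?thesis by (simp add: quotient_module_def)
    qed
  qed (simp add: car)
qed

text \<open>
  Elements of \<open>\<tau> M\<close> are functionals on a cokernel of \<open>Hom(d, R)\<close>. They are handled as functionals on
  \<open>Hom(P1, R)\<close> vanishing on the maps that factor through \<open>d\<close>.
\<close>

locale pairing =
  fixes k :: "('k, 'l) ring_scheme" and \<phi> :: "'k \<Rightarrow> 'a" and E :: "('k, 'e) module"
    and R :: "('a, 'm) ring_scheme" (structure) and P1 :: "('a, 'b) module" and d :: "'b \<Rightarrow> 'c"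
    and P0 :: "('a, 'c) module" and Y :: "('a, 'y) module" and ev :: "'y \<Rightarrow> ('b \<Rightarrow> 'a) \<Rightarrow> 'e"
  assumes Y_module: "left_module R Y"
    and ev_closed: "\<lbrakk>y \<in> carrier Y; g \<in> mod_hom R P1 (regular_module R)\<rbrakk> \<Longrightarrow> ev y g \<in> carrier E"
    and ev_add: "\<lbrakk>y \<in> carrier Y; g \<in> mod_hom R P1 (regular_module R); h \<in> mod_hom R P1 (regular_module R)\<rbrakk> \<Longrightarrow>
      ev y (\<lambda>x. g x \<oplus> h x) = ev y g \<oplus>\<^bsub>E\<^esub> ev y h"
    and ev_scale: "\<lbrakk>y \<in> carrier Y; g \<in> mod_hom R P1 (regular_module R); s \<in> carrier k\<rbrakk> \<Longrightarrow>
      ev y (\<lambda>x. g x \<otimes> \<phi> s) = s \<odot>\<^bsub>E\<^esub> ev y g"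
    and ev_boundary: "\<lbrakk>y \<in> carrier Y; f \<in> mod_hom R P0 (regular_module R)\<rbrakk> \<Longrightarrow> ev y (\<lambda>x. f (d x)) = \<zero>\<^bsub>E\<^esub>"
    and ev_cong: "\<lbrakk>\<And>x. x \<in> carrier P1 \<Longrightarrow> g x = h x\<rbrakk> \<Longrightarrow> ev y g = ev y h"
    and ev_plus: "\<lbrakk>y \<in> carrier Y; z \<in> carrier Y; g \<in> mod_hom R P1 (regular_module R)\<rbrakk> \<Longrightarrow>
      ev (y \<oplus>\<^bsub>Y\<^esub> z) g = ev y g \<oplus>\<^bsub>E\<^esub> ev z g"
    and ev_smult: "\<lbrakk>a \<in> carrier R; y \<in> carrier Y; g \<in> mod_hom R P1 (regular_module R)\<rbrakk> \<Longrightarrow>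
      ev (a \<odot>\<^bsub>Y\<^esub> y) g = ev y (\<lambda>x. g x \<otimes> a)"
    and ev_ext: "\<lbrakk>y \<in> carrier Y; z \<in> carrier Y; \<And>g. g \<in> mod_hom R P1 (regular_module R) \<Longrightarrow> ev y g = ev z g\<rbrakk> \<Longrightarrow> y = z"
    and ev_construct: "\<And>\<theta>. \<lbrakk>\<And>g. g \<in> mod_hom R P1 (regular_module R) \<Longrightarrow> \<theta> g \<in> carrier E;
      \<And>g h. \<lbrakk>g \<in> mod_hom R P1 (regular_module R); h \<in> mod_hom R P1 (regular_module R)\<rbrakk> \<Longrightarrow> \<theta> (\<lambda>x. g x \<oplus> h x) = \<theta> g \<oplus>\<^bsub>E\<^esub> \<theta> h;
      \<And>g s. \<lbrakk>g \<in> mod_hom R P1 (regular_module R); s \<in> carrier k\<rbrakk> \<Longrightarrow> \<theta> (\<lambda>x. g x \<otimes> \<phi> s) = s \<odot>\<^bsub>E\<^esub> \<theta> g;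
      \<And>f. f \<in> mod_hom R P0 (regular_module R) \<Longrightarrow> \<theta> (\<lambda>x. f (d x)) = \<zero>\<^bsub>E\<^esub>;
      \<And>g h. (\<And>x. x \<in> carrier P1 \<Longrightarrow> g x = h x) \<Longrightarrow> \<theta> g = \<theta> h\<rbrakk> \<Longrightarrow>
      \<exists>y\<in>carrier Y. \<forall>g\<in>mod_hom R P1 (regular_module R). ev y g = \<theta> g"

text \<open>The value of a functional on the class of g in the cokernel. The restriction is there
  because \<open>star_module\<close> consists of extensional functions, whereas g may be any
  function that is a homomorphism on P1.\<close>

definition dual_ev :: "('a, 'm) ring_scheme \<Rightarrow> ('a, 'b) module \<Rightarrow> ('b \<Rightarrow> 'c) \<Rightarrow> ('a, 'c) module \<Rightarrow>
    (('b \<Rightarrow> 'a) set \<Rightarrow> 'e) \<Rightarrow> ('b \<Rightarrow> 'a) \<Rightarrow> 'e" where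
  "dual_ev R P1 d P0 y g = y (((\<lambda>f. compose (carrier P1) f d) ` carrier (star_module R P0)) +>\<^bsub>star_module R P1\<^esub>
     restrict g (carrier P1))"

lemma pairing_dual_transpose:
  fixes R :: "('a, 'm) ring_scheme" (structure) and P1 :: "('a, 'b) module"
  assumes A: "artin_algebra k \<phi> R" and E: "left_module k E" and P1: "left_module R P1" and P0: "left_module R P0"
    and d: "d \<in> mod_hom R P1 P0"
  shows "pairing k \<phi> E R P1 d P0 (dual_module k \<phi> E (transpose_module R P1 d P0)) (dual_ev R P1 d P0)"
proof -
  interpret P1: left_module R P1 by fact
  interpret P0: left_module R P0 by fact
  interpret E: left_module k E by fact
  have phi: "\<phi> c \<in> carrier R" if "c \<in> carrier k" for c
    using A that by (auto simp: artin_algebra_def ring_hom_def)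
  define St where "St = star_module R P1"
  define Im where "Im = (\<lambda>f. compose (carrier P1) f d) ` carrier (star_module R P0)"
  define Tr where "Tr = transpose_module R P1 d P0"
  define cl where "cl g = Im +>\<^bsub>St\<^esub> g" for g
  define H where "H = mod_hom R P1 (regular_module R)"
  define Y where "Y = dual_module k \<phi> E Tr"
  have lSt: "left_module (opp_ring R) St" unfolding St_def by (rule left_module_star[OF P1])
  have lSt0: "left_module (opp_ring R) (star_module R P0)" by (rule left_module_star[OF P0])
  interpret St: left_module "opp_ring R" St by (rule lSt)
  have hd: "(\<lambda>f. compose (carrier P1) f d) \<in> mod_hom (opp_ring R) (star_module R P0) St"
    using mod_homD[OF d] unfolding St_def
    by (intro mod_homI)
       (auto simp: star_module_def compose_def mod_hom_def Pi_iff intro!: restrict_ext)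
  have sIm: "submodule Im (opp_ring R) St"
    unfolding Im_def by (rule submodule_image[OF lSt0 lSt hd left_module.submodule_carrier[OF lSt0]])
  have Tr: "Tr = quotient_module St Im" by (simp add: Tr_def transpose_module_def St_def Im_def)
  have lTr: "left_module (opp_ring R) Tr" unfolding Tr by (rule left_module_quotient[OF lSt sIm])
  interpret Tr: left_module "opp_ring R" Tr by (rule lTr)
  note q = quotient_module_proj[OF lSt sIm, folded Tr cl_def]
  note cl = mod_homD[OF q(1), simplified]
  have lY: "left_module R Y" unfolding Y_def by (rule left_module_dual[OF A E lTr])
  have St_eq: "carrier St = H \<inter> extensional (carrier P1)" by (simp add: St_def star_module_def H_def)
  have rSt: "restrict g (carrier P1) \<in> carrier St" if "g \<in> H" for g
    using that mod_hom_cong[OF P1, of g "regular_module R" "restrict g (carrier P1)"] by (simp add: St_eq H_def)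
  have St_r: "g = restrict g (carrier P1)" "g \<in> H" if "g \<in> carrier St" for g
    using that by (auto simp: St_eq extensional_restrict)
  let ?r = "\<lambda>g. restrict g (carrier P1)"
  have ev: "dual_ev R P1 d P0 y g = y (cl (?r g))" for y g
    by (simp add: dual_ev_def cl_def St_def Im_def)
  have r_add: "?r (\<lambda>x. g x \<oplus> h x) = ?r g \<oplus>\<^bsub>St\<^esub> ?r h" for g h
    by (auto simp: St_def star_module_def intro!: restrict_ext)
  have r_smult: "?r (\<lambda>x. g x \<otimes> a) = a \<odot>\<^bsub>St\<^esub> ?r g" for g a
    by (auto simp: St_def star_module_def intro!: restrict_ext)
  have Tr_smult: "a \<odot>\<^bsub>Tr\<^esub> t \<in> carrier Tr" if "a \<in> carrier R" "t \<in> carrier Tr" for a t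
    using Tr.smult_closed[of a t] that by simp
  have Y_mem: "y \<in> carrier Y \<longleftrightarrow> y \<in> mod_hom k (restrict_scalars \<phi> Tr) E \<inter> extensional (carrier Tr)" for y
    by (simp add: Y_def dual_module_def)
  have Yh: "\<lbrakk>y \<in> carrier Y; t \<in> carrier Tr\<rbrakk> \<Longrightarrow> y t \<in> carrier E"
    "\<lbrakk>y \<in> carrier Y; t \<in> carrier Tr; u \<in> carrier Tr\<rbrakk> \<Longrightarrow> y (t \<oplus>\<^bsub>Tr\<^esub> u) = y t \<oplus>\<^bsub>E\<^esub> y u"
    "\<lbrakk>y \<in> carrier Y; t \<in> carrier Tr; s \<in> carrier k\<rbrakk> \<Longrightarrow> y (\<phi> s \<odot>\<^bsub>Tr\<^esub> t) = s \<odot>\<^bsub>E\<^esub> y t" for y t u s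
    by (auto simp: Y_mem mod_hom_def restrict_scalars_def)
  have clC: "cl (?r g) \<in> carrier Tr" if "g \<in> H" for g using cl(1) rSt[OF that] by simp
  have Y0: "y \<zero>\<^bsub>Tr\<^esub> = \<zero>\<^bsub>E\<^esub>" if "y \<in> carrier Y" for y
  proof -
    have "y \<zero>\<^bsub>Tr\<^esub> \<oplus>\<^bsub>E\<^esub> y \<zero>\<^bsub>Tr\<^esub> = y \<zero>\<^bsub>Tr\<^esub>" using Yh(2)[OF that, of "\<zero>\<^bsub>Tr\<^esub>" "\<zero>\<^bsub>Tr\<^esub>"] by simp
    moreover have "y \<zero>\<^bsub>Tr\<^esub> \<in> carrier E" by (rule Yh(1)[OF that]) auto
    ultimately show ?thesis using E.M.add.r_cancel_one'[of "y \<zero>\<^bsub>Tr\<^esub>" "y \<zero>\<^bsub>Tr\<^esub>"] by simp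
  qed
  have mk: "pairing k \<phi> E R P1 d P0 Y (dual_ev R P1 d P0)"
  proof (rule pairing.intro, unfold H_def[symmetric])
    show "left_module R Y" by (rule lY)
    fix y g assume y: "y \<in> carrier Y" and g: "g \<in> H"
    show "dual_ev R P1 d P0 y g \<in> carrier E" using y g clC Yh(1) by (simp add: ev)
    show "dual_ev R P1 d P0 y (\<lambda>x. g x \<oplus> h x) = dual_ev R P1 d P0 y g \<oplus>\<^bsub>E\<^esub> dual_ev R P1 d P0 y h" if h: "h \<in> H" for h
      using Yh(2)[OF y clC[OF g] clC[OF h]] cl(2)[OF rSt[OF g] rSt[OF h]] by (simp add: ev r_add)
    show "dual_ev R P1 d P0 y (\<lambda>x. g x \<otimes> \<phi> s) = s \<odot>\<^bsub>E\<^esub> dual_ev R P1 d P0 y g" if s: "s \<in> carrier k" for s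
      using Yh(3)[OF y clC[OF g] s] cl(3)[OF phi[OF s] rSt[OF g]] by (simp add: ev r_smult)
    show "dual_ev R P1 d P0 (y \<oplus>\<^bsub>Y\<^esub> z) g = dual_ev R P1 d P0 y g \<oplus>\<^bsub>E\<^esub> dual_ev R P1 d P0 z g" if "z \<in> carrier Y" for z
      using clC[OF g] by (simp add: ev Y_def dual_module_def)
    show "dual_ev R P1 d P0 (a \<odot>\<^bsub>Y\<^esub> y) g = dual_ev R P1 d P0 y (\<lambda>x. g x \<otimes> a)" if a: "a \<in> carrier R" for a
      using clC[OF g] cl(3)[OF a rSt[OF g]] by (simp add: ev Y_def dual_module_def r_smult)
  next
    fix y f assume y: "y \<in> carrier Y" and f: "f \<in> mod_hom R P0 (regular_module R)"
    have rf: "restrict f (carrier P0) \<in> carrier (star_module R P0)"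
      using f mod_hom_cong[OF P0 f, of "restrict f (carrier P0)"] by (simp add: star_module_def)
    have "?r (\<lambda>x. f (d x)) = compose (carrier P1) (restrict f (carrier P0)) d"
      using mod_homD(1)[OF d] by (auto simp: compose_def intro!: restrict_ext)
    then have im: "?r (\<lambda>x. f (d x)) \<in> Im" using rf by (auto simp: Im_def)
    have "cl (?r (\<lambda>x. f (d x))) = cl \<zero>\<^bsub>St\<^esub>"
      using q(3)[of "?r (\<lambda>x. f (d x))" "\<zero>\<^bsub>St\<^esub>"] St.submoduleD(3)[OF sIm im] St.submoduleD(2,7)[OF sIm] im by simp
    also have "\<dots> = \<zero>\<^bsub>Tr\<^esub>" using mod_hom_zero[OF lSt lTr q(1)] .
    finally show "dual_ev R P1 d P0 y (\<lambda>x. f (d x)) = \<zero>\<^bsub>E\<^esub>" using Y0[OF y] by (simp add: ev)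
  next
    fix g h :: "'b \<Rightarrow> 'a" and y assume "\<And>x. x \<in> carrier P1 \<Longrightarrow> g x = h x"
    then have "?r g = ?r h" by (intro restrict_ext) auto
    then show "dual_ev R P1 d P0 y g = dual_ev R P1 d P0 y h" by (simp add: ev)
  next
    fix y z assume y: "y \<in> carrier Y" and z: "z \<in> carrier Y"
      and eq: "\<And>g. g \<in> H \<Longrightarrow> dual_ev R P1 d P0 y g = dual_ev R P1 d P0 z g"
    show "y = z"
    proof (rule extensionalityI[of _ "carrier Tr"])
      show "y \<in> extensional (carrier Tr)" "z \<in> extensional (carrier Tr)" using y z by (auto simp: Y_mem)
      fix t assume "t \<in> carrier Tr"
      then obtain g where g: "g \<in> carrier St" "t = cl g" using q(2) by auto
      then show "y t = z t" using eq[of g] St_r[OF g(1)] by (simp add: ev)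
    qed
  next
    fix \<theta>
    assume th: "\<And>g. g \<in> H \<Longrightarrow> \<theta> g \<in> carrier E"
      "\<And>g h. \<lbrakk>g \<in> H; h \<in> H\<rbrakk> \<Longrightarrow> \<theta> (\<lambda>x. g x \<oplus> h x) = \<theta> g \<oplus>\<^bsub>E\<^esub> \<theta> h"
      "\<And>g s. \<lbrakk>g \<in> H; s \<in> carrier k\<rbrakk> \<Longrightarrow> \<theta> (\<lambda>x. g x \<otimes> \<phi> s) = s \<odot>\<^bsub>E\<^esub> \<theta> g"
      "\<And>f. f \<in> mod_hom R P0 (regular_module R) \<Longrightarrow> \<theta> (\<lambda>x. f (d x)) = \<zero>\<^bsub>E\<^esub>"
      "\<And>g h. (\<And>x. x \<in> carrier P1 \<Longrightarrow> g x = h x) \<Longrightarrow> \<theta> g = \<theta> h"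
    have th_r: "\<theta> (?r g) = \<theta> g" for g by (rule th(5)) simp
    have th_Im: "\<theta> g = \<zero>\<^bsub>E\<^esub>" if "g \<in> Im" for g
    proof -
      obtain f where f: "f \<in> carrier (star_module R P0)" "g = compose (carrier P1) f d" using \<open>g \<in> Im\<close> by (auto simp: Im_def)
      have "\<theta> g = \<theta> (\<lambda>x. f (d x))" by (rule th(5)) (simp add: f compose_def)
      then show ?thesis using th(4)[of f] f(1) by (simp add: star_module_def)
    qed
    have St_add: "\<theta> (g \<oplus>\<^bsub>St\<^esub> h) = \<theta> g \<oplus>\<^bsub>E\<^esub> \<theta> h" if "g \<in> carrier St" "h \<in> carrier St" for g h
      using th(2)[OF St_r(2)[OF that(1)] St_r(2)[OF that(2)]] th_r[of "\<lambda>x. g x \<oplus> h x"]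
      by (simp add: r_add St_r(1)[OF that(1), symmetric] St_r(1)[OF that(2), symmetric])
    have St_scale: "\<theta> (\<phi> s \<odot>\<^bsub>St\<^esub> g) = s \<odot>\<^bsub>E\<^esub> \<theta> g" if "g \<in> carrier St" "s \<in> carrier k" for g s
      using th(3)[OF St_r(2)[OF that(1)] that(2)] th_r[of "\<lambda>x. g x \<otimes> \<phi> s"]
      by (simp add: r_smult St_r(1)[OF that(1), symmetric])
    \<comment> \<open>Additivity and vanishing on the image make \<open>\<theta>\<close> constant on
      cosets, so its value at a chosen representative defines a functional on the cokernel.\<close>
    have th_eq: "\<theta> g = \<theta> h" if gh: "g \<in> carrier St" "h \<in> carrier St" "cl g = cl h" for g h
    proof -
      have im: "g \<ominus>\<^bsub>St\<^esub> h \<in> Im" using q(3) gh by simp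
      have "g = (g \<ominus>\<^bsub>St\<^esub> h) \<oplus>\<^bsub>St\<^esub> h" using gh by (simp add: a_minus_def St.M.a_assoc St.M.l_neg)
      then have "\<theta> g = \<theta> (g \<ominus>\<^bsub>St\<^esub> h) \<oplus>\<^bsub>E\<^esub> \<theta> h" using St_add[of "g \<ominus>\<^bsub>St\<^esub> h" h] gh by simp
      then show ?thesis using th_Im[OF im] th(1) St_r(2) gh by simp
    qed
    define y where "y = (\<lambda>t\<in>carrier Tr. \<theta> (SOME g. g \<in> carrier St \<and> cl g = t))"
    have y: "y (cl g) = \<theta> g" if g: "g \<in> carrier St" for g
    proof -
      have "(SOME h. h \<in> carrier St \<and> cl h = cl g) \<in> carrier St \<and> cl (SOME h. h \<in> carrier St \<and> cl h = cl g) = cl g"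
        using g by (intro someI[of "\<lambda>h. h \<in> carrier St \<and> cl h = cl g" g]) simp
      then have "\<theta> (SOME h. h \<in> carrier St \<and> cl h = cl g) = \<theta> g" using g by (intro th_eq) (elim conjE, assumption)+
      then show ?thesis using cl(1)[OF g] by (simp add: y_def)
    qed
    have "y \<in> mod_hom k (restrict_scalars \<phi> Tr) E"
    proof (rule mod_homI)
      fix t assume "t \<in> carrier (restrict_scalars \<phi> Tr)"
      then obtain g where g: "g \<in> carrier St" "t = cl g" using q(2) by (auto simp: restrict_scalars_def)
      show "y t \<in> carrier E" using y th(1) St_r(2) g by simp
      show "y (s \<odot>\<^bsub>restrict_scalars \<phi> Tr\<^esub> t) = s \<odot>\<^bsub>E\<^esub> y t" if s: "s \<in> carrier k" for s
      proof -
        have gs: "\<phi> s \<odot>\<^bsub>St\<^esub> g \<in> carrier St" using St.smult_closed[of "\<phi> s" g] phi[OF s] g by simp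
        have "y (\<phi> s \<odot>\<^bsub>Tr\<^esub> t) = y (cl (\<phi> s \<odot>\<^bsub>St\<^esub> g))" using cl(3)[OF phi[OF s] g(1)] g by simp
        also have "\<dots> = s \<odot>\<^bsub>E\<^esub> y t" using y[OF gs] y[OF g(1)] St_scale[OF g(1) s] g by simp
        finally show ?thesis by (simp add: restrict_scalars_def)
      qed
      fix u assume "u \<in> carrier (restrict_scalars \<phi> Tr)"
      then obtain h where h: "h \<in> carrier St" "u = cl h" using q(2) by (auto simp: restrict_scalars_def)
      have "y (t \<oplus>\<^bsub>Tr\<^esub> u) = y (cl (g \<oplus>\<^bsub>St\<^esub> h))" using cl(2)[OF g(1) h(1)] g h by simp
      also have "\<dots> = y t \<oplus>\<^bsub>E\<^esub> y u" using y St_add g h by simp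
      finally show "y (t \<oplus>\<^bsub>restrict_scalars \<phi> Tr\<^esub> u) = y t \<oplus>\<^bsub>E\<^esub> y u" by (simp add: restrict_scalars_def)
    qed
    then have "y \<in> carrier Y" by (simp add: Y_mem y_def)
    moreover have "dual_ev R P1 d P0 y g = \<theta> g" if "g \<in> H" for g
      using y[OF rSt[OF that]] th_r by (simp add: ev)
    ultimately show "\<exists>y\<in>carrier Y. \<forall>g\<in>H. dual_ev R P1 d P0 y g = \<theta> g" by blast
  qed
  then show ?thesis by (simp add: Y_def Tr_def)
qed

section \<open>The base ring k and the socle of its injective module E\<close>

lemma (in cring) ideal_of_submodule:
  assumes "submodule X R (regular_module R)" shows "ideal X R"
proof -
  interpret K: left_module R "regular_module R" by (rule left_module_regular[OF ring_axioms])
  note D = K.submoduleD[OF assms, simplified]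
  have "subgroup X (add_monoid R)"
    by (rule subgroup.intro) (use D in \<open>auto simp: a_inv_def[symmetric]\<close>)
  then show ?thesis
  proof (rule idealI[OF ring_axioms])
    show "x \<otimes> a \<in> X" "a \<otimes> x \<in> X" if "a \<in> X" "x \<in> carrier R" for a x
      using D(5)[of x a] m_comm[of x a] D(3)[of a] that by auto
  qed
qed

text \<open>If every member had a smaller one, dependent choice would produce a strictly descending
  chain of ideals.\<close>

lemma artinian_minimal:
  assumes "artinian_ring k" "S I0" "\<And>I. S I \<Longrightarrow> ideal I k"
  shows "\<exists>I. S I \<and> (\<forall>I'. S I' \<and> I' \<subseteq> I \<longrightarrow> I' = I)"
proof (rule ccontr)
  assume "\<not> ?thesis"
  then have step: "\<exists>I'. S I' \<and> I' \<subset> I" if "S I" for I using that by blast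
  obtain f :: "nat \<Rightarrow> _" where f: "\<And>n. S (f n)" "\<And>n. f (Suc n) \<subset> f n"
    using dependent_nat_choice[of "\<lambda>_. S" "\<lambda>_ I I'. I' \<subset> I"] assms(2) step by metis
  have "\<forall>i. ideal (f i) k \<and> f (Suc i) \<subseteq> f i" using f assms(3) by blast
  then obtain n where n: "\<forall>i\<ge>n. f i = f n"
    using assms(1)[unfolded artinian_ring_def, THEN spec, of f] by blast
  have "f (Suc n) = f n" by (rule n[rule_format]) simp
  then show False using f(2)[of n] by blast
qed

locale nak_algebra = nak_ring R N e J
  for R :: "('a, 'm) ring_scheme" (structure) and N e J +
  fixes k :: "('k, 'l) ring_scheme" and \<phi> :: "'k \<Rightarrow> 'a" and E :: "('k, 'e) module" and \<iota> :: "'k set \<Rightarrow> 'e"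
  assumes algebra: "artin_algebra k \<phi> R"
    and envelope: "injective_envelope k (quotient_module (regular_module k) (jacobson_radical k)) \<iota> E"
begin

lemma k_cring: "cring k" and k_artinian: "artinian_ring k"
  using algebra by (auto simp: artin_algebra_def)

sublocale k: cring k by (rule k_cring)

lemma \<phi>_simps [simp]:
  "s \<in> carrier k \<Longrightarrow> \<phi> s \<in> carrier R" "\<phi> \<one>\<^bsub>k\<^esub> = \<one>"
  "\<lbrakk>s \<in> carrier k; t \<in> carrier k\<rbrakk> \<Longrightarrow> \<phi> (s \<oplus>\<^bsub>k\<^esub> t) = \<phi> s \<oplus> \<phi> t"
  "\<lbrakk>s \<in> carrier k; t \<in> carrier k\<rbrakk> \<Longrightarrow> \<phi> (s \<otimes>\<^bsub>k\<^esub> t) = \<phi> s \<otimes> \<phi> t"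
  using algebra by (auto simp: artin_algebra_def ring_hom_def)

lemma \<phi>_central: "\<lbrakk>s \<in> carrier k; x \<in> carrier R\<rbrakk> \<Longrightarrow> x \<otimes> \<phi> s = \<phi> s \<otimes> x"
  using algebra by (auto simp: artin_algebra_def)

lemma \<phi>_shift: "\<lbrakk>s \<in> carrier k; x \<in> carrier R; y \<in> carrier R\<rbrakk> \<Longrightarrow> x \<otimes> (\<phi> s \<otimes> y) = \<phi> s \<otimes> (x \<otimes> y)"
  by (metis \<phi>_central \<phi>_simps(1) m_assoc)

lemma \<phi>_zero [simp]: "\<phi> \<zero>\<^bsub>k\<^esub> = \<zero>"
proof -
  have "\<phi> \<zero>\<^bsub>k\<^esub> \<oplus> \<phi> \<zero>\<^bsub>k\<^esub> = \<phi> \<zero>\<^bsub>k\<^esub>" using \<phi>_simps(3)[of "\<zero>\<^bsub>k\<^esub>" "\<zero>\<^bsub>k\<^esub>"] by simp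
  then show ?thesis using add.r_cancel_one'[of "\<phi> \<zero>\<^bsub>k\<^esub>" "\<phi> \<zero>\<^bsub>k\<^esub>"] by simp
qed

lemma \<phi>_minus [simp]: "s \<in> carrier k \<Longrightarrow> \<phi> (\<ominus>\<^bsub>k\<^esub> s) = \<ominus> \<phi> s"
  using \<phi>_simps(3)[of "\<ominus>\<^bsub>k\<^esub> s" s] by (intro minus_equality[symmetric]) (auto simp: k.l_neg)

lemma E_module: "left_module k E"
  using envelope by (simp add: injective_envelope_def injective_module_def fg_module_def)

sublocale E: left_module k E by (rule E_module)

text \<open>The annihilator in k of the simple module with top e_c. It is shown below to be a
  maximal ideal.\<close>

definition ann :: "nat \<Rightarrow> 'k set" where
  "ann c = {s \<in> carrier k. \<phi> s \<otimes> e c \<in> J}"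

text \<open>The powers of s generate a stationary chain of ideals, so s^n = x s^(n+1) for some x and
  n. Since \<open>\<phi> s\<close> acts injectively on e_c R, the factor s^n can be cancelled after
  multiplying by e_c.\<close>

lemma k_unit:
  assumes c: "c < N" and s: "s \<in> carrier k" "s \<notin> ann c"
  shows "\<exists>x\<in>carrier k. \<phi> (x \<otimes>\<^bsub>k\<^esub> s) \<otimes> e c = e c"
proof -
  have "ideal (PIdl\<^bsub>k\<^esub> (s [^]\<^bsub>k\<^esub> i)) k \<and> PIdl\<^bsub>k\<^esub> (s [^]\<^bsub>k\<^esub> Suc i) \<subseteq> PIdl\<^bsub>k\<^esub> (s [^]\<^bsub>k\<^esub> i)" for i :: nat
  proof
    show "ideal (PIdl\<^bsub>k\<^esub> (s [^]\<^bsub>k\<^esub> i)) k" using s by (intro k.cgenideal_ideal) auto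
    show "PIdl\<^bsub>k\<^esub> (s [^]\<^bsub>k\<^esub> Suc i) \<subseteq> PIdl\<^bsub>k\<^esub> (s [^]\<^bsub>k\<^esub> i)"
    proof
      fix y assume "y \<in> PIdl\<^bsub>k\<^esub> (s [^]\<^bsub>k\<^esub> Suc i)"
      then obtain x where x: "x \<in> carrier k" "y = x \<otimes>\<^bsub>k\<^esub> (s [^]\<^bsub>k\<^esub> i \<otimes>\<^bsub>k\<^esub> s)" by (auto simp: cgenideal_def)
      then have "y = (x \<otimes>\<^bsub>k\<^esub> s) \<otimes>\<^bsub>k\<^esub> s [^]\<^bsub>k\<^esub> i" using s by (simp add: k.m_ac)
      then show "y \<in> PIdl\<^bsub>k\<^esub> (s [^]\<^bsub>k\<^esub> i)" using x s unfolding cgenideal_def by blast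
    qed
  qed
  then obtain n :: nat where n: "\<forall>i\<ge>n. PIdl\<^bsub>k\<^esub> (s [^]\<^bsub>k\<^esub> i) = PIdl\<^bsub>k\<^esub> (s [^]\<^bsub>k\<^esub> n)"
    using k_artinian[unfolded artinian_ring_def, THEN spec, of "\<lambda>i. PIdl\<^bsub>k\<^esub> (s [^]\<^bsub>k\<^esub> i)"] by blast
  have "PIdl\<^bsub>k\<^esub> (s [^]\<^bsub>k\<^esub> Suc n) = PIdl\<^bsub>k\<^esub> (s [^]\<^bsub>k\<^esub> n)" by (rule n[rule_format]) simp
  moreover have "s [^]\<^bsub>k\<^esub> n \<in> PIdl\<^bsub>k\<^esub> (s [^]\<^bsub>k\<^esub> n)" using s by (intro k.cgenideal_self) auto
  ultimately obtain x where x: "x \<in> carrier k" "s [^]\<^bsub>k\<^esub> n = x \<otimes>\<^bsub>k\<^esub> (s [^]\<^bsub>k\<^esub> n \<otimes>\<^bsub>k\<^esub> s)"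
    by (auto simp: cgenideal_def)
  obtain y where y: "y \<in> carrier R" "y \<otimes> \<phi> s \<otimes> e c = e c"
    using left_unit[of "\<phi> s" c] s c by (auto simp: ann_def)
  \<comment> \<open>The left inverse y of \<open>\<phi> s\<close> at e_c gives z = y
    (\<open>\<phi> s\<close> z) for z in e_c R, using that \<open>\<phi> s\<close> is central; one
    power is removed at a time.\<close>
  have cancel: "z = \<zero>" if "z \<in> carrier R" "e c \<otimes> z = z" "\<phi> (s [^]\<^bsub>k\<^esub> n) \<otimes> z = \<zero>" for z and n :: nat
    using that
  proof (induction n arbitrary: z)
    case (Suc n)
    have sn: "s [^]\<^bsub>k\<^esub> n \<in> carrier k" using s by simp
    have "\<phi> s \<otimes> z = \<zero>"
    proof (rule Suc.IH)
      show "e c \<otimes> (\<phi> s \<otimes> z) = \<phi> s \<otimes> z" using Suc.prems c s \<phi>_shift by simp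
      show "\<phi> (s [^]\<^bsub>k\<^esub> n) \<otimes> (\<phi> s \<otimes> z) = \<zero>" using Suc.prems s sn by (simp add: m_assoc)
    qed (use Suc.prems s in auto)
    have "z = (y \<otimes> \<phi> s \<otimes> e c) \<otimes> z" using y Suc.prems c by simp
    also have "\<dots> = y \<otimes> (\<phi> s \<otimes> z)" using y(1) Suc.prems c s by (simp add: m_assoc)
    finally show ?case using \<open>\<phi> s \<otimes> z = \<zero>\<close> y by simp
  qed simp
  let ?z = "e c \<ominus> \<phi> (x \<otimes>\<^bsub>k\<^esub> s) \<otimes> e c"
  have sn: "s [^]\<^bsub>k\<^esub> n \<in> carrier k" using s by simp
  have eq: "\<phi> (s [^]\<^bsub>k\<^esub> n) = \<phi> (s [^]\<^bsub>k\<^esub> n) \<otimes> \<phi> (x \<otimes>\<^bsub>k\<^esub> s)"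
  proof -
    have "s [^]\<^bsub>k\<^esub> n = s [^]\<^bsub>k\<^esub> n \<otimes>\<^bsub>k\<^esub> (x \<otimes>\<^bsub>k\<^esub> s)" using x sn s by (metis k.m_comm k.m_lcomm k.m_closed)
    then have "\<phi> (s [^]\<^bsub>k\<^esub> n) = \<phi> (s [^]\<^bsub>k\<^esub> n \<otimes>\<^bsub>k\<^esub> (x \<otimes>\<^bsub>k\<^esub> s))" by simp
    then show ?thesis using sn x(1) s(1) by simp
  qed
  have "?z = \<zero>"
  proof (rule cancel[of _ n])
    show "e c \<otimes> ?z = ?z"
      using c x s \<phi>_shift[of "x \<otimes>\<^bsub>k\<^esub> s" "e c" "e c"] by (simp add: a_minus_def r_distr r_minus)
    have "\<phi> (s [^]\<^bsub>k\<^esub> n) \<otimes> ?z = \<phi> (s [^]\<^bsub>k\<^esub> n) \<otimes> e c \<ominus> (\<phi> (s [^]\<^bsub>k\<^esub> n) \<otimes> \<phi> (x \<otimes>\<^bsub>k\<^esub> s)) \<otimes> e c"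
      using c x(1) s sn by (simp add: a_minus_def r_distr r_minus m_assoc)
    also have "\<dots> = \<zero>"
      unfolding eq[symmetric] using c \<phi>_simps(1)[OF sn] by (simp add: a_minus_def r_neg del: \<phi>_simps)
    finally show "\<phi> (s [^]\<^bsub>k\<^esub> n) \<otimes> ?z = \<zero>" .
  qed (use c x(1) s in auto)
  then have "?z \<oplus> \<phi> (x \<otimes>\<^bsub>k\<^esub> s) \<otimes> e c = \<phi> (x \<otimes>\<^bsub>k\<^esub> s) \<otimes> e c" using c x(1) s by simp
  then have "e c = \<phi> (x \<otimes>\<^bsub>k\<^esub> s) \<otimes> e c" using c x(1) s diff_add_cancel[of "e c" "\<phi> (x \<otimes>\<^bsub>k\<^esub> s) \<otimes> e c"] by simp
  then show ?thesis using x(1) by force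
qed

lemma k_unit_ann:
  assumes c: "c < N" and s: "s \<in> carrier k" "s \<notin> ann c"
  shows "\<exists>x\<in>carrier k. \<one>\<^bsub>k\<^esub> \<ominus>\<^bsub>k\<^esub> x \<otimes>\<^bsub>k\<^esub> s \<in> ann c"
proof -
  obtain x where x: "x \<in> carrier k" "\<phi> (x \<otimes>\<^bsub>k\<^esub> s) \<otimes> e c = e c" using k_unit[OF assms] by blast
  have "\<phi> (\<one>\<^bsub>k\<^esub> \<ominus>\<^bsub>k\<^esub> x \<otimes>\<^bsub>k\<^esub> s) \<otimes> e c = e c \<ominus> \<phi> (x \<otimes>\<^bsub>k\<^esub> s) \<otimes> e c"
    using x(1) s c by (simp add: a_minus_def l_distr l_minus)
  also have "\<dots> = \<zero>" using x c by (simp add: a_minus_def r_neg del: \<phi>_simps)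
  finally have "\<phi> (\<one>\<^bsub>k\<^esub> \<ominus>\<^bsub>k\<^esub> x \<otimes>\<^bsub>k\<^esub> s) \<otimes> e c \<in> J" using J_D(2) by simp
  then have "\<one>\<^bsub>k\<^esub> \<ominus>\<^bsub>k\<^esub> x \<otimes>\<^bsub>k\<^esub> s \<in> ann c" unfolding ann_def using x(1) s by blast
  then show ?thesis using x(1) by blast
qed

lemma k_reg: "left_module k (regular_module k)"
  by (rule left_module_regular[OF k.ring_axioms])

lemma ann_submodule: "c < N \<Longrightarrow> submodule (ann c) k (regular_module k)"
  using J_D by (intro left_module.submoduleI[OF k_reg]) (auto simp: ann_def l_distr m_assoc)

lemma ann_prime:
  assumes "c < N" "s \<in> carrier k" "t \<in> carrier k" "s \<otimes>\<^bsub>k\<^esub> t \<in> ann c" "s \<notin> ann c" shows "t \<in> ann c"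
proof -
  obtain x where x: "x \<in> carrier k" "\<phi> (x \<otimes>\<^bsub>k\<^esub> s) \<otimes> e c = e c" using k_unit[OF assms(1,2,5)] by blast
  have "\<phi> t \<otimes> e c = \<phi> t \<otimes> (\<phi> (x \<otimes>\<^bsub>k\<^esub> s) \<otimes> e c)" using x by simp
  also have "\<dots> = \<phi> x \<otimes> (\<phi> (s \<otimes>\<^bsub>k\<^esub> t) \<otimes> e c)"
    using x(1) assms(1-3) \<phi>_central[of t "\<phi> x"] \<phi>_central[of t "\<phi> s"]
    by (simp add: m_assoc[symmetric])
  also have "\<dots> \<in> J" using J_D(4) assms(4) x(1) by (simp add: ann_def)
  finally show ?thesis using assms(3) by (simp add: ann_def)
qed

lemma ann_maximal:
  assumes c: "c < N" shows "maximal_submodule k (regular_module k) (ann c)"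
  unfolding maximal_submodule_def
proof (intro conjI allI impI ann_submodule[OF c])
  have "\<one>\<^bsub>k\<^esub> \<notin> ann c" using c e_notin by (simp add: ann_def)
  then show "ann c \<noteq> carrier (regular_module k)" by force
  fix X assume X: "submodule X k (regular_module k) \<and> ann c \<subseteq> X"
  interpret K: left_module k "regular_module k" by (rule k_reg)
  note D = K.submoduleD[OF X[THEN conjunct1], simplified]
  show "X = ann c \<or> X = carrier (regular_module k)"
  proof (cases "X \<subseteq> ann c")
    case False
    then obtain s where s: "s \<in> X" "s \<notin> ann c" by blast
    then obtain x where x: "x \<in> carrier k" "\<one>\<^bsub>k\<^esub> \<ominus>\<^bsub>k\<^esub> x \<otimes>\<^bsub>k\<^esub> s \<in> ann c" using k_unit_ann[OF c] D(3) by blast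
    have "(\<one>\<^bsub>k\<^esub> \<ominus>\<^bsub>k\<^esub> x \<otimes>\<^bsub>k\<^esub> s) \<oplus>\<^bsub>k\<^esub> x \<otimes>\<^bsub>k\<^esub> s \<in> X" using x X D(4,5) s by blast
    moreover have "(\<one>\<^bsub>k\<^esub> \<ominus>\<^bsub>k\<^esub> x \<otimes>\<^bsub>k\<^esub> s) \<oplus>\<^bsub>k\<^esub> x \<otimes>\<^bsub>k\<^esub> s = \<one>\<^bsub>k\<^esub>"
      using x(1) D(3)[OF s(1)] by (simp add: a_minus_def k.a_assoc k.l_neg)
    ultimately have "t \<in> X" if "t \<in> carrier k" for t using D(5)[of t "\<one>\<^bsub>k\<^esub>"] that by simp
    then show ?thesis using D(1) by auto
  qed (use X in auto)
qed

text \<open>E is essential over k / rad k, so its elements killed by \<open>ann c\<close> already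
  lie in the image of k / rad k, and there they form the simple component belonging to the maximal
  ideal \<open>ann c\<close>. A generator of that component is found without decomposing k / rad k,
  from an ideal minimal among those not contained in \<open>ann c\<close>.\<close>

lemma socle_generator:
  assumes c: "c < N"
  obtains \<epsilon> where "\<epsilon> \<in> carrier E" "\<epsilon> \<noteq> \<zero>\<^bsub>E\<^esub>" "\<And>s. s \<in> ann c \<Longrightarrow> s \<odot>\<^bsub>E\<^esub> \<epsilon> = \<zero>\<^bsub>E\<^esub>"
    "\<And>y. \<lbrakk>y \<in> carrier E; \<And>s. s \<in> ann c \<Longrightarrow> s \<odot>\<^bsub>E\<^esub> y = \<zero>\<^bsub>E\<^esub>\<rbrakk> \<Longrightarrow> \<exists>s\<in>carrier k. y = s \<odot>\<^bsub>E\<^esub> \<epsilon>"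
proof -
  interpret K: left_module k "regular_module k" by (rule k_reg)
  let ?r = "jacobson_radical k" and ?Q = "quotient_module (regular_module k) (jacobson_radical k)"
  note m = ann_maximal[OF c] and ms = ann_submodule[OF c]
  note Dm = K.submoduleD[OF ms, simplified]
  have r_iff: "x \<in> ?r \<longleftrightarrow> x \<in> carrier k \<and> (\<forall>X. maximal_submodule k (regular_module k) X \<longrightarrow> x \<in> X)" for x
    by (auto simp: jacobson_radical_def)
  have max_sub: "submodule X k (regular_module k)" if "maximal_submodule k (regular_module k) X" for X
    using that by (simp add: maximal_submodule_def)
  have rs: "submodule ?r k (regular_module k)"
    using K.submoduleD[OF max_sub] by (intro K.submoduleI) (auto simp: r_iff)
  have rm: "?r \<subseteq> ann c" using m r_iff by blast
  have "\<exists>I. (ideal I k \<and> \<not> I \<subseteq> ann c) \<and> (\<forall>I'. (ideal I' k \<and> \<not> I' \<subseteq> ann c) \<and> I' \<subseteq> I \<longrightarrow> I' = I)"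
  proof (rule artinian_minimal[OF k_artinian])
    have "\<one>\<^bsub>k\<^esub> \<notin> ann c" using c e_notin by (simp add: ann_def)
    then show "ideal (carrier k) k \<and> \<not> carrier k \<subseteq> ann c" using k.oneideal by auto
  qed auto
  then obtain I where I: "ideal I k" "\<not> I \<subseteq> ann c" "\<And>I'. ideal I' k \<Longrightarrow> \<not> I' \<subseteq> ann c \<Longrightarrow> I' \<subseteq> I \<Longrightarrow> I' = I" by blast
  interpret I: ideal I k by (rule I(1))
  obtain b0 where b0: "b0 \<in> I" "b0 \<notin> ann c" using I(2) by blast
  have b0k: "b0 \<in> carrier k" using b0 I.Icarr by simp
  \<comment> \<open>Every maximal ideal X other than \<open>ann c\<close> contains I: for t in X
    outside \<open>ann c\<close> the product t b0 is in both I and X but, \<open>ann c\<close> being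
    prime, not in \<open>ann c\<close>, so minimality gives I inside X. Hence \<open>ann c\<close>
    times b0 lies in all maximal ideals.\<close>
  have mb0: "s \<otimes>\<^bsub>k\<^esub> b0 \<in> ?r" if s: "s \<in> ann c" for s
    unfolding r_iff
  proof (intro conjI allI impI)
    have sk: "s \<in> carrier k" using Dm(3) s .
    show "s \<otimes>\<^bsub>k\<^esub> b0 \<in> carrier k" using sk b0k by simp
    fix X assume X: "maximal_submodule k (regular_module k) X"
    note DX = K.submoduleD[OF max_sub[OF X], simplified]
    show "s \<otimes>\<^bsub>k\<^esub> b0 \<in> X"
    proof (cases "X \<subseteq> ann c")
      case True
      then have "X = ann c" using X ms m by (auto simp: maximal_submodule_def)
      then show ?thesis using DX(5)[of b0 s] s sk b0k by (simp add: k.m_comm)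
    next
      case False
      then obtain t where t: "t \<in> X" "t \<notin> ann c" by blast
      have tk: "t \<in> carrier k" using DX(3) t by simp
      have "t \<otimes>\<^bsub>k\<^esub> b0 \<in> I \<inter> X"
        using I.I_l_closed[OF b0(1) tk] DX(5)[OF b0k t(1)] tk b0k by (simp add: k.m_comm)
      moreover have "t \<otimes>\<^bsub>k\<^esub> b0 \<notin> ann c" using ann_prime[OF c tk b0k] t b0 by blast
      moreover have "ideal (I \<inter> X) k" by (rule k.i_intersect[OF I(1) k.ideal_of_submodule[OF max_sub[OF X]]])
      ultimately have "I \<inter> X = I" by (intro I(3)) auto
      then show ?thesis using I.I_l_closed[OF b0(1) sk] by blast
    qed
  qed
  define cl where "cl x = ?r +>\<^bsub>regular_module k\<^esub> x" for x
  note q = quotient_module_proj[OF k_reg rs, folded cl_def, simplified]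
  have env: "left_module k ?Q" "\<iota> \<in> mod_hom k ?Q E" "inj_on \<iota> (carrier ?Q)"
    "\<And>X. submodule X k E \<Longrightarrow> X \<inter> \<iota> ` carrier ?Q = {\<zero>\<^bsub>E\<^esub>} \<Longrightarrow> X = {\<zero>\<^bsub>E\<^esub>}"
    using envelope by (auto simp: injective_envelope_def)
  interpret Q: left_module k ?Q by (rule env)
  note hq = mod_homD[OF q(1), simplified] and h\<iota> = mod_homD[OF env(2)]
  have clQ: "cl x \<in> carrier ?Q" if "x \<in> carrier k" for x using hq(1) that .
  have \<iota>0: "\<iota> \<zero>\<^bsub>?Q\<^esub> = \<zero>\<^bsub>E\<^esub>" by (rule mod_hom_zero[OF env(1) E_module env(2)])
  have cl0: "cl \<zero>\<^bsub>k\<^esub> = \<zero>\<^bsub>?Q\<^esub>" using mod_hom_zero[OF k_reg env(1) q(1)] by simp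
  have cl_r: "cl x = \<zero>\<^bsub>?Q\<^esub> \<longleftrightarrow> x \<in> ?r" if "x \<in> carrier k" for x
    using q(3)[of x "\<zero>\<^bsub>k\<^esub>"] that cl0 by (simp add: a_minus_def)
  define h where "h x = \<iota> (cl x)" for x
  have h: "x \<in> carrier k \<Longrightarrow> h x \<in> carrier E" "\<lbrakk>x \<in> carrier k; s \<in> carrier k\<rbrakk> \<Longrightarrow> h (s \<otimes>\<^bsub>k\<^esub> x) = s \<odot>\<^bsub>E\<^esub> h x" for x s
    using hq h\<iota> clQ by (auto simp: h_def)
  have h0: "h x = \<zero>\<^bsub>E\<^esub> \<longleftrightarrow> x \<in> ?r" if "x \<in> carrier k" for x
  proof -
    have "\<iota> (cl x) = \<iota> \<zero>\<^bsub>?Q\<^esub> \<longleftrightarrow> cl x = \<zero>\<^bsub>?Q\<^esub>"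
      using inj_on_eq_iff[OF env(3) clQ[OF that] Q.M.zero_closed] .
    then show ?thesis using cl_r[OF that] \<iota>0 by (simp add: h_def)
  qed
  have h_diff: "h x = h y" if "x \<in> carrier k" "y \<in> carrier k" "x \<ominus>\<^bsub>k\<^esub> y \<in> ?r" for x y
    using q(3)[of x y] that by (simp add: h_def a_minus_def)
  show ?thesis
  proof (rule that[of "h b0"])
    show "h b0 \<in> carrier E" "h b0 \<noteq> \<zero>\<^bsub>E\<^esub>" using h(1) h0 b0k b0 rm by auto
    show "s \<odot>\<^bsub>E\<^esub> h b0 = \<zero>\<^bsub>E\<^esub>" if "s \<in> ann c" for s
      using mb0[OF that] h(2)[of b0 s] h0[of "s \<otimes>\<^bsub>k\<^esub> b0"] b0k Dm(3)[OF that] by simp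
    fix y assume y: "y \<in> carrier E" "\<And>s. s \<in> ann c \<Longrightarrow> s \<odot>\<^bsub>E\<^esub> y = \<zero>\<^bsub>E\<^esub>"
    show "\<exists>s\<in>carrier k. y = s \<odot>\<^bsub>E\<^esub> h b0"
    proof (cases "y = \<zero>\<^bsub>E\<^esub>")
      case True then show ?thesis using h(1) b0k by (intro bexI[of _ "\<zero>\<^bsub>k\<^esub>"]) auto
    next
      case False
      let ?X = "(\<lambda>s. s \<odot>\<^bsub>E\<^esub> y) ` carrier k"
      have X: "submodule ?X k E" by (rule E.cyclic_submodule[OF y(1)])
      have "y \<in> ?X" using y by (intro image_eqI[of _ _ "\<one>\<^bsub>k\<^esub>"]) auto
      then have "?X \<inter> \<iota> ` carrier ?Q \<noteq> {\<zero>\<^bsub>E\<^esub>}" using env(4)[OF X] False by blast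
      moreover have "\<zero>\<^bsub>E\<^esub> \<in> ?X \<inter> \<iota> ` carrier ?Q" using E.submoduleD(2)[OF X] \<iota>0 Q.M.zero_closed by force
      ultimately obtain s w where s: "s \<in> carrier k" "w \<in> carrier ?Q" "s \<odot>\<^bsub>E\<^esub> y = \<iota> w" "s \<odot>\<^bsub>E\<^esub> y \<noteq> \<zero>\<^bsub>E\<^esub>" by blast
      obtain b where b: "b \<in> carrier k" "s \<odot>\<^bsub>E\<^esub> y = h b" using q(2) s by (auto simp: h_def)
      \<comment> \<open>Essentiality only gives a nonzero multiple s y in the image of k / rad k. As
        s is invertible modulo \<open>ann c\<close>, which kills y, the element y is recovered from
        s y and lies in the image as well.\<close>
      have "s \<notin> ann c" using y(2) s(4) by blast
      then obtain x where x: "x \<in> carrier k" "\<one>\<^bsub>k\<^esub> \<ominus>\<^bsub>k\<^esub> x \<otimes>\<^bsub>k\<^esub> s \<in> ann c" using k_unit_ann[OF c s(1)] by blast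
      have "\<zero>\<^bsub>E\<^esub> = (\<one>\<^bsub>k\<^esub> \<ominus>\<^bsub>k\<^esub> x \<otimes>\<^bsub>k\<^esub> s) \<odot>\<^bsub>E\<^esub> y" using y(2) x(2) by simp
      also have "\<dots> = y \<ominus>\<^bsub>E\<^esub> x \<odot>\<^bsub>E\<^esub> (s \<odot>\<^bsub>E\<^esub> y)"
        using x(1) s(1) y(1) by (simp add: a_minus_def E.smult_l_distr E.smult_l_minus E.smult_assoc1)
      finally have "y \<ominus>\<^bsub>E\<^esub> x \<odot>\<^bsub>E\<^esub> (s \<odot>\<^bsub>E\<^esub> y) \<oplus>\<^bsub>E\<^esub> x \<odot>\<^bsub>E\<^esub> (s \<odot>\<^bsub>E\<^esub> y) = x \<odot>\<^bsub>E\<^esub> (s \<odot>\<^bsub>E\<^esub> y)"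
        using x(1) s(1) y(1) by simp
      then have "y = x \<odot>\<^bsub>E\<^esub> (s \<odot>\<^bsub>E\<^esub> y)" using x(1) s(1) y(1) by (simp add: a_minus_def E.M.a_assoc E.M.l_neg)
      then have yb: "y = h (x \<otimes>\<^bsub>k\<^esub> b)" using b h(2) x(1) by simp
      let ?b = "x \<otimes>\<^bsub>k\<^esub> b"
      have bk: "?b \<in> carrier k" using x b by simp
      have mb: "t \<otimes>\<^bsub>k\<^esub> ?b \<in> ?r" if "t \<in> ann c" for t
        using y(2)[OF that] yb h(2)[OF bk, of t] h0[of "t \<otimes>\<^bsub>k\<^esub> ?b"] bk Dm(3)[OF that] by simp
      \<comment> \<open>x0 b0 is 1 modulo \<open>ann c\<close>, and \<open>ann c\<close> kills the
        class of x b; hence this class is a multiple of that of b0.\<close>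
      obtain x0 where x0: "x0 \<in> carrier k" "\<one>\<^bsub>k\<^esub> \<ominus>\<^bsub>k\<^esub> x0 \<otimes>\<^bsub>k\<^esub> b0 \<in> ann c" using k_unit_ann[OF c b0k b0(2)] by blast
      have "(\<one>\<^bsub>k\<^esub> \<ominus>\<^bsub>k\<^esub> x0 \<otimes>\<^bsub>k\<^esub> b0) \<otimes>\<^bsub>k\<^esub> ?b = ?b \<ominus>\<^bsub>k\<^esub> (x0 \<otimes>\<^bsub>k\<^esub> b0) \<otimes>\<^bsub>k\<^esub> ?b"
        using x0(1) b0k bk by (simp add: a_minus_def k.l_distr k.l_minus del: k.m_assoc)
      also have "(x0 \<otimes>\<^bsub>k\<^esub> b0) \<otimes>\<^bsub>k\<^esub> ?b = (x0 \<otimes>\<^bsub>k\<^esub> ?b) \<otimes>\<^bsub>k\<^esub> b0"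
        using x0(1) b0k bk by (metis k.m_assoc k.m_comm k.m_closed)
      finally have "?b \<ominus>\<^bsub>k\<^esub> (x0 \<otimes>\<^bsub>k\<^esub> ?b) \<otimes>\<^bsub>k\<^esub> b0 \<in> ?r" using mb[OF x0(2)] by simp
      then have "y = h ((x0 \<otimes>\<^bsub>k\<^esub> ?b) \<otimes>\<^bsub>k\<^esub> b0)" using yb h_diff bk x0(1) b0k by simp
      then have "y = (x0 \<otimes>\<^bsub>k\<^esub> ?b) \<odot>\<^bsub>E\<^esub> h b0" using h(2)[OF b0k, of "x0 \<otimes>\<^bsub>k\<^esub> ?b"] x0(1) bk by simp
      then show ?thesis using x0(1) bk by blast
    qed
  qed
qed

end

section \<open>Functionals on the division ring at an idempotent\<close>

context nak_algebra
begin

abbreviation "kR \<equiv> restrict_scalars \<phi> (regular_module R)"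

lemma kR_simps: "carrier kR = carrier R" "\<zero>\<^bsub>kR\<^esub> = \<zero>" "x \<oplus>\<^bsub>kR\<^esub> y = x \<oplus> y" "s \<odot>\<^bsub>kR\<^esub> x = \<phi> s \<otimes> x"
  by (simp_all add: restrict_scalars_def)

lemma fg_kR: "fg_module k kR" and kR_module: "left_module k kR"
  using algebra by (auto simp: artin_algebra_def fg_module_def)

sublocale kR: left_module k kR by (rule kR_module)

text \<open>The k-linear maps from e_c R e_c / e_c J e_c to E, written as functions on all of R that
  kill J and only see the corner e_c x e_c. This avoids introducing the quotient ring.\<close>

definition funct :: "nat \<Rightarrow> ('a \<Rightarrow> 'e) set" where
  "funct c = {\<eta>. (\<forall>x\<in>carrier R. \<eta> x \<in> carrier E) \<and> (\<forall>x\<in>carrier R. \<forall>y\<in>carrier R. \<eta> (x \<oplus> y) = \<eta> x \<oplus>\<^bsub>E\<^esub> \<eta> y) \<and>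
     (\<forall>s\<in>carrier k. \<forall>x\<in>carrier R. \<eta> (\<phi> s \<otimes> x) = s \<odot>\<^bsub>E\<^esub> \<eta> x) \<and> (\<forall>x\<in>J. \<eta> x = \<zero>\<^bsub>E\<^esub>) \<and>
     (\<forall>x\<in>carrier R. \<eta> (e c \<otimes> x \<otimes> e c) = \<eta> x)}"

lemma functD:
  assumes "\<eta> \<in> funct c"
  shows "x \<in> carrier R \<Longrightarrow> \<eta> x \<in> carrier E" "\<lbrakk>x \<in> carrier R; y \<in> carrier R\<rbrakk> \<Longrightarrow> \<eta> (x \<oplus> y) = \<eta> x \<oplus>\<^bsub>E\<^esub> \<eta> y"
    "\<lbrakk>s \<in> carrier k; x \<in> carrier R\<rbrakk> \<Longrightarrow> \<eta> (\<phi> s \<otimes> x) = s \<odot>\<^bsub>E\<^esub> \<eta> x" "x \<in> J \<Longrightarrow> \<eta> x = \<zero>\<^bsub>E\<^esub>"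
    "x \<in> carrier R \<Longrightarrow> \<eta> (e c \<otimes> x \<otimes> e c) = \<eta> x"
  using assms by (auto simp: funct_def)

text \<open>The kernel of the projection of R onto e_c R e_c / e_c J e_c; all functionals in
  \<open>funct c\<close> vanish on it.\<close>

definition corner_rad :: "nat \<Rightarrow> 'a set" where
  "corner_rad c = {x \<in> carrier R. e c \<otimes> x \<otimes> e c \<in> J}"

lemma corner_rad_submodule: "c < N \<Longrightarrow> submodule (corner_rad c) k kR"
  using J_D \<phi>_shift by (intro kR.submoduleI) (auto simp: corner_rad_def kR_simps l_distr r_distr m_assoc)

lemma funct_corner_rad: "\<lbrakk>\<eta> \<in> funct c; x \<in> corner_rad c\<rbrakk> \<Longrightarrow> \<eta> x = \<zero>\<^bsub>E\<^esub>"
  using functD[of \<eta> c] by (metis (mono_tags, lifting) corner_rad_def mem_Collect_eq)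

lemma funct_ann:
  assumes "c < N" "\<eta> \<in> funct c" "x \<in> carrier R" "s \<in> ann c" shows "s \<odot>\<^bsub>E\<^esub> \<eta> x = \<zero>\<^bsub>E\<^esub>"
proof -
  have s: "s \<in> carrier k" "\<phi> s \<otimes> e c \<in> J" using assms by (auto simp: ann_def)
  have "e c \<otimes> (\<phi> s \<otimes> x) \<otimes> e c = (\<phi> s \<otimes> e c) \<otimes> (x \<otimes> e c)"
    using assms s(1) \<phi>_central[of s "e c"] by (simp add: m_assoc[symmetric])
  then have "\<phi> s \<otimes> x \<in> corner_rad c" using J_D(5)[OF s(2)] assms s(1) by (simp add: corner_rad_def)
  then show ?thesis using funct_corner_rad[OF assms(2)] functD(3)[OF assms(2) s(1) assms(3)] by simp
qed

text \<open>A functional is prescribed on R = A + k b, zero on a proper k-submodule A containing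
  \<open>corner_rad c\<close> and equal to the socle generator at b. This is consistent because s b
  in A forces s into \<open>ann c\<close>.\<close>

lemma funct_exists:
  assumes c: "c < N" shows "\<exists>\<eta>\<in>funct c. \<exists>x\<in>carrier R. \<eta> x \<noteq> \<zero>\<^bsub>E\<^esub>"
proof -
  obtain \<epsilon> where \<epsilon>: "\<epsilon> \<in> carrier E" "\<epsilon> \<noteq> \<zero>\<^bsub>E\<^esub>" "\<And>s. s \<in> ann c \<Longrightarrow> s \<odot>\<^bsub>E\<^esub> \<epsilon> = \<zero>\<^bsub>E\<^esub>"
    using socle_generator[OF c] by metis
  note W0 = corner_rad_submodule[OF c]
  \<comment> \<open>R is finitely generated over k. If adjoining one element to a proper submodule
    above \<open>corner_rad c\<close> never gave all of R, the induction over generators would end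
    with a proper submodule.\<close>
  have "\<exists>A b. submodule A k kR \<and> corner_rad c \<subseteq> A \<and> A \<noteq> carrier R \<and> b \<in> carrier R \<and> kR.adjoin A b = carrier R"
  proof (rule ccontr)
    assume n: "\<not> ?thesis"
    have "carrier kR \<noteq> carrier R"
    proof (rule kR.fg_induct[OF fg_kR W0, of "\<lambda>A. A \<noteq> carrier R"])
      have "\<one> \<notin> corner_rad c" using c e_notin by (simp add: corner_rad_def)
      then show "corner_rad c \<noteq> carrier R" by auto
      fix A b assume A: "submodule A k kR" "corner_rad c \<subseteq> A" "A \<noteq> carrier R" "b \<in> carrier kR"
      then show "\<exists>B. submodule B k kR \<and> A \<subseteq> B \<and> b \<in> B \<and> B \<noteq> carrier R"
        using n kR.submodule_adjoin[of A b] kR.adjoin_subset[of A b]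
        by (intro exI[of _ "kR.adjoin A b"]) (auto simp: kR_simps)
    qed
    then show False by (simp add: kR_simps)
  qed
  then obtain A b where A: "submodule A k kR" "corner_rad c \<subseteq> A" "A \<noteq> carrier R" and b: "b \<in> carrier R"
    "kR.adjoin A b = carrier R" by blast
  note DA = kR.submoduleD[OF A(1), unfolded kR_simps]
  have bA: "b \<notin> A"
  proof
    assume bA: "b \<in> A"
    have "x \<oplus> \<phi> s \<otimes> b \<in> A" if "x \<in> A" "s \<in> carrier k" for x s using DA(4,5) bA that by simp
    then have "kR.adjoin A b \<subseteq> A" by (auto simp: kR.adjoin_def kR_simps)
    then show False using b A(3) DA(1) by auto
  qed
  have "s \<in> ann c" if s: "s \<in> carrier k" "\<phi> s \<otimes> b \<in> A" for s
  proof (rule ccontr)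
    assume "s \<notin> ann c"
    then obtain x where x: "x \<in> carrier k" "\<phi> (x \<otimes>\<^bsub>k\<^esub> s) \<otimes> e c = e c" using k_unit c s by blast
    let ?t = "\<phi> (x \<otimes>\<^bsub>k\<^esub> s)"
    have tR: "?t \<in> carrier R" using x(1) s(1) by (intro \<phi>_simps(1)) auto
    have "e c \<otimes> (?t \<otimes> b) \<otimes> e c = (?t \<otimes> e c) \<otimes> (b \<otimes> e c)"
      using c b x(1) s(1) tR \<phi>_central[of "x \<otimes>\<^bsub>k\<^esub> s" "e c"] by (simp add: m_assoc[symmetric] del: \<phi>_simps)
    then have "e c \<otimes> (?t \<otimes> b) \<otimes> e c = e c \<otimes> b \<otimes> e c" using x(2) c b by (simp add: m_assoc)
    then have "e c \<otimes> (b \<ominus> ?t \<otimes> b) \<otimes> e c = \<zero>"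
      using c b tR by (simp add: a_minus_def r_distr l_distr l_minus r_minus r_neg del: \<phi>_simps)
    then have "b \<ominus> ?t \<otimes> b \<in> A" using A(2) J_D(2) b tR by (auto simp: corner_rad_def simp del: \<phi>_simps)
    moreover have "?t \<otimes> b \<in> A" using DA(5)[OF x(1) s(2)] x(1) s(1) b by (simp add: m_assoc)
    ultimately have "(b \<ominus> ?t \<otimes> b) \<oplus> ?t \<otimes> b \<in> A" by (rule DA(4))
    then show False using bA diff_add_cancel[OF b(1), of "?t \<otimes> b"] tR b by (simp del: \<phi>_simps)
  qed
  then have cond: "(\<lambda>_. \<zero>\<^bsub>E\<^esub>) (s \<odot>\<^bsub>kR\<^esub> b) = s \<odot>\<^bsub>E\<^esub> \<epsilon>" if "s \<in> carrier k" "s \<odot>\<^bsub>kR\<^esub> b \<in> A" for s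
    using \<epsilon>(3) that by (simp add: kR_simps)
  have hom0: "(\<lambda>_. \<zero>\<^bsub>E\<^esub>) \<in> mod_hom k (sub_mod kR A) E" by (intro mod_homI) auto
  obtain \<eta> where \<eta>: "\<eta> \<in> mod_hom k (sub_mod kR (kR.adjoin A b)) E" "\<forall>x\<in>A. \<eta> x = \<zero>\<^bsub>E\<^esub>" "\<eta> b = \<epsilon>"
    using kR.adjoin_extend[where b = b, OF E_module A(1) _ hom0 \<epsilon>(1) cond] b by (auto simp: kR_simps)
  note h = mod_homD[OF \<eta>(1), unfolded b(2), simplified, unfolded kR_simps]
  have "\<eta> (e c \<otimes> x \<otimes> e c) = \<eta> x" if x: "x \<in> carrier R" for x
  proof -
    have "x \<ominus> e c \<otimes> x \<otimes> e c \<in> corner_rad c"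
    proof -
      have "e c \<otimes> (e c \<otimes> x \<otimes> e c) \<otimes> e c = e c \<otimes> e c \<otimes> x \<otimes> (e c \<otimes> e c)"
        using x c by (simp only: m_assoc e_closed m_closed)
      then have "e c \<otimes> (e c \<otimes> x \<otimes> e c) \<otimes> e c = e c \<otimes> x \<otimes> e c" using c by simp
      then have "e c \<otimes> (x \<ominus> e c \<otimes> x \<otimes> e c) \<otimes> e c = \<zero>"
        using x c by (simp add: a_minus_def r_distr l_distr l_minus r_minus r_neg)
      then show ?thesis using x c J_D(2) by (simp add: corner_rad_def)
    qed
    then have "\<eta> (x \<ominus> e c \<otimes> x \<otimes> e c) = \<zero>\<^bsub>E\<^esub>" using A(2) \<eta>(2) by auto
    then have "\<eta> ((x \<ominus> e c \<otimes> x \<otimes> e c) \<oplus> e c \<otimes> x \<otimes> e c) = \<eta> (e c \<otimes> x \<otimes> e c)"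
      using h(1,2) x c by simp
    then show ?thesis using diff_add_cancel[of x "e c \<otimes> x \<otimes> e c"] x c by simp
  qed
  moreover have "\<eta> x = \<zero>\<^bsub>E\<^esub>" if "x \<in> J" for x
  proof -
    have "x \<in> corner_rad c" using that J_D c by (auto simp: corner_rad_def)
    then show ?thesis using A(2) \<eta>(2) by auto
  qed
  ultimately have "\<eta> \<in> funct c" using h by (auto simp: funct_def)
  then show ?thesis using \<eta>(3) \<epsilon>(2) b(1) by blast
qed

text \<open>
  The dual of the division ring \<open>D = e\<^sub>c R e\<^sub>c / e\<^sub>c J e\<^sub>c\<close> is one-dimensional over \<open>D\<close>: by induction on
  a \<open>k\<close>-submodule \<open>W\<close>, translates of one nonzero functional interpolate every functional on \<open>W\<close> and
  separate \<open>W\<close> from the elements outside it.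
\<close>

lemma funct_generated:
  assumes c: "c < N" and \<eta>0: "\<eta>0 \<in> funct c" "x1 \<in> carrier R" "\<eta>0 x1 \<noteq> \<zero>\<^bsub>E\<^esub>" and \<eta>: "\<eta> \<in> funct c"
  shows "\<exists>a\<in>carrier R. \<forall>x\<in>carrier R. \<eta> x = \<eta>0 (x \<otimes> a)"
proof -
  obtain \<epsilon> where \<epsilon>: "\<epsilon> \<in> carrier E" "\<And>s. s \<in> ann c \<Longrightarrow> s \<odot>\<^bsub>E\<^esub> \<epsilon> = \<zero>\<^bsub>E\<^esub>"
    "\<And>y. \<lbrakk>y \<in> carrier E; \<And>s. s \<in> ann c \<Longrightarrow> s \<odot>\<^bsub>E\<^esub> y = \<zero>\<^bsub>E\<^esub>\<rbrakk> \<Longrightarrow> \<exists>s\<in>carrier k. y = s \<odot>\<^bsub>E\<^esub> \<epsilon>"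
    using socle_generator[OF c] by metis
  \<comment> \<open>The admissible multipliers satisfy e_c a = a, so that translates of
    \<open>\<eta>0\<close> by them still vanish on \<open>corner_rad c\<close>.\<close>
  define K where "K = {a \<in> carrier R. e c \<otimes> a = a}"
  note f0 = functD[OF \<eta>0(1)] and f = functD[OF \<eta>]
  have val: "\<exists>s\<in>carrier k. \<psi> x = s \<odot>\<^bsub>E\<^esub> \<epsilon>" if "\<psi> \<in> funct c" "x \<in> carrier R" for \<psi> x
    by (rule \<epsilon>(3)) (use functD(1)[OF that(1) that(2)] funct_ann[OF c that] in auto)
  have KR: "a \<in> carrier R" if "a \<in> K" for a using that by (simp add: K_def)
  have Kadd: "a \<oplus> \<phi> s \<otimes> b \<in> K" if "a \<in> K" "b \<in> K" "s \<in> carrier k" for a b s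
    using that c \<phi>_shift[of s "e c" b] by (simp add: K_def r_distr)
  have eadd: "\<eta>0 (x \<otimes> (a \<oplus> \<phi> s \<otimes> b)) = \<eta>0 (x \<otimes> a) \<oplus>\<^bsub>E\<^esub> s \<odot>\<^bsub>E\<^esub> \<eta>0 (x \<otimes> b)"
    if "a \<in> K" "b \<in> K" "s \<in> carrier k" "x \<in> carrier R" for a b s x
    using that KR f0(2,3) \<phi>_shift[of s x b] by (simp add: r_distr)
  let ?A = "\<lambda>W. \<forall>\<psi>\<in>funct c. \<exists>a\<in>K. \<forall>w\<in>W. \<psi> w = \<eta>0 (w \<otimes> a)"
  let ?B = "\<lambda>W. \<forall>x\<in>carrier R. x \<notin> W \<longrightarrow> (\<exists>a\<in>K. (\<forall>w\<in>W. \<eta>0 (w \<otimes> a) = \<zero>\<^bsub>E\<^esub>) \<and> \<eta>0 (x \<otimes> a) \<noteq> \<zero>\<^bsub>E\<^esub>)"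
  have rad0: "\<eta>0 (w \<otimes> a) = \<zero>\<^bsub>E\<^esub>" if "w \<in> corner_rad c" "a \<in> K" for w a
  proof -
    have w: "w \<in> carrier R" "e c \<otimes> w \<otimes> e c \<in> J" and a: "a \<in> carrier R" "e c \<otimes> a = a" using that by (auto simp: corner_rad_def K_def)
    have "e c \<otimes> (w \<otimes> a) \<otimes> e c = (e c \<otimes> w \<otimes> e c) \<otimes> (a \<otimes> e c)"
      using w(1) a(1) c by (subst a(2)[symmetric]) (simp only: m_assoc e_closed m_closed)
    also have "\<dots> \<in> J" using J_D(5)[OF w(2)] a c by simp
    finally show ?thesis using f0(4) f0(5)[of "w \<otimes> a"] w a by simp
  qed
  have "?A (carrier kR) \<and> ?B (carrier kR)"
  proof (rule kR.fg_induct[OF fg_kR corner_rad_submodule[OF c]])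
    show "?A (corner_rad c) \<and> ?B (corner_rad c)"
    proof (intro conjI ballI impI)
      fix \<psi> assume "\<psi> \<in> funct c"
      then show "\<exists>a\<in>K. \<forall>w\<in>corner_rad c. \<psi> w = \<eta>0 (w \<otimes> a)"
        using funct_corner_rad rad0 c by (intro bexI[of _ "e c"]) (auto simp: K_def)
    next
      fix x assume x: "x \<in> carrier R" "x \<notin> corner_rad c"
      then obtain y where y: "y \<in> carrier R" "e c \<otimes> y = y" "e c \<otimes> x \<otimes> y = e c"
        using diag_unit[of x c] c by (auto simp: corner_rad_def)
      \<comment> \<open>y inverts x in the corner, so the multiplier y x1 moves x to an element with
        the same corner as x1, where \<open>\<eta>0\<close> does not vanish.\<close>
      let ?a = "y \<otimes> x1"
      have a: "?a \<in> K" using y \<eta>0 c by (simp add: K_def m_assoc[symmetric])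
      have "e c \<otimes> (x \<otimes> ?a) \<otimes> e c = (e c \<otimes> x \<otimes> y) \<otimes> x1 \<otimes> e c"
        using y(1) x(1) \<eta>0(2) c by (simp only: m_assoc e_closed m_closed)
      then have "\<eta>0 (x \<otimes> ?a) = \<eta>0 x1" using f0(5)[of "x \<otimes> ?a"] f0(5)[of x1] y(1,3) x(1) \<eta>0(2) by simp
      then show "\<exists>a\<in>K. (\<forall>w\<in>corner_rad c. \<eta>0 (w \<otimes> a) = \<zero>\<^bsub>E\<^esub>) \<and> \<eta>0 (x \<otimes> a) \<noteq> \<zero>\<^bsub>E\<^esub>"
        using rad0 a \<eta>0 by (intro bexI[of _ ?a]) auto
    qed
    fix W b
    assume W: "submodule W k kR" "corner_rad c \<subseteq> W" "?A W \<and> ?B W" "b \<in> carrier kR"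
    then have A: "\<And>\<psi>. \<psi> \<in> funct c \<Longrightarrow> \<exists>a\<in>K. \<forall>w\<in>W. \<psi> w = \<eta>0 (w \<otimes> a)"
      and B: "\<And>x. x \<in> carrier R \<Longrightarrow> x \<notin> W \<Longrightarrow> \<exists>a\<in>K. (\<forall>w\<in>W. \<eta>0 (w \<otimes> a) = \<zero>\<^bsub>E\<^esub>) \<and> \<eta>0 (x \<otimes> a) \<noteq> \<zero>\<^bsub>E\<^esub>"
      and b: "b \<in> carrier R" by (auto simp: kR_simps)
    note DW = kR.submoduleD[OF W(1), unfolded kR_simps]
    show "\<exists>V. submodule V k kR \<and> W \<subseteq> V \<and> b \<in> V \<and> ?A V \<and> ?B V"
    proof (cases "b \<in> W")
      case True then show ?thesis using W by blast
    next
      case False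
      \<comment> \<open>A separating multiplier for b, rescaled so that its value at b is exactly
        the socle generator: the scalar s of the original value is invertible modulo
        \<open>ann c\<close>. So a1 plays the role of a dual basis vector to b modulo W.\<close>
      obtain a1 where a1: "a1 \<in> K" "\<And>w. w \<in> W \<Longrightarrow> \<eta>0 (w \<otimes> a1) = \<zero>\<^bsub>E\<^esub>" "\<eta>0 (b \<otimes> a1) = \<epsilon>"
      proof -
        obtain a where a: "a \<in> K" "\<forall>w\<in>W. \<eta>0 (w \<otimes> a) = \<zero>\<^bsub>E\<^esub>" "\<eta>0 (b \<otimes> a) \<noteq> \<zero>\<^bsub>E\<^esub>" using B[OF b False] by blast
        obtain s where s: "s \<in> carrier k" "\<eta>0 (b \<otimes> a) = s \<odot>\<^bsub>E\<^esub> \<epsilon>" using val[OF \<eta>0(1), of "b \<otimes> a"] b KR[OF a(1)] by auto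
        then have "s \<notin> ann c" using \<epsilon>(2) a(3) by auto
        then obtain x where x: "x \<in> carrier k" "\<one>\<^bsub>k\<^esub> \<ominus>\<^bsub>k\<^esub> x \<otimes>\<^bsub>k\<^esub> s \<in> ann c" using k_unit_ann[OF c s(1)] by blast
        have "\<zero>\<^bsub>E\<^esub> = (\<one>\<^bsub>k\<^esub> \<ominus>\<^bsub>k\<^esub> x \<otimes>\<^bsub>k\<^esub> s) \<odot>\<^bsub>E\<^esub> \<epsilon>" using \<epsilon>(2) x(2) by simp
        also have "\<dots> = \<epsilon> \<ominus>\<^bsub>E\<^esub> x \<odot>\<^bsub>E\<^esub> (s \<odot>\<^bsub>E\<^esub> \<epsilon>)"
          using x(1) s(1) \<epsilon>(1) by (simp add: a_minus_def E.smult_l_distr E.smult_l_minus E.smult_assoc1)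
        finally have "\<epsilon> \<ominus>\<^bsub>E\<^esub> x \<odot>\<^bsub>E\<^esub> (s \<odot>\<^bsub>E\<^esub> \<epsilon>) \<oplus>\<^bsub>E\<^esub> x \<odot>\<^bsub>E\<^esub> (s \<odot>\<^bsub>E\<^esub> \<epsilon>) = x \<odot>\<^bsub>E\<^esub> (s \<odot>\<^bsub>E\<^esub> \<epsilon>)"
          using x(1) s(1) \<epsilon>(1) by simp
        then have e: "\<epsilon> = x \<odot>\<^bsub>E\<^esub> (s \<odot>\<^bsub>E\<^esub> \<epsilon>)" using x(1) s(1) \<epsilon>(1) by (simp add: a_minus_def E.M.a_assoc E.M.l_neg)
        have ev: "\<eta>0 (w \<otimes> (\<phi> x \<otimes> a)) = x \<odot>\<^bsub>E\<^esub> \<eta>0 (w \<otimes> a)" if "w \<in> carrier R" for w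
          using that x(1) KR[OF a(1)] \<phi>_shift[of x w a] f0(3) by simp
        show ?thesis
        proof (rule that[of "\<phi> x \<otimes> a"])
          show "\<phi> x \<otimes> a \<in> K" using a(1) x(1) c \<phi>_shift[of x "e c" a] by (simp add: K_def)
          show "\<eta>0 (w \<otimes> (\<phi> x \<otimes> a)) = \<zero>\<^bsub>E\<^esub>" if "w \<in> W" for w using ev[OF DW(3)[OF that]] a(2) that x(1) by simp
          show "\<eta>0 (b \<otimes> (\<phi> x \<otimes> a)) = \<epsilon>" using ev[OF b] s(2) e by simp
        qed
      qed
      let ?V = "kR.adjoin W b"
      have V: "submodule ?V k kR" "W \<subseteq> ?V" "b \<in> ?V"
        using kR.submodule_adjoin[OF W(1)] kR.adjoin_subset[OF W(1)] W(4) by auto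
      have Vmem: "\<exists>w\<in>W. \<exists>s\<in>carrier k. v = w \<oplus> \<phi> s \<otimes> b" if "v \<in> ?V" for v
        using that by (auto simp: kR.adjoin_def kR_simps)
      have split: "\<psi> (w \<oplus> \<phi> s \<otimes> b) = \<psi> w \<oplus>\<^bsub>E\<^esub> s \<odot>\<^bsub>E\<^esub> \<psi> b" if "\<psi> \<in> funct c" "w \<in> W" "s \<in> carrier k" for \<psi> w s
        using functD(2,3)[OF that(1)] DW(3)[OF that(2)] that(3) b by simp
      have split0: "\<eta>0 ((w \<oplus> \<phi> s \<otimes> b) \<otimes> a) = \<eta>0 (w \<otimes> a) \<oplus>\<^bsub>E\<^esub> s \<odot>\<^bsub>E\<^esub> \<eta>0 (b \<otimes> a)"
        if "a \<in> K" "w \<in> W" "s \<in> carrier k" for a w s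
        using f0(2,3) DW(3)[OF that(2)] that(3) b KR[OF that(1)] by (simp add: l_distr m_assoc)
      have "?A ?V"
      proof
        fix \<psi> assume \<psi>: "\<psi> \<in> funct c"
        obtain a0 where a0: "a0 \<in> K" "\<And>w. w \<in> W \<Longrightarrow> \<psi> w = \<eta>0 (w \<otimes> a0)" using A[OF \<psi>] by blast
        obtain s where s: "s \<in> carrier k" "\<psi> b = s \<odot>\<^bsub>E\<^esub> \<epsilon>" using val[OF \<psi> b] by blast
        obtain s' where s': "s' \<in> carrier k" "\<eta>0 (b \<otimes> a0) = s' \<odot>\<^bsub>E\<^esub> \<epsilon>" using val[OF \<eta>0(1), of "b \<otimes> a0"] b KR[OF a0(1)] by auto
        \<comment> \<open>a0 interpolates on W; a multiple of a1 corrects the value at b without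
          changing anything on W.\<close>
        let ?t = "s \<ominus>\<^bsub>k\<^esub> s'" and ?a = "a0 \<oplus> \<phi> (s \<ominus>\<^bsub>k\<^esub> s') \<otimes> a1"
        have t: "?t \<in> carrier k" using s s' by simp
        have a: "?a \<in> K" by (rule Kadd[OF a0(1) a1(1) t])
        have on_W: "\<eta>0 (w \<otimes> ?a) = \<psi> w" if "w \<in> W" for w
          using eadd[OF a0(1) a1(1) t DW(3)[OF that]] a1(2)[OF that] a0(2)[OF that] t
            functD(1)[OF \<psi> DW(3)[OF that]] by simp
        have "s' \<oplus>\<^bsub>k\<^esub> (s \<ominus>\<^bsub>k\<^esub> s') = s" using s(1) s'(1) k.a_lcomm[of s' s "\<ominus>\<^bsub>k\<^esub> s'"] by (simp add: a_minus_def k.r_neg)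
        then have "s' \<odot>\<^bsub>E\<^esub> \<epsilon> \<oplus>\<^bsub>E\<^esub> (s \<ominus>\<^bsub>k\<^esub> s') \<odot>\<^bsub>E\<^esub> \<epsilon> = s \<odot>\<^bsub>E\<^esub> \<epsilon>"
          using E.smult_l_distr[OF s'(1) t \<epsilon>(1)] by simp
        then have on_b: "\<eta>0 (b \<otimes> ?a) = \<psi> b"
          using eadd[OF a0(1) a1(1) t b] a1(3) s s' by simp
        have "\<psi> v = \<eta>0 (v \<otimes> ?a)" if v: "v \<in> ?V" for v
        proof -
          obtain w s where "w \<in> W" "s \<in> carrier k" "v = w \<oplus> \<phi> s \<otimes> b" using Vmem[OF v] by blast
          then show ?thesis using split[OF \<psi>] split0[OF a] on_W on_b by simp
        qed
        then show "\<exists>a\<in>K. \<forall>w\<in>?V. \<psi> w = \<eta>0 (w \<otimes> a)" using a by blast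
      qed
      moreover have "?B ?V"
      proof (intro ballI impI)
        fix x assume x: "x \<in> carrier R" "x \<notin> ?V"
        obtain t where t: "t \<in> carrier k" "\<eta>0 (x \<otimes> a1) = t \<odot>\<^bsub>E\<^esub> \<epsilon>" using val[OF \<eta>0(1), of "x \<otimes> a1"] x KR[OF a1(1)] by auto
        \<comment> \<open>Subtracting t b makes the pairing with a1 zero and leaves the element
          outside W. Let a2 separate it from W; then a2 - u a1 vanishes on W and at b, and its value
          at x equals that of a2 at x - t b, because t u = u t.\<close>
        let ?x = "x \<ominus> \<phi> t \<otimes> b"
        have xR: "?x \<in> carrier R" using x t b by simp
        have "?x \<notin> W"
        proof
          assume "?x \<in> W"
          then have "?x \<oplus> \<phi> t \<otimes> b \<in> ?V" using t by (auto simp: kR.adjoin_def kR_simps)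
          then show False using x t b diff_add_cancel[of x "\<phi> t \<otimes> b"] by simp
        qed
        then obtain a2 where a2: "a2 \<in> K" "\<And>w. w \<in> W \<Longrightarrow> \<eta>0 (w \<otimes> a2) = \<zero>\<^bsub>E\<^esub>" "\<eta>0 (?x \<otimes> a2) \<noteq> \<zero>\<^bsub>E\<^esub>" using B[OF xR] by blast
        obtain u where u: "u \<in> carrier k" "\<eta>0 (b \<otimes> a2) = u \<odot>\<^bsub>E\<^esub> \<epsilon>" using val[OF \<eta>0(1), of "b \<otimes> a2"] b KR[OF a2(1)] by auto
        let ?a = "a2 \<oplus> \<phi> (\<ominus>\<^bsub>k\<^esub> u) \<otimes> a1"
        have u': "\<ominus>\<^bsub>k\<^esub> u \<in> carrier k" using u by simp
        have a: "?a \<in> K" by (rule Kadd[OF a2(1) a1(1) u'])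
        note ea = eadd[OF a2(1) a1(1) u']
        have on_W: "\<eta>0 (w \<otimes> ?a) = \<zero>\<^bsub>E\<^esub>" if "w \<in> W" for w
          using ea[OF DW(3)[OF that]] a1(2)[OF that] a2(2)[OF that] u' by simp
        have on_b: "\<eta>0 (b \<otimes> ?a) = \<zero>\<^bsub>E\<^esub>"
          using ea[OF b] a1(3) u \<epsilon>(1) by (simp add: E.smult_l_minus E.M.r_neg)
        have "\<eta>0 v' = \<zero>\<^bsub>E\<^esub>" if "v \<in> ?V" "v' = v \<otimes> ?a" for v v'
        proof -
          obtain w s where "w \<in> W" "s \<in> carrier k" "v = w \<oplus> \<phi> s \<otimes> b" using Vmem[OF \<open>v \<in> ?V\<close>] by blast
          then show ?thesis using split0[OF a] on_W on_b that(2) by simp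
        qed
        moreover have "\<eta>0 (x \<otimes> ?a) = \<eta>0 (?x \<otimes> a2)"
        proof -
          have "\<eta>0 (?x \<otimes> a2) = \<eta>0 (x \<otimes> a2) \<oplus>\<^bsub>E\<^esub> (\<ominus>\<^bsub>k\<^esub> t) \<odot>\<^bsub>E\<^esub> \<eta>0 (b \<otimes> a2)"
          proof -
            have "?x \<otimes> a2 = x \<otimes> a2 \<oplus> \<phi> (\<ominus>\<^bsub>k\<^esub> t) \<otimes> (b \<otimes> a2)"
              using x(1) t(1) b KR[OF a2(1)] by (simp add: a_minus_def l_distr l_minus m_assoc)
            then show ?thesis using f0(2,3) x(1) t(1) b KR[OF a2(1)] by (simp del: \<phi>_minus)
          qed
          also have "(\<ominus>\<^bsub>k\<^esub> t) \<odot>\<^bsub>E\<^esub> \<eta>0 (b \<otimes> a2) = (\<ominus>\<^bsub>k\<^esub> u) \<odot>\<^bsub>E\<^esub> \<eta>0 (x \<otimes> a1)"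
          proof -
            have "(\<ominus>\<^bsub>k\<^esub> t) \<otimes>\<^bsub>k\<^esub> u = (\<ominus>\<^bsub>k\<^esub> u) \<otimes>\<^bsub>k\<^esub> t" using u(1) t(1) k.l_minus[of t u] k.l_minus[of u t] k.m_comm[of t u] by simp
            then show ?thesis
              using u t \<epsilon>(1) E.smult_assoc1[of "\<ominus>\<^bsub>k\<^esub> t" u \<epsilon>] E.smult_assoc1[of "\<ominus>\<^bsub>k\<^esub> u" t \<epsilon>] by simp
          qed
          finally show ?thesis using ea[OF x(1)] by simp
        qed
        ultimately show "\<exists>a\<in>K. (\<forall>w\<in>?V. \<eta>0 (w \<otimes> a) = \<zero>\<^bsub>E\<^esub>) \<and> \<eta>0 (x \<otimes> a) \<noteq> \<zero>\<^bsub>E\<^esub>" using a a2(3) by (intro bexI[OF _ a]) auto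
      qed
      ultimately show ?thesis using V by blast
    qed
  qed
  then obtain a where "a \<in> K" "\<forall>w\<in>carrier R. \<eta> w = \<eta>0 (w \<otimes> a)" using \<eta> by (auto simp: kR_simps)
  then show ?thesis using KR by blast
qed

end

text \<open>For projective P this is J P, as a dual basis shows. The description by functionals
  spares sums of products and is what the evaluation of Hom(P, R) needs.\<close>

definition (in nak_ring) rad_of :: "('a, 'x) module \<Rightarrow> 'x set" where
  "rad_of P = {x \<in> carrier P. \<forall>g\<in>mod_hom R P (regular_module R). g x \<in> J}"

context nak_ring
begin

lemma reg: "left_module R (regular_module R)"
  by (rule left_module_regular[OF ring_axioms])

lemma cover_kernel_rad:
  assumes cov: "projective_cover R P p M"
  shows "a_kernel P M p \<subseteq> rad_of P"
proof
  have lP: "left_module R P" and lM: "left_module R M" and p: "p \<in> mod_hom R P M"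
    and sf: "superfluous R P (a_kernel P M p)"
    using cov by (simp_all add: projective_cover_def projective_module_def fg_module_def)
  interpret P: nak_module R N e J P by (intro nak_module.intro nak_ring_axioms lP)
  note K = P.submoduleD[OF submodule_kernel[OF lP lM p]]
  fix x assume x: "x \<in> a_kernel P M p"
  have "g x \<in> J" if g: "g \<in> mod_hom R P (regular_module R)" for g
  proof (rule ccontr)
    assume n: "g x \<notin> J"
    note h = mod_homD[OF g, simplified]
    have gx: "g x \<in> carrier R" using h(1) K(3)[OF x] by simp
    obtain i where i: "i < N" "e i \<otimes> g x \<notin> J" using not_J_left[OF gx n] by blast
    obtain y where y: "y \<in> carrier R" "y \<otimes> e i = y" "e i \<otimes> g x \<otimes> y = e i" using right_unit[OF gx i] by blast
    define x' where "x' = e i \<odot>\<^bsub>P\<^esub> x"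
    have x': "x' \<in> a_kernel P M p" using K(5) i x by (simp add: x'_def)
    define \<psi> where "\<psi> z = g z \<otimes> y" for z
    have \<psi>: "\<psi> \<in> mod_hom R P (regular_module R)"
      unfolding \<psi>_def using h y by (intro mod_homI) (auto simp: l_distr m_assoc)
    have \<psi>x: "\<psi> x' = e i" using h(3)[of "e i" x] K(3)[OF x] i y by (simp add: \<psi>_def x'_def)
    note h\<psi> = mod_homD[OF \<psi>, simplified]
    have \<psi>e: "\<psi> z \<otimes> e i = \<psi> z" if "z \<in> carrier P" for z
      using that h(1) y i by (simp add: \<psi>_def m_assoc)
    have "a_kernel P (regular_module R) \<psi> = carrier P"
    proof (rule superfluousD[OF sf lP submodule_kernel[OF lP reg \<psi>]])
      fix z assume z: "z \<in> carrier P"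
      let ?w = "\<psi> z \<odot>\<^bsub>P\<^esub> x'"
      have w: "?w \<in> a_kernel P M p" "?w \<in> carrier P" using K(3,5) x' h\<psi>(1) z by auto
      have "\<psi> ?w = \<psi> z" using h\<psi>(3)[of "\<psi> z" x'] h\<psi>(1)[OF z] K(3)[OF x'] \<psi>x \<psi>e[OF z] by simp
      then have "\<psi> (z \<ominus>\<^bsub>P\<^esub> ?w) = \<zero>"
        using mod_hom_diff[OF lP reg \<psi> z w(2)] h\<psi>(1)[OF z] by (simp add: a_minus_def r_neg)
      then have "z \<ominus>\<^bsub>P\<^esub> ?w \<in> a_kernel P (regular_module R) \<psi>" using z w by (simp add: a_kernel_eq)
      moreover have "z = ?w \<oplus>\<^bsub>P\<^esub> (z \<ominus>\<^bsub>P\<^esub> ?w)" using z w(2) by (simp add: a_minus_def P.M.a_lcomm P.M.r_neg)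
      ultimately show "\<exists>k\<in>a_kernel P M p. \<exists>x\<in>a_kernel P (regular_module R) \<psi>. z = k \<oplus>\<^bsub>P\<^esub> x" using w by blast
    qed
    then have "\<psi> x' = \<zero>" using K(3)[OF x'] by (auto simp: a_kernel_eq)
    then show False using \<psi>x e_ne_0 i by simp
  qed
  then show "x \<in> rad_of P" using K(3)[OF x] by (simp add: rad_of_def)
qed

text \<open>In a dual basis x has coefficients in J, and J annihilates the image of h.\<close>

lemma rad_kill:
  fixes P :: "'a fg_mod"
  assumes P: "projective_module R P" and x: "x \<in> rad_of P" and X: "left_module R X"
    and h: "h \<in> mod_hom R P X" and J0: "\<And>j z. \<lbrakk>j \<in> J; z \<in> carrier P\<rbrakk> \<Longrightarrow> j \<odot>\<^bsub>X\<^esub> h z = \<zero>\<^bsub>X\<^esub>"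
  shows "h x = \<zero>\<^bsub>X\<^esub>"
proof -
  have lP: "left_module R P" using P by (auto simp: projective_module_def fg_module_def)
  interpret P: left_module R P by (rule lP)
  interpret X: left_module R X by (rule X)
  have xP: "x \<in> carrier P" using x by (simp add: rad_of_def)
  obtain K :: "nat set" and b \<psi> where K: "finite K" "\<And>k. k \<in> K \<Longrightarrow> b k \<in> carrier P"
    "\<And>k. k \<in> K \<Longrightarrow> \<psi> k \<in> mod_hom R P (regular_module R)"
    "\<And>x. x \<in> carrier P \<Longrightarrow> x = (\<Oplus>\<^bsub>P\<^esub>k\<in>K. \<psi> k x \<odot>\<^bsub>P\<^esub> b k)"
    using projective_dual_basis[OF P] by blast
  have \<psi>J: "\<psi> k x \<in> J" if "k \<in> K" for k using x K(3)[OF that] by (simp add: rad_of_def)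
  have "h x = h (\<Oplus>\<^bsub>P\<^esub>k\<in>K. \<psi> k x \<odot>\<^bsub>P\<^esub> b k)" by (rule arg_cong[OF K(4)[OF xP]])
  also have "\<dots> = (\<Oplus>\<^bsub>X\<^esub>k\<in>K. h (\<psi> k x \<odot>\<^bsub>P\<^esub> b k))"
    using \<psi>J J_D(1) K(2) by (intro mod_hom_finsum[OF lP X h]) auto
  also have "\<dots> = \<zero>\<^bsub>X\<^esub>"
    using \<psi>J J_D(1) K(2) J0 mod_homD(3)[OF h] by (intro X.M.add.finprod_one_eqI) auto
  finally show ?thesis .
qed

lemma J_rad:
  fixes P :: "'a fg_mod"
  assumes P: "projective_module R P" and x: "x \<in> rad_of P" and j: "j \<in> J"
  shows "j \<odot>\<^bsub>P\<^esub> x = \<zero>\<^bsub>P\<^esub>"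
proof -
  have lP: "left_module R P" using P by (auto simp: projective_module_def fg_module_def)
  interpret P: left_module R P by (rule lP)
  have xP: "x \<in> carrier P" using x by (simp add: rad_of_def)
  obtain K :: "nat set" and b \<psi> where K: "finite K" "\<And>k. k \<in> K \<Longrightarrow> b k \<in> carrier P"
    "\<And>k. k \<in> K \<Longrightarrow> \<psi> k \<in> mod_hom R P (regular_module R)"
    "\<And>x. x \<in> carrier P \<Longrightarrow> x = (\<Oplus>\<^bsub>P\<^esub>k\<in>K. \<psi> k x \<odot>\<^bsub>P\<^esub> b k)"
    using projective_dual_basis[OF P] by blast
  have \<psi>J: "\<psi> k x \<in> J" if "k \<in> K" for k using x K(3)[OF that] by (simp add: rad_of_def)
  have jR: "j \<in> carrier R" using j J_D(1) by simp
  have "j \<odot>\<^bsub>P\<^esub> x = j \<odot>\<^bsub>P\<^esub> (\<Oplus>\<^bsub>P\<^esub>k\<in>K. \<psi> k x \<odot>\<^bsub>P\<^esub> b k)" by (rule arg_cong[OF K(4)[OF xP]])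
  also have "\<dots> = (\<Oplus>\<^bsub>P\<^esub>k\<in>K. j \<odot>\<^bsub>P\<^esub> (\<psi> k x \<odot>\<^bsub>P\<^esub> b k))"
    using \<psi>J J_D(1) K(2) jR by (intro P.finsum_smult_r) auto
  also have "\<dots> = \<zero>\<^bsub>P\<^esub>"
    using \<psi>J J_D(1) K(2) jR JJ[OF j \<psi>J]
    by (intro P.M.add.finprod_one_eqI) (auto simp: P.smult_assoc1[symmetric])
  finally show ?thesis .
qed

text \<open>Some functional has a value outside J at x; multiplying it on the right by a corner
  inverse normalises this value to e_c.\<close>

lemma lift_idem:
  assumes lP: "left_module R P" and x: "x \<in> carrier P" "x \<notin> rad_of P" and c: "c < N" "e c \<odot>\<^bsub>P\<^esub> x = x"
  shows "\<exists>g\<in>mod_hom R P (regular_module R). g x = e c"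
proof -
  obtain g where g: "g \<in> mod_hom R P (regular_module R)" "g x \<notin> J" using x by (auto simp: rad_of_def)
  note h = mod_homD[OF g(1), simplified]
  have ex: "e c \<otimes> g x = g x" using h(3)[of "e c" x] c x by simp
  then obtain y where y: "y \<in> carrier R" "e c \<otimes> g x \<otimes> y = e c" using right_unit[of "g x" c] h(1) x c g(2) by auto
  have "(\<lambda>z. g z \<otimes> y) \<in> mod_hom R P (regular_module R)"
    using h y by (intro mod_homI) (auto simp: l_distr m_assoc)
  then show ?thesis using y(2) ex by auto
qed

lemma mult_nonzero:
  assumes lP: "left_module R P" and x: "x \<in> carrier P" "x \<notin> rad_of P" and c: "c < N" "e c \<odot>\<^bsub>P\<^esub> x = x"
    and u: "u \<in> carrier R" "u \<otimes> e c \<noteq> \<zero>"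
  shows "u \<odot>\<^bsub>P\<^esub> x \<noteq> \<zero>\<^bsub>P\<^esub>"
proof
  assume "u \<odot>\<^bsub>P\<^esub> x = \<zero>\<^bsub>P\<^esub>"
  moreover obtain g where g: "g \<in> mod_hom R P (regular_module R)" "g x = e c" using lift_idem[OF lP x c] by blast
  ultimately show False using mod_homD(3)[OF g(1) u(1) x(1)] mod_hom_zero[OF lP reg g(1)] u(2) by simp
qed

end

section \<open>Minimal presentations and the idempotent components of the translate\<close>

lemma (in idem_module) simple_element:
  assumes y: "y \<in> carrier M" "y \<noteq> \<zero>\<^bsub>M\<^esub>" "c < N" "e c \<odot>\<^bsub>M\<^esub> y = y" and J0: "\<And>j. j \<in> J \<Longrightarrow> j \<odot>\<^bsub>M\<^esub> y = \<zero>\<^bsub>M\<^esub>"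
  shows "cyclic_gen R (e c) J (sub_mod M ((\<lambda>a. a \<odot>\<^bsub>M\<^esub> y) ` carrier R)) y"
proof -
  note X = cyclic_submodule[OF y(1)]
  have "l \<odot>\<^bsub>M\<^esub> y = \<zero>\<^bsub>M\<^esub> \<longleftrightarrow> l \<otimes> e c \<in> J" if l: "l \<in> carrier R" for l
  proof
    show "l \<otimes> e c \<in> J" if "l \<odot>\<^bsub>M\<^esub> y = \<zero>\<^bsub>M\<^esub>"
      using mem_or_J[OF submodule_zero y(1,3,4) _ l] that y(2) by auto
    have "(l \<otimes> e c) \<odot>\<^bsub>M\<^esub> y = l \<odot>\<^bsub>M\<^esub> y" using y l by (simp add: smult_assoc1)
    then show "l \<odot>\<^bsub>M\<^esub> y = \<zero>\<^bsub>M\<^esub>" if "l \<otimes> e c \<in> J" using J0[OF that] by simp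
  qed
  then show ?thesis
    unfolding cyclic_gen_def using left_module_sub_mod[OF X] y by (auto intro!: image_eqI[of _ _ \<one>])
qed

text \<open>An arbitrary minimal presentation of M together with a module Y paired with Hom(P1, R)
  modulo boundaries. Nothing refers to how the presentation was chosen, so uniqueness up to
  isomorphism is never called upon.\<close>

locale nak_presentation = nak_algebra R N e J k \<phi> E \<iota> + M: left_module R M + pairing k \<phi> E R P1 d P0 Y ev
  for R :: "('a, 'm) ring_scheme" (structure) and N e J and k :: "('k, 'l) ring_scheme" and \<phi>
    and E :: "('k, 'e) module" and \<iota> :: "'k set \<Rightarrow> 'e" and M :: "('a, 'b) module"
    and P1 :: "'a fg_mod" and d and P0 :: "'a fg_mod" and p and Y :: "('a, 'y) module" and ev +
  assumes pres: "minimal_projective_presentation R P1 d P0 p M"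
begin

abbreviation "H \<equiv> mod_hom R P1 (regular_module R)"
abbreviation "\<Omega> \<equiv> a_kernel P0 M p"

lemma P0: "projective_module R P0" "left_module R P0" "fg_module R P0"
  and p: "p \<in> mod_hom R P0 M" "p ` carrier P0 = carrier M" "superfluous R P0 \<Omega>"
  and P1: "projective_module R P1" "left_module R P1"
  and d: "d \<in> mod_hom R P1 (sub_mod P0 \<Omega>)" "d ` carrier P1 = \<Omega>"
proof -
  have pr: "projective_module R P0" "projective_module R P1"
    using pres by (auto simp: minimal_projective_presentation_def projective_cover_def)
  have fg: "fg_module R P" "left_module R P" if "projective_module R P" for P :: "'a fg_mod"
    using that by (simp_all add: projective_module_def fg_module_def)
  show "projective_module R P0" "left_module R P0" "fg_module R P0" "projective_module R P1" "left_module R P1"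
    using pr fg by auto
  show "p \<in> mod_hom R P0 M" "p ` carrier P0 = carrier M" "superfluous R P0 \<Omega>"
    "d \<in> mod_hom R P1 (sub_mod P0 \<Omega>)" "d ` carrier P1 = \<Omega>"
    using pres by (auto simp: minimal_projective_presentation_def projective_cover_def)
qed

sublocale Y: idem_module R N e J Y
  by (intro idem_module.intro idem_ring_axioms Y_module)
sublocale P0: nak_module R N e J P0
  by (intro nak_module.intro nak_ring_axioms P0)
sublocale P1: left_module R P1 by (rule P1)

lemma \<Omega>_sub: "submodule \<Omega> R P0"
  by (rule submodule_kernel[OF P0(2) M.left_module_axioms p(1)])

lemma d_hom: "d \<in> mod_hom R P1 P0"
  using d(1) P0.submoduleD(3)[OF \<Omega>_sub] by (auto simp: mod_hom_def)

lemma \<Omega>_rad: "\<Omega> \<subseteq> rad_of P0"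
  by (rule cover_kernel_rad) (use pres in \<open>simp add: minimal_projective_presentation_def\<close>)

lemma d_\<Omega>: "x \<in> carrier P1 \<Longrightarrow> d x \<in> \<Omega>"
  using d(2) by blast

lemma ker_d: "\<lbrakk>x \<in> carrier P1; d x = \<zero>\<^bsub>P0\<^esub>\<rbrakk> \<Longrightarrow> x \<in> rad_of P1"
proof -
  have "a_kernel P1 (sub_mod P0 \<Omega>) d \<subseteq> rad_of P1"
    by (rule cover_kernel_rad) (use pres in \<open>simp add: minimal_projective_presentation_def\<close>)
  then show "\<lbrakk>x \<in> carrier P1; d x = \<zero>\<^bsub>P0\<^esub>\<rbrakk> \<Longrightarrow> x \<in> rad_of P1" by (auto simp: a_kernel_eq)
qed

text \<open>The image of d is the syzygy, which lies in rad P0 and is killed by J. With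
  \<open>ker_d\<close> this identifies the kernel of d with rad P1, so the syzygy is the top of
  P1.\<close>

lemma d_rad: "x \<in> rad_of P1 \<Longrightarrow> d x = \<zero>\<^bsub>P0\<^esub>"
  by (rule rad_kill[OF P1(1) _ P0(2) d_hom]) (use J_rad[OF P0(1)] d_\<Omega> \<Omega>_rad in auto)

lemma ev_zero_fun: "y \<in> carrier Y \<Longrightarrow> ev y (\<lambda>_. \<zero>) = \<zero>\<^bsub>E\<^esub>"
  using ev_boundary[of y "\<lambda>_. \<zero>"] by (auto simp: mod_hom_def)

lemma H_mult: "\<lbrakk>g \<in> H; a \<in> carrier R\<rbrakk> \<Longrightarrow> (\<lambda>x. g x \<otimes> a) \<in> H"
  using mod_homD[of g R P1 "regular_module R"] by (intro mod_homI) (auto simp: l_distr m_assoc)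

lemma H_add: "\<lbrakk>g \<in> H; h \<in> H\<rbrakk> \<Longrightarrow> (\<lambda>x. g x \<oplus> h x) \<in> H"
  using mod_homD[of g R P1 "regular_module R"] mod_homD[of h R P1 "regular_module R"]
  by (intro mod_homI) (auto simp: r_distr a_ac)

text \<open>
  A map into the radical extends from \<open>\<Omega>\<close> to \<open>P0\<close>, since the summands of \<open>R\<close> with nonzero radical
  are injective; so it is a boundary.
\<close>

lemma ev_radical:
  assumes y: "y \<in> carrier Y" and g: "g \<in> H" and gJ: "\<And>x. x \<in> carrier P1 \<Longrightarrow> g x \<in> J"
  shows "ev y g = \<zero>\<^bsub>E\<^esub>"
proof -
  have one: "ev y h = \<zero>\<^bsub>E\<^esub>"
    if l: "l < N" and h: "h \<in> H" "\<And>x. x \<in> carrier P1 \<Longrightarrow> h x \<in> J" "\<And>x. x \<in> carrier P1 \<Longrightarrow> h x \<otimes> e l = h x" for l h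
  proof (cases "good l")
    case False
    then have "h x = \<zero>" if "x \<in> carrier P1" for x using not_goodD[OF False h(2)[OF that]] h(3)[OF that] by simp
    then have "ev y h = ev y (\<lambda>_. \<zero>)" by (rule ev_cong)
    then show ?thesis using ev_zero_fun[OF y] by simp
  next
    case True
    then obtain v where v: "v \<in> J" "v \<otimes> e l \<noteq> \<zero>" by (auto simp: good_def)
    note hh = mod_homD[OF h(1), simplified]
    \<comment> \<open>h has values in J, which J annihilates, so h vanishes on rad P1 and in
      particular on the kernel of d. Hence h factors through d, and the factor, defined on the
      syzygy, extends to P0 by injectivity.\<close>
    have h_rad: "h x = \<zero>" if "x \<in> rad_of P1" for x
      using rad_kill[OF P1(1) that reg h(1)] h(2) JJ by auto
    have h_eq: "h x = h x'" if "x \<in> carrier P1" "x' \<in> carrier P1" "d x = d x'" for x x'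
    proof -
      have "d (x \<ominus>\<^bsub>P1\<^esub> x') = \<zero>\<^bsub>P0\<^esub>"
        using mod_hom_diff[OF P1(2) P0(2) d_hom that(1,2)] that mod_homD(1)[OF d_hom] by (simp add: a_minus_def P0.M.r_neg)
      then have "h (x \<ominus>\<^bsub>P1\<^esub> x') = \<zero>" using ker_d h_rad that by simp
      then have "h x \<ominus> h x' = \<zero>" using mod_hom_diff[OF P1(2) reg h(1) that(1,2)] by (simp add: a_minus_def)
      then show ?thesis using diff_add_cancel[of "h x" "h x'"] hh(1) that by simp
    qed
    define f where "f w = h (SOME x. x \<in> carrier P1 \<and> d x = w)" for w
    have f: "f (d x) = h x" if x: "x \<in> carrier P1" for x
    proof -
      have "(SOME z. z \<in> carrier P1 \<and> d z = d x) \<in> carrier P1 \<and> d (SOME z. z \<in> carrier P1 \<and> d z = d x) = d x"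
        using x by (intro someI[of "\<lambda>z. z \<in> carrier P1 \<and> d z = d x" x]) simp
      then show ?thesis unfolding f_def using x by (intro h_eq) (elim conjE, assumption)+
    qed
    have \<Omega>d: "\<exists>x\<in>carrier P1. w = d x" if "w \<in> \<Omega>" for w using that d(2) by blast
    have fh: "f \<in> mod_hom R (sub_mod P0 \<Omega>) (regular_module R)"
    proof (rule mod_homI)
      fix w assume "w \<in> carrier (sub_mod P0 \<Omega>)"
      then obtain x where x: "x \<in> carrier P1" "w = d x" using \<Omega>d by auto
      show "f w \<in> carrier (regular_module R)" using x f hh(1) by simp
      show "f (a \<odot>\<^bsub>sub_mod P0 \<Omega>\<^esub> w) = a \<odot>\<^bsub>regular_module R\<^esub> f w" if "a \<in> carrier R" for a
        using f[of "a \<odot>\<^bsub>P1\<^esub> x"] f[OF x(1)] x hh(3) mod_homD(3)[OF d_hom that x(1)] that by simp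
      fix w' assume "w' \<in> carrier (sub_mod P0 \<Omega>)"
      then obtain x' where x': "x' \<in> carrier P1" "w' = d x'" using \<Omega>d by auto
      show "f (w \<oplus>\<^bsub>sub_mod P0 \<Omega>\<^esub> w') = f w \<oplus>\<^bsub>regular_module R\<^esub> f w'"
        using f[of "x \<oplus>\<^bsub>P1\<^esub> x'"] f[OF x(1)] f[OF x'(1)] x x' hh(2) mod_homD(2)[OF d_hom x(1) x'(1)] by simp
    qed
    have fl: "f w \<otimes> e l = f w" if "w \<in> \<Omega>" for w using \<Omega>d[OF that] f h(3) by auto
    obtain F where F: "F \<in> mod_hom R P0 (regular_module R)" "\<forall>w\<in>\<Omega>. F w = f w"
      using P0.injective_extend[OF P0(3) l v \<Omega>_sub fh fl] by blast
    have "ev y h = ev y (\<lambda>x. F (d x))" by (rule ev_cong) (use F(2) f d_\<Omega> in auto)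
    then show ?thesis using ev_boundary[OF y F(1)] by simp
  qed
  note hg = mod_homD[OF g, simplified]
  have part: "(\<lambda>x. \<Oplus>i\<in>{..<m}. g x \<otimes> e i) \<in> H \<and> ev y (\<lambda>x. \<Oplus>i\<in>{..<m}. g x \<otimes> e i) = \<zero>\<^bsub>E\<^esub>" if "m \<le> N" for m
    using that
  proof (induction m)
    case 0
    show ?case using ev_zero_fun[OF y] by (auto simp: mod_hom_def)
  next
    case (Suc m)
    let ?s = "\<lambda>x. \<Oplus>i\<in>{..<m}. g x \<otimes> e i" and ?g = "\<lambda>x. g x \<otimes> e m"
    have m: "m < N" using Suc by simp
    have s: "?s \<in> H" "ev y ?s = \<zero>\<^bsub>E\<^esub>" using Suc by auto
    have gm: "?g \<in> H" using H_mult[OF g] m by simp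
    have eq: "(\<Oplus>i\<in>{..<Suc m}. g x \<otimes> e i) = ?g x \<oplus> ?s x" if "x \<in> carrier P1" for x
      unfolding lessThan_Suc using Suc.prems hg(1)[OF that] by (intro finsum_insert) auto
    have "ev y ?g = \<zero>\<^bsub>E\<^esub>" by (rule one[OF m gm]) (use gJ hg(1) m J_D(5) in \<open>auto simp: m_assoc\<close>)
    then have "ev y (\<lambda>x. ?g x \<oplus> ?s x) = \<zero>\<^bsub>E\<^esub>" using ev_add[OF y gm s(1)] s(2) by simp
    moreover have "ev y (\<lambda>x. \<Oplus>i\<in>{..<Suc m}. g x \<otimes> e i) = ev y (\<lambda>x. ?g x \<oplus> ?s x)" by (rule ev_cong) (rule eq)
    moreover have "(\<lambda>x. \<Oplus>i\<in>{..<Suc m}. g x \<otimes> e i) \<in> H"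
      by (rule mod_hom_cong[OF P1(2) H_add[OF gm s(1)]]) (rule eq[symmetric])
    ultimately show ?case by simp
  qed
  have "ev y g = ev y (\<lambda>x. \<Oplus>i\<in>{..<N}. g x \<otimes> e i)" by (rule ev_cong) (rule e_decomp_right, rule hg(1))
  then show ?thesis using part[of N] by simp
qed

lemma Y_zeroI: "\<lbrakk>y \<in> carrier Y; \<And>g. g \<in> H \<Longrightarrow> ev y g = \<zero>\<^bsub>E\<^esub>\<rbrakk> \<Longrightarrow> y = \<zero>\<^bsub>Y\<^esub>"
proof (rule ev_ext)
  fix g assume y: "y \<in> carrier Y" "\<And>g. g \<in> H \<Longrightarrow> ev y g = \<zero>\<^bsub>E\<^esub>" and g: "g \<in> H"
  have "ev (\<zero> \<odot>\<^bsub>Y\<^esub> \<zero>\<^bsub>Y\<^esub>) g = ev \<zero>\<^bsub>Y\<^esub> (\<lambda>x. g x \<otimes> \<zero>)" by (rule ev_smult) (use g in auto)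
  also have "\<dots> = ev \<zero>\<^bsub>Y\<^esub> (\<lambda>_. \<zero>)" by (rule ev_cong) (use mod_homD(1)[OF g] in simp)
  finally show "ev y g = ev \<zero>\<^bsub>Y\<^esub> g" using y(2)[OF g] ev_zero_fun by simp
qed auto

text \<open>Evaluating j y at g means evaluating y at the map g j, whose values lie in J.\<close>

lemma J_Y: "\<lbrakk>j \<in> J; y \<in> carrier Y\<rbrakk> \<Longrightarrow> j \<odot>\<^bsub>Y\<^esub> y = \<zero>\<^bsub>Y\<^esub>"
proof (rule Y_zeroI)
  fix g assume j: "j \<in> J" and y: "y \<in> carrier Y" and g: "g \<in> H"
  have "ev y (\<lambda>x. g x \<otimes> j) = \<zero>\<^bsub>E\<^esub>"
    by (rule ev_radical[OF y]) (use H_mult[OF g] j J_D mod_homD(1)[OF g] in auto)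
  then show "ev (j \<odot>\<^bsub>Y\<^esub> y) g = \<zero>\<^bsub>E\<^esub>" using ev_smult[OF J_D(1)[OF j] y g] by simp
qed (use J_D in auto)

text \<open>For x = x e_c all components e_l x with l different from c are radical anyway, so only
  the component at c has to be checked.\<close>

lemma corner_J:
  assumes "x \<in> carrier R" "c < N" "x \<otimes> e c = x" "e c \<otimes> x \<in> J" shows "x \<in> J"
proof (rule ccontr)
  assume "x \<notin> J"
  then obtain l where l: "l < N" "e l \<otimes> x \<notin> J" using not_J_left assms by blast
  then show False using offdiag[OF assms(1) l(1) assms(2)] assms by (cases "l = c") (auto simp: m_assoc)
qed

text \<open>d kills e_l P1 here, so e_l P1 lies in rad P1 and g e_l has radical values for every g;
  evaluating e_l y at g is evaluating y at g e_l.\<close>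

lemma Y_component_zero:
  assumes l: "l < N" and ker: "\<And>w. w \<in> \<Omega> \<Longrightarrow> e l \<odot>\<^bsub>P0\<^esub> w = \<zero>\<^bsub>P0\<^esub>" and y: "y \<in> carrier Y"
  shows "e l \<odot>\<^bsub>Y\<^esub> y = \<zero>\<^bsub>Y\<^esub>"
proof (rule Y_zeroI)
  fix g assume g: "g \<in> H"
  note hg = mod_homD[OF g, simplified]
  have "ev y (\<lambda>x. g x \<otimes> e l) = \<zero>\<^bsub>E\<^esub>"
  proof (rule ev_radical[OF y])
    fix q assume q: "q \<in> carrier P1"
    have "d (e l \<odot>\<^bsub>P1\<^esub> q) = \<zero>\<^bsub>P0\<^esub>" using mod_homD(3)[OF d_hom _ q] ker[OF d_\<Omega>[OF q]] l by simp
    then have "e l \<odot>\<^bsub>P1\<^esub> q \<in> rad_of P1" using ker_d l q by simp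
    then have "g (e l \<odot>\<^bsub>P1\<^esub> q) \<in> J" using g by (simp add: rad_of_def)
    then have "e l \<otimes> (g q \<otimes> e l) \<in> J" using hg q l J_D(5) by (simp add: m_assoc[symmetric])
    then show "g q \<otimes> e l \<in> J" using hg(1)[OF q] l by - (rule corner_J[OF _ l], simp_all add: m_assoc)
  qed (use H_mult[OF g] l in simp)
  then show "ev (e l \<odot>\<^bsub>Y\<^esub> y) g = \<zero>\<^bsub>E\<^esub>" using ev_smult[of "e l" y g] l y g by simp
qed (use l y in auto)

text \<open>The index c records which simple modules occur in the syzygy and passes unchanged to the
  translate. The element y0 is evaluation at a lift q of v followed by a functional on the division
  ring at c. If e_c times the syzygy is generated by v, then one-dimensionality of the dual makes
  e_c Y generated by y0.\<close>

lemma Y_component: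
  assumes c: "c < N" and v: "v \<in> \<Omega>" "e c \<odot>\<^bsub>P0\<^esub> v = v" "v \<noteq> \<zero>\<^bsub>P0\<^esub>"
  shows "\<exists>y0\<in>carrier Y. e c \<odot>\<^bsub>Y\<^esub> y0 = y0 \<and> y0 \<noteq> \<zero>\<^bsub>Y\<^esub> \<and>
    ((\<forall>w\<in>\<Omega>. \<exists>l\<in>carrier R. e c \<odot>\<^bsub>P0\<^esub> w = l \<odot>\<^bsub>P0\<^esub> v) \<longrightarrow> (\<forall>y\<in>carrier Y. \<exists>a\<in>carrier R. e c \<odot>\<^bsub>Y\<^esub> y = a \<odot>\<^bsub>Y\<^esub> y0))"
proof -
  obtain q0 where q0: "q0 \<in> carrier P1" "d q0 = v" using v(1) d(2) by (metis imageE)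
  define q where "q = e c \<odot>\<^bsub>P1\<^esub> q0"
  have q: "q \<in> carrier P1" "e c \<odot>\<^bsub>P1\<^esub> q = q" "d q = v"
    using q0 c v(2) mod_homD(3)[OF d_hom _ q0(1), of "e c"] by (auto simp: q_def P1.smult_assoc1[symmetric])
  have qr: "q \<notin> rad_of P1" using d_rad q(3) v(3) by auto
  obtain g1 where g1: "g1 \<in> H" "g1 q = e c" using lift_idem[OF P1(2) q(1) qr c q(2)] by blast
  obtain \<eta>0 x1 where \<eta>0: "\<eta>0 \<in> funct c" "x1 \<in> carrier R" "\<eta>0 x1 \<noteq> \<zero>\<^bsub>E\<^esub>" using funct_exists[OF c] by blast
  note f0 = functD[OF \<eta>0(1)]
  have Hq: "g q \<in> carrier R" "e c \<otimes> g q = g q" if "g \<in> H" for g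
    using mod_homD(1)[OF that q(1)] mod_homD(3)[OF that e_closed[OF c] q(1)] q(2) by simp_all
  have dqJ: "f (d q) \<in> J" if "f \<in> mod_hom R P0 (regular_module R)" for f
    using \<Omega>_rad v(1) q(3) that by (auto simp: rad_of_def)
  \<comment> \<open>Boundaries take values f(v) at q, with v in rad P0, so these values are in J and
    \<open>\<eta>0\<close> kills them; this makes g to \<open>\<eta>0 (g q)\<close> an element of
    Y.\<close>
  obtain y0 where y0: "y0 \<in> carrier Y" "\<And>g. g \<in> H \<Longrightarrow> ev y0 g = \<eta>0 (g q)"
  proof -
    have "\<exists>y\<in>carrier Y. \<forall>g\<in>H. ev y g = \<eta>0 (g q)"
      by (rule ev_construct) (use Hq f0 q dqJ \<phi>_central in auto)
    then show ?thesis using that by blast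
  qed
  have ev0: "ev (a \<odot>\<^bsub>Y\<^esub> y0) g = \<eta>0 (g q \<otimes> a)" if "a \<in> carrier R" "g \<in> H" for a g
    using ev_smult[OF that(1) y0(1) that(2)] y0(2)[OF H_mult[OF that(2,1)]] by simp
  have ey0: "e c \<odot>\<^bsub>Y\<^esub> y0 = y0"
  proof (rule ev_ext)
    fix g assume g: "g \<in> H"
    have "\<eta>0 (g q \<otimes> e c) = \<eta>0 (g q)" using f0(5)[OF Hq(1)[OF g]] Hq(2)[OF g] by simp
    then show "ev (e c \<odot>\<^bsub>Y\<^esub> y0) g = ev y0 g" using ev0[OF _ g, of "e c"] y0(2)[OF g] c by simp
  qed (use y0 c in auto)
  have y0n: "y0 \<noteq> \<zero>\<^bsub>Y\<^esub>"
  proof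
    assume y00: "y0 = \<zero>\<^bsub>Y\<^esub>"
    have "\<eta>0 (e c \<otimes> x1) = \<eta>0 x1"
      using f0(5)[of "e c \<otimes> x1"] f0(5)[OF \<eta>0(2)] c \<eta>0(2) by (simp add: m_assoc[symmetric])
    then have "ev (x1 \<odot>\<^bsub>Y\<^esub> y0) g1 = \<eta>0 x1" using ev0[OF \<eta>0(2) g1(1)] g1(2) by simp
    moreover have "x1 \<odot>\<^bsub>Y\<^esub> y0 = \<zero> \<odot>\<^bsub>Y\<^esub> y0" using y00 \<eta>0(2) by simp
    moreover have "ev (\<zero> \<odot>\<^bsub>Y\<^esub> y0) g1 = \<zero>\<^bsub>E\<^esub>" using ev0[OF _ g1(1), of \<zero>] f0(4)[of \<zero>] J_D(2) g1(2) c by simp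
    ultimately show False using \<eta>0(3) by simp
  qed
  have "\<exists>a\<in>carrier R. e c \<odot>\<^bsub>Y\<^esub> y = a \<odot>\<^bsub>Y\<^esub> y0"
    if one: "\<forall>w\<in>\<Omega>. \<exists>l\<in>carrier R. e c \<odot>\<^bsub>P0\<^esub> w = l \<odot>\<^bsub>P0\<^esub> v" and y: "y \<in> carrier Y" for y
  proof -
    have P1q: "\<exists>l\<in>carrier R. e c \<odot>\<^bsub>P1\<^esub> z \<ominus>\<^bsub>P1\<^esub> l \<odot>\<^bsub>P1\<^esub> q \<in> rad_of P1" if z: "z \<in> carrier P1" for z
    proof -
      obtain l where l: "l \<in> carrier R" "e c \<odot>\<^bsub>P0\<^esub> d z = l \<odot>\<^bsub>P0\<^esub> v" using one d_\<Omega>[OF z] by blast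
      have "d (e c \<odot>\<^bsub>P1\<^esub> z \<ominus>\<^bsub>P1\<^esub> l \<odot>\<^bsub>P1\<^esub> q) = d (e c \<odot>\<^bsub>P1\<^esub> z) \<ominus>\<^bsub>P0\<^esub> d (l \<odot>\<^bsub>P1\<^esub> q)"
        using z l c q by (intro mod_hom_diff[OF P1(2) P0(2) d_hom]) auto
      also have "\<dots> = e c \<odot>\<^bsub>P0\<^esub> d z \<ominus>\<^bsub>P0\<^esub> l \<odot>\<^bsub>P0\<^esub> v"
        using mod_homD(3)[OF d_hom _ z, of "e c"] mod_homD(3)[OF d_hom l(1) q(1)] c q(3) by simp
      also have "\<dots> = \<zero>\<^bsub>P0\<^esub>" using l mod_homD(1)[OF d_hom z] c P0.submoduleD(3)[OF \<Omega>_sub v(1)] by (simp add: a_minus_def P0.M.r_neg)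
      finally have "e c \<odot>\<^bsub>P1\<^esub> z \<ominus>\<^bsub>P1\<^esub> l \<odot>\<^bsub>P1\<^esub> q \<in> rad_of P1"
        using z l(1) c q(1) by - (rule ker_d, simp_all)
      then show ?thesis using l(1) by blast
    qed
    \<comment> \<open>y is tested only on the multiples of g1 by corner elements. This gives a
      functional in \<open>funct c\<close>, hence a translate of \<open>\<eta>0\<close> by some a,
      and a turns out to be the coefficient sought.\<close>
    define \<eta> where "\<eta> x = ev y (\<lambda>z. g1 z \<otimes> (e c \<otimes> x \<otimes> e c))" for x
    note h1 = mod_homD[OF g1(1), simplified]
    have gx: "(\<lambda>z. g1 z \<otimes> (e c \<otimes> x \<otimes> e c)) \<in> H" if "x \<in> carrier R" for x using H_mult[OF g1(1)] that c by simp
    have "\<eta> \<in> funct c"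
      unfolding funct_def
    proof (intro CollectI conjI ballI)
      fix x assume x: "x \<in> carrier R"
      show "\<eta> x \<in> carrier E" unfolding \<eta>_def by (rule ev_closed[OF y gx[OF x]])
      show "\<eta> (x \<oplus> x') = \<eta> x \<oplus>\<^bsub>E\<^esub> \<eta> x'" if x': "x' \<in> carrier R" for x'
        unfolding \<eta>_def ev_add[OF y gx[OF x] gx[OF x'], symmetric]
        by (rule ev_cong) (use x x' c h1(1) in \<open>simp add: l_distr r_distr\<close>)
      show "\<eta> (e c \<otimes> x \<otimes> e c) = \<eta> x"
      proof -
        have "e c \<otimes> (e c \<otimes> x \<otimes> e c) \<otimes> e c = (e c \<otimes> e c) \<otimes> x \<otimes> (e c \<otimes> e c)"
          using x c by (simp only: m_assoc e_closed m_closed)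
        then show ?thesis using c by (simp add: \<eta>_def)
      qed
    next
      fix s x assume s: "s \<in> carrier k" and x: "x \<in> carrier R"
      show "\<eta> (\<phi> s \<otimes> x) = s \<odot>\<^bsub>E\<^esub> \<eta> x"
        unfolding \<eta>_def ev_scale[OF y gx[OF x] s, symmetric]
      proof (rule ev_cong)
        fix z assume z: "z \<in> carrier P1"
        have "e c \<otimes> (\<phi> s \<otimes> x) \<otimes> e c = (e c \<otimes> x \<otimes> e c) \<otimes> \<phi> s"
          using \<phi>_shift[OF s _ x, of "e c"] \<phi>_central[OF s, of "e c \<otimes> x \<otimes> e c"] s x c by (simp add: m_assoc)
        then show "g1 z \<otimes> (e c \<otimes> (\<phi> s \<otimes> x) \<otimes> e c) = g1 z \<otimes> (e c \<otimes> x \<otimes> e c) \<otimes> \<phi> s"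
          using h1(1)[OF z] x c \<phi>_simps(1)[OF s] by (simp only: m_assoc e_closed m_closed)
      qed
    next
      fix x assume x: "x \<in> J"
      show "\<eta> x = \<zero>\<^bsub>E\<^esub>" unfolding \<eta>_def
        by (rule ev_radical[OF y gx]) (use x J_D h1(1) c in auto)
    qed
    then obtain a where a: "a \<in> carrier R" "\<And>x. x \<in> carrier R \<Longrightarrow> \<eta> x = \<eta>0 (x \<otimes> a)"
      using funct_generated[OF c \<eta>0] by blast
    have "e c \<odot>\<^bsub>Y\<^esub> y = a \<odot>\<^bsub>Y\<^esub> y0"
    proof (rule ev_ext)
      fix g assume g: "g \<in> H"
      note hg = mod_homD[OF g, simplified]
      let ?h = "\<lambda>z. g1 z \<otimes> (e c \<otimes> g q \<otimes> e c)"
      have hH: "?h \<in> H" by (rule gx) (rule Hq(1)[OF g])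
      have gH: "(\<lambda>z. g z \<otimes> e c) \<in> H" using H_mult[OF g] c by simp
      let ?\<delta> = "\<lambda>z. g z \<otimes> e c \<oplus> (\<ominus> \<one>) \<otimes> ?h z"
      have \<delta>_eq: "?\<delta> z = g z \<otimes> e c \<ominus> ?h z" if "z \<in> carrier P1" for z
        using that h1(1) Hq(1)[OF g] c by (simp add: a_minus_def l_minus)
      have \<delta>H: "(\<lambda>z. g z \<otimes> e c \<ominus> ?h z) \<in> H"
        using hg h1 Hq(1)[OF g] c
        by (intro mod_homI) (auto simp: a_minus_def l_distr r_distr minus_add a_ac m_assoc r_minus l_minus)
      \<comment> \<open>Modulo rad P1 the element e_c z is l q, so e_c g(z) and e_c g1(z) agree with
        l g(q) and l e_c modulo J. The l-terms cancel in the difference, and \<open>corner_J\<close>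
        removes the factor e_c. So g e_c and ?h differ by a map that y cannot see.\<close>
      have \<delta>J: "g z \<otimes> e c \<ominus> ?h z \<in> J" if z: "z \<in> carrier P1" for z
      proof -
        obtain l where l: "l \<in> carrier R" "e c \<odot>\<^bsub>P1\<^esub> z \<ominus>\<^bsub>P1\<^esub> l \<odot>\<^bsub>P1\<^esub> q \<in> rad_of P1" using P1q[OF z] by blast
        have \<psi>: "e c \<otimes> \<psi> z \<ominus> l \<otimes> \<psi> q \<in> J" if "\<psi> \<in> H" for \<psi>
        proof -
          have "\<psi> (e c \<odot>\<^bsub>P1\<^esub> z \<ominus>\<^bsub>P1\<^esub> l \<odot>\<^bsub>P1\<^esub> q) = e c \<otimes> \<psi> z \<ominus> l \<otimes> \<psi> q"
            using mod_hom_diff[OF P1(2) reg that, of "e c \<odot>\<^bsub>P1\<^esub> z" "l \<odot>\<^bsub>P1\<^esub> q"] mod_homD(3)[OF that] z l c q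
            by (simp add: a_minus_def)
          then show ?thesis using l(2) that by (auto simp: rad_of_def)
        qed
        let ?j = "e c \<otimes> g z \<ominus> l \<otimes> g q" and ?j1 = "e c \<otimes> g1 z \<ominus> l \<otimes> e c"
        have j: "?j \<in> J" "?j1 \<in> J" using \<psi>[OF g] \<psi>[OF g1(1)] g1(2) by auto
        have Rz: "g z \<in> carrier R" "g1 z \<in> carrier R" "g q \<in> carrier R" using hg(1) h1(1) z q by auto
        have "?j1 \<otimes> (e c \<otimes> g q \<otimes> e c) = e c \<otimes> g1 z \<otimes> (e c \<otimes> g q \<otimes> e c) \<ominus> l \<otimes> g q \<otimes> e c"
        proof -
          have "l \<otimes> e c \<otimes> (e c \<otimes> g q \<otimes> e c) = l \<otimes> (e c \<otimes> (e c \<otimes> g q)) \<otimes> e c"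
            using Rz l(1) c by (simp only: m_assoc e_closed m_closed)
          also have "\<dots> = l \<otimes> g q \<otimes> e c" using Hq(2)[OF g] by simp
          finally show ?thesis using Rz l(1) c by (simp add: a_minus_def l_distr l_minus)
        qed
        moreover have "?j \<otimes> e c = e c \<otimes> g z \<otimes> e c \<ominus> l \<otimes> g q \<otimes> e c"
          using Rz l(1) c by (simp add: a_minus_def l_distr l_minus)
        moreover have "(x \<ominus> w) \<ominus> (x' \<ominus> w) = x \<ominus> x'" if "x \<in> carrier R" "x' \<in> carrier R" "w \<in> carrier R" for x x' w
        proof -
          have "(x \<ominus> w) \<ominus> (x' \<ominus> w) = x \<ominus> x' \<oplus> (\<ominus> w \<oplus> w)"
            using that by (simp add: a_minus_def minus_add a_ac)
          then show ?thesis using that by (simp add: l_neg)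
        qed
        ultimately have "?j \<otimes> e c \<ominus> ?j1 \<otimes> (e c \<otimes> g q \<otimes> e c) = e c \<otimes> g z \<otimes> e c \<ominus> e c \<otimes> g1 z \<otimes> (e c \<otimes> g q \<otimes> e c)"
          using Rz l(1) c by simp
        also have "\<dots> = e c \<otimes> (g z \<otimes> e c \<ominus> ?h z)"
          using Rz c by (simp add: a_minus_def r_distr r_minus m_assoc)
        finally have "e c \<otimes> (g z \<otimes> e c \<ominus> ?h z) \<in> J"
          using J_D(3,5,6) j Rz c unfolding a_minus_def by (metis e_closed m_closed)
        moreover have "(g z \<otimes> e c \<ominus> ?h z) \<otimes> e c = g z \<otimes> e c \<ominus> ?h z"
          using Rz c by (simp add: a_minus_def l_distr l_minus m_assoc)
        ultimately show ?thesis using Rz by - (rule corner_J[OF _ c], simp_all add: c)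
      qed
      have "ev y (\<lambda>z. g z \<otimes> e c) = ev y (\<lambda>z. (g z \<otimes> e c \<ominus> ?h z) \<oplus> ?h z)"
        by (rule ev_cong) (use diff_add_cancel hg(1) h1(1) Hq(1)[OF g] c in simp)
      also have "\<dots> = ev y ?h"
        using ev_add[OF y \<delta>H hH] ev_radical[OF y \<delta>H \<delta>J] ev_closed[OF y hH] by simp
      also have "\<dots> = \<eta>0 (g q \<otimes> a)" using a(2)[OF Hq(1)[OF g]] by (simp add: \<eta>_def)
      finally show "ev (e c \<odot>\<^bsub>Y\<^esub> y) g = ev (a \<odot>\<^bsub>Y\<^esub> y0) g"
        using ev_smult[of "e c" y g] ev0[OF a(1) g] c y g by simp
    qed (use y y0 a c in auto)
    then show ?thesis using a(1) by blast
  qed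
  then show ?thesis using y0(1) ey0 y0n by blast
qed

text \<open>The relation u s = 0 lifts to the element u z of the syzygy. It does not vanish because
  z is outside rad P0: the composite of p and \<pi> has a target killed by J, hence kills rad P0,
  but is nonzero at z.\<close>

lemma \<Omega>_nonzero:
  assumes a: "a < N" "c < N" and s: "s \<in> carrier M" "e a \<odot>\<^bsub>M\<^esub> s = s" "\<And>j. j \<in> J \<Longrightarrow> j \<odot>\<^bsub>M\<^esub> s = \<zero>\<^bsub>M\<^esub>"
    and u: "u \<in> J" "e c \<otimes> u = u" "u \<otimes> e a \<noteq> \<zero>"
    and X: "left_module R X" "\<And>j x. \<lbrakk>j \<in> J; x \<in> carrier X\<rbrakk> \<Longrightarrow> j \<odot>\<^bsub>X\<^esub> x = \<zero>\<^bsub>X\<^esub>"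
    and \<pi>: "\<pi> \<in> mod_hom R M X" "\<pi> s \<noteq> \<zero>\<^bsub>X\<^esub>" and z: "z \<in> carrier P0" "p z = s" "e a \<odot>\<^bsub>P0\<^esub> z = z"
  shows "u \<odot>\<^bsub>P0\<^esub> z \<in> \<Omega>" "e c \<odot>\<^bsub>P0\<^esub> (u \<odot>\<^bsub>P0\<^esub> z) = u \<odot>\<^bsub>P0\<^esub> z" "u \<odot>\<^bsub>P0\<^esub> z \<noteq> \<zero>\<^bsub>P0\<^esub>"
proof -
  have uR: "u \<in> carrier R" using u J_D by simp
  have zr: "z \<notin> rad_of P0"
  proof
    assume "z \<in> rad_of P0"
    then have "\<pi> (p z) = \<zero>\<^bsub>X\<^esub>"
      by (rule rad_kill[OF P0(1) _ X(1) mod_hom_compose[OF p(1) \<pi>(1)]])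
         (use X(2) mod_homD(1)[OF \<pi>(1)] mod_homD(1)[OF p(1)] in auto)
    then show False using \<pi>(2) z(2) by simp
  qed
  show "u \<odot>\<^bsub>P0\<^esub> z \<noteq> \<zero>\<^bsub>P0\<^esub>" by (rule mult_nonzero[OF P0(2) z(1) zr a(1) z(3) uR u(3)])
  show "u \<odot>\<^bsub>P0\<^esub> z \<in> \<Omega>" using mod_homD(3)[OF p(1) uR z(1)] s(3)[OF u(1)] z uR by (simp add: a_kernel_eq)
  show "e c \<odot>\<^bsub>P0\<^esub> (u \<odot>\<^bsub>P0\<^esub> z) = u \<odot>\<^bsub>P0\<^esub> z" using u(2) uR z a by (simp add: P0.smult_assoc1[symmetric])
qed

lemma lift_P0:
  assumes "s \<in> carrier M" "a < N" "e a \<odot>\<^bsub>M\<^esub> s = s"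
  shows "\<exists>z\<in>carrier P0. p z = s \<and> e a \<odot>\<^bsub>P0\<^esub> z = z"
proof -
  obtain z where z: "z \<in> carrier P0" "p z = s" using p(2) assms(1) by (metis imageE)
  have "p (e a \<odot>\<^bsub>P0\<^esub> z) = s" using assms(2,3) mod_homD(3)[OF p(1) _ z(1), of "e a"] z(2) by simp
  then show ?thesis using assms(2) z(1) by (intro bexI[of _ "e a \<odot>\<^bsub>P0\<^esub> z"]) auto
qed

end

section \<open>From Artin algebras to idempotents\<close>

lemma (in ring) projective_ideal_module:
  assumes a: "a \<in> carrier R" "a \<otimes> a = a" shows "projective_module R (ideal_module R a)"
proof (rule projectiveI)
  have l: "left_module R (ideal_module R a)" by (rule left_module_ideal_module[OF a(1)])
  have am: "a \<in> carrier (ideal_module R a)" using a by (intro ideal_module_memI)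
  show "fg_module R (ideal_module R a)"
    by (rule left_module.fg_cyclic[OF l am]) auto
  fix A B :: "'a fg_mod" and g f
  assume *: "fg_module R A" "fg_module R B" "g \<in> mod_hom R A B" "g ` carrier A = carrier B"
    "f \<in> mod_hom R (ideal_module R a) B"
  have lA: "left_module R A" using * by (simp add: fg_module_def)
  interpret A: left_module R A by fact
  obtain z where z: "z \<in> carrier A" "g z = f a" using mod_homD(1)[OF *(5) am] *(4) by (metis imageE)
  have "g (x \<odot>\<^bsub>A\<^esub> z) = f x" if "x \<in> carrier (ideal_module R a)" for x
  proof -
    note x = ideal_module_idem[OF a that]
    show ?thesis using mod_homD(3)[OF *(3) x(1) z(1)] mod_homD(3)[OF *(5) x(1) am] x z by simp
  qed
  then show "\<exists>h\<in>mod_hom R (ideal_module R a) A. \<forall>x\<in>carrier (ideal_module R a). g (h x) = f x"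
    by (intro bexI[OF _ ideal_module_hom[OF a(1) lA z(1)]] ballI)
qed

text \<open>\<open>left_serial\<close> only quantifies over modules of type
  \<open>'a fg_mod\<close>, so R a is replaced by such a representative and uniseriality is carried
  back.\<close>

lemma (in ring) left_serial_uniserial:
  assumes "left_serial R" and a: "a \<in> carrier R" "a \<otimes> a = a" and ind: "indecomposable_module R (ideal_module R a)"
  shows "uniserial_module R (ideal_module R a)"
proof -
  have l: "left_module R (ideal_module R a)" by (rule left_module_ideal_module[OF a(1)])
  have pr: "projective_module R (ideal_module R a)" by (rule projective_ideal_module[OF a])
  then obtain P :: "'a fg_mod" where P: "fg_module R P" "mod_iso R (ideal_module R a) P"
    using fg_module_representative[of R "ideal_module R a"] by (auto simp: projective_module_def)
  have lP: "left_module R P" using P by (simp add: fg_module_def)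
  have "uniserial_module R P"
    using assms(1)[unfolded left_serial_def, THEN spec, of P] projective_iso[OF lP P(2) pr]
      indecomposable_iso[OF lP P(2) ind] by simp
  then show ?thesis by (rule uniserial_iso[OF l mod_iso_sym[OF l P(2)]])
qed

lemma (in ring) ideal_submodule:
  assumes a: "a \<in> carrier R" "a \<otimes> a = a" and x: "x \<in> carrier R" "x \<otimes> a = x"
  shows "submodule ((\<lambda>l. l \<otimes> x) ` carrier R) R (ideal_module R a)"
proof -
  interpret I: left_module R "ideal_module R a" by (rule left_module_ideal_module[OF a(1)])
  show ?thesis using I.cyclic_submodule[of x] ideal_module_memI[OF x] by simp
qed

lemma (in ring) uniserial_ideal:
  assumes u: "uniserial_module R (ideal_module R a)" and a: "a \<in> carrier R" "a \<otimes> a = a"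
    and x: "x \<in> carrier R" "x \<otimes> a = x" and y: "y \<in> carrier R" "y \<otimes> a = y"
  shows "(\<exists>l\<in>carrier R. x = l \<otimes> y) \<or> (\<exists>l\<in>carrier R. y = l \<otimes> x)"
proof -
  have "x \<in> (\<lambda>l. l \<otimes> x) ` carrier R" "y \<in> (\<lambda>l. l \<otimes> y) ` carrier R"
    using x y by (auto intro!: image_eqI[of _ _ \<one>])
  moreover have "(\<lambda>l. l \<otimes> x) ` carrier R \<subseteq> (\<lambda>l. l \<otimes> y) ` carrier R \<or> (\<lambda>l. l \<otimes> y) ` carrier R \<subseteq> (\<lambda>l. l \<otimes> x) ` carrier R"
    using u ideal_submodule[OF a x] ideal_submodule[OF a y] by (simp add: uniserial_module_def)
  ultimately show ?thesis by blast
qed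

text \<open>Uniseriality only says that one of two elements of R e_i divides the other. For radical
  components the direction does not matter: if w = e_m w is in J and l w is nonzero, then l e_m is
  outside J and can be inverted, so w is again a multiple of l w.\<close>

lemma (in idem_ring) uniserial_left_uni:
  assumes us: "uniserial_module R (ideal_module R (e i))" and i: "i < N"
    and u: "u \<in> J" "u \<otimes> e i = u" "u \<noteq> \<zero>" and v: "v \<in> J" "v \<otimes> e i = v"
  shows "\<exists>a\<in>carrier R. v = a \<otimes> u"
proof -
  have uR: "u \<in> carrier R" and vR: "v \<in> carrier R" using u v J_D by auto
  interpret K: left_module R "regular_module R" by (rule left_module_regular[OF ring_axioms])
  have recover: "\<exists>a\<in>carrier R. w = a \<otimes> (l \<otimes> w)" if w: "w \<in> J" "m < N" "e m \<otimes> w = w" "l \<in> carrier R" "l \<otimes> w \<noteq> \<zero>" for w m l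
  proof -
    have wR: "w \<in> carrier R" using that J_D by simp
    have lw: "l \<otimes> w = (l \<otimes> e m) \<otimes> w" using that wR by (simp add: m_assoc)
    then have "l \<otimes> e m \<notin> J" using JJ[OF _ that(1)] that(5) by metis
    then obtain y where y: "y \<in> carrier R" "y \<otimes> l \<otimes> e m = e m" using left_unit[of l m] w by blast
    have "y \<otimes> (l \<otimes> w) = y \<otimes> ((l \<otimes> e m) \<otimes> w)" by (rule arg_cong[OF lw])
    also have "\<dots> = (y \<otimes> l \<otimes> e m) \<otimes> w" using y(1) w(2,4) wR by (simp only: m_assoc e_closed m_closed)
    finally have "w = y \<otimes> (l \<otimes> w)" using y(2) w(3) by simp
    then show ?thesis using y(1) by blast
  qed
  obtain m where m: "m < N" "e m \<otimes> u \<noteq> \<zero>" using nonzero_left[OF uR u(3)] by blast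
  let ?X = "(\<lambda>a. a \<otimes> u) ` carrier R"
  have X: "submodule ?X R (regular_module R)" using K.cyclic_submodule[of u] uR by simp
  have "e l \<otimes> v \<in> ?X" if l: "l < N" for l
  proof -
    have el: "e l \<otimes> v \<in> J" "e l \<otimes> v \<in> carrier R" "e l \<otimes> v \<otimes> e i = e l \<otimes> v" "e l \<otimes> (e l \<otimes> v) = e l \<otimes> v"
      using l v vR i J_D(4) by (auto simp: m_assoc m_assoc[symmetric, of "e l" "e l"])
    have em: "e m \<otimes> u \<in> carrier R" "e m \<otimes> u \<otimes> e i = e m \<otimes> u" using m u uR i by (auto simp: m_assoc)
    consider a where "a \<in> carrier R" "e l \<otimes> v = a \<otimes> (e m \<otimes> u)" | a where "a \<in> carrier R" "e m \<otimes> u = a \<otimes> (e l \<otimes> v)"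
      using uniserial_ideal[OF us e_closed[OF i] e_idem[OF i] el(2,3) em] by blast
    then show ?thesis
    proof cases
      case 1
      then show ?thesis using m uR by (auto simp: m_assoc[symmetric] intro!: image_eqI[of _ _ "a \<otimes> e m"])
    next
      case 2
      then obtain b where b: "b \<in> carrier R" "e l \<otimes> v = b \<otimes> (a \<otimes> (e l \<otimes> v))"
        using recover[OF el(1) l el(4), of a] m(2) by auto
      then have "e l \<otimes> v = (b \<otimes> e m) \<otimes> u" using 2(2) m uR by (simp add: m_assoc)
      then show ?thesis using b m by blast
    qed
  qed
  then have "(\<Oplus>l\<in>{..<N}. e l \<otimes> v) \<in> ?X" using K.submodule_finsum[OF X, of "\<lambda>l. e l \<otimes> v" "{..<N}"] by (simp add: Pi_iff)
  then show ?thesis using e_decomp_left[OF vR] by auto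
qed

lemma (in idem_ring) idem_ring_opp: "idem_ring (opp_ring R) N e J"
proof -
  interpret O: ring "opp_ring R" by (rule ring_opp_ring[OF ring_axioms])
  interpret J: ideal J R by (rule J_ideal)
  have sum: "finsum (opp_ring R) e {..<N} = finsum R e {..<N}" by (simp add: finsum_def)
  have "ideal J (opp_ring R)"
    by (rule idealI[OF O.ring_axioms]) (use J.a_subgroup in \<open>auto simp: J.I_l_closed J.I_r_closed\<close>)
  moreover have "i = l \<and> (\<exists>y\<in>carrier (opp_ring R). y \<otimes>\<^bsub>opp_ring R\<^esub> x = e i \<and> x \<otimes>\<^bsub>opp_ring R\<^esub> y = e i)"
    if "x \<in> carrier (opp_ring R)" "i < N" "l < N" "e i \<otimes>\<^bsub>opp_ring R\<^esub> x \<otimes>\<^bsub>opp_ring R\<^esub> e l = x" "x \<notin> J" for x i l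
  proof -
    have "e l \<otimes> x \<otimes> e i = x" using that by (simp add: m_assoc)
    then have "l = i \<and> (\<exists>y\<in>carrier R. y \<otimes> x = e l \<and> x \<otimes> y = e l)" using that by (intro unit_or_J) auto
    then show ?thesis by auto
  qed
  ultimately show ?thesis
    using e_orth e_sum sum JJ e_notin by (intro idem_ring.intro idem_ring_axioms.intro O.ring_axioms) auto
qed

text \<open>The given decomposition concerns left ideals; for e_i R the statement comes from
  locality of the corner. Writing e_i = x + y along a decomposition, x e_i - x = y - y e_i lies in
  both parts, so x and y are in the corner. One of them is outside J, hence a unit there, and its
  part is everything.\<close>

lemma (in idem_ring) indecomposable_opp:
  assumes i: "i < N" shows "indecomposable_module (opp_ring R) (ideal_module (opp_ring R) (e i))"
proof -
  interpret O: ring "opp_ring R" by (rule ring_opp_ring[OF ring_axioms])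
  have l: "left_module (opp_ring R) (ideal_module (opp_ring R) (e i))" (is "left_module _ ?I")
    by (rule O.left_module_ideal_module) (use i in simp)
  interpret I: left_module "opp_ring R" ?I by (rule l)
  have smult: "a \<odot>\<^bsub>?I\<^esub> x = x \<otimes> a" for a x by simp
  have eI: "e i \<in> carrier ?I" using O.ideal_module_memI[of "e i" "e i"] i by simp
  have mem: "x \<in> carrier R" "e i \<otimes> x = x" if "x \<in> carrier ?I" for x
    using O.ideal_module_idem[of "e i" x] that i by simp_all
  show ?thesis
    unfolding indecomposable_module_def
  proof (intro conjI allI impI l)
    show "carrier ?I \<noteq> {\<zero>\<^bsub>?I\<^esub>}" using eI e_ne_0[OF i] by auto
    fix X Y assume "complementary (opp_ring R) ?I X Y"
    note c = complementaryD[OF l this]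
    have full: "Y' = {\<zero>\<^bsub>?I\<^esub>}"
      if X': "submodule X' (opp_ring R) ?I" and Y': "submodule Y' (opp_ring R) ?I" "X' \<inter> Y' = {\<zero>\<^bsub>?I\<^esub>}"
        and x: "x \<in> X'" "x \<otimes> e i = x" "x \<notin> J" for X' Y' x
    proof -
      note DX = I.submoduleD[OF X'] and DY = I.submoduleD[OF Y'(1)]
      note xm = mem[OF DX(3)[OF x(1)]]
      obtain y where y: "y \<in> carrier R" "x \<otimes> y = e i" using unit_or_J[of x i i] xm x i by auto
      have "e i \<in> X'" using DX(5)[of y x] y x by simp
      then have "z \<in> X'" if "z \<in> carrier ?I" for z
        using DX(5)[of z "e i"] mem[OF that] by simp
      then have "Y' \<subseteq> X'" using DY(3) by blast
      then show ?thesis using Y'(2) by blast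
    qed
    obtain x y where xy: "x \<in> X" "y \<in> Y" "e i = x \<oplus> y" using c(4)[OF eI] by auto
    note DX = I.submoduleD[OF c(1)] and DY = I.submoduleD[OF c(2)]
    note xR = mem(1)[OF DX(3)[OF xy(1)]] mem(1)[OF DY(3)[OF xy(2)]]
    have xe: "x \<otimes> e i \<in> X" "y \<otimes> e i \<in> Y" using DX(5)[of "e i" x] DY(5)[of "e i" y] xy(1,2) i by auto
    have eq: "x \<otimes> e i \<oplus> y \<otimes> e i = x \<oplus> y"    proof -
      have "(x \<oplus> y) \<otimes> e i = x \<oplus> y" by (simp only: xy(3)[symmetric] e_idem[OF i])
      then show ?thesis using xR i by (simp add: l_distr)
    qed
    have minI: "\<ominus>\<^bsub>?I\<^esub> z = \<ominus> z" if "z \<in> carrier ?I" for z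
    proof -
      have "\<ominus> z \<in> carrier ?I"
        using O.ideal_module_memI[of "\<ominus> z" "e i"] mem[OF that] i by (simp add: r_minus)
      then show ?thesis using mem(1)[OF that] that by (intro I.M.minus_equality) (simp_all add: l_neg)
    qed
    have "x \<otimes> e i \<oplus> \<ominus> x = y \<oplus> \<ominus> (y \<otimes> e i)"
    proof -
      have "x \<otimes> e i \<oplus> \<ominus> x = (x \<otimes> e i \<oplus> y \<otimes> e i) \<oplus> \<ominus> (y \<otimes> e i) \<oplus> \<ominus> x" using xR i by (simp add: a_assoc r_neg)
      also have "\<dots> = (x \<oplus> y) \<oplus> \<ominus> (y \<otimes> e i) \<oplus> \<ominus> x" using eq by simp
      also have "\<dots> = y \<oplus> \<ominus> (y \<otimes> e i) \<oplus> (x \<oplus> \<ominus> x)" using xR i by (simp add: a_ac)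
      finally show ?thesis using xR i by (simp add: r_neg)
    qed
    moreover have "x \<otimes> e i \<oplus> \<ominus> x \<in> X" using DX(4)[OF xe(1) DX(6)[OF xy(1)]] minI[OF DX(3)[OF xy(1)]] by simp
    moreover have "y \<oplus> \<ominus> (y \<otimes> e i) \<in> Y" using DY(4)[OF xy(2) DY(6)[OF xe(2)]] minI[OF DY(3)[OF xe(2)]] by simp
    ultimately have z: "x \<otimes> e i \<oplus> \<ominus> x = \<zero>" "y \<oplus> \<ominus> (y \<otimes> e i) = \<zero>" using c(3) by auto
    have xx: "x \<otimes> e i = x" using minus_equality[OF z(1)] xR i by simp
    have yy: "y \<otimes> e i = y" using minus_equality[OF z(2)] xR i by simp
    show "X = {\<zero>\<^bsub>?I\<^esub>} \<or> Y = {\<zero>\<^bsub>?I\<^esub>}"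
    proof (cases "x \<in> J")
      case True
      then have "y \<notin> J" using xy(3) e_notin[OF i] J_D(3) by auto
      then have "X = {\<zero>\<^bsub>?I\<^esub>}" using full[OF c(2,1) _ xy(2) yy] c(3) by blast
      then show ?thesis ..
    next
      case False
      then have "Y = {\<zero>\<^bsub>?I\<^esub>}" using full[OF c(1,2,3) xy(1) xx] by blast
      then show ?thesis ..
    qed
  qed
qed

text \<open>The right-hand condition is the left-hand one in the opposite ring, where
  \<open>indecomposable_opp\<close> supplies the indecomposability needed to apply
  seriality.\<close>

lemma (in idem_ring) nak_ringI:
  assumes us: "\<And>i. i < N \<Longrightarrow> uniserial_module R (ideal_module R (e i))" and op: "left_serial (opp_ring R)"
  shows "nak_ring R N e J"
proof -
  interpret O: idem_ring "opp_ring R" N e J by (rule idem_ring_opp)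
  have uo: "uniserial_module (opp_ring R) (ideal_module (opp_ring R) (e i))" if "i < N" for i
    using that by (intro O.left_serial_uniserial[OF op] indecomposable_opp) auto
  show ?thesis
  proof (intro nak_ring.intro nak_ring_axioms.intro idem_ring_axioms)
    show "\<exists>a\<in>carrier R. v = a \<otimes> u" if "i < N" "u \<in> J" "v \<in> J" "u \<otimes> e i = u" "v \<otimes> e i = v" "u \<noteq> \<zero>" for i u v
      using uniserial_left_uni[OF us] that by blast
    show "\<exists>a\<in>carrier R. v = u \<otimes> a" if "i < N" "u \<in> J" "v \<in> J" "e i \<otimes> u = u" "e i \<otimes> v = v" "u \<noteq> \<zero>" for i u v
      using O.uniserial_left_uni[OF uo, of i u v] that by simp
  qed
qed

section \<open>The radical of a basic left serial ring in terms of its idempotents\<close>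

locale serial_idem = ring R for R :: "('a, 'm) ring_scheme" (structure) +
  fixes N :: nat and e :: "nat \<Rightarrow> 'a"
  assumes e_closed [simp, intro]: "i < N \<Longrightarrow> e i \<in> carrier R"
    and e_idem [simp]: "i < N \<Longrightarrow> e i \<otimes> e i = e i"
    and e_orth: "\<lbrakk>i < N; j < N; i \<noteq> j\<rbrakk> \<Longrightarrow> e i \<otimes> e j = \<zero>"
    and e_sum: "(\<Oplus>i\<in>{..<N}. e i) = \<one>"
    and ind: "i < N \<Longrightarrow> indecomposable_module R (ideal_module R (e i))"
    and non_iso: "\<lbrakk>i < N; j < N; i \<noteq> j\<rbrakk> \<Longrightarrow> \<not> mod_iso R (ideal_module R (e i)) (ideal_module R (e j))"
    and us: "i < N \<Longrightarrow> uniserial_module R (ideal_module R (e i))"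
begin

lemma e_ne_0: "i < N \<Longrightarrow> e i \<noteq> \<zero>"
proof
  assume i: "i < N" "e i = \<zero>"
  have "carrier (ideal_module R (e i)) = {\<zero>}" by (auto simp: i(2) intro!: image_eqI[of _ _ \<zero>])
  then show False using ind[OF i(1)] by (simp add: indecomposable_module_def)
qed

lemma e_right: "x \<in> carrier R \<Longrightarrow> x = (\<Oplus>i\<in>{..<N}. x \<otimes> e i)"
  using finsum_rdistr[of "{..<N}" x e] by (simp add: e_sum Pi_iff)

text \<open>A one-sided inverse z of x makes x z a nonzero idempotent in e_i R e_i. It splits R e_i,
  so it equals e_i by indecomposability. Then right multiplication by x is an isomorphism from R e_i
  to R e_l, which forces i = l.\<close>

lemma unit:
  assumes x: "x \<in> carrier R" "i < N" "l < N" "e i \<otimes> x \<otimes> e l = x" and y: "y \<in> carrier R" "y \<otimes> x = e l"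
  shows "i = l \<and> (\<exists>y\<in>carrier R. y \<otimes> x = e l \<and> x \<otimes> y = e i)"
proof -
  have ex: "e i \<otimes> x = x" "x \<otimes> e l = x"
  proof -
    have "e i \<otimes> (e i \<otimes> x \<otimes> e l) = (e i \<otimes> e i) \<otimes> x \<otimes> e l" "(e i \<otimes> x \<otimes> e l) \<otimes> e l = e i \<otimes> x \<otimes> (e l \<otimes> e l)"
      using x(1-3) by (simp_all only: m_assoc e_closed m_closed)
    then show "e i \<otimes> x = x" "x \<otimes> e l = x" using x by simp_all
  qed
  define z where "z = e l \<otimes> y \<otimes> e i"
  have z: "z \<in> carrier R" "e l \<otimes> z = z" "z \<otimes> e i = z"
  proof -
    show "z \<in> carrier R" using x y by (simp add: z_def)
    have "e l \<otimes> z = (e l \<otimes> e l) \<otimes> y \<otimes> e i" "z \<otimes> e i = e l \<otimes> y \<otimes> (e i \<otimes> e i)"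
      using x(2,3) y(1) unfolding z_def by (simp_all only: m_assoc e_closed m_closed)
    then show "e l \<otimes> z = z" "z \<otimes> e i = z" using x(2,3) by (simp_all add: z_def)
  qed
  have zx: "z \<otimes> x = e l" using x y ex by (simp add: z_def m_assoc)
  let ?f = "x \<otimes> z"
  have f: "?f \<in> carrier R" "?f \<otimes> e i = ?f" "e i \<otimes> ?f = ?f" "?f \<otimes> ?f = ?f"
  proof -
    show "?f \<in> carrier R" using x z by simp
    show "?f \<otimes> e i = ?f" using x z by (simp add: m_assoc)
    show "e i \<otimes> ?f = ?f" using x z ex by (simp add: m_assoc[symmetric])
    have "?f \<otimes> ?f = x \<otimes> (z \<otimes> x) \<otimes> z" using x(1) z(1) by (simp only: m_assoc m_closed)
    then show "?f \<otimes> ?f = ?f" using zx ex by simp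
  qed
  have f0: "?f \<noteq> \<zero>"
  proof
    assume "?f = \<zero>"
    then have "z \<otimes> ?f \<otimes> x = \<zero>" using x z by simp
    moreover have "z \<otimes> ?f \<otimes> x = (z \<otimes> x) \<otimes> (z \<otimes> x)" using x(1) z(1) by (simp only: m_assoc m_closed)
    ultimately show False using zx e_ne_0 x by simp
  qed
  define w where "w = e i \<ominus> ?f"
  have w: "w \<in> carrier R" "w \<otimes> e i = w" "w \<otimes> ?f = \<zero>" "?f \<otimes> w = \<zero>" "?f \<oplus> w = e i"
    using f x by (auto simp: w_def a_minus_def l_distr r_distr l_minus r_minus r_neg a_lcomm[of ?f])
  have lI: "left_module R (ideal_module R (e i))" by (rule left_module_ideal_module) (use x in simp)
  interpret I: left_module R "ideal_module R (e i)" by (rule lI)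
  have "complementary R (ideal_module R (e i)) ((\<lambda>l. l \<otimes> ?f) ` carrier R) ((\<lambda>l. l \<otimes> w) ` carrier R)"
  proof (rule complementaryI[OF lI])
    show "submodule ((\<lambda>l. l \<otimes> ?f) ` carrier R) R (ideal_module R (e i))"
      "submodule ((\<lambda>l. l \<otimes> w) ` carrier R) R (ideal_module R (e i))"
      using ideal_submodule[of "e i"] f w x by auto
    show "v = \<zero>\<^bsub>ideal_module R (e i)\<^esub>" if v: "v \<in> (\<lambda>l. l \<otimes> ?f) ` carrier R" "v \<in> (\<lambda>l. l \<otimes> w) ` carrier R" for v
    proof -
      obtain a b where ab: "a \<in> carrier R" "b \<in> carrier R" "v = a \<otimes> ?f" "v = b \<otimes> w" using v by auto
      have "v \<otimes> ?f = a \<otimes> (?f \<otimes> ?f)" unfolding ab(3) using ab(1) f(1) by (simp only: m_assoc)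
      then have "v = v \<otimes> ?f" using f(4) ab(3) by simp
      also have "\<dots> = b \<otimes> (w \<otimes> ?f)" unfolding ab(4) using ab(2) w(1) f(1) by (simp only: m_assoc)
      finally show ?thesis using w(3) ab(2) by simp
    qed
    fix v assume "v \<in> carrier (ideal_module R (e i))"
    then obtain a where a: "a \<in> carrier R" "v = a \<otimes> e i" by auto
    then have "v = a \<otimes> ?f \<oplus> a \<otimes> w" using w(1,5) f(1) r_distr[of ?f w a] by simp
    then show "\<exists>x\<in>(\<lambda>l. l \<otimes> ?f) ` carrier R. \<exists>y\<in>(\<lambda>l. l \<otimes> w) ` carrier R. v = x \<oplus>\<^bsub>ideal_module R (e i)\<^esub> y"
      using a by auto
  qed
  then have "(\<lambda>l. l \<otimes> ?f) ` carrier R = {\<zero>} \<or> (\<lambda>l. l \<otimes> w) ` carrier R = {\<zero>}"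
    using ind[OF x(2)] by (auto simp: indecomposable_module_def)
  moreover have "?f \<in> (\<lambda>l. l \<otimes> ?f) ` carrier R" "w \<in> (\<lambda>l. l \<otimes> w) ` carrier R"
    using f w by (auto intro!: image_eqI[of _ _ \<one>])
  ultimately have "w = \<zero>" using f0 by blast
  then have xz: "x \<otimes> z = e i" using w f by simp
  have lIl: "left_module R (ideal_module R (e l))" by (rule left_module_ideal_module) (use x in simp)
  have hom: "(\<lambda>a. a \<otimes> x) \<in> mod_hom R (ideal_module R (e i)) (ideal_module R (e l))"
  proof (rule mod_homI)
    show "a \<otimes> x \<in> carrier (ideal_module R (e l))" if "a \<in> carrier (ideal_module R (e i))" for a
      using that x ex by (intro ideal_module_memI) (auto simp: m_assoc)
  qed (use x in \<open>auto simp: l_distr m_assoc\<close>)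
  have "bij_betw (\<lambda>a. a \<otimes> x) (carrier (ideal_module R (e i))) (carrier (ideal_module R (e l)))"
  proof (rule bij_betw_byWitness[of _ "\<lambda>a. a \<otimes> z"])
    show "\<forall>a\<in>carrier (ideal_module R (e i)). a \<otimes> x \<otimes> z = a"
      using x(1,2) z(1) xz by (auto simp: m_assoc)
    show "\<forall>a\<in>carrier (ideal_module R (e l)). a \<otimes> z \<otimes> x = a"
      using x(1,3) z(1) zx by (auto simp: m_assoc)
    show "(\<lambda>a. a \<otimes> x) ` carrier (ideal_module R (e i)) \<subseteq> carrier (ideal_module R (e l))"
      using mod_homD(1)[OF hom] by blast
    show "(\<lambda>a. a \<otimes> z) ` carrier (ideal_module R (e l)) \<subseteq> carrier (ideal_module R (e i))"
      using x z by (auto intro!: ideal_module_memI[of _ "e i", simplified] simp: m_assoc)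
  qed
  then have "i = l" using non_iso[OF x(2,3)] hom by (auto simp: mod_iso_def)
  then show ?thesis using xz zx z by blast
qed

text \<open>The elements of R e_i that do not generate it. By uniseriality they form a submodule,
  which is the unique maximal submodule of R e_i.\<close>

definition Jl :: "nat \<Rightarrow> 'a set" where
  "Jl i = {x \<in> carrier R. x \<otimes> e i = x \<and> (\<forall>y\<in>carrier R. y \<otimes> x \<noteq> e i)}"

definition radical :: "'a set" where
  "radical = {x \<in> carrier R. \<forall>i<N. x \<otimes> e i \<in> Jl i}"

lemma Jl_smult: "\<lbrakk>i < N; x \<in> Jl i; a \<in> carrier R\<rbrakk> \<Longrightarrow> a \<otimes> x \<in> Jl i"
  unfolding Jl_def by (auto simp: m_assoc) (metis m_assoc m_closed)

lemma Jl_zero: "i < N \<Longrightarrow> \<zero> \<in> Jl i"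
  using e_ne_0 by (force simp: Jl_def)

text \<open>One of x, y is a multiple of the other, so x + y is a multiple of a
  non-generator.\<close>

lemma Jl_add:
  assumes i: "i < N" and x: "x \<in> Jl i" "y \<in> Jl i" shows "x \<oplus> y \<in> Jl i"
proof -
  have R: "x \<in> carrier R" "x \<otimes> e i = x" "y \<in> carrier R" "y \<otimes> e i = y" using x by (auto simp: Jl_def)
  consider l where "l \<in> carrier R" "x = l \<otimes> y" | l where "l \<in> carrier R" "y = l \<otimes> x"
    using uniserial_ideal[OF us[OF i] e_closed[OF i] e_idem[OF i] R] by blast
  then show ?thesis
  proof cases
    case 1
    then have "x \<oplus> y = (l \<oplus> \<one>) \<otimes> y" using R by (simp add: l_distr)
    then show ?thesis using Jl_smult[OF i x(2), of "l \<oplus> \<one>"] 1 by simp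
  next
    case 2
    then have "x \<oplus> y = (\<one> \<oplus> l) \<otimes> x" using R by (simp add: l_distr)
    then show ?thesis using Jl_smult[OF i x(1), of "\<one> \<oplus> l"] 2 by simp
  qed
qed

lemma Jl_submodule: "i < N \<Longrightarrow> submodule (Jl i) R (regular_module R)"
  using Jl_smult Jl_zero Jl_add
  by (intro left_module.submoduleI[OF left_module_regular[OF ring_axioms]]) (auto simp: Jl_def)

lemma e_notin_Jl: "i < N \<Longrightarrow> e i \<notin> Jl i"
  by (force simp: Jl_def)

lemma not_JlD: "\<lbrakk>i < N; x \<in> carrier R; x \<otimes> e i \<notin> Jl i\<rbrakk> \<Longrightarrow> \<exists>y\<in>carrier R. y \<otimes> (x \<otimes> e i) = e i"
  by (auto simp: Jl_def m_assoc)

text \<open>The sets of x with x e_i in \<open>Jl i\<close> are maximal left ideals, which gives one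
  inclusion. For the other, if a maximal X misses x e_i, then e_i = v + l x e_i with v in X; v is
  not in \<open>Jl i\<close>, so it generates e_i and X contains x e_i after all.\<close>

lemma jacobson_radical_eq: "jacobson_radical R = radical"
proof
  interpret K: left_module R "regular_module R" by (rule left_module_regular[OF ring_axioms])
  show "jacobson_radical R \<subseteq> radical"
  proof
    fix x assume x: "x \<in> jacobson_radical R"
    then have xR: "x \<in> carrier R" by (simp add: jacobson_radical_def)
    have "x \<otimes> e i \<in> Jl i" if i: "i < N" for i
    proof -
      let ?M = "{x \<in> carrier R. x \<otimes> e i \<in> Jl i}"
      have M: "submodule ?M R (regular_module R)"
        using i Jl_smult[OF i] Jl_zero[OF i] Jl_add[OF i] by (intro K.submoduleI) (auto simp: l_distr m_assoc)
      have "maximal_submodule R (regular_module R) ?M"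
        unfolding maximal_submodule_def
      proof (intro conjI allI impI M)
        show "?M \<noteq> carrier (regular_module R)" using e_notin_Jl[OF i] i by force
        fix X assume X: "submodule X R (regular_module R) \<and> ?M \<subseteq> X"
        note D = K.submoduleD[OF X[THEN conjunct1], simplified]
        show "X = ?M \<or> X = carrier (regular_module R)"
        proof (cases "X \<subseteq> ?M")
          case False
          then obtain z where z: "z \<in> X" "z \<otimes> e i \<notin> Jl i" using D(3) by blast
          have zR: "z \<in> carrier R" using D(3) z by simp
          obtain y where y: "y \<in> carrier R" "y \<otimes> (z \<otimes> e i) = e i" using not_JlD[OF i zR z(2)] by blast
          have "(\<one> \<ominus> y \<otimes> z) \<otimes> e i = \<zero>"
            using y zR i by (simp add: a_minus_def l_distr l_minus m_assoc r_neg)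
          then have "\<one> \<ominus> y \<otimes> z \<in> X" using X Jl_zero[OF i] y zR by auto
          then have "(\<one> \<ominus> y \<otimes> z) \<oplus> y \<otimes> z \<in> X" using D(4,5) y z by blast
          then have "\<one> \<in> X" using y zR by (simp add: a_minus_def a_assoc l_neg)
          then have "a \<in> X" if "a \<in> carrier R" for a using D(5)[OF that, of \<one>] that by simp
          then show ?thesis using D(1) by auto
        qed (use X in auto)
      qed
      then have "x \<in> ?M" using x by (auto simp: jacobson_radical_def)
      then show ?thesis by simp
    qed
    then show "x \<in> radical" using xR by (simp add: radical_def)
  qed
  show "radical \<subseteq> jacobson_radical R"
  proof
    fix x assume x: "x \<in> radical"
    then have xR: "x \<in> carrier R" and xJ: "\<And>i. i < N \<Longrightarrow> x \<otimes> e i \<in> Jl i" by (auto simp: radical_def)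
    have "x \<in> X" if X: "maximal_submodule R (regular_module R) X" for X
    proof -
      have sX: "submodule X R (regular_module R)" using X by (simp add: maximal_submodule_def)
      note D = K.submoduleD[OF sX, simplified]
      have "x \<otimes> e i \<in> X" if i: "i < N" for i
      proof (rule ccontr)
        assume n: "x \<otimes> e i \<notin> X"
        have xe: "x \<otimes> e i \<in> carrier R" using xR i by simp
        have "K.adjoin X (x \<otimes> e i) = carrier R"
          using X K.submodule_adjoin[OF sX, of "x \<otimes> e i"] K.adjoin_subset[OF sX, of "x \<otimes> e i"] n xe
          unfolding maximal_submodule_def by auto
        then have "e i \<in> K.adjoin X (x \<otimes> e i)" using i by simp
        then obtain v l where v: "v \<in> X" "l \<in> carrier R" "e i = v \<oplus> l \<otimes> (x \<otimes> e i)" by (auto simp: K.adjoin_def)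
        have vR: "v \<in> carrier R" using D(3) v by simp
        have lJ: "l \<otimes> (x \<otimes> e i) \<in> Jl i" by (rule Jl_smult[OF i xJ[OF i] v(2)])
        have "v = (v \<oplus> l \<otimes> (x \<otimes> e i)) \<ominus> l \<otimes> (x \<otimes> e i)"
          using vR v(2) xR i by (simp add: a_minus_def a_assoc r_neg)
        then have "v = e i \<ominus> l \<otimes> (x \<otimes> e i)" by (simp only: v(3)[symmetric])
        then have ve: "v \<otimes> e i = v" using v(2) xR i by (simp add: a_minus_def l_distr l_minus m_assoc)
        have "v \<notin> Jl i" using Jl_add[OF i _ lJ, of v] v(3) e_notin_Jl[OF i] by auto
        then obtain y where "y \<in> carrier R" "y \<otimes> v = e i" using not_JlD[OF i vR] ve by auto
        then have "e i \<in> X" using D(5) v(1) by metis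
        then show False using D(5)[OF xR] n by simp
      qed
      then have "(\<Oplus>i\<in>{..<N}. x \<otimes> e i) \<in> X" using K.submodule_finsum[OF sX, of "\<lambda>i. x \<otimes> e i" "{..<N}"] by (simp add: Pi_iff)
      then show ?thesis using e_right[OF xR] by simp
    qed
    then show "x \<in> jacobson_radical R" using xR by (auto simp: jacobson_radical_def)
  qed
qed

text \<open>The description of \<open>radical\<close> is one-sided, so right multiplication needs an
  argument. If x a e_l escaped, some x b with b in e_i R e_l would have a left inverse up to e_l;
  then b is invertible by \<open>unit\<close>, and conjugating by b gives a left inverse of x
  e_i.\<close>

lemma radical_right:
  assumes x: "x \<in> radical" and a: "a \<in> carrier R" shows "x \<otimes> a \<in> radical"
proof -
  have xR: "x \<in> carrier R" and xJ: "\<And>i. i < N \<Longrightarrow> x \<otimes> e i \<in> Jl i" using x by (auto simp: radical_def)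
  interpret K: left_module R "regular_module R" by (rule left_module_regular[OF ring_axioms])
  have "x \<otimes> a \<otimes> e l \<in> Jl l" if l: "l < N" for l
  proof (rule ccontr)
    assume n: "x \<otimes> a \<otimes> e l \<notin> Jl l"
    have ael: "a \<otimes> e l \<in> carrier R" using a l by simp
    have "(\<Oplus>i\<in>{..<N}. x \<otimes> e i) \<otimes> (a \<otimes> e l) = (\<Oplus>i\<in>{..<N}. x \<otimes> e i \<otimes> (a \<otimes> e l))"
      using finsum_ldistr[of "{..<N}" "a \<otimes> e l" "\<lambda>i. x \<otimes> e i"] xR ael by (simp add: Pi_iff)
    then have "x \<otimes> (a \<otimes> e l) = (\<Oplus>i\<in>{..<N}. x \<otimes> e i \<otimes> (a \<otimes> e l))" using e_right[OF xR] by simp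
    then have nS: "(\<Oplus>i\<in>{..<N}. x \<otimes> e i \<otimes> (a \<otimes> e l)) \<notin> Jl l" using n xR a l by (simp add: m_assoc)
    have "\<exists>i<N. x \<otimes> e i \<otimes> (a \<otimes> e l) \<notin> Jl l"
    proof (rule ccontr)
      assume "\<not> ?thesis"
      then have "finsum (regular_module R) (\<lambda>i. x \<otimes> e i \<otimes> (a \<otimes> e l)) {..<N} \<in> Jl l"
        by (intro K.submodule_finsum[OF Jl_submodule[OF l]]) auto
      then show False using nS by simp
    qed
    then obtain i where i: "i < N" "x \<otimes> e i \<otimes> (a \<otimes> e l) \<notin> Jl l" by blast
    define b where "b = e i \<otimes> a \<otimes> e l"
    have b: "b \<in> carrier R" "e i \<otimes> b = b" "b \<otimes> e l = b"
      using a l i by (auto simp: b_def m_assoc) (simp_all add: m_assoc[symmetric])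
    have "x \<otimes> e i \<otimes> (a \<otimes> e l) = x \<otimes> b" using xR a l i by (simp add: b_def m_assoc)
    then obtain z where z: "z \<in> carrier R" "z \<otimes> (x \<otimes> b) = e l"
    proof -
      have xb: "x \<otimes> b \<otimes> e l = x \<otimes> b" using xR b l by (simp add: m_assoc)
      then have "\<exists>z\<in>carrier R. z \<otimes> (x \<otimes> b \<otimes> e l) = e l"
        using i(2) \<open>x \<otimes> e i \<otimes> (a \<otimes> e l) = x \<otimes> b\<close> xR b by (intro not_JlD[OF l]) auto
      then show ?thesis using xb that by auto
    qed
    have "(z \<otimes> x) \<otimes> b = e l" using z xR b by (simp add: m_assoc)
    then obtain y where y: "i = l" "y \<in> carrier R" "y \<otimes> b = e l" "b \<otimes> y = e i"
      using unit[of b i l "z \<otimes> x"] b z xR i l by auto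
    have "(b \<otimes> z) \<otimes> (x \<otimes> e i) = b \<otimes> (z \<otimes> (x \<otimes> b)) \<otimes> y"
      using y(4)[symmetric] b(1) z(1) xR y(2) by (simp add: m_assoc)
    also have "\<dots> = e i" using z(2) b y by simp
    finally have "(b \<otimes> z) \<otimes> (x \<otimes> e i) = e i" .
    then show False using xJ[OF i(1)] b z by (auto simp: Jl_def)
  qed
  then show ?thesis using xR a by (simp add: radical_def)
qed

lemma idem_ring_radical:
  assumes JJ: "\<And>x y. \<lbrakk>x \<in> jacobson_radical R; y \<in> jacobson_radical R\<rbrakk> \<Longrightarrow> x \<otimes> y = \<zero>"
  shows "idem_ring R N e radical"
proof -
  have add: "x \<oplus> y \<in> radical" if "x \<in> radical" "y \<in> radical" for x y
    using that Jl_add by (auto simp: radical_def l_distr)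
  have left: "a \<otimes> x \<in> radical" if "x \<in> radical" "a \<in> carrier R" for a x
    using that Jl_smult by (auto simp: radical_def m_assoc)
  have R: "x \<in> carrier R" if "x \<in> radical" for x using that by (simp add: radical_def)
  have neg: "\<ominus> x \<in> radical" if "x \<in> radical" for x
    using left[OF that, of "\<ominus> \<one>"] R[OF that] by (simp add: l_minus)
  have "\<zero> \<in> radical" using Jl_zero by (simp add: radical_def)
  then have "subgroup radical (add_monoid R)"
    by (intro subgroup.intro) (use R add neg in \<open>auto simp: a_inv_def[symmetric]\<close>)
  then have id: "ideal radical R" by (rule idealI[OF ring_axioms]) (use left radical_right in auto)
  show ?thesis
  proof (intro idem_ring.intro idem_ring_axioms.intro ring_axioms)
    show "e i \<notin> radical" if "i < N" for i
      using e_notin_Jl[OF that] that by (auto simp: radical_def)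
    show "i = l \<and> (\<exists>y\<in>carrier R. y \<otimes> x = e i \<and> x \<otimes> y = e i)"
      if x: "x \<in> carrier R" "i < N" "l < N" "e i \<otimes> x \<otimes> e l = x" "x \<notin> radical" for x i l
    proof -
      obtain m where m: "m < N" "x \<otimes> e m \<notin> Jl m" using x by (auto simp: radical_def)
      have "(e i \<otimes> x \<otimes> e l) \<otimes> e m = (e i \<otimes> x) \<otimes> (e l \<otimes> e m)"
        using x(1-3) m(1) by (simp only: m_assoc e_closed m_closed)
      then have xm: "x \<otimes> e m = (e i \<otimes> x) \<otimes> (e l \<otimes> e m)" using x(4) by simp
      have ml: "m = l"
      proof (rule ccontr)
        assume "m \<noteq> l"
        then have "x \<otimes> e m = \<zero>" using xm e_orth[of l m] x m by simp
        then show False using m Jl_zero by simp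
      qed
      moreover have "x \<otimes> e l = x" using xm ml x by (simp add: m_assoc)
      ultimately show ?thesis using not_JlD[OF m(1) x(1)] m unit[OF x(1-4)] by auto
    qed
  qed (use id e_orth e_sum JJ jacobson_radical_eq in auto)
qed

end

text \<open>The projections of a decomposition of the regular module are right multiplications by
  e_i = \<pi>_i(1), and the summands are the R e_i.\<close>

lemma (in ring) serial_idem_exists:
  assumes basic: "basic_ring R" and serial: "left_serial R"
  obtains N e where "serial_idem R N e" "internal_direct_sum R (regular_module R) {..<N} (\<lambda>i. carrier (ideal_module R (e i)))"
proof -
  have reg: "left_module R (regular_module R)" by (rule left_module_regular[OF ring_axioms])
  obtain N :: nat and H where H: "internal_direct_sum R (regular_module R) {..<N} H"
    "\<And>i. i < N \<Longrightarrow> indecomposable_module R (sub_mod (regular_module R) (H i))"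
    "\<And>i j. \<lbrakk>i < N; j < N; i \<noteq> j\<rbrakk> \<Longrightarrow> \<not> mod_iso R (sub_mod (regular_module R) (H i)) (sub_mod (regular_module R) (H j))"
    using basic by (auto simp: basic_ring_def basic_module_def)
  interpret K: left_module R "regular_module R" by (rule reg)
  have sub: "submodule (H i) R (regular_module R)" if "i < N" for i using H(1) that by (auto simp: internal_direct_sum_def)
  show ?thesis
  proof (rule direct_sum_projections[OF reg H(1)])
    fix \<pi> assume \<pi>: "\<And>i. i \<in> {..<N} \<Longrightarrow> \<pi> i \<in> mod_hom R (regular_module R) (regular_module R)"
      "\<And>i x. \<lbrakk>i \<in> {..<N}; x \<in> carrier (regular_module R)\<rbrakk> \<Longrightarrow> \<pi> i x \<in> H i"
      "\<And>x. x \<in> carrier (regular_module R) \<Longrightarrow> x = (\<Oplus>\<^bsub>regular_module R\<^esub>i\<in>{..<N}. \<pi> i x)"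
      "\<And>i x. \<lbrakk>i \<in> {..<N}; x \<in> H i\<rbrakk> \<Longrightarrow> \<pi> i x = x"
      "\<And>i j x. \<lbrakk>i \<in> {..<N}; j \<in> {..<N}; i \<noteq> j; x \<in> H j\<rbrakk> \<Longrightarrow> \<pi> i x = \<zero>\<^bsub>regular_module R\<^esub>"
    define e where "e i = \<pi> i \<one>" for i
    note D = K.submoduleD[OF sub, simplified]
    have eH: "e i \<in> H i" if "i < N" for i using \<pi>(2) that by (simp add: e_def)
    have eR: "e i \<in> carrier R" if "i < N" for i using D(3)[OF that eH[OF that]] .
    have \<pi>e: "\<pi> i x = x \<otimes> e i" if "i < N" "x \<in> carrier R" for i x
      using mod_homD(3)[OF \<pi>(1), of i x \<one>] that by (simp add: e_def)
    have Hi: "H i = carrier (ideal_module R (e i))" if i: "i < N" for i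
    proof
      show "H i \<subseteq> carrier (ideal_module R (e i))"
        using D(3)[OF i] \<pi>(4) \<pi>e i by (force intro!: ideal_module_memI)
      show "carrier (ideal_module R (e i)) \<subseteq> H i" using D(5)[OF i _ eH[OF i]] by auto
    qed
    have Hm: "sub_mod (regular_module R) (H i) = ideal_module R (e i)" if "i < N" for i
      using Hi[OF that] by (simp add: ideal_module_def)
    have idem: "e i \<otimes> e i = e i" if "i < N" for i using \<pi>(4)[of i "e i"] eH eR \<pi>e that by simp
    have ind: "indecomposable_module R (ideal_module R (e i))" if "i < N" for i using H(2) Hm that by metis
    have "serial_idem R N e"
    proof unfold_locales
      show "e i \<otimes> e j = \<zero>" if "i < N" "j < N" "i \<noteq> j" for i j
        using \<pi>(5)[of j i "e i"] eH eR \<pi>e that by simp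
      show "(\<Oplus>i\<in>{..<N}. e i) = \<one>" using \<pi>(3)[of \<one>] by (simp add: e_def)
      show "\<not> mod_iso R (ideal_module R (e i)) (ideal_module R (e j))" if "i < N" "j < N" "i \<noteq> j" for i j
        using H(3)[OF that] Hm that by metis
      show "uniserial_module R (ideal_module R (e i))" if "i < N" for i
        by (rule left_serial_uniserial[OF serial eR[OF that] idem[OF that] ind[OF that]])
    qed (use eR idem ind in auto)
    moreover have "internal_direct_sum R (regular_module R) {..<N} (\<lambda>i. carrier (ideal_module R (e i)))"
    proof -
      have "(\<Pi>\<^sub>E i\<in>{..<N}. H i) = (\<Pi>\<^sub>E i\<in>{..<N}. carrier (ideal_module R (e i)))"
        by (rule PiE_cong) (use Hi in auto)
      then show ?thesis using H(1) Hi unfolding internal_direct_sum_def by simp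
    qed
    ultimately show ?thesis by (rule that)
  qed
qed

section \<open>Simple modules and loops\<close>

context nak_ring
begin

lemma cyclic_J_zero:
  assumes g: "cyclic_gen R (e i) J S x" and i: "i < N" and j: "j \<in> J" "y \<in> carrier S"
  shows "j \<odot>\<^bsub>S\<^esub> y = \<zero>\<^bsub>S\<^esub>"
proof -
  note d = cyclic_genD[OF g]
  interpret S: left_module R S by (rule d)
  obtain l where l: "l \<in> carrier R" "y = l \<odot>\<^bsub>S\<^esub> x" using d(5)[OF j(2)] by blast
  have jR: "j \<in> carrier R" using j J_D by simp
  have "(j \<otimes> l) \<otimes> e i \<in> J" using j l i J_D(5) by simp
  then have "(j \<otimes> l) \<odot>\<^bsub>S\<^esub> x = \<zero>\<^bsub>S\<^esub>" using d(6)[of "j \<otimes> l"] jR l by simp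
  then show ?thesis using l jR d(2) by (simp add: S.smult_assoc1)
qed

lemma cyclic_J_simple:
  assumes g: "cyclic_gen R (e i) J S x" and i: "i < N" shows "simple_module R S"
proof -
  note d = cyclic_genD[OF g]
  interpret S: left_module R S by (rule d)
  have "x \<noteq> \<zero>\<^bsub>S\<^esub>" using d(6)[of \<one>] e_notin[OF i] d(2) i by auto
  moreover have "X = {\<zero>\<^bsub>S\<^esub>} \<or> X = carrier S" if X: "submodule X R S" for X
  proof (cases "X \<subseteq> {\<zero>\<^bsub>S\<^esub>}")
    case True then show ?thesis using S.submoduleD(2)[OF X] by auto
  next
    case False
    note D = S.submoduleD[OF X]
    obtain y where y: "y \<in> X" "y \<noteq> \<zero>\<^bsub>S\<^esub>" using False by auto
    obtain l where l: "l \<in> carrier R" "y = l \<odot>\<^bsub>S\<^esub> x" using d(5)[OF D(3)[OF y(1)]] by blast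
    have "l \<otimes> e i \<notin> J" using d(6)[OF l(1)] l y by auto
    then obtain z where z: "z \<in> carrier R" "z \<otimes> l \<otimes> e i = e i" using left_unit[OF l(1) i] by blast
    have "z \<odot>\<^bsub>S\<^esub> y = (z \<otimes> l \<otimes> e i) \<odot>\<^bsub>S\<^esub> x" using l d(2,3) z(1) i by (simp add: S.smult_assoc1)
    then have "x \<in> X" using D(5)[OF z(1) y(1)] z(2) d(3) by simp
    then have "w \<in> X" if "w \<in> carrier S" for w using d(5)[OF that] D(5) by blast
    then show ?thesis using D(1) by auto
  qed
  ultimately show ?thesis using d(1,2) by (auto simp: simple_module_def)
qed

text \<open>J kills a generator x: if j x were nonzero, then x = l j x for some l, and j x = j l j x
  = 0.\<close>

lemma simple_cyclic_J:
  assumes S: "simple_module R S" shows "\<exists>i<N. \<exists>x. cyclic_gen R (e i) J S x"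
proof -
  have lS: "left_module R S" using S by (simp add: simple_module_def)
  interpret S: idem_module R N e J S by (intro idem_module.intro idem_ring_axioms lS)
  have full: "(\<lambda>a. a \<odot>\<^bsub>S\<^esub> x) ` carrier R = carrier S" if "x \<in> carrier S" "x \<noteq> \<zero>\<^bsub>S\<^esub>" for x
  proof -
    have "x \<in> (\<lambda>a. a \<odot>\<^bsub>S\<^esub> x) ` carrier R" using that by (intro image_eqI[of _ _ \<one>]) auto
    then show ?thesis using S S.cyclic_submodule[OF that(1)] that(2) by (auto simp: simple_module_def)
  qed
  obtain x0 where "x0 \<in> carrier S" "x0 \<noteq> \<zero>\<^bsub>S\<^esub>"
    using S S.M.zero_closed unfolding simple_module_def by blast
  then obtain i where i: "i < N" "e i \<odot>\<^bsub>S\<^esub> x0 \<noteq> \<zero>\<^bsub>S\<^esub>" using S.nonzero_component by blast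
  define x where "x = e i \<odot>\<^bsub>S\<^esub> x0"
  have x: "x \<in> carrier S" "x \<noteq> \<zero>\<^bsub>S\<^esub>" "e i \<odot>\<^bsub>S\<^esub> x = x" using i \<open>x0 \<in> carrier S\<close> by (auto simp: x_def)
  have "j \<odot>\<^bsub>S\<^esub> x = \<zero>\<^bsub>S\<^esub>" if j: "j \<in> J" for j
  proof (rule ccontr)
    assume n: "j \<odot>\<^bsub>S\<^esub> x \<noteq> \<zero>\<^bsub>S\<^esub>"
    have jR: "j \<in> carrier R" using j J_D by simp
    have jx: "j \<odot>\<^bsub>S\<^esub> x \<in> carrier S" using jR x by simp
    then have "x \<in> (\<lambda>a. a \<odot>\<^bsub>S\<^esub> (j \<odot>\<^bsub>S\<^esub> x)) ` carrier R" using full[OF jx n] x by simp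
    then obtain l where l: "l \<in> carrier R" "x = l \<odot>\<^bsub>S\<^esub> (j \<odot>\<^bsub>S\<^esub> x)" by blast
    have "j \<odot>\<^bsub>S\<^esub> x = j \<odot>\<^bsub>S\<^esub> (l \<odot>\<^bsub>S\<^esub> (j \<odot>\<^bsub>S\<^esub> x))" by (rule arg_cong[OF l(2)])
    also have "\<dots> = (j \<otimes> (l \<otimes> j)) \<odot>\<^bsub>S\<^esub> x" using l(1) jR x(1) by (simp add: S.smult_assoc1)
    also have "\<dots> = \<zero>\<^bsub>S\<^esub>" using JJ[OF j J_D(4)[OF j l(1)]] x(1) by simp
    finally show False using n by simp
  qed
  from S.simple_element[OF x(1,2) i(1) x(3) this] show ?thesis using full[OF x(1,2)] i(1) by auto
qed

lemma cyclic_J_unique: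
  assumes "cyclic_gen R (e i) J S x" "cyclic_gen R (e l) J S y" "i < N" "l < N" shows "i = l"
proof (rule ccontr)
  assume n: "i \<noteq> l"
  note d = cyclic_genD[OF assms(1)] and d' = cyclic_genD[OF assms(2)]
  interpret S: left_module R S by (rule d)
  obtain a where a: "a \<in> carrier R" "y = a \<odot>\<^bsub>S\<^esub> x" using d(5)[OF d'(2)] by blast
  have "y = e l \<odot>\<^bsub>S\<^esub> (a \<odot>\<^bsub>S\<^esub> (e i \<odot>\<^bsub>S\<^esub> x))" using d(3) d'(3) a(2) by simp
  also have "\<dots> = (e l \<otimes> a \<otimes> e i) \<odot>\<^bsub>S\<^esub> x" using a(1) d(2) assms by (simp add: S.smult_assoc1)
  also have "\<dots> = \<zero>\<^bsub>S\<^esub>" using cyclic_J_zero[OF assms(1,3) offdiag[OF a(1) assms(4,3)] d(2)] n by simp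
  finally show False using d'(6)[of \<one>] d'(2) e_notin[OF assms(4)] assms(4) by simp
qed

text \<open>The top of R e_i, realised as the quotient of R by the left ideal of all x with x e_i in
  J, and then moved to a representative of the type used for modules up to isomorphism.\<close>

lemma simple_exists:
  assumes i: "i < N" shows "\<exists>(S :: 'a fg_mod) x. cyclic_gen R (e i) J S x"
proof -
  let ?M = "{x \<in> carrier R. x \<otimes> e i \<in> J}"
  interpret K: left_module R "regular_module R" by (rule reg)
  have M: "submodule ?M R (regular_module R)"
    using i J_D by (intro K.submoduleI) (auto simp: l_distr m_assoc)
  define Q where "Q = quotient_module (regular_module R) ?M"
  define cl where "cl x = ?M +>\<^bsub>regular_module R\<^esub> x" for x
  note q = quotient_module_proj[OF reg M, folded Q_def cl_def, simplified]
  have lQ: "left_module R Q" unfolding Q_def by (rule left_module_quotient[OF reg M])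
  interpret Q: left_module R Q by (rule lQ)
  note h = mod_homD[OF q(1), simplified]
  have c0: "cl \<zero> = \<zero>\<^bsub>Q\<^esub>" using mod_hom_zero[OF reg lQ q(1)] by simp
  have cl_i: "cl x = l \<odot>\<^bsub>Q\<^esub> cl (e i)" if "x \<in> carrier R" "l = x" for x l
  proof -
    have "(x \<ominus> x \<otimes> e i) \<otimes> e i = \<zero>" using that i by (simp add: a_minus_def l_distr l_minus m_assoc r_neg)
    then have "cl x = cl (x \<otimes> e i)" using q(3)[of x "x \<otimes> e i"] that i J_D(2) by (simp add: a_minus_def)
    then show ?thesis using h(3)[of x "e i"] that i by simp
  qed
  have g: "cyclic_gen R (e i) J Q (cl (e i))"
    unfolding cyclic_gen_def
  proof (intro conjI ballI lQ)
    show "e i \<in> carrier R" "cl (e i) \<in> carrier Q" "e i \<odot>\<^bsub>Q\<^esub> cl (e i) = cl (e i)"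
      using i h(1) h(3)[of "e i" "e i"] by auto
    show "\<exists>l\<in>carrier R. y = l \<odot>\<^bsub>Q\<^esub> cl (e i)" if "y \<in> carrier Q" for y
      using that q(2) cl_i by auto
    fix l assume l: "l \<in> carrier R"
    have "l \<odot>\<^bsub>Q\<^esub> cl (e i) = cl \<zero> \<longleftrightarrow> l \<in> ?M"
      using cl_i[OF l refl] q(3)[OF l, of \<zero>] l by (simp add: a_minus_def)
    then show "l \<odot>\<^bsub>Q\<^esub> cl (e i) = \<zero>\<^bsub>Q\<^esub> \<longleftrightarrow> l \<otimes> e i \<in> J" using l c0 by simp
  qed
  have "fg_module R Q" by (rule Q.fg_cyclic[of "cl (e i)"]) (use cyclic_genD[OF g] in auto)
  then obtain S :: "'a fg_mod" where S: "fg_module R S" "mod_iso R Q S" using fg_module_representative by blast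
  then show ?thesis using cyclic_gen_iso[OF g] unfolding mod_iso_def fg_module_def by blast
qed

lemma num_simple_modules_eq: "num_simple_modules R = N"
proof -
  define A where "A = {S :: 'a fg_mod. simple_module R S}"
  define g where "g S = (SOME i. i < N \<and> (\<exists>x. cyclic_gen R (e i) J S x))" for S :: "'a fg_mod"
  have g: "g S < N \<and> (\<exists>x. cyclic_gen R (e (g S)) J S x)" if "S \<in> A" for S
  proof -
    have "\<exists>i<N. \<exists>x. cyclic_gen R (e i) J S x" by (rule simple_cyclic_J) (use that in \<open>simp add: A_def\<close>)
    then show ?thesis unfolding g_def by (rule someI_ex)
  qed
  have gu: "g S = i" if SA: "S \<in> A" and iN: "i < N" and cg: "cyclic_gen R (e i) J S x" for S i x
  proof -
    obtain y where "cyclic_gen R (e (g S)) J S y" using g[OF SA] by (elim conjE exE)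
    from cyclic_J_unique[OF this cg] show ?thesis using g[OF SA] iN by simp
  qed
  have "card (A // {(S, S'). S \<in> A \<and> S' \<in> A \<and> mod_iso R S S'}) = N"
  proof (rule card_quotient_by_label[of _ g])
    show "\<exists>S\<in>A. g S = i" if iN: "i < N" for i
    proof -
      obtain S :: "'a fg_mod" and x where S: "cyclic_gen R (e i) J S x" using simple_exists[OF iN] by blast
      then have "S \<in> A" using cyclic_J_simple iN by (simp add: A_def)
      from gu[OF this iN S] this show ?thesis by (rule bexI)
    qed
    show "mod_iso R S S' \<longleftrightarrow> g S = g S'" if SS: "S \<in> A" "S' \<in> A" for S S'
    proof
      obtain x y where x: "cyclic_gen R (e (g S)) J S x" and y: "cyclic_gen R (e (g S')) J S' y"
        using g[OF SS(1)] g[OF SS(2)] by (elim conjE exE)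
      show "mod_iso R S S'" if "g S = g S'"
        using cyclic_gen_hom[OF x, of J S' y] y that by (auto simp: mod_iso_def)
      assume "mod_iso R S S'"
      then obtain f where "f \<in> mod_hom R S S'" "bij_betw f (carrier S) (carrier S')" by (auto simp: mod_iso_def)
      from gu[OF SS(2) conjunct1[OF g[OF SS(1)]] cyclic_gen_iso[OF x cyclic_genD(1)[OF y] this]]
      show "g S = g S'" by simp
    qed
  qed (use g in auto)
  then show ?thesis by (simp add: num_simple_modules_def A_def Let_def)
qed

end

section \<open>Central idempotents, connectedness and loops\<close>

definition corner_ring :: "('a, 'm) ring_scheme \<Rightarrow> 'a \<Rightarrow> 'a ring" where
  "corner_ring R c = \<lparr>carrier = {x \<in> carrier R. c \<otimes>\<^bsub>R\<^esub> x = x}, mult = mult R, one = c,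
     zero = \<zero>\<^bsub>R\<^esub>, add = add R\<rparr>"

lemma (in ring) corner_ring:
  assumes c: "c \<in> carrier R" "c \<otimes> c = c" "\<And>x. x \<in> carrier R \<Longrightarrow> c \<otimes> x = x \<otimes> c"
  shows "ring (corner_ring R c)"
proof (rule ringI)
  show "abelian_group (corner_ring R c)"
  proof (rule abelian_groupI)
    show "\<exists>y\<in>carrier (corner_ring R c). y \<oplus>\<^bsub>corner_ring R c\<^esub> x = \<zero>\<^bsub>corner_ring R c\<^esub>"
      if "x \<in> carrier (corner_ring R c)" for x
      using that c(1) by (intro bexI[of _ "\<ominus> x"]) (auto simp: corner_ring_def l_neg r_minus)
  qed (use c(1) in \<open>auto simp: corner_ring_def r_distr a_ac\<close>)
  show "monoid (corner_ring R c)"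
  proof (rule monoidI)
    show "x \<otimes>\<^bsub>corner_ring R c\<^esub> y \<in> carrier (corner_ring R c)"
      if "x \<in> carrier (corner_ring R c)" "y \<in> carrier (corner_ring R c)" for x y
      using that c(1) m_assoc[of c x y] by (simp add: corner_ring_def)
    show "x \<otimes>\<^bsub>corner_ring R c\<^esub> \<one>\<^bsub>corner_ring R c\<^esub> = x" if "x \<in> carrier (corner_ring R c)" for x
      using that c(3)[of x] by (simp add: corner_ring_def)
  qed (use c(1,2) in \<open>auto simp: corner_ring_def m_assoc\<close>)
qed (auto simp: corner_ring_def l_distr r_distr)

text \<open>Otherwise R is the product of the nonzero rings c R and (1 - c) R.\<close>

lemma (in ring) central_idem_connected:
  assumes conn: "connected_ring R" and c: "c \<in> carrier R" "c \<otimes> c = c" "\<And>x. x \<in> carrier R \<Longrightarrow> c \<otimes> x = x \<otimes> c" "c \<noteq> \<zero>"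
  shows "c = \<one>"
proof (rule ccontr)
  assume n: "c \<noteq> \<one>"
  define f where "f = \<one> \<ominus> c"
  have f: "f \<in> carrier R" "f \<otimes> f = f" "f \<otimes> c = \<zero>" "c \<otimes> f = \<zero>" "c \<oplus> f = \<one>"
    using c(1,2) by (auto simp: f_def a_minus_def l_distr r_distr l_minus r_minus r_neg l_neg a_lcomm[of c] a_assoc)
  have fc: "f \<otimes> x = x \<otimes> f" if "x \<in> carrier R" for x
    using that c(1) c(3)[OF that] by (simp add: f_def a_minus_def l_distr r_distr l_minus r_minus)
  have "f \<noteq> \<zero>" using f(5) c(1) n by auto
  have rA: "ring (corner_ring R c)" and rB: "ring (corner_ring R f)"
    by (rule corner_ring[OF c(1-3)], assumption) (rule corner_ring[OF f(1,2) fc], assumption)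
  have mul: "(z \<otimes> x) \<otimes> (z \<otimes> y) = z \<otimes> (x \<otimes> y)" if z: "z \<in> carrier R" "z \<otimes> z = z" "\<And>x. x \<in> carrier R \<Longrightarrow> z \<otimes> x = x \<otimes> z"
    and xy: "x \<in> carrier R" "y \<in> carrier R" for z x y
  proof -
    have "(z \<otimes> x) \<otimes> (z \<otimes> y) = z \<otimes> (x \<otimes> z) \<otimes> y" using z(1) xy by (simp only: m_assoc m_closed)
    also have "\<dots> = z \<otimes> (z \<otimes> x) \<otimes> y" by (simp only: z(3)[OF xy(1)])
    also have "\<dots> = (z \<otimes> z) \<otimes> (x \<otimes> y)" using z(1) xy by (simp only: m_assoc m_closed)
    finally show ?thesis by (simp only: z(2))
  qed
  have split: "c \<otimes> x \<oplus> f \<otimes> x = x" if "x \<in> carrier R" for x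
    using that c(1) f(1,5) l_distr[of c f x] by simp
  have cc: "z \<otimes> (z \<otimes> x) = z \<otimes> x" if "z \<in> carrier R" "z \<otimes> z = z" "x \<in> carrier R" for z x
    using that by (simp add: m_assoc[symmetric])
  have hom: "(\<lambda>x. (c \<otimes> x, f \<otimes> x)) \<in> ring_hom R (RDirProd (corner_ring R c) (corner_ring R f))"
    using c(1,2) f(1,2) mul[OF c(1-3)] mul[OF f(1,2) fc] cc
    by (intro ring_hom_memI) (auto simp: RDirProd_def DirProd_def monoid.defs corner_ring_def r_distr)
  moreover have "bij_betw (\<lambda>x. (c \<otimes> x, f \<otimes> x)) (carrier R) (carrier (RDirProd (corner_ring R c) (corner_ring R f)))"
  proof (rule bij_betw_byWitness[of _ "\<lambda>(a, b). a \<oplus> b"])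
    show "\<forall>a'\<in>carrier (RDirProd (corner_ring R c) (corner_ring R f)).
      (c \<otimes> (case a' of (a, b) \<Rightarrow> a \<oplus> b), f \<otimes> (case a' of (a, b) \<Rightarrow> a \<oplus> b)) = a'"
    proof
      fix a' assume "a' \<in> carrier (RDirProd (corner_ring R c) (corner_ring R f))"
      then obtain a b where ab: "a' = (a, b)" "a \<in> carrier R" "c \<otimes> a = a" "b \<in> carrier R" "f \<otimes> b = b"
        by (auto simp: RDirProd_def DirProd_def monoid.defs corner_ring_def)
      have "c \<otimes> (f \<otimes> b) = \<zero>" "f \<otimes> (c \<otimes> a) = \<zero>"
        using ab(2,4) c(1) f(1) f(3,4) by (simp_all add: m_assoc[symmetric])
      then have "c \<otimes> b = \<zero>" "f \<otimes> a = \<zero>" using ab(3,5) by simp_all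
      then show "(c \<otimes> (case a' of (a, b) \<Rightarrow> a \<oplus> b), f \<otimes> (case a' of (a, b) \<Rightarrow> a \<oplus> b)) = a'"
        using ab c(1) f(1) by (simp add: r_distr)
    qed
  qed (use split c(1,2) f(1,2) cc in \<open>auto simp: RDirProd_def DirProd_def monoid.defs corner_ring_def\<close>)
  ultimately have "R \<simeq> RDirProd (corner_ring R c) (corner_ring R f)"
    by (auto simp: is_ring_iso_def ring_iso_def)
  moreover have "carrier (corner_ring R c) \<noteq> {\<zero>\<^bsub>corner_ring R c\<^esub>}" "carrier (corner_ring R f) \<noteq> {\<zero>\<^bsub>corner_ring R f\<^esub>}"
  proof -
    have "c \<in> carrier (corner_ring R c)" "f \<in> carrier (corner_ring R f)"
      using c(1,2) f(1,2) by (auto simp: corner_ring_def)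
    moreover have "\<zero>\<^bsub>corner_ring R c\<^esub> = \<zero>" "\<zero>\<^bsub>corner_ring R f\<^esub> = \<zero>" by (auto simp: corner_ring_def)
    ultimately show "carrier (corner_ring R c) \<noteq> {\<zero>\<^bsub>corner_ring R c\<^esub>}" "carrier (corner_ring R f) \<noteq> {\<zero>\<^bsub>corner_ring R f\<^esub>}"
      using c(4) \<open>f \<noteq> \<zero>\<close> by force+
  qed
  ultimately show False using conn rA rB unfolding connected_ring_def by blast
qed

text \<open>A nonzero w in e_i J e_i generates e_i J on the right and J e_i on the left. An element
  of e_i R e_l with l different from i is then w times an element of e_i R e_l, a product of two
  radical elements, hence zero; likewise on the other side. So e_i is central and equals 1.\<close>

lemma (in nak_ring) no_loop:
  assumes conn: "connected_ring R" and nsl: "\<not> (self_injective R \<and> local_ring R)"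
    and i: "i < N" and u: "u \<in> J"
  shows "e i \<otimes> u \<otimes> e i = \<zero>"
proof (rule ccontr)
  assume n: "e i \<otimes> u \<otimes> e i \<noteq> \<zero>"
  define w where "w = e i \<otimes> u \<otimes> e i"
  have uR: "u \<in> carrier R" using u J_D by simp
  have w: "w \<in> J" "w \<in> carrier R" "w \<noteq> \<zero>" "e i \<otimes> w = w" "w \<otimes> e i = w"
    using u uR i J_D(4,5) n by (auto simp: w_def m_assoc) (simp_all add: m_assoc[symmetric])
  have z1: "e i \<otimes> x \<otimes> e l = \<zero>" if x: "x \<in> carrier R" "l < N" "l \<noteq> i" for x l
  proof -
    have "e i \<otimes> (e i \<otimes> x \<otimes> e l) = e i \<otimes> x \<otimes> e l" using x i by (simp add: m_assoc[symmetric])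
    then obtain a where a: "a \<in> carrier R" "e i \<otimes> x \<otimes> e l = w \<otimes> a"
      using right_uni[OF i w(1) offdiag[OF x(1) i x(2)] w(4) _ w(3)] x(3) by auto
    have "e i \<otimes> x \<otimes> e l = (e i \<otimes> x \<otimes> e l) \<otimes> e l" using x i by (simp add: m_assoc)
    also have "\<dots> = (w \<otimes> e i) \<otimes> (a \<otimes> e l)" unfolding a(2) w(5) using a(1) w(2) x by (simp add: m_assoc)
    also have "\<dots> = w \<otimes> (e i \<otimes> a \<otimes> e l)" using a(1) w(2) x i by (simp only: m_assoc e_closed m_closed)
    also have "\<dots> = \<zero>" using JJ[OF w(1) offdiag[OF a(1) i x(2)]] x(3) by auto
    finally show ?thesis .
  qed
  have z2: "e l \<otimes> x \<otimes> e i = \<zero>" if x: "x \<in> carrier R" "l < N" "l \<noteq> i" for x l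
  proof -
    have "(e l \<otimes> x \<otimes> e i) \<otimes> e i = e l \<otimes> x \<otimes> e i" using x i by (simp add: m_assoc)
    then obtain a where a: "a \<in> carrier R" "e l \<otimes> x \<otimes> e i = a \<otimes> w"
      using left_uni[OF i w(1) offdiag[OF x(1,2) i x(3)] w(5) _ w(3)] by auto
    have "e l \<otimes> x \<otimes> e i = e l \<otimes> (e l \<otimes> x \<otimes> e i)" using x i by (simp add: m_assoc[symmetric])
    also have "\<dots> = e l \<otimes> (a \<otimes> (e i \<otimes> w))" using a w(4) by simp
    also have "\<dots> = (e l \<otimes> a \<otimes> e i) \<otimes> w" using a(1) w(2) x i by (simp add: m_assoc)
    also have "\<dots> = \<zero>" using JJ[OF offdiag[OF a(1) x(2) i x(3)] w(1)] .
    finally show ?thesis .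
  qed
  have cen: "e i \<otimes> x = x \<otimes> e i" if x: "x \<in> carrier R" for x
  proof -
    have "e i \<otimes> x = (\<Oplus>l\<in>{..<N}. e i \<otimes> x \<otimes> e l)" using e_decomp_right[of "e i \<otimes> x"] x i by simp
    also have "\<dots> = (\<Oplus>l\<in>{..<N}. if i = l then e i \<otimes> x \<otimes> e i else \<zero>)"
      using z1[OF x] x i by (intro finsum_cong') auto
    also have "\<dots> = e i \<otimes> x \<otimes> e i" using add.finprod_singleton[of i "{..<N}" "\<lambda>_. e i \<otimes> x \<otimes> e i"] i x by simp
    finally have 1: "e i \<otimes> x = e i \<otimes> x \<otimes> e i" .
    have "x \<otimes> e i = (\<Oplus>l\<in>{..<N}. e l \<otimes> (x \<otimes> e i))" using e_decomp_left[of "x \<otimes> e i"] x i by simp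
    also have "\<dots> = (\<Oplus>l\<in>{..<N}. if i = l then e i \<otimes> x \<otimes> e i else \<zero>)"
      using z2[OF x] x i by (intro finsum_cong') (auto simp: m_assoc[symmetric])
    also have "\<dots> = e i \<otimes> x \<otimes> e i" using add.finprod_singleton[of i "{..<N}" "\<lambda>_. e i \<otimes> x \<otimes> e i"] i x by simp
    finally show ?thesis using 1 by simp
  qed
  have one: "e i = \<one>" by (rule central_idem_connected[OF conn]) (use i cen e_ne_0 in auto)
  interpret K: left_module R "regular_module R" by (rule reg)
  have JK: "submodule J R (regular_module R)" using J_D by (intro K.submoduleI) auto
  have full: "X = carrier R" if X: "submodule X R (regular_module R)" "\<not> X \<subseteq> J" for X
  proof -
    note D = K.submoduleD[OF X(1), simplified]
    obtain x where x: "x \<in> X" "x \<notin> J" using X(2) by blast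
    have xR: "x \<in> carrier R" using D(3) x by simp
    have "x \<otimes> e i \<notin> J" using x xR one by simp
    then obtain y where "y \<in> carrier R" "y \<otimes> x \<otimes> e i = e i" using left_unit[OF xR i] by blast
    then have "\<one> \<in> X" using D(5)[of y x] x xR one by simp
    then have "z \<in> X" if "z \<in> carrier R" for z using D(5)[OF that, of \<one>] that by simp
    then show ?thesis using D(1) by auto
  qed
  have Jn: "J \<noteq> carrier R" using e_notin[OF i] i by auto
  have "maximal_submodule R (regular_module R) J"
    unfolding maximal_submodule_def using JK Jn full by auto
  moreover have "X = J" if "maximal_submodule R (regular_module R) X" for X
    using that full[of X] JK Jn unfolding maximal_submodule_def by auto
  ultimately have loc: "local_ring R" unfolding local_ring_def by blast
  \<comment> \<open>With e_i = 1 the element w shows that R itself has nonzero radical, so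
    \<open>injective_extend\<close> applies to maps into R; the test embedding is replaced by the
    inclusion of its image.\<close>
  have "injective_module R (regular_module R)"
    unfolding injective_module_def
  proof (intro conjI allI impI fg_regular, elim conjE)
    fix A B :: "'a fg_mod" and \<iota> f
    assume AB: "fg_module R A" "fg_module R B" "\<iota> \<in> mod_hom R A B" "inj_on \<iota> (carrier A)" "f \<in> mod_hom R A (regular_module R)"
    have lA: "left_module R A" and lB: "left_module R B" using AB by (auto simp: fg_module_def)
    interpret A: left_module R A by (rule lA)
    interpret B: nak_module R N e J B by (intro nak_module.intro nak_ring_axioms lB)
    let ?X = "\<iota> ` carrier A"
    have X: "submodule ?X R B" by (rule submodule_image[OF lA lB AB(3) A.submodule_carrier])
    have ih: "\<iota> \<in> mod_hom R A (sub_mod B ?X)" by (rule mod_hom_into_sub[OF AB(3)]) simp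
    have ib: "bij_betw \<iota> (carrier A) (carrier (sub_mod B ?X))" using AB(4) by (simp add: bij_betw_def)
    let ?g = "\<lambda>x. f (inv_into (carrier A) \<iota> x)"
    have g: "?g \<in> mod_hom R (sub_mod B ?X) (regular_module R)"
      by (rule mod_hom_compose[OF inv_into_mod_hom[OF lA ih ib] AB(5)])
    have ge: "?g x \<otimes> e i = ?g x" if "x \<in> ?X" for x using mod_homD(1)[OF g, of x] that one by simp
    obtain F where F: "F \<in> mod_hom R B (regular_module R)" "\<forall>x\<in>?X. F x = ?g x"
      using B.injective_extend[OF AB(2) i w(1) _ X g ge] w(3,5) by auto
    have "F (\<iota> x) = f x" if "x \<in> carrier A" for x using F(2) that inv_into_f_f[OF AB(4) that] by auto
    then show "\<exists>h\<in>mod_hom R B (regular_module R). \<forall>x\<in>carrier A. h (\<iota> x) = f x" using F(1) by blast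
  qed
  then show False using nsl loc by (simp add: self_injective_def)
qed

text \<open>Opens the choice made in \<open>tau\<close>: minimal presentations exist, so the chosen
  tuple is one, and the dual of its transpose is paired with Hom(P1, R).\<close>

lemma (in nak_algebra) tau_presentation:
  assumes fg: "fg_module R M"
  shows "\<exists>P1 d P0 p. nak_presentation R N e J k \<phi> E \<iota> M P1 d P0 p (tau k \<phi> E R M) (dual_ev R P1 d P0)"
proof -
  have lM: "left_module R M" using fg by (simp add: fg_module_def)
  interpret M: nak_module R N e J M by (intro nak_module.intro nak_ring_axioms lM)
  let ?p = "\<lambda>z :: ('a, _) presentation. case z of (P1, d, P0, p) \<Rightarrow> minimal_projective_presentation R P1 d P0 p M"
  obtain P1 d P0 p where z: "(SOME z. ?p z) = (P1, d, P0, p)" by (metis prod_cases4)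
  have "?p (SOME z. ?p z)" by (rule someI_ex[OF M.minimal_presentation_exists[OF fg]])
  then have pres: "minimal_projective_presentation R P1 d P0 p M" unfolding z by simp
  have t: "tau k \<phi> E R M = dual_module k \<phi> E (transpose_module R P1 d P0)"
    unfolding tau_def z by simp
  have c: "projective_cover R P0 p M" "projective_cover R P1 d (sub_mod P0 (a_kernel P0 M p))"
    using pres by (auto simp: minimal_projective_presentation_def)
  have lP: "left_module R P0" "left_module R P1"
    using c by (simp_all add: projective_cover_def projective_module_def fg_module_def)
  have "d \<in> mod_hom R P1 P0" using c(2) by (auto simp: projective_cover_def mod_hom_def a_kernel_eq Pi_iff)
  then have "pairing k \<phi> E R P1 d P0 (tau k \<phi> E R M) (dual_ev R P1 d P0)"
    unfolding t by (rule pairing_dual_transpose[OF algebra E_module lP(2,1)])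
  then have "nak_presentation R N e J k \<phi> E \<iota> M P1 d P0 p (tau k \<phi> E R M) (dual_ev R P1 d P0)"
    by (intro nak_presentation.intro nak_presentation_axioms.intro nak_algebra_axioms lM pres)
  then show ?thesis by blast
qed

section \<open>Translates of cyclic and of semisimple modules\<close>

context nak_presentation
begin

lemma P0_combos:
  assumes K: "finite K" and \<delta>: "\<And>k. k \<in> K \<Longrightarrow> \<delta> k \<in> carrier M" "M.combos K \<delta> = carrier M"
    and z: "\<And>k. k \<in> K \<Longrightarrow> z k \<in> carrier P0" "\<And>k. k \<in> K \<Longrightarrow> p (z k) = \<delta> k"
  shows "P0.combos K z = carrier P0"
proof (rule superfluousD[OF p(3) P0(2) P0.submodule_combos[OF K]])
  show "z \<in> K \<rightarrow> carrier P0" using z by auto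
  fix w assume w: "w \<in> carrier P0"
  obtain l where l: "l \<in> K \<rightarrow> carrier R" "p w = (\<Oplus>\<^bsub>M\<^esub>k\<in>K. l k \<odot>\<^bsub>M\<^esub> \<delta> k)"
    using mod_homD(1)[OF p(1) w] \<delta>(2) by (auto simp: M.combos_def)
  let ?v = "\<Oplus>\<^bsub>P0\<^esub>k\<in>K. l k \<odot>\<^bsub>P0\<^esub> z k"
  have v: "?v \<in> P0.combos K z" using l(1) by (auto simp: P0.combos_def)
  have vP: "?v \<in> carrier P0" using l(1) z(1) by (intro P0.M.finsum_closed) (auto simp: Pi_iff)
  have "p ?v = (\<Oplus>\<^bsub>M\<^esub>k\<in>K. p (l k \<odot>\<^bsub>P0\<^esub> z k))"
    using l(1) z(1) by (intro mod_hom_finsum[OF P0(2) M.left_module_axioms p(1)]) (auto simp: Pi_iff)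
  also have "\<dots> = p w"
    unfolding l(2) using l(1) z \<delta>(1) mod_homD(3)[OF p(1)] by (intro M.M.finsum_cong') (auto simp: Pi_iff)
  finally have "p (w \<ominus>\<^bsub>P0\<^esub> ?v) = \<zero>\<^bsub>M\<^esub>"
    using mod_hom_diff[OF P0(2) M.left_module_axioms p(1) w vP] mod_homD(1)[OF p(1) w] by (simp add: a_minus_def M.M.r_neg)
  then have "w \<ominus>\<^bsub>P0\<^esub> ?v \<in> \<Omega>" using w vP by (simp add: a_kernel_eq)
  moreover have "w = (w \<ominus>\<^bsub>P0\<^esub> ?v) \<oplus>\<^bsub>P0\<^esub> ?v" using w vP by (simp add: a_minus_def P0.M.a_assoc P0.M.l_neg)
  ultimately show "\<exists>k\<in>\<Omega>. \<exists>x\<in>P0.combos K z. w = k \<oplus>\<^bsub>P0\<^esub> x" using v by blast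
qed

text \<open>P0 is generated by one lift z = e_i z, and the syzygy consists of multiples l z with l
  e_i in I. Without loops e_i kills them, so e_i kills Y; but f x = e_i f x.\<close>

lemma cyclic_hom_zero:
  assumes i: "i < N" and g: "cyclic_gen R (e i) I M x" and I: "I \<subseteq> J"
    and nl: "\<And>u. u \<in> I \<Longrightarrow> e i \<otimes> u \<otimes> e i = \<zero>"
    and f: "f \<in> mod_hom R M Y" "y \<in> carrier M"
  shows "f y = \<zero>\<^bsub>Y\<^esub>"
proof -
  note d = cyclic_genD[OF g]
  obtain z where z: "z \<in> carrier P0" "p z = x" "e i \<odot>\<^bsub>P0\<^esub> z = z" using lift_P0[OF d(2) i d(3)] by blast
  have "y \<in> M.combos {0::nat} (\<lambda>_. x)" if yM: "y \<in> carrier M" for y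
  proof -
    obtain l where l: "l \<in> carrier R" "y = l \<odot>\<^bsub>M\<^esub> x" using d(5)[OF yM] by blast
    have "(\<Oplus>\<^bsub>M\<^esub>k\<in>{0::nat}. (\<lambda>_. l) k \<odot>\<^bsub>M\<^esub> x) = y" using l d(2) by (subst M.M.finsum_insert) auto
    then show ?thesis using l(1) unfolding M.combos_def by (intro CollectI exI[of _ "\<lambda>_. l"]) auto
  qed
  moreover have "M.combos {0::nat} (\<lambda>_. x) \<subseteq> carrier M"
    by (rule M.submoduleD(1)[OF M.submodule_combos]) (use d in auto)
  ultimately have "M.combos {0::nat} (\<lambda>_. x) = carrier M" by blast
  from P0_combos[of "{0::nat}" "\<lambda>_. x" "\<lambda>_. z", OF _ _ this]
  have P0z: "P0.combos {0::nat} (\<lambda>_. z) = carrier P0" using d z by auto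
  have "e i \<odot>\<^bsub>P0\<^esub> w = \<zero>\<^bsub>P0\<^esub>" if w: "w \<in> \<Omega>" for w
  proof -
    have wP: "w \<in> carrier P0" "p w = \<zero>\<^bsub>M\<^esub>" using w by (auto simp: a_kernel_eq)
    obtain l where l: "l \<in> {0::nat} \<rightarrow> carrier R" "w = (\<Oplus>\<^bsub>P0\<^esub>k\<in>{0::nat}. l k \<odot>\<^bsub>P0\<^esub> z)"
      using P0z wP(1) by (auto simp: P0.combos_def)
    have lR: "l 0 \<in> carrier R" using l(1) by auto
    have wl: "w = l 0 \<odot>\<^bsub>P0\<^esub> z" unfolding l(2) using lR z by (subst P0.M.finsum_insert) auto
    then have "l 0 \<odot>\<^bsub>M\<^esub> x = \<zero>\<^bsub>M\<^esub>" using wP(2) mod_homD(3)[OF p(1) lR z(1)] z(2) by simp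
    then have "l 0 \<otimes> e i \<in> I" using d(6)[OF lR] by simp
    then have "e i \<otimes> (l 0 \<otimes> e i) \<otimes> e i = \<zero>" by (rule nl)
    then have "e i \<otimes> l 0 \<otimes> e i = \<zero>" using lR i by (simp add: m_assoc)
    moreover have "e i \<odot>\<^bsub>P0\<^esub> w = (e i \<otimes> l 0 \<otimes> e i) \<odot>\<^bsub>P0\<^esub> z" using wl z lR i by (simp add: P0.smult_assoc1)
    ultimately show ?thesis using z by simp
  qed
  then have "e i \<odot>\<^bsub>Y\<^esub> f x = \<zero>\<^bsub>Y\<^esub>" using mod_homD(1)[OF f(1) d(2)] by (intro Y_component_zero[OF i]) auto
  then have fx: "f x = \<zero>\<^bsub>Y\<^esub>" using mod_homD(3)[OF f(1) d(4,2)] d(3) by simp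
  obtain l where l: "l \<in> carrier R" "y = l \<odot>\<^bsub>M\<^esub> x" using d(5)[OF f(2)] by blast
  then show ?thesis using mod_homD(3)[OF f(1) l(1) d(2)] fx by simp
qed

end

lemma (in nak_algebra) indecomposable_tau_rigid:
  assumes nl: "\<And>i u. \<lbrakk>i < N; u \<in> J\<rbrakk> \<Longrightarrow> e i \<otimes> u \<otimes> e i = \<zero>"
    and fg: "fg_module R M" and ind: "indecomposable_module R M"
  shows "tau_rigid k \<phi> E R M"
proof -
  have lM: "left_module R M" using fg by (simp add: fg_module_def)
  interpret M: nak_module R N e J M by (intro nak_module.intro nak_ring_axioms lM)
  obtain i x I where i: "i < N" and g: "cyclic_gen R (e i) I M x" and I: "I = {\<zero>} \<or> I = J"
    using M.indecomposable_cyclic_gen[OF fg ind] by blast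
  obtain P1 d P0 p where "nak_presentation R N e J k \<phi> E \<iota> M P1 d P0 p (tau k \<phi> E R M) (dual_ev R P1 d P0)"
    using tau_presentation[OF fg] by blast
  then interpret T: nak_presentation R N e J k \<phi> E \<iota> M P1 d P0 p "tau k \<phi> E R M" "dual_ev R P1 d P0" .
  have "I \<subseteq> J" using I J_D(2) by auto
  moreover have "\<And>u. u \<in> I \<Longrightarrow> e i \<otimes> u \<otimes> e i = \<zero>" using nl[OF i] \<open>I \<subseteq> J\<close> by blast
  ultimately show ?thesis
    unfolding tau_rigid_def using fg T.cyclic_hom_zero[OF i g] by blast
qed

text \<open>By \<open>indep\<close> the relations have coefficients in J e_(a k), which u_k
  generates, so the syzygy is spanned by v_k = u_k z_k. Since c is injective, each v_k lives at its
  own idempotent e_(c k); the components of the syzygy are thus cyclic or zero, and the same follows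
  for Y.\<close>

lemma (in nak_presentation) semisimple_tau:
  assumes K: "finite K" and a: "\<And>k. k \<in> K \<Longrightarrow> a k < N" and c: "\<And>k. k \<in> K \<Longrightarrow> c k < N" "inj_on c K"
    and \<delta>: "\<And>k. k \<in> K \<Longrightarrow> \<delta> k \<in> carrier M" "\<And>k. k \<in> K \<Longrightarrow> e (a k) \<odot>\<^bsub>M\<^esub> \<delta> k = \<delta> k" "\<And>k. k \<in> K \<Longrightarrow> \<delta> k \<noteq> \<zero>\<^bsub>M\<^esub>"
      "M.combos K \<delta> = carrier M"
    and indep: "\<And>l k. \<lbrakk>l \<in> K \<rightarrow> carrier R; (\<Oplus>\<^bsub>M\<^esub>k\<in>K. l k \<odot>\<^bsub>M\<^esub> \<delta> k) = \<zero>\<^bsub>M\<^esub>; k \<in> K\<rbrakk> \<Longrightarrow> l k \<otimes> e (a k) \<in> J"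
    and u: "\<And>k. k \<in> K \<Longrightarrow> u k \<in> J" "\<And>k. k \<in> K \<Longrightarrow> e (c k) \<otimes> u k = u k" "\<And>k. k \<in> K \<Longrightarrow> u k \<otimes> e (a k) = u k"
      "\<And>k. k \<in> K \<Longrightarrow> u k \<noteq> \<zero>"
    and JM: "\<And>j x. \<lbrakk>j \<in> J; x \<in> carrier M\<rbrakk> \<Longrightarrow> j \<odot>\<^bsub>M\<^esub> x = \<zero>\<^bsub>M\<^esub>"
  shows "\<exists>yy. (\<forall>l\<in>c ` K. yy l \<in> carrier Y \<and> e l \<odot>\<^bsub>Y\<^esub> yy l = yy l \<and> yy l \<noteq> \<zero>\<^bsub>Y\<^esub> \<and>
      (\<forall>y\<in>carrier Y. \<exists>b\<in>carrier R. e l \<odot>\<^bsub>Y\<^esub> y = b \<odot>\<^bsub>Y\<^esub> yy l)) \<and>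
    (\<forall>l<N. l \<notin> c ` K \<longrightarrow> (\<forall>y\<in>carrier Y. e l \<odot>\<^bsub>Y\<^esub> y = \<zero>\<^bsub>Y\<^esub>))"
proof -
  have "\<exists>z. z \<in> carrier P0 \<and> p z = \<delta> k \<and> e (a k) \<odot>\<^bsub>P0\<^esub> z = z" if "k \<in> K" for k
    using lift_P0[OF \<delta>(1)[OF that] a[OF that] \<delta>(2)[OF that]] by blast
  then obtain z where z: "\<And>k. k \<in> K \<Longrightarrow> z k \<in> carrier P0 \<and> p (z k) = \<delta> k \<and> e (a k) \<odot>\<^bsub>P0\<^esub> z k = z k" by metis
  have P0z: "P0.combos K z = carrier P0" by (rule P0_combos[OF K \<delta>(1,4)]) (use z in auto)
  define v where "v k = u k \<odot>\<^bsub>P0\<^esub> z k" for k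
  have uR: "u k \<in> carrier R" if "k \<in> K" for k using u(1)[OF that] J_D by simp
  have idh: "(\<lambda>x. x) \<in> mod_hom R M M" by (auto simp: mod_hom_def)
  have v: "v k \<in> \<Omega>" "e (c k) \<odot>\<^bsub>P0\<^esub> v k = v k" "v k \<noteq> \<zero>\<^bsub>P0\<^esub>" if k: "k \<in> K" for k
  proof -
    have "u k \<otimes> e (a k) \<noteq> \<zero>" using u(3,4)[OF k] by simp
    note w = \<Omega>_nonzero[OF a[OF k] c(1)[OF k] \<delta>(1,2)[OF k] JM[OF _ \<delta>(1)[OF k]] u(1,2)[OF k] this
        M.left_module_axioms JM idh \<delta>(3)[OF k]]
    show "v k \<in> \<Omega>" "e (c k) \<odot>\<^bsub>P0\<^esub> v k = v k" "v k \<noteq> \<zero>\<^bsub>P0\<^esub>"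
      unfolding v_def using w[of "z k"] z[OF k] by auto
  qed
  have vP: "v k \<in> carrier P0" if "k \<in> K" for k using P0.submoduleD(3)[OF \<Omega>_sub v(1)[OF that]] .
  have Jv: "j \<odot>\<^bsub>P0\<^esub> v k = \<zero>\<^bsub>P0\<^esub>" if "k \<in> K" "j \<in> J" for j k
    using J_rad[OF P0(1) _ that(2)] \<Omega>_rad v(1)[OF that(1)] by blast
  have \<Omega>v: "\<exists>b. b \<in> K \<rightarrow> carrier R \<and> w = (\<Oplus>\<^bsub>P0\<^esub>k\<in>K. b k \<odot>\<^bsub>P0\<^esub> v k)" if w: "w \<in> \<Omega>" for w
  proof -
    have wP: "w \<in> carrier P0" "p w = \<zero>\<^bsub>M\<^esub>" using w by (auto simp: a_kernel_eq)
    obtain l where l: "l \<in> K \<rightarrow> carrier R" "w = (\<Oplus>\<^bsub>P0\<^esub>k\<in>K. l k \<odot>\<^bsub>P0\<^esub> z k)"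
      using P0z wP(1) by (auto simp: P0.combos_def)
    have "(\<Oplus>\<^bsub>M\<^esub>k\<in>K. l k \<odot>\<^bsub>M\<^esub> \<delta> k) = (\<Oplus>\<^bsub>M\<^esub>k\<in>K. p (l k \<odot>\<^bsub>P0\<^esub> z k))"
      using l(1) z \<delta>(1) mod_homD(3)[OF p(1)] mod_homD(1)[OF p(1)] by (intro M.M.finsum_cong') (auto simp: Pi_iff)
    also have "\<dots> = p w"
      unfolding l(2) using l(1) z by (intro mod_hom_finsum[OF P0(2) M.left_module_axioms p(1), symmetric]) (auto simp: Pi_iff)
    finally have lJ: "l k \<otimes> e (a k) \<in> J" if "k \<in> K" for k using indep[OF l(1) _ that] wP(2) by simp
    have "\<exists>b\<in>carrier R. l k \<otimes> e (a k) = b \<otimes> u k" if k: "k \<in> K" for k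
    proof -
      have "l k \<in> carrier R" using l(1) k by auto
      then show ?thesis
        using left_uni[OF a[OF k] u(1)[OF k] lJ[OF k] u(3)[OF k] _ u(4)[OF k]] a[OF k] by (simp add: m_assoc)
    qed
    then obtain b where b: "\<And>k. k \<in> K \<Longrightarrow> b k \<in> carrier R \<and> l k \<otimes> e (a k) = b k \<otimes> u k" by metis
    have "w = (\<Oplus>\<^bsub>P0\<^esub>k\<in>K. b k \<odot>\<^bsub>P0\<^esub> v k)"
      unfolding l(2)
    proof (rule P0.M.finsum_cong'[OF refl])
      show "(\<lambda>k. b k \<odot>\<^bsub>P0\<^esub> v k) \<in> K \<rightarrow> carrier P0" using b vP by auto
      fix k assume k: "k \<in> K"
      have lk: "l k \<in> carrier R" using l(1) k by auto
      have "l k \<odot>\<^bsub>P0\<^esub> z k = (l k \<otimes> e (a k)) \<odot>\<^bsub>P0\<^esub> z k" using lk z[OF k] a[OF k] by (simp add: P0.smult_assoc1)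
      also have "\<dots> = b k \<odot>\<^bsub>P0\<^esub> v k"
        using b[OF k] uR[OF k] z[OF k] by (simp add: v_def P0.smult_assoc1)
      finally show "l k \<odot>\<^bsub>P0\<^esub> z k = b k \<odot>\<^bsub>P0\<^esub> v k" .
    qed
    then show ?thesis using b by (intro exI[of _ b]) auto
  qed
  have el: "e l \<odot>\<^bsub>P0\<^esub> (\<Oplus>\<^bsub>P0\<^esub>k\<in>K. b k \<odot>\<^bsub>P0\<^esub> v k) = (\<Oplus>\<^bsub>P0\<^esub>k\<in>K. if l = c k then (e l \<otimes> b k) \<odot>\<^bsub>P0\<^esub> v k else \<zero>\<^bsub>P0\<^esub>)"
    if l: "l < N" and b: "b \<in> K \<rightarrow> carrier R" for l b
  proof -
    have "e l \<odot>\<^bsub>P0\<^esub> (\<Oplus>\<^bsub>P0\<^esub>k\<in>K. b k \<odot>\<^bsub>P0\<^esub> v k) = (\<Oplus>\<^bsub>P0\<^esub>k\<in>K. e l \<odot>\<^bsub>P0\<^esub> (b k \<odot>\<^bsub>P0\<^esub> v k))"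
      using l b vP by (intro P0.finsum_smult_r) (auto simp: Pi_iff)
    also have "\<dots> = (\<Oplus>\<^bsub>P0\<^esub>k\<in>K. if l = c k then (e l \<otimes> b k) \<odot>\<^bsub>P0\<^esub> v k else \<zero>\<^bsub>P0\<^esub>)"
    proof (rule P0.M.finsum_cong'[OF refl])
      show "(\<lambda>k. if l = c k then (e l \<otimes> b k) \<odot>\<^bsub>P0\<^esub> v k else \<zero>\<^bsub>P0\<^esub>) \<in> K \<rightarrow> carrier P0" using l b vP by (auto simp: Pi_iff)
      fix k assume k: "k \<in> K"
      have bk: "b k \<in> carrier R" using b k by auto
      have "e l \<odot>\<^bsub>P0\<^esub> (b k \<odot>\<^bsub>P0\<^esub> v k) = e l \<odot>\<^bsub>P0\<^esub> (b k \<odot>\<^bsub>P0\<^esub> (e (c k) \<odot>\<^bsub>P0\<^esub> v k))" using v(2)[OF k] by simp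
      also have "\<dots> = (e l \<otimes> b k \<otimes> e (c k)) \<odot>\<^bsub>P0\<^esub> v k" using l bk vP[OF k] c(1)[OF k] by (simp add: P0.smult_assoc1)
      finally have *: "e l \<odot>\<^bsub>P0\<^esub> (b k \<odot>\<^bsub>P0\<^esub> v k) = (e l \<otimes> b k \<otimes> e (c k)) \<odot>\<^bsub>P0\<^esub> v k" .
      show "e l \<odot>\<^bsub>P0\<^esub> (b k \<odot>\<^bsub>P0\<^esub> v k) = (if l = c k then (e l \<otimes> b k) \<odot>\<^bsub>P0\<^esub> v k else \<zero>\<^bsub>P0\<^esub>)"
      proof (cases "l = c k")
        case True then show ?thesis using l bk vP[OF k] by (simp add: P0.smult_assoc1)
      next
        case False then show ?thesis using * Jv[OF k offdiag[OF bk l c(1)[OF k] False]] by simp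
      qed
    qed
    finally show ?thesis .
  qed
  have out: "e l \<odot>\<^bsub>Y\<^esub> y = \<zero>\<^bsub>Y\<^esub>" if l: "l < N" "l \<notin> c ` K" and y: "y \<in> carrier Y" for l y
  proof (rule Y_component_zero[OF l(1) _ y])
    fix w assume "w \<in> \<Omega>"
    then obtain b where b: "b \<in> K \<rightarrow> carrier R" "w = (\<Oplus>\<^bsub>P0\<^esub>k\<in>K. b k \<odot>\<^bsub>P0\<^esub> v k)" using \<Omega>v by blast
    show "e l \<odot>\<^bsub>P0\<^esub> w = \<zero>\<^bsub>P0\<^esub>"
      unfolding b(2) el[OF l(1) b(1)] using l(2) by (intro P0.M.add.finprod_one_eqI) auto
  qed
  have "\<exists>y0. y0 \<in> carrier Y \<and> e (c k) \<odot>\<^bsub>Y\<^esub> y0 = y0 \<and> y0 \<noteq> \<zero>\<^bsub>Y\<^esub> \<and> (\<forall>y\<in>carrier Y. \<exists>b\<in>carrier R. e (c k) \<odot>\<^bsub>Y\<^esub> y = b \<odot>\<^bsub>Y\<^esub> y0)"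
    if k: "k \<in> K" for k
  proof -
    have "\<exists>l\<in>carrier R. e (c k) \<odot>\<^bsub>P0\<^esub> w = l \<odot>\<^bsub>P0\<^esub> v k" if "w \<in> \<Omega>" for w
    proof -
      obtain b where b: "b \<in> K \<rightarrow> carrier R" "w = (\<Oplus>\<^bsub>P0\<^esub>k\<in>K. b k \<odot>\<^bsub>P0\<^esub> v k)" using \<Omega>v[OF \<open>w \<in> \<Omega>\<close>] by blast
      have "e (c k) \<odot>\<^bsub>P0\<^esub> w = (\<Oplus>\<^bsub>P0\<^esub>k'\<in>K. if c k = c k' then (e (c k) \<otimes> b k') \<odot>\<^bsub>P0\<^esub> v k' else \<zero>\<^bsub>P0\<^esub>)"
        unfolding b(2) by (rule el[OF c(1)[OF k] b(1)])
      also have "\<dots> = (\<Oplus>\<^bsub>P0\<^esub>k'\<in>K. if k = k' then (e (c k) \<otimes> b k') \<odot>\<^bsub>P0\<^esub> v k' else \<zero>\<^bsub>P0\<^esub>)"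
        using b(1) vP c k by (intro P0.M.finsum_cong') (auto simp: Pi_iff inj_on_eq_iff)
      also have "\<dots> = (e (c k) \<otimes> b k) \<odot>\<^bsub>P0\<^esub> v k"
        using P0.M.add.finprod_singleton[OF k K, of "\<lambda>k'. (e (c k) \<otimes> b k') \<odot>\<^bsub>P0\<^esub> v k'"] b(1) vP c(1) k by (simp add: Pi_iff)
      finally show ?thesis using b(1) c(1)[OF k] k by auto
    qed
    then show ?thesis using Y_component[OF c(1)[OF k] v[OF k]] by blast
  qed
  then obtain y0 where y0: "\<And>k. k \<in> K \<Longrightarrow> y0 k \<in> carrier Y \<and> e (c k) \<odot>\<^bsub>Y\<^esub> y0 k = y0 k \<and> y0 k \<noteq> \<zero>\<^bsub>Y\<^esub> \<and>
    (\<forall>y\<in>carrier Y. \<exists>b\<in>carrier R. e (c k) \<odot>\<^bsub>Y\<^esub> y = b \<odot>\<^bsub>Y\<^esub> y0 k)" by metis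
  show ?thesis
    by (rule exI[of _ "\<lambda>l. y0 (inv_into K c l)"])
       (use y0 out inv_into_f_f[OF c(2)] in auto)
qed

text \<open>The obstruction to rigidity: s contributes a simple submodule with top e_c to Y, and any
  quotient Z of M with that top maps onto it.\<close>

lemma (in nak_presentation) nonzero_hom:
  assumes a: "a < N" "c < N" and s: "s \<in> carrier M" "e a \<odot>\<^bsub>M\<^esub> s = s" "\<And>j. j \<in> J \<Longrightarrow> j \<odot>\<^bsub>M\<^esub> s = \<zero>\<^bsub>M\<^esub>"
    and u: "u \<in> J" "e c \<otimes> u = u" "u \<otimes> e a \<noteq> \<zero>"
    and X: "left_module R X" "\<And>j x. \<lbrakk>j \<in> J; x \<in> carrier X\<rbrakk> \<Longrightarrow> j \<odot>\<^bsub>X\<^esub> x = \<zero>\<^bsub>X\<^esub>"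
    and \<pi>: "\<pi> \<in> mod_hom R M X" "\<pi> s \<noteq> \<zero>\<^bsub>X\<^esub>"
    and Z: "cyclic_gen R (e c) I Z z" "I \<subseteq> J" and \<rho>: "\<rho> \<in> mod_hom R M Z" "x \<in> carrier M" "\<rho> x = z"
  shows "\<exists>f\<in>mod_hom R M Y. f x \<noteq> \<zero>\<^bsub>Y\<^esub>"
proof -
  obtain w where w: "w \<in> carrier P0" "p w = s" "e a \<odot>\<^bsub>P0\<^esub> w = w" using lift_P0[OF s(1) a(1) s(2)] by blast
  note v = \<Omega>_nonzero[OF a s u X \<pi> w]
  obtain y0 where y0: "y0 \<in> carrier Y" "e c \<odot>\<^bsub>Y\<^esub> y0 = y0" "y0 \<noteq> \<zero>\<^bsub>Y\<^esub>"
    using Y_component[OF a(2) v] by blast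
  note g = Y.simple_element[OF y0(1,3) a(2) y0(2) J_Y[OF _ y0(1)]]
  obtain f where f: "f \<in> mod_hom R Z (sub_mod Y ((\<lambda>a. a \<odot>\<^bsub>Y\<^esub> y0) ` carrier R))" "f z = y0"
    using cyclic_gen_hom[OF Z(1) g Z(2)] by blast
  have "f \<in> mod_hom R Z Y" using f(1) y0(1) by (auto simp: mod_hom_def Pi_iff)
  from mod_hom_compose[OF \<rho>(1) this] show ?thesis using f(2) \<rho>(3) y0(3) by (intro bexI) auto
qed

section \<open>Sums of idempotents, covers and complementary summands\<close>

context idem_ring
begin

lemma diff_self: "x \<in> carrier R \<Longrightarrow> x \<ominus> x = \<zero>" by (simp add: a_minus_def r_neg)

lemma idem_sum:
  assumes C: "C \<subseteq> {..<N}"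
  shows "(\<Oplus>l\<in>C. e l) \<in> carrier R" "m < N \<Longrightarrow> e m \<otimes> (\<Oplus>l\<in>C. e l) = (if m \<in> C then e m else \<zero>)"
    "m < N \<Longrightarrow> (\<Oplus>l\<in>C. e l) \<otimes> e m = (if m \<in> C then e m else \<zero>)" "(\<Oplus>l\<in>C. e l) \<otimes> (\<Oplus>l\<in>C. e l) = (\<Oplus>l\<in>C. e l)"
proof -
  have fin: "finite C" using C finite_subset by auto
  have eC: "e \<in> C \<rightarrow> carrier R" using C by auto
  show cl: "(\<Oplus>l\<in>C. e l) \<in> carrier R" by (rule finsum_closed[OF eC])
  have sing: "(\<Oplus>l\<in>C. if m = l then e l else \<zero>) = (if m \<in> C then e m else \<zero>)" for m
  proof (cases "m \<in> C")
    case True then show ?thesis using add.finprod_singleton[OF True fin eC] by simp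
  next
    case False then show ?thesis by (simp, intro add.finprod_one_eqI) auto
  qed
  show l: "e m \<otimes> (\<Oplus>l\<in>C. e l) = (if m \<in> C then e m else \<zero>)" if m: "m < N" for m
  proof -
    have "e m \<otimes> (\<Oplus>l\<in>C. e l) = (\<Oplus>l\<in>C. e m \<otimes> e l)" using finsum_rdistr[OF fin e_closed[OF m] eC] .
    also have "\<dots> = (\<Oplus>l\<in>C. if m = l then e l else \<zero>)" using C m e_orth by (intro finsum_cong') auto
    finally show ?thesis using sing by simp
  qed
  show "(\<Oplus>l\<in>C. e l) \<otimes> e m = (if m \<in> C then e m else \<zero>)" if m: "m < N" for m
  proof -
    have "(\<Oplus>l\<in>C. e l) \<otimes> e m = (\<Oplus>l\<in>C. e l \<otimes> e m)" using finsum_ldistr[OF fin e_closed[OF m] eC] .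
    also have "\<dots> = (\<Oplus>l\<in>C. if m = l then e l else \<zero>)" using C m e_orth by (intro finsum_cong') auto
    finally show ?thesis using sing by simp
  qed
  have "(\<Oplus>l\<in>C. e l) \<otimes> (\<Oplus>l\<in>C. e l) = (\<Oplus>l\<in>C. e l \<otimes> (\<Oplus>l\<in>C. e l))" using finsum_ldistr[OF fin cl eC] .
  also have "\<dots> = (\<Oplus>l\<in>C. e l)" using C l by (intro finsum_cong') auto
  finally show "(\<Oplus>l\<in>C. e l) \<otimes> (\<Oplus>l\<in>C. e l) = (\<Oplus>l\<in>C. e l)" .
qed

end

text \<open>M is a multiplicity-free sum of simple modules, one for each index in C, so it is cyclic
  and R \<epsilon> with \<epsilon> the sum of these e_l covers it. The kernel lies in J because M
  carries every top occurring in R \<epsilon>.\<close>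

lemma (in idem_module) semisimple_cover:
  assumes C: "C \<subseteq> {..<N}"
    and y: "\<And>l. l \<in> C \<Longrightarrow> y l \<in> carrier M \<and> e l \<odot>\<^bsub>M\<^esub> y l = y l \<and> y l \<noteq> \<zero>\<^bsub>M\<^esub> \<and>
      (\<forall>x\<in>carrier M. \<exists>b\<in>carrier R. e l \<odot>\<^bsub>M\<^esub> x = b \<odot>\<^bsub>M\<^esub> y l)"
    and out: "\<And>l x. \<lbrakk>l < N; l \<notin> C; x \<in> carrier M\<rbrakk> \<Longrightarrow> e l \<odot>\<^bsub>M\<^esub> x = \<zero>\<^bsub>M\<^esub>"
    and JM: "\<And>j x. \<lbrakk>j \<in> J; x \<in> carrier M\<rbrakk> \<Longrightarrow> j \<odot>\<^bsub>M\<^esub> x = \<zero>\<^bsub>M\<^esub>"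
  shows "\<exists>p. projective_cover R (ideal_module R (\<Oplus>l\<in>C. e l)) p M"
proof -
  define \<epsilon> where "\<epsilon> = (\<Oplus>l\<in>C. e l)"
  note \<epsilon> = idem_sum[OF C, folded \<epsilon>_def]
  have fin: "finite C" using C finite_subset by auto
  have yM: "y \<in> C \<rightarrow> carrier M" using y by auto
  \<comment> \<open>A single generator: e_m recovers y_m from the sum because the indices are
    distinct.\<close>
  define ys where "ys = (\<Oplus>\<^bsub>M\<^esub>l\<in>C. y l)"
  have ysM: "ys \<in> carrier M" unfolding ys_def by (rule M.finsum_closed[OF yM])
  have eys: "e m \<odot>\<^bsub>M\<^esub> ys = y m" if m: "m \<in> C" for m
  proof -
    have mN: "m < N" using C m by auto
    have "e m \<odot>\<^bsub>M\<^esub> ys = (\<Oplus>\<^bsub>M\<^esub>l\<in>C. e m \<odot>\<^bsub>M\<^esub> y l)"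
      unfolding ys_def by (rule finsum_smult_r[OF e_closed[OF mN] yM])
    also have "\<dots> = (\<Oplus>\<^bsub>M\<^esub>l\<in>C. if m = l then y l else \<zero>\<^bsub>M\<^esub>)"
    proof (rule M.finsum_cong'[OF refl])
      show "(\<lambda>l. if m = l then y l else \<zero>\<^bsub>M\<^esub>) \<in> C \<rightarrow> carrier M" using yM by auto
      fix l assume l: "l \<in> C"
      have lN: "l < N" using C l by auto
      have "e m \<odot>\<^bsub>M\<^esub> y l = (e m \<otimes> e l) \<odot>\<^bsub>M\<^esub> y l" using y[OF l] mN lN by (simp add: smult_assoc1)
      then show "e m \<odot>\<^bsub>M\<^esub> y l = (if m = l then y l else \<zero>\<^bsub>M\<^esub>)"
        using y[OF l] mN lN e_orth[OF mN lN] by (cases "m = l") auto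
    qed
    also have "\<dots> = y m" by (rule M.add.finprod_singleton[OF m fin yM])
    finally show ?thesis .
  qed
  let ?I = "ideal_module R \<epsilon>"
  have lI: "left_module R ?I" by (rule left_module_ideal_module[OF \<epsilon>(1)])
  interpret I: left_module R ?I by (rule lI)
  let ?p = "\<lambda>x. x \<odot>\<^bsub>M\<^esub> ys"
  have p: "?p \<in> mod_hom R ?I M" by (rule ideal_module_hom[OF \<epsilon>(1) left_module_axioms ysM])
  have im: "submodule (?p ` carrier ?I) R M"
    by (rule submodule_image[OF lI left_module_axioms p I.submodule_carrier])
  have "x \<in> ?p ` carrier ?I" if x: "x \<in> carrier M" for x
  proof -
    have "e l \<odot>\<^bsub>M\<^esub> x \<in> ?p ` carrier ?I" if l: "l < N" for l
    proof (cases "l \<in> C")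
      case False then show ?thesis using out[OF l False x] submoduleD(2)[OF im] by simp
    next
      case True
      then obtain b where b: "b \<in> carrier R" "e l \<odot>\<^bsub>M\<^esub> x = b \<odot>\<^bsub>M\<^esub> y l" using y x by blast
      have "b \<otimes> e l \<in> carrier ?I" using b l \<epsilon>(2)[OF l] True by (intro ideal_module_memI) (auto simp: m_assoc \<epsilon>(1))
      moreover have "e l \<odot>\<^bsub>M\<^esub> x = (b \<otimes> e l) \<odot>\<^bsub>M\<^esub> ys" using b l ysM eys[OF True] by (simp add: smult_assoc1)
      ultimately show ?thesis by blast
    qed
    then have "(\<Oplus>\<^bsub>M\<^esub>l\<in>{..<N}. e l \<odot>\<^bsub>M\<^esub> x) \<in> ?p ` carrier ?I" by (intro submodule_finsum[OF im]) auto
    then show ?thesis using module_decomp[OF x] by simp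
  qed
  then have sur: "?p ` carrier ?I = carrier M" using mod_homD(1)[OF p] by blast
  have kerJ: "x \<in> J" if x: "x \<in> a_kernel ?I M ?p" for x
  proof (rule ccontr)
    assume n: "x \<notin> J"
    have "x \<in> carrier ?I" and x0: "x \<odot>\<^bsub>M\<^esub> ys = \<zero>\<^bsub>M\<^esub>" using x by (auto simp: a_kernel_eq)
    note xI = ideal_module_idem[OF \<epsilon>(1,4) this(1)]
    obtain m where m: "m < N" "x \<otimes> e m \<notin> J" using not_J_right[OF xI(1) n] by blast
    have "x \<otimes> e m = x \<otimes> (\<epsilon> \<otimes> e m)" using xI m \<epsilon>(1) by (simp add: m_assoc[symmetric])
    then have mC: "m \<in> C" using m \<epsilon>(3)[OF m(1)] xI(1) J_D(2) by (cases "m \<in> C") auto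
    obtain z where z: "z \<in> carrier R" "e m \<otimes> z = z" "z \<otimes> x \<otimes> e m = e m" using left_unit[OF xI(1) m] by blast
    \<comment> \<open>Normalising a kernel element x outside J turns it into e_m plus a radical
      element. Applied to ys, the left side and the radical part give zero, so y_m would be
      zero.\<close>
    have "z \<otimes> x \<ominus> e m \<in> J"
    proof (rule ccontr)
      assume "z \<otimes> x \<ominus> e m \<notin> J"
      then obtain l where l: "l < N" "(z \<otimes> x \<ominus> e m) \<otimes> e l \<notin> J" using not_J_right[of "z \<otimes> x \<ominus> e m"] z(1) xI(1) m by auto
      have eq: "(z \<otimes> x \<ominus> e m) \<otimes> e l = z \<otimes> x \<otimes> e l \<ominus> e m \<otimes> e l"
        using z(1) xI(1) m l by (simp add: a_minus_def l_distr l_minus)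
      show False
      proof (cases "l = m")
        case True then show False using eq z(3) l m J_D(2) diff_self[of "e m"] by simp
      next
        case False
        have "e m \<otimes> (z \<otimes> x) \<otimes> e l = z \<otimes> x \<otimes> e l" using z(1,2) xI(1) m l by (simp add: m_assoc[symmetric])
        then have "z \<otimes> x \<otimes> e l \<in> J" using offdiag[of "z \<otimes> x" m l] z(1) xI(1) m l False by simp
        moreover have "(z \<otimes> x \<ominus> e m) \<otimes> e l = z \<otimes> x \<otimes> e l"
          using eq e_orth[OF m(1) l(1)] False z(1) xI(1) l by (simp add: a_minus_def)
        ultimately show False using l(2) by simp
      qed
    qed
    then have "(z \<otimes> x \<ominus> e m) \<odot>\<^bsub>M\<^esub> ys = \<zero>\<^bsub>M\<^esub>" using JM ysM by simp
    moreover have "(z \<otimes> x \<ominus> e m) \<odot>\<^bsub>M\<^esub> ys = z \<odot>\<^bsub>M\<^esub> (x \<odot>\<^bsub>M\<^esub> ys) \<ominus>\<^bsub>M\<^esub> e m \<odot>\<^bsub>M\<^esub> ys"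
      using z(1) xI(1) m ysM by (simp add: a_minus_def smult_l_distr smult_l_minus smult_assoc1)
    ultimately have "\<ominus>\<^bsub>M\<^esub> y m = \<zero>\<^bsub>M\<^esub>" using x0 eys[OF mC] z(1) y[OF mC] by (simp add: a_minus_def)
    then have "\<ominus>\<^bsub>M\<^esub> (\<ominus>\<^bsub>M\<^esub> y m) \<oplus>\<^bsub>M\<^esub> \<zero>\<^bsub>M\<^esub> = \<zero>\<^bsub>M\<^esub>" using y[OF mC] M.l_neg[of "\<ominus>\<^bsub>M\<^esub> y m"] by simp
    then show False using y[OF mC] by simp
  qed
  have "superfluous R ?I (a_kernel ?I M ?p)"
  proof (rule superfluousI[OF submodule_kernel[OF lI left_module_axioms p] _ lI])
    fix X assume X: "submodule X R ?I" and all: "\<And>z. z \<in> carrier ?I \<Longrightarrow> \<exists>k\<in>a_kernel ?I M ?p. \<exists>x\<in>X. z = k \<oplus>\<^bsub>?I\<^esub> x"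
    note DX = I.submoduleD[OF X]
    have \<epsilon>I: "\<epsilon> \<in> carrier ?I" by (rule ideal_module_memI[OF \<epsilon>(1,4)])
    obtain k x where kx: "k \<in> a_kernel ?I M ?p" "x \<in> X" "\<epsilon> = k \<oplus> x" using all[OF \<epsilon>I] by auto
    have kJ: "k \<in> J" by (rule kerJ[OF kx(1)])
    have xR: "x \<in> carrier R" using ideal_module_idem(1)[OF \<epsilon>(1,4) DX(3)[OF kx(2)]] .
    \<comment> \<open>With \<epsilon> = k + x and both k, k' in J, one gets k' = k' \<epsilon> = k'
      x, which lies in X. Applied to k itself this puts \<epsilon> into X.\<close>
    have kX: "k' \<in> X" if k': "k' \<in> a_kernel ?I M ?p" for k'
    proof -
      have "k' \<in> carrier ?I" using k' by (auto simp: a_kernel_eq)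
      note k'I = ideal_module_idem[OF \<epsilon>(1,4) this]
      have "k' \<otimes> (k \<oplus> x) = k'" using k'I(2) kx(3) by simp
      then have "k' = k' \<otimes> x" using JJ[OF kerJ[OF k'] kJ] k'I(1) xR J_D(1)[OF kJ] by (simp add: r_distr)
      then show ?thesis using DX(5)[OF k'I(1) kx(2)] by simp
    qed
    have "\<epsilon> \<in> X" using DX(4)[OF kX[OF kx(1)] kx(2)] kx(3) by simp
    then show "carrier ?I \<subseteq> X" using DX(5) by auto
  qed
  then show ?thesis
    unfolding \<epsilon>_def[symmetric] projective_cover_def
    using projective_ideal_module[OF \<epsilon>(1,4)] left_module_axioms p sur by blast
qed

lemma projective_cover_iso:
  assumes cov: "projective_cover R P p M" and lQ: "left_module R Q" and h: "h \<in> mod_hom R Q P" "bij_betw h (carrier Q) (carrier P)"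
  shows "projective_cover R Q (\<lambda>x. p (h x)) M"
proof -
  have pr: "projective_module R P" and lM: "left_module R M" and p: "p \<in> mod_hom R P M"
    and sur: "p ` carrier P = carrier M" and sf: "superfluous R P (a_kernel P M p)"
    using cov by (simp_all add: projective_cover_def)
  have lP: "left_module R P" using pr by (simp add: projective_module_def fg_module_def)
  interpret P: left_module R P by (rule lP)
  interpret Q: left_module R Q by (rule lQ)
  have hS: "h ` carrier Q = carrier P" and hI: "inj_on h (carrier Q)" using h(2) by (auto simp: bij_betw_def)
  have ph: "(\<lambda>x. p (h x)) \<in> mod_hom R Q M" by (rule mod_hom_compose[OF h(1) p])
  have "superfluous R Q (a_kernel Q M (\<lambda>x. p (h x)))"
  proof (rule superfluousI[OF submodule_kernel[OF lQ lM ph] _ lQ])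
    fix X assume X: "submodule X R Q" and all: "\<And>z. z \<in> carrier Q \<Longrightarrow> \<exists>k\<in>a_kernel Q M (\<lambda>x. p (h x)). \<exists>x\<in>X. z = k \<oplus>\<^bsub>Q\<^esub> x"
    note DX = Q.submoduleD[OF X]
    have hX: "h ` X = carrier P"
    proof (rule superfluousD[OF sf lP submodule_image[OF lQ lP h(1) X]])
      fix z assume "z \<in> carrier P"
      then obtain z' where z': "z' \<in> carrier Q" "z = h z'" using hS by (metis imageE)
      then obtain k x where kx: "k \<in> a_kernel Q M (\<lambda>x. p (h x))" "x \<in> X" "z' = k \<oplus>\<^bsub>Q\<^esub> x" using all by blast
      have "h k \<in> a_kernel P M p" using kx(1) mod_homD(1)[OF h(1)] by (auto simp: a_kernel_eq)
      moreover have "z = h k \<oplus>\<^bsub>P\<^esub> h x"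
        using z' kx mod_homD(2)[OF h(1)] DX(3) by (auto simp: a_kernel_eq)
      ultimately show "\<exists>k\<in>a_kernel P M p. \<exists>x\<in>h ` X. z = k \<oplus>\<^bsub>P\<^esub> x" using kx(2) by blast
    qed
    show "carrier Q \<subseteq> X"
    proof
      fix z assume z: "z \<in> carrier Q"
      then have "h z \<in> h ` X" using hX mod_homD(1)[OF h(1)] by simp
      then show "z \<in> X" using inj_on_image_mem_iff[OF hI z DX(1)] by simp
    qed
  qed
  moreover have "(\<lambda>x. p (h x)) ` carrier Q = carrier M" using sur hS by (metis image_image)
  moreover have "projective_module R Q"
    by (rule projective_iso[OF lQ mod_iso_sym[OF lQ] pr]) (use h in \<open>auto simp: mod_iso_def\<close>)
  ultimately show ?thesis using lM ph by (simp add: projective_cover_def)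
qed

lemma mod_prod_simps:
  "carrier (mod_prod M K) = carrier M \<times> carrier K" "\<zero>\<^bsub>mod_prod M K\<^esub> = (\<zero>\<^bsub>M\<^esub>, \<zero>\<^bsub>K\<^esub>)"
  "(x, y) \<oplus>\<^bsub>mod_prod M K\<^esub> (x', y') = (x \<oplus>\<^bsub>M\<^esub> x', y \<oplus>\<^bsub>K\<^esub> y')" "r \<odot>\<^bsub>mod_prod M K\<^esub> (x, y) = (r \<odot>\<^bsub>M\<^esub> x, r \<odot>\<^bsub>K\<^esub> y)"
  by (simp_all add: mod_prod_def)

lemma left_module_mod_prod:
  assumes "left_module R M" "left_module R K" shows "left_module R (mod_prod M K)"
proof -
  interpret M: left_module R M by fact
  interpret K: left_module R K by fact
  have "abelian_group (mod_prod M K)"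
  proof (rule abelian_groupI)
    show "\<exists>y\<in>carrier (mod_prod M K). y \<oplus>\<^bsub>mod_prod M K\<^esub> x = \<zero>\<^bsub>mod_prod M K\<^esub>" if "x \<in> carrier (mod_prod M K)" for x
      using that by (intro bexI[of _ "(\<ominus>\<^bsub>M\<^esub> fst x, \<ominus>\<^bsub>K\<^esub> snd x)"]) (auto simp: mod_prod_simps M.M.l_neg K.M.l_neg)
  qed (auto simp: mod_prod_simps M.M.a_ac K.M.a_ac)
  then show ?thesis
    by (rule left_moduleI[OF M.R.ring_axioms])
       (auto simp: mod_prod_simps M.smult_l_distr K.smult_l_distr M.smult_r_distr K.smult_r_distr
          M.smult_assoc1 K.smult_assoc1)
qed

lemma mod_prod_fst: "fst \<in> mod_hom R (mod_prod M K) M" and mod_prod_snd: "snd \<in> mod_hom R (mod_prod M K) K"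
  by (auto simp: mod_hom_def mod_prod_simps)

lemma mod_hom_sum:
  assumes "left_module R M" "left_module R K" "finite I" "\<And>i. i \<in> I \<Longrightarrow> f i \<in> mod_hom R M K"
  shows "(\<lambda>x. \<Oplus>\<^bsub>K\<^esub>i\<in>I. f i x) \<in> mod_hom R M K"
proof -
  interpret M: left_module R M by fact
  interpret K: left_module R K by fact
  note h = mod_homD[OF assms(4)]
  show ?thesis
  proof (rule mod_homI)
    fix x assume x: "x \<in> carrier M"
    have fx: "(\<lambda>i. f i x) \<in> I \<rightarrow> carrier K" using h(1) x by auto
    then show "(\<Oplus>\<^bsub>K\<^esub>i\<in>I. f i x) \<in> carrier K" by (rule K.M.finsum_closed)
    show "(\<Oplus>\<^bsub>K\<^esub>i\<in>I. f i (a \<odot>\<^bsub>M\<^esub> x)) = a \<odot>\<^bsub>K\<^esub> (\<Oplus>\<^bsub>K\<^esub>i\<in>I. f i x)" if "a \<in> carrier R" for a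
      unfolding K.finsum_smult_r[OF that fx] using h(1,3) x that by (intro K.M.finsum_cong') auto
    fix y assume y: "y \<in> carrier M"
    have fy: "(\<lambda>i. f i y) \<in> I \<rightarrow> carrier K" using h(1) y by auto
    show "(\<Oplus>\<^bsub>K\<^esub>i\<in>I. f i (x \<oplus>\<^bsub>M\<^esub> y)) = (\<Oplus>\<^bsub>K\<^esub>i\<in>I. f i x) \<oplus>\<^bsub>K\<^esub> (\<Oplus>\<^bsub>K\<^esub>i\<in>I. f i y)"
      unfolding K.M.finsum_addf[OF fx fy, symmetric] using h(1,2) x y by (intro K.M.finsum_cong') auto
  qed
qed

text \<open>The decomposition of R into R c and R (1 - c), stated for modules merely isomorphic to
  the two left ideals.\<close>

lemma (in ring) regular_split:
  assumes c: "c \<in> carrier R" "c \<otimes> c = c"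
    and P: "left_module R P" "h \<in> mod_hom R P (ideal_module R c)" "bij_betw h (carrier P) (carrier (ideal_module R c))"
    and Q: "left_module R Q" "g \<in> mod_hom R Q (ideal_module R (\<one> \<ominus> c))" "bij_betw g (carrier Q) (carrier (ideal_module R (\<one> \<ominus> c)))"
  shows "mod_iso R (regular_module R) (mod_prod P Q)"
proof -
  have reg: "left_module R (regular_module R)" by (rule left_module_regular[OF ring_axioms])
  interpret P: left_module R P by (rule P(1))
  interpret Q: left_module R Q by (rule Q(1))
  have f: "\<one> \<ominus> c \<in> carrier R" "(\<one> \<ominus> c) \<otimes> (\<one> \<ominus> c) = \<one> \<ominus> c" "(\<one> \<ominus> c) \<otimes> c = \<zero>" "c \<oplus> (\<one> \<ominus> c) = \<one>"
    using c by (auto simp: a_minus_def l_distr r_distr l_minus r_minus r_neg l_neg a_lcomm[of c])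
  have hP: "h x \<in> carrier R" "h x \<otimes> c = h x" if "x \<in> carrier P" for x
    using ideal_module_idem[OF c mod_homD(1)[OF P(2) that]] by auto
  have gQ: "g x \<in> carrier R" "g x \<otimes> (\<one> \<ominus> c) = g x" if "x \<in> carrier Q" for x
    using ideal_module_idem[OF f(1,2) mod_homD(1)[OF Q(2) that]] by auto
  have gc: "g x \<otimes> c = \<zero>" if "x \<in> carrier Q" for x
  proof -
    have "g x \<otimes> (\<one> \<ominus> c) \<otimes> c = \<zero>" using gQ(1)[OF that] f(1,3) c by (simp add: m_assoc)
    then show ?thesis using gQ(2)[OF that] by simp
  qed
  let ?F = "\<lambda>(x, y). h x \<oplus> g y"
  have lPQ: "left_module R (mod_prod P Q)" by (rule left_module_mod_prod[OF P(1) Q(1)])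
  have hom: "?F \<in> mod_hom R (mod_prod P Q) (regular_module R)"
    using mod_homD[OF P(2)] mod_homD[OF Q(2)] hP(1) gQ(1)
    by (intro mod_homI) (auto simp: mod_prod_simps r_distr a_ac)
  have inj: "inj_on ?F (carrier (mod_prod P Q))"
  proof (rule mod_hom_inj_onI[OF lPQ reg hom])
    fix xy assume "xy \<in> carrier (mod_prod P Q)" "?F xy = \<zero>\<^bsub>regular_module R\<^esub>"
    then obtain x y where xy: "xy = (x, y)" "x \<in> carrier P" "y \<in> carrier Q" "h x \<oplus> g y = \<zero>" by (auto simp: mod_prod_simps)
    have "(h x \<oplus> g y) \<otimes> c = h x" using hP gQ gc c xy(2,3) by (simp add: l_distr)
    then have hx: "h x = \<zero>" using xy(4) c by simp
    then have gy: "g y = \<zero>" using xy(4) gQ(1)[OF xy(3)] by simp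
    have "x = \<zero>\<^bsub>P\<^esub>"
      using P(3) hx mod_hom_zero[OF P(1) left_module_ideal_module[OF c(1)] P(2)] xy(2)
      by (auto simp: bij_betw_def inj_on_def)
    moreover have "y = \<zero>\<^bsub>Q\<^esub>"
      using Q(3) gy mod_hom_zero[OF Q(1) left_module_ideal_module[OF f(1)] Q(2)] xy(3)
      by (auto simp: bij_betw_def inj_on_def)
    ultimately show "xy = \<zero>\<^bsub>mod_prod P Q\<^esub>" by (simp add: xy mod_prod_simps)
  qed
  have "z \<in> ?F ` carrier (mod_prod P Q)" if z: "z \<in> carrier R" for z
  proof -
    have "z \<otimes> c \<in> h ` carrier P" "z \<otimes> (\<one> \<ominus> c) \<in> g ` carrier Q"
      using P(3) Q(3) z by (auto simp: bij_betw_def)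
    then obtain x y where "x \<in> carrier P" "h x = z \<otimes> c" "y \<in> carrier Q" "g y = z \<otimes> (\<one> \<ominus> c)" by (metis imageE)
    moreover have "z = z \<otimes> c \<oplus> z \<otimes> (\<one> \<ominus> c)" using r_distr[OF c(1) f(1) z] f(4) z by simp
    ultimately show ?thesis by (intro image_eqI[of _ _ "(x, y)"]) (auto simp: mod_prod_simps)
  qed
  then have "?F ` carrier (mod_prod P Q) = carrier (regular_module R)" using mod_homD(1)[OF hom] by fastforce
  then have "mod_iso R (mod_prod P Q) (regular_module R)" using hom inj unfolding mod_iso_def bij_betw_def by blast
  then show ?thesis by (rule mod_iso_sym[OF lPQ])
qed

section \<open>Tau-tilting modules\<close>

lemma fg_representative_iso:
  fixes M :: "('a, 'b) module"
  assumes "fg_module R M"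
  shows "\<exists>(K :: 'a fg_mod) h. left_module R K \<and> h \<in> mod_hom R K M \<and> bij_betw h (carrier K) (carrier M)"
proof -
  have lM: "left_module R M" using assms by (simp add: fg_module_def)
  obtain K :: "'a fg_mod" where K: "fg_module R K" "mod_iso R M K" using fg_module_representative[OF assms] by blast
  then show ?thesis using mod_iso_sym[OF lM K(2)] by (auto simp: mod_iso_def fg_module_def)
qed

lemma (in nak_algebra) semisimple_tau_cover:
  fixes S :: "nat \<Rightarrow> 'a fg_mod" and t :: nat
  assumes a: "\<And>j. j < t \<Longrightarrow> a j < N" and c: "\<And>j. j < t \<Longrightarrow> c j < N" "inj_on c {..<t}"
    and S: "\<And>j. j < t \<Longrightarrow> cyclic_gen R (e (a j)) J (S j) (s j)"
    and u: "\<And>j. j < t \<Longrightarrow> u j \<in> J \<and> e (c j) \<otimes> u j = u j \<and> u j \<otimes> e (a j) = u j \<and> u j \<noteq> \<zero>"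
  shows "\<exists>(P :: 'a fg_mod) p h. projective_cover R P p (tau k \<phi> E R (mod_sum {..<t} S)) \<and> left_module R P \<and>
    h \<in> mod_hom R P (ideal_module R (\<Oplus>l\<in>c ` {..<t}. e l)) \<and>
    bij_betw h (carrier P) (carrier (ideal_module R (\<Oplus>l\<in>c ` {..<t}. e l)))"
proof -
  let ?M = "mod_sum {..<t} S"
  let ?d = "\<lambda>j. mod_delta {..<t} S j (s j)"
  note d = cyclic_genD[OF S]
  have lS: "left_module R (S j)" if "j \<in> {..<t}" for j using d(1) that by simp
  have lM: "left_module R ?M" by (rule left_module_mod_sum[OF ring_axioms lS])
  interpret M: left_module R ?M by (rule lM)
  have fg: "fg_module R ?M" by (rule fg_mod_sum[OF ring_axioms finite_lessThan lS]) (use d in auto)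
  have s0: "s j \<noteq> \<zero>\<^bsub>S j\<^esub>" if "j < t" for j
  proof
    assume "s j = \<zero>\<^bsub>S j\<^esub>"
    interpret Sj: left_module R "S j" by (rule d(1)[OF that])
    have "\<one> \<odot>\<^bsub>S j\<^esub> s j = \<zero>\<^bsub>S j\<^esub>" using d(2)[OF that] \<open>s j = _\<close> by simp
    then show False using d(6)[OF that, of \<one>] e_notin[OF a[OF that]] a[OF that] by simp
  qed
  have dM: "?d j \<in> carrier ?M" if "j \<in> {..<t}" for j
    by (rule mod_delta_closed[OF lS that]) (use that d(2) in auto)
  have dcmp: "(\<lambda>j\<in>{..<t}. l j \<odot>\<^bsub>S j\<^esub> s j) = (\<Oplus>\<^bsub>?M\<^esub>j\<in>{..<t}. l j \<odot>\<^bsub>?M\<^esub> ?d j)" if "l \<in> {..<t} \<rightarrow> carrier R" for l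
    by (rule mod_sum_decomp[OF ring_axioms finite_lessThan lS]) (use that d(2) in auto)
  obtain P1 d' P0 p where pr: "nak_presentation R N e J k \<phi> E \<iota> ?M P1 d' P0 p (tau k \<phi> E R ?M) (dual_ev R P1 d' P0)"
    using tau_presentation[OF fg] by blast
  interpret Z: nak_presentation R N e J k \<phi> E \<iota> ?M P1 d' P0 p "tau k \<phi> E R ?M" "dual_ev R P1 d' P0" by (rule pr)
  let ?Y = "tau k \<phi> E R ?M"
  have "\<exists>yy. (\<forall>l\<in>c ` {..<t}. yy l \<in> carrier ?Y \<and> e l \<odot>\<^bsub>?Y\<^esub> yy l = yy l \<and> yy l \<noteq> \<zero>\<^bsub>?Y\<^esub> \<and>
      (\<forall>y\<in>carrier ?Y. \<exists>b\<in>carrier R. e l \<odot>\<^bsub>?Y\<^esub> y = b \<odot>\<^bsub>?Y\<^esub> yy l)) \<and>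
    (\<forall>l<N. l \<notin> c ` {..<t} \<longrightarrow> (\<forall>y\<in>carrier ?Y. e l \<odot>\<^bsub>?Y\<^esub> y = \<zero>\<^bsub>?Y\<^esub>))"
  proof (rule Z.semisimple_tau[OF finite_lessThan, where a = a and u = u and \<delta> = ?d])
    show "e (a j) \<odot>\<^bsub>?M\<^esub> ?d j = ?d j" if "j \<in> {..<t}" for j
    proof -
      have "e (a j) \<odot>\<^bsub>S i\<^esub> \<zero>\<^bsub>S i\<^esub> = \<zero>\<^bsub>S i\<^esub>" if "i < t" for i
        using left_module.smult_r_null[OF d(1)[OF that]] a \<open>j \<in> {..<t}\<close> by simp
      then show ?thesis using d(3) that by (auto simp: mod_sum_simps mod_delta_def)
    qed
    show "?d j \<noteq> \<zero>\<^bsub>?M\<^esub>" if "j \<in> {..<t}" for j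
    proof
      assume "?d j = \<zero>\<^bsub>?M\<^esub>"
      then have "?d j j = \<zero>\<^bsub>?M\<^esub> j" by simp
      then show False using s0 that by (simp add: mod_sum_simps mod_delta_def)
    qed
    show "M.combos {..<t} ?d = carrier ?M"
    proof
      show "M.combos {..<t} ?d \<subseteq> carrier ?M" by (rule M.combos_subset[OF M.submodule_carrier]) (use dM in auto)
      show "carrier ?M \<subseteq> M.combos {..<t} ?d"
      proof
        fix x assume x: "x \<in> carrier ?M"
        have "\<exists>l\<in>carrier R. x j = l \<odot>\<^bsub>S j\<^esub> s j" if "j < t" for j
          using d(5)[OF that] x that by (auto simp: mod_sum_simps)
        then obtain l where l: "\<And>j. j < t \<Longrightarrow> l j \<in> carrier R \<and> x j = l j \<odot>\<^bsub>S j\<^esub> s j" by metis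
        have "x = (\<lambda>j\<in>{..<t}. l j \<odot>\<^bsub>S j\<^esub> s j)"
          using x l by (auto simp: mod_sum_simps PiE_iff extensional_def)
        also have "\<dots> = (\<Oplus>\<^bsub>?M\<^esub>j\<in>{..<t}. l j \<odot>\<^bsub>?M\<^esub> ?d j)" by (rule dcmp) (use l in auto)
        finally show "x \<in> M.combos {..<t} ?d" using l by (auto simp: M.combos_def)
      qed
    qed
    show "l j \<otimes> e (a j) \<in> J"
      if l: "l \<in> {..<t} \<rightarrow> carrier R" and z: "(\<Oplus>\<^bsub>?M\<^esub>j\<in>{..<t}. l j \<odot>\<^bsub>?M\<^esub> ?d j) = \<zero>\<^bsub>?M\<^esub>" and j: "j \<in> {..<t}" for l j
    proof -
      have "(\<lambda>j\<in>{..<t}. l j \<odot>\<^bsub>S j\<^esub> s j) j = \<zero>\<^bsub>?M\<^esub> j" using dcmp[OF l] z by simp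
      then have "l j \<odot>\<^bsub>S j\<^esub> s j = \<zero>\<^bsub>S j\<^esub>" using j by (simp add: mod_sum_simps)
      moreover have "l j \<in> carrier R" using l j by auto
      ultimately show ?thesis using d(6)[of j "l j"] j by simp
    qed
    show "j \<odot>\<^bsub>?M\<^esub> x = \<zero>\<^bsub>?M\<^esub>" if j: "j \<in> J" and x: "x \<in> carrier ?M" for j x
    proof -
      have "j \<odot>\<^bsub>S i\<^esub> x i = \<zero>\<^bsub>S i\<^esub>" if "i < t" for i
        using cyclic_J_zero[OF S[OF that] a[OF that] j] x that by (auto simp: mod_sum_simps)
      then show ?thesis by (auto simp: mod_sum_simps)
    qed
  qed (use a c u dM in auto)
  then obtain yy where yy: "\<And>l. l \<in> c ` {..<t} \<Longrightarrow> yy l \<in> carrier ?Y \<and> e l \<odot>\<^bsub>?Y\<^esub> yy l = yy l \<and> yy l \<noteq> \<zero>\<^bsub>?Y\<^esub> \<and>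
      (\<forall>y\<in>carrier ?Y. \<exists>b\<in>carrier R. e l \<odot>\<^bsub>?Y\<^esub> y = b \<odot>\<^bsub>?Y\<^esub> yy l)"
    "\<And>l y. \<lbrakk>l < N; l \<notin> c ` {..<t}; y \<in> carrier ?Y\<rbrakk> \<Longrightarrow> e l \<odot>\<^bsub>?Y\<^esub> y = \<zero>\<^bsub>?Y\<^esub>" by metis
  have C: "c ` {..<t} \<subseteq> {..<N}" using c by auto
  obtain q where q: "projective_cover R (ideal_module R (\<Oplus>l\<in>c ` {..<t}. e l)) q ?Y"
    using Z.Y.semisimple_cover[OF C yy Z.J_Y] by blast
  have "fg_module R (ideal_module R (\<Oplus>l\<in>c ` {..<t}. e l))"
    using q by (simp add: projective_cover_def projective_module_def)
  from fg_representative_iso[OF this]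
  obtain P :: "'a fg_mod" and h where P: "left_module R P" "h \<in> mod_hom R P (ideal_module R (\<Oplus>l\<in>c ` {..<t}. e l))"
    "bij_betw h (carrier P) (carrier (ideal_module R (\<Oplus>l\<in>c ` {..<t}. e l)))" by blast
  show ?thesis using projective_cover_iso[OF q P] P by blast
qed

lemma (in idem_ring) complementary_idem:
  assumes C: "C \<subseteq> {..<N}"
  defines "f \<equiv> \<one> \<ominus> (\<Oplus>l\<in>C. e l)"
  shows "f \<in> carrier R" "f \<otimes> f = f" "\<And>m. m < N \<Longrightarrow> f \<otimes> e m = (if m \<in> C then \<zero> else e m)"
    "\<And>m. \<lbrakk>m < N; m \<notin> C\<rbrakk> \<Longrightarrow> e m \<otimes> f = e m"
proof -
  note \<epsilon> = idem_sum[OF C]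
  show f: "f \<in> carrier R" using \<epsilon>(1) by (simp add: f_def)
  show "f \<otimes> e m = (if m \<in> C then \<zero> else e m)" if "m < N" for m
    using \<epsilon>(1) \<epsilon>(3)[OF that] that by (auto simp: f_def a_minus_def l_distr l_minus r_neg)
  show "e m \<otimes> f = e m" if "m < N" "m \<notin> C" for m
    using \<epsilon>(1) \<epsilon>(2)[OF that(1)] that by (auto simp: f_def a_minus_def r_distr r_minus)
  show "f \<otimes> f = f"
    using \<epsilon>(1,4) by (simp add: f_def a_minus_def l_distr r_distr l_minus r_minus r_neg l_neg a_assoc)
qed

text \<open>The summands with index in A match the S_j. The others are copies of R e_m, each m
  outside C occurring once, and together they form the left ideal R f of f = 1 minus the sum of e_l
  over C. All comparisons are made through generators.\<close>

lemma (in idem_ring) simples_and_projectives_iso: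
  fixes S :: "nat \<Rightarrow> ('a, 's) module"
  assumes T: "left_module R T" and ds: "internal_direct_sum R T {..<N} H"
    and \<alpha>: "bij_betw \<alpha> {..<t} A" "A \<subseteq> {..<N}"
    and S: "\<And>j. j < t \<Longrightarrow> cyclic_gen R (e (idx (\<alpha> j))) J (S j) (s j)"
    and xA: "\<And>i. i \<in> A \<Longrightarrow> cyclic_gen R (e (idx i)) J (sub_mod T (H i)) (x i)"
    and xB: "\<And>i. i \<in> {..<N} - A \<Longrightarrow> cyclic_gen R (e (idx i)) {\<zero>} (sub_mod T (H i)) (x i)"
    and idx: "\<And>i. i < N \<Longrightarrow> idx i < N" "inj_on idx ({..<N} - A)" "idx ` ({..<N} - A) = {..<N} - C" and C: "C \<subseteq> {..<N}"
    and Q: "left_module R Q" "g \<in> mod_hom R Q (ideal_module R (\<one> \<ominus> (\<Oplus>l\<in>C. e l)))"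
      "bij_betw g (carrier Q) (carrier (ideal_module R (\<one> \<ominus> (\<Oplus>l\<in>C. e l))))"
  shows "mod_iso R T (mod_prod (mod_sum {..<t} S) Q)"
proof -
  interpret T: left_module R T by (rule T)
  interpret Q: left_module R Q by (rule Q(1))
  define f where "f = \<one> \<ominus> (\<Oplus>l\<in>C. e l)"
  note f = complementary_idem[OF C, folded f_def]
  note Q' = Q(2,3)[folded f_def]
  obtain \<pi> where \<pi>: "\<And>i. i \<in> {..<N} \<Longrightarrow> \<pi> i \<in> mod_hom R T T" "\<And>i x. \<lbrakk>i \<in> {..<N}; x \<in> carrier T\<rbrakk> \<Longrightarrow> \<pi> i x \<in> H i"
    "\<And>x. x \<in> carrier T \<Longrightarrow> x = (\<Oplus>\<^bsub>T\<^esub>i\<in>{..<N}. \<pi> i x)"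
    "\<And>c i. \<lbrakk>c \<in> (\<Pi> i\<in>{..<N}. H i); i \<in> {..<N}\<rbrakk> \<Longrightarrow> \<pi> i (finsum T c {..<N}) = c i"
    by (rule direct_sum_projections[OF T ds]) blast
  have HT: "H i \<subseteq> carrier T" if "i < N" for i
    using T.submoduleD(1)[of "H i"] ds that by (auto simp: internal_direct_sum_def)
  let ?M = "mod_sum {..<t} S"
  have lS: "left_module R (S j)" if "j \<in> {..<t}" for j using cyclic_genD(1)[OF S] that by simp
  have lM: "left_module R ?M" by (rule left_module_mod_sum[OF ring_axioms lS])
  let ?Z = "mod_prod ?M Q"
  have lZ: "left_module R ?Z" by (rule left_module_mod_prod[OF lM Q(1)])
  have \<alpha>A: "\<alpha> j \<in> A" "\<alpha> j < N" if "j < t" for j using \<alpha> that by (auto simp: bij_betw_def)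
  have "\<exists>h\<in>mod_hom R (S j) (sub_mod T (H (\<alpha> j))). bij_betw h (carrier (S j)) (H (\<alpha> j))" if "j < t" for j
    using cyclic_gen_hom[OF S[OF that] xA[OF \<alpha>A(1)[OF that]]] by auto
  then obtain hh where hh: "\<And>j. j < t \<Longrightarrow> hh j \<in> mod_hom R (S j) (sub_mod T (H (\<alpha> j))) \<and> bij_betw (hh j) (carrier (S j)) (H (\<alpha> j))"
    by metis
  define \<beta> where "\<beta> = inv_into {..<t} \<alpha>"
  have \<beta>: "\<beta> i < t" "\<alpha> (\<beta> i) = i" if "i \<in> A" for i
    using \<alpha> that inv_into_into[of i \<alpha> "{..<t}"] by (auto simp: \<beta>_def bij_betw_def f_inv_into_f)
  have \<beta>\<alpha>: "\<beta> (\<alpha> j) = j" if "j < t" for j using \<alpha> that by (simp add: \<beta>_def bij_betw_def)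
  \<comment> \<open>The component in H_i of the comparison map: simple coordinates go through fixed
    isomorphisms, while on a projective summand the element g(q) of R f acts on the generator
    x_i.\<close>
  define comp where "comp i = (if i \<in> A then (\<lambda>z. hh (\<beta> i) (fst z (\<beta> i))) else (\<lambda>z. g (snd z) \<odot>\<^bsub>T\<^esub> x i))" for i
  have xH: "x i \<in> H i" if "i < N" for i using cyclic_genD(2)[OF xA, of i] cyclic_genD(2)[OF xB, of i] that by auto
  have xT: "x i \<in> carrier T" if "i < N" for i using xH[OF that] HT[OF that] by auto
  have ex: "e (idx i) \<odot>\<^bsub>T\<^esub> x i = x i" if "i < N" for i
    using cyclic_genD(3)[OF xA, of i] cyclic_genD(3)[OF xB, of i] that by auto
  have gq: "g q \<in> carrier R" "g q \<otimes> f = g q" if "q \<in> carrier Q" for q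
    using ideal_module_idem[OF f(1,2) mod_homD(1)[OF Q'(1) that]] by auto
  have homc: "comp i \<in> mod_hom R ?Z T" and cH: "\<And>z. z \<in> carrier ?Z \<Longrightarrow> comp i z \<in> H i" if i: "i < N" for i
  proof -
    show "comp i \<in> mod_hom R ?Z T"
    proof (cases "i \<in> A")
      case True
      have inT: "h \<in> mod_hom R K T" if "h \<in> mod_hom R K (sub_mod T (H i))" for h and K :: "('a, 's) module"
        using that HT[OF i] by (auto simp: mod_hom_def)
      have "hh (\<beta> i) \<in> mod_hom R (S (\<beta> i)) T"
        by (rule inT) (use hh[OF \<beta>(1)[OF True]] \<beta>(2)[OF True] in simp)
      moreover have "(\<lambda>z. fst z (\<beta> i)) \<in> mod_hom R ?Z (S (\<beta> i))"
        using \<beta>(1)[OF True] by (intro mod_hom_compose[OF mod_prod_fst mod_sum_coord]) simp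
      ultimately have "(\<lambda>z. hh (\<beta> i) (fst z (\<beta> i))) \<in> mod_hom R ?Z T" by - (rule mod_hom_compose)
      then show ?thesis using True by (simp add: comp_def)
    next
      case False
      have "(\<lambda>z. g (snd z)) \<in> mod_hom R ?Z (ideal_module R f)" by (rule mod_hom_compose[OF mod_prod_snd Q'(1)])
      from mod_hom_compose[OF this ideal_module_hom[OF f(1) T xT[OF i]]] show ?thesis using False by (simp add: comp_def)
    qed
    show "comp i z \<in> H i" if z: "z \<in> carrier ?Z" for z
    proof (cases "i \<in> A")
      case True
      have "fst z \<in> carrier ?M" using z by (simp add: mod_prod_simps mem_Times_iff)
      then have "fst z (\<beta> i) \<in> carrier (S (\<beta> i))" using \<beta>(1)[OF True] by (simp add: mod_sum_simps PiE_iff)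
      moreover have "hh (\<beta> i) ` carrier (S (\<beta> i)) = H i" using hh[OF \<beta>(1)[OF True]] \<beta>(2)[OF True] by (simp add: bij_betw_def)
      ultimately show ?thesis using True by (simp add: comp_def image_iff) blast
    next
      case False
      have "snd z \<in> carrier Q" using z by (simp add: mod_prod_simps mem_Times_iff)
      moreover have "submodule (H i) R T" using ds i by (simp add: internal_direct_sum_def)
      ultimately show ?thesis using T.submoduleD(5)[OF \<open>submodule (H i) R T\<close> gq(1) xH[OF i]] False by (simp add: comp_def)
    qed
  qed
  define \<Phi> where "\<Phi> z = (\<Oplus>\<^bsub>T\<^esub>i\<in>{..<N}. comp i z)" for z
  have \<Phi>: "\<Phi> \<in> mod_hom R ?Z T"
    unfolding \<Phi>_def[abs_def] by (rule mod_hom_sum[OF lZ T finite_lessThan]) (use homc in auto)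
  have \<pi>\<Phi>: "\<pi> i (\<Phi> z) = comp i z" if "i < N" "z \<in> carrier ?Z" for i z
    unfolding \<Phi>_def using \<pi>(4)[of "\<lambda>i. comp i z" i] cH that by (auto simp: Pi_iff)
  have inj: "inj_on \<Phi> (carrier ?Z)"
  proof (rule mod_hom_inj_onI[OF lZ T \<Phi>])
    fix z assume z: "z \<in> carrier ?Z" and \<Phi>0: "\<Phi> z = \<zero>\<^bsub>T\<^esub>"
    have c0: "comp i z = \<zero>\<^bsub>T\<^esub>" if "i < N" for i
      using \<pi>\<Phi>[OF that z] \<Phi>0 mod_hom_zero[OF T T \<pi>(1)] that by simp
    obtain v q where vq: "z = (v, q)" "v \<in> carrier ?M" "q \<in> carrier Q" using z by (auto simp: mod_prod_simps)
    have v0: "v j = \<zero>\<^bsub>S j\<^esub>" if j: "j < t" for j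
    proof -
      interpret Sj: left_module R "S j" using lS j by simp
      have lH: "left_module R (sub_mod T (H (\<alpha> j)))" by (rule cyclic_genD(1)[OF xA[OF \<alpha>A(1)[OF j]]])
      have "hh j (v j) = \<zero>\<^bsub>T\<^esub>" using c0[OF \<alpha>A(2)[OF j]] \<alpha>A(1)[OF j] \<beta>\<alpha>[OF j] vq(1) by (simp add: comp_def)
      moreover have "hh j \<zero>\<^bsub>S j\<^esub> = \<zero>\<^bsub>T\<^esub>" using mod_hom_zero[OF Sj.left_module_axioms lH] hh[OF j] by simp
      moreover have "v j \<in> carrier (S j)" using vq(2) j by (auto simp: mod_sum_simps)
      ultimately show ?thesis using hh[OF j] by (auto simp: bij_betw_def inj_on_def)
    qed
    have v: "v = \<zero>\<^bsub>?M\<^esub>" using v0 vq(2) by (auto simp: mod_sum_simps PiE_iff extensional_def)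
    have "g q \<otimes> e m = \<zero>" if m: "m < N" for m
    proof (cases "m \<in> C")
      case True
      have "g q \<otimes> e m = g q \<otimes> (f \<otimes> e m)" using gq[OF vq(3)] f(1) m by (simp add: m_assoc[symmetric])
      then show ?thesis using f(3)[OF m] True gq(1)[OF vq(3)] by simp
    next
      case False
      then obtain i where i: "i \<in> {..<N} - A" "m = idx i" using m idx(3) by blast
      have "g q \<odot>\<^bsub>T\<^esub> x i = \<zero>\<^bsub>T\<^esub>" using c0[of i] i vq(1) by (simp add: comp_def)
      then show ?thesis using cyclic_genD(6)[OF xB[OF i(1)] gq(1)[OF vq(3)]] i(2) by simp
    qed
    then have "g q = \<zero>" using nonzero_right[OF gq(1)[OF vq(3)]] by blast
    then have "q = \<zero>\<^bsub>Q\<^esub>"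
      using Q'(2) mod_hom_zero[OF Q(1) left_module_ideal_module[OF f(1)] Q'(1)] vq(3)
      by (auto simp: bij_betw_def inj_on_def)
    then show "z = \<zero>\<^bsub>?Z\<^esub>" using v vq(1) by (simp add: mod_prod_simps)
  qed
  have "y \<in> \<Phi> ` carrier ?Z" if y: "y \<in> carrier T" for y
  proof -
    have "\<exists>w\<in>carrier (S j). hh j w = \<pi> (\<alpha> j) y" if "j < t" for j
    proof -
      have "\<pi> (\<alpha> j) y \<in> hh j ` carrier (S j)" using hh[OF that] \<pi>(2)[OF _ y] \<alpha>A(2)[OF that] by (simp add: bij_betw_def)
      then show ?thesis by (metis imageE)
    qed
    then obtain w where w: "\<And>j. j < t \<Longrightarrow> w j \<in> carrier (S j) \<and> hh j (w j) = \<pi> (\<alpha> j) y" by metis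
    have "\<exists>l\<in>carrier R. \<pi> i y = l \<odot>\<^bsub>T\<^esub> x i" if "i \<in> {..<N} - A" for i
      using cyclic_genD(5)[OF xB[OF that], of "\<pi> i y"] \<pi>(2)[OF _ y] that by simp
    then obtain l where l: "\<And>i. i \<in> {..<N} - A \<Longrightarrow> l i \<in> carrier R \<and> \<pi> i y = l i \<odot>\<^bsub>T\<^esub> x i" by metis
    \<comment> \<open>All projective coordinates of y packed into one ring element. Since idx is
      injective outside A, multiplying by e_(idx i) isolates the coefficient l_i; since idx avoids C
      there, r lies in R f.\<close>
    define r where "r = (\<Oplus>i\<in>{..<N} - A. l i \<otimes> e (idx i))"
    have le: "(\<lambda>i. l i \<otimes> e (idx i)) \<in> ({..<N} - A) \<rightarrow> carrier R" using l idx(1) by auto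
    have rR: "r \<in> carrier R" unfolding r_def by (rule finsum_closed[OF le])
    have "r \<otimes> f = (\<Oplus>i\<in>{..<N} - A. l i \<otimes> e (idx i) \<otimes> f)"
      unfolding r_def by (rule finsum_ldistr) (use f(1) le in auto)
    also have "\<dots> = r"
      unfolding r_def
    proof (rule finsum_cong'[OF refl le])
      fix i assume i: "i \<in> {..<N} - A"
      have "idx i \<notin> C" using idx(3) i by blast
      then show "l i \<otimes> e (idx i) \<otimes> f = l i \<otimes> e (idx i)" using f(1,4) l[OF i] idx(1) i by (simp add: m_assoc)
    qed
    finally have "r \<in> carrier (ideal_module R f)" by (rule ideal_module_memI[OF rR])
    then have "r \<in> g ` carrier Q" using Q'(2) unfolding bij_betw_def by blast
    then obtain q where q: "q \<in> carrier Q" "g q = r" by (metis imageE)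
    have re: "r \<otimes> e (idx i) = l i \<otimes> e (idx i)" if i: "i \<in> {..<N} - A" for i
    proof -
      have "r \<otimes> e (idx i) = (\<Oplus>k\<in>{..<N} - A. l k \<otimes> e (idx k) \<otimes> e (idx i))"
        unfolding r_def by (rule finsum_ldistr) (use idx(1) i le in auto)
      also have "\<dots> = (\<Oplus>k\<in>{..<N} - A. if i = k then l k \<otimes> e (idx k) else \<zero>)"
      proof (rule finsum_cong'[OF refl])
        show "(\<lambda>k. if i = k then l k \<otimes> e (idx k) else \<zero>) \<in> ({..<N} - A) \<rightarrow> carrier R" using le by auto
        fix k assume k: "k \<in> {..<N} - A"
        have lk: "l k \<in> carrier R" using l[OF k] by simp
        show "l k \<otimes> e (idx k) \<otimes> e (idx i) = (if i = k then l k \<otimes> e (idx k) else \<zero>)"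
        proof (cases "i = k")
          case False
          then have "idx k \<noteq> idx i" using inj_onD[OF idx(2), of k i] i k by blast
          then show ?thesis using False lk e_orth idx(1) i k by (simp add: m_assoc)
        qed (use lk idx(1) k in \<open>simp add: m_assoc\<close>)
      qed
      also have "\<dots> = l i \<otimes> e (idx i)" by (rule add.finprod_singleton[OF i _ le]) simp
      finally show ?thesis .
    qed
    define z where "z = (restrict w {..<t}, q)"
    have z: "z \<in> carrier ?Z" using w q(1) by (simp add: z_def mod_prod_simps mod_sum_simps)
    have "comp i z = \<pi> i y" if i: "i < N" for i
    proof (cases "i \<in> A")
      case True then show ?thesis using w[OF \<beta>(1)[OF True]] \<beta>[OF True] by (simp add: comp_def z_def)
    next
      case False
      then have iB: "i \<in> {..<N} - A" using i by simp
      have "r \<odot>\<^bsub>T\<^esub> x i = (r \<otimes> e (idx i)) \<odot>\<^bsub>T\<^esub> x i" using rR ex[OF i] xT[OF i] idx(1)[OF i] by (simp add: T.smult_assoc1)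
      also have "\<dots> = \<pi> i y" using l[OF iB] ex[OF i] xT[OF i] idx(1)[OF i] by (simp add: re[OF iB] T.smult_assoc1)
      finally show ?thesis using False q(2) by (simp add: comp_def z_def)
    qed
    then have "\<Phi> z = (\<Oplus>\<^bsub>T\<^esub>i\<in>{..<N}. \<pi> i y)"
      unfolding \<Phi>_def using \<pi>(1) y mod_homD(1) by (intro T.M.finsum_cong') fastforce+
    then have "\<Phi> z = y" using \<pi>(3)[OF y] by simp
    then show ?thesis using z by blast
  qed
  then have "\<Phi> ` carrier ?Z = carrier T" using mod_homD(1)[OF \<Phi>] by blast
  then have "mod_iso R ?Z T" using \<Phi> inj unfolding mod_iso_def bij_betw_def by blast
  then show ?thesis by (rule mod_iso_sym[OF lZ])
qed

text \<open>Four facts about indices are combined: the summands number N, the arrow from a simple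
  summand determines it, no top of a summand is the target of such an arrow, and the remaining tops
  are counted. \<open>C\<close> is the set of indices of the simple modules \<tau> S_j.\<close>

lemma (in nak_algebra) tau_tilting_form:
  assumes reg_sum: "internal_direct_sum R (regular_module R) {..<N} (\<lambda>i. carrier (ideal_module R (e i)))"
    and reg_ind: "\<And>i. i < N \<Longrightarrow> indecomposable_module R (ideal_module R (e i))"
    and reg_ni: "\<And>i l. \<lbrakk>i < N; l < N; i \<noteq> l\<rbrakk> \<Longrightarrow> \<not> mod_iso R (ideal_module R (e i)) (ideal_module R (e l))"
    and tilting: "tau_tilting k \<phi> E R T" and basic: "basic_module R T"
  shows "\<exists>(t::nat) (S :: nat \<Rightarrow> 'a fg_mod) (P :: 'a fg_mod) p (Q :: 'a fg_mod).
    2 * t \<le> N \<and> (\<forall>j<t. simple_module R (S j)) \<and> projective_cover R P p (tau k \<phi> E R (mod_sum {..<t} S)) \<and>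
    left_module R Q \<and> mod_iso R (regular_module R) (mod_prod P Q) \<and> mod_iso R T (mod_prod (mod_sum {..<t} S) Q)"
proof -
  have rigid: "tau_rigid k \<phi> E R T" and num: "num_summands R T = num_summands R (regular_module R)"
    using tilting by (simp_all add: tau_tilting_def)
  have fg: "fg_module R T" using rigid by (simp add: tau_rigid_def)
  then have lT: "left_module R T" by (simp add: fg_module_def)
  interpret T: nak_module R N e J T by (intro nak_module.intro nak_ring_axioms lT)
  interpret K: nak_module R N e J "regular_module R" by (intro nak_module.intro nak_ring_axioms reg)
  obtain m :: nat and H where H: "internal_direct_sum R T {..<m} H"
    "\<And>i. i < m \<Longrightarrow> indecomposable_module R (sub_mod T (H i))"
    "\<And>i l. \<lbrakk>i < m; l < m; i \<noteq> l\<rbrakk> \<Longrightarrow> \<not> mod_iso R (sub_mod T (H i)) (sub_mod T (H l))"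
    using basic by (auto simp: basic_module_def)
  have sm: "sub_mod (regular_module R) (carrier (ideal_module R (e i))) = ideal_module R (e i)" for i
    by (simp add: ideal_module_def)
  have "num_summands R (regular_module R) = N"
    by (rule K.num_summands_eq[OF fg_regular reg_sum, unfolded sm, OF reg_ind reg_ni])
  moreover have "num_summands R T = m" by (rule T.num_summands_eq[OF fg H])
  \<comment> \<open>The tilting condition enters here: T has as many indecomposable summands as
    there are idempotents, which makes the later cardinality argument exact.\<close>
  ultimately have m: "m = N" using num by simp
  note H = H[unfolded m]
  obtain \<pi> where \<pi>: "\<And>i. i \<in> {..<N} \<Longrightarrow> \<pi> i \<in> mod_hom R T T" "\<And>i x. \<lbrakk>i \<in> {..<N}; x \<in> carrier T\<rbrakk> \<Longrightarrow> \<pi> i x \<in> H i"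
    "\<And>i x. \<lbrakk>i \<in> {..<N}; x \<in> H i\<rbrakk> \<Longrightarrow> \<pi> i x = x"
    by (rule direct_sum_projections[OF lT H(1)]) blast
  have HT: "H i \<subseteq> carrier T" and lH: "left_module R (sub_mod T (H i))" if "i < N" for i
    using T.submoduleD(1)[of "H i"] T.left_module_sub_mod[of "H i"] H(1) that by (auto simp: internal_direct_sum_def)
  have \<pi>H: "\<pi> i \<in> mod_hom R T (sub_mod T (H i))" if "i < N" for i
    by (rule mod_hom_into_sub[OF \<pi>(1)]) (use \<pi>(2) that in auto)
  have "\<exists>a x. a < N \<and> (cyclic_gen R (e a) {\<zero>} (sub_mod T (H i)) x \<or> good a \<and> cyclic_gen R (e a) J (sub_mod T (H i)) x)"
    if i: "i < N" for i
  proof -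
    interpret X: nak_module R N e J "sub_mod T (H i)" by (intro nak_module.intro nak_ring_axioms lH i)
    have "\<pi> i ` carrier T = carrier (sub_mod T (H i))"
    proof
      show "carrier (sub_mod T (H i)) \<subseteq> \<pi> i ` carrier T"
      proof
        fix y assume "y \<in> carrier (sub_mod T (H i))"
        then show "y \<in> \<pi> i ` carrier T" using \<pi>(3)[of i y] HT[OF i] i by (intro image_eqI[of _ _ y]) auto
      qed
    qed (use \<pi>(2) i in auto)
    then have "fg_module R (sub_mod T (H i))" by (rule fg_surj[OF lH[OF i] fg \<pi>H[OF i]])
    from X.indecomposable_cyclic_gen[OF this H(2)[OF i]] show ?thesis by blast
  qed
  then obtain idx x where idx: "\<And>i. i < N \<Longrightarrow> idx i < N"
    and x: "\<And>i. i < N \<Longrightarrow> cyclic_gen R (e (idx i)) {\<zero>} (sub_mod T (H i)) (x i) \<or>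
      good (idx i) \<and> cyclic_gen R (e (idx i)) J (sub_mod T (H i)) (x i)" by metis
  \<comment> \<open>The summands that are simple and not projective; outside A the summand is R
    e_(idx i).\<close>
  define A where "A = {i. i < N \<and> good (idx i) \<and> cyclic_gen R (e (idx i)) J (sub_mod T (H i)) (x i)}"
  have AN: "A \<subseteq> {..<N}" by (auto simp: A_def)
  have xA: "cyclic_gen R (e (idx i)) J (sub_mod T (H i)) (x i)" if "i \<in> A" for i using that by (simp add: A_def)
  have xB: "cyclic_gen R (e (idx i)) {\<zero>} (sub_mod T (H i)) (x i)" if "i \<in> {..<N} - A" for i
    using x[of i] that by (auto simp: A_def)
  have same: "i = l" if "i < N" "l < N" "idx i = idx l"
    and cg: "cyclic_gen R (e (idx i)) I (sub_mod T (H i)) (x i)" "cyclic_gen R (e (idx l)) I (sub_mod T (H l)) (x l)" for i l I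
  proof (rule ccontr)
    assume "i \<noteq> l"
    moreover have "mod_iso R (sub_mod T (H i)) (sub_mod T (H l))"
      using cyclic_gen_hom[OF cg(1) cg(2)[folded \<open>idx i = idx l\<close>] subset_refl] unfolding mod_iso_def by blast
    ultimately show False using H(3) that(1,2) by blast
  qed
  have idxA: "inj_on idx A"
  proof (rule inj_onI)
    fix i l assume il: "i \<in> A" "l \<in> A" "idx i = idx l"
    have "i < N" "l < N" using il AN by blast+
    then show "i = l" by (rule same[OF _ _ il(3) xA[OF il(1)] xA[OF il(2)]])
  qed
  have idxB: "inj_on idx ({..<N} - A)"
  proof (rule inj_onI)
    fix i l assume il: "i \<in> {..<N} - A" "l \<in> {..<N} - A" "idx i = idx l"
    have "i < N" "l < N" using il by blast+
    then show "i = l" by (rule same[OF _ _ il(3) xB[OF il(1)] xB[OF il(2)]])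
  qed
  have "\<exists>c u. c < N \<and> u \<in> J \<and> e c \<otimes> u = u \<and> u \<otimes> e (idx i) = u \<and> u \<noteq> \<zero>" if i: "i \<in> A" for i
  proof -
    have a: "idx i < N" "good (idx i)" using i idx by (auto simp: A_def)
    obtain v where v: "v \<in> J" "v \<otimes> e (idx i) \<noteq> \<zero>" using a(2) by (auto simp: good_def)
    have vR: "v \<in> carrier R" using v J_D by simp
    obtain c where c: "c < N" "e c \<otimes> (v \<otimes> e (idx i)) \<noteq> \<zero>" using nonzero_left[OF _ v(2)] vR a(1) by auto
    have "e c \<otimes> (v \<otimes> e (idx i)) \<in> J" using J_D(4,5) v(1) c(1) a(1) by simp
    moreover have "e c \<otimes> (e c \<otimes> (v \<otimes> e (idx i))) = e c \<otimes> (v \<otimes> e (idx i))"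
      using vR c(1) a(1) by (simp add: m_assoc[symmetric])
    moreover have "e c \<otimes> (v \<otimes> e (idx i)) \<otimes> e (idx i) = e c \<otimes> (v \<otimes> e (idx i))"
      using vR c(1) a(1) by (simp add: m_assoc)
    ultimately show ?thesis using c by blast
  qed
  then obtain c u where cu: "\<And>i. i \<in> A \<Longrightarrow> c i < N \<and> u i \<in> J \<and> e (c i) \<otimes> u i = u i \<and> u i \<otimes> e (idx i) = u i \<and> u i \<noteq> \<zero>"
    by metis
  \<comment> \<open>e_c J is generated on the right by each of its nonzero elements. If two arrows
    from different indices ended at the same c, one would be the other times an element of an
    off-diagonal corner, that is, a product of two radical elements.\<close>
  have cA: "inj_on c A"
  proof (rule inj_onI)
    fix i l assume il: "i \<in> A" "l \<in> A" "c i = c l"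
    have iN: "i < N" "l < N" using il AN by auto
    note U = cu[OF il(1)] and V = cu[OF il(2)]
    obtain a where a: "a \<in> carrier R" "u l = u i \<otimes> a"
      using right_uni[of "c i" "u i" "u l"] U V il(3) by auto
    have uR: "u i \<in> carrier R" using U J_D by simp
    have "idx i = idx l"
    proof (rule ccontr)
      assume n: "idx i \<noteq> idx l"
      have "u l = u i \<otimes> e (idx i) \<otimes> a \<otimes> e (idx l)" using U V a by simp
      also have "\<dots> = u i \<otimes> (e (idx i) \<otimes> a \<otimes> e (idx l))" using uR a(1) idx iN by (simp add: m_assoc)
      also have "\<dots> = \<zero>" using JJ[OF _ offdiag[OF a(1) idx[OF iN(1)] idx[OF iN(2)] n]] U by simp
      finally show False using V by simp
    qed
    then show "i = l" using inj_onD[OF idxA] il by blast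
  qed
  obtain P1 d P0 p where pr: "nak_presentation R N e J k \<phi> E \<iota> T P1 d P0 p (tau k \<phi> E R T) (dual_ev R P1 d P0)"
    using tau_presentation[OF fg] by blast
  interpret Z: nak_presentation R N e J k \<phi> E \<iota> T P1 d P0 p "tau k \<phi> E R T" "dual_ev R P1 d P0" by (rule pr)
  \<comment> \<open>Otherwise T projects onto H_l, whose top is \<tau> of the simple summand H_i,
    and that simple module embeds into \<tau> T: a nonzero map against rigidity. The index l runs
    over all summands, the simple ones included, and it is this that yields the bound on t.\<close>
  have disj: "idx l \<noteq> c i" if i: "i \<in> A" and l: "l < N" for i l
  proof
    assume eq: "idx l = c i"
    have iN: "i < N" using i AN by auto
    note U = cu[OF i] and gi = cyclic_genD[OF xA[OF i]]
    have xi: "x i \<in> H i" "x i \<in> carrier T" using gi(2) HT[OF iN] by auto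
    have Jx: "j \<odot>\<^bsub>T\<^esub> y = \<zero>\<^bsub>T\<^esub>" if "j \<in> J" "y \<in> H i" for j y
      using cyclic_J_zero[OF xA[OF i] idx[OF iN] that(1), of y] that(2) by simp
    have x0: "x i \<noteq> \<zero>\<^bsub>T\<^esub>"
    proof
      assume "x i = \<zero>\<^bsub>T\<^esub>"
      then have "\<one> \<odot>\<^bsub>T\<^esub> x i = \<zero>\<^bsub>T\<^esub>" by simp
      then show False using gi(6)[of \<one>] e_notin[OF idx[OF iN]] idx[OF iN] by simp
    qed
    have "\<exists>I. cyclic_gen R (e (idx l)) I (sub_mod T (H l)) (x l) \<and> I \<subseteq> J" using x[OF l] J_D(2) by blast
    then obtain I where I: "cyclic_gen R (e (c i)) I (sub_mod T (H l)) (x l)" "I \<subseteq> J" unfolding eq by blast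
    have xl: "x l \<in> H l" "x l \<in> carrier T" using cyclic_genD(2)[OF I(1)] HT[OF l] by auto
    have "\<exists>f\<in>mod_hom R T (tau k \<phi> E R T). f (x l) \<noteq> \<zero>\<^bsub>tau k \<phi> E R T\<^esub>"
    proof (rule Z.nonzero_hom[where a = "idx i" and c = "c i" and s = "x i" and u = "u i" and
          X = "sub_mod T (H i)" and \<pi> = "\<pi> i" and Z = "sub_mod T (H l)" and I = I and z = "x l" and \<rho> = "\<pi> l"])
      show "\<pi> i (x i) \<noteq> \<zero>\<^bsub>sub_mod T (H i)\<^esub>" using \<pi>(3)[of i "x i"] iN xi(1) x0 by simp
      show "\<pi> l (x l) = x l" using \<pi>(3) l xl(1) by simp
      show "e (idx i) \<odot>\<^bsub>T\<^esub> x i = x i" using gi(3) by simp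
    qed (use idx[OF iN] U xi xl Jx lH[OF iN] \<pi>H iN l I in auto)
    then show False using rigid xl(2) by (auto simp: tau_rigid_def)
  qed
  define C where "C = c ` A"
  have fA: "finite A" using AN finite_subset by blast
  have C: "C \<subseteq> {..<N}" using cu by (auto simp: C_def)
  have cardC: "card C = card A" unfolding C_def by (rule card_image[OF cA])
  \<comment> \<open>The inclusion is \<open>disj\<close>; both sides have N minus the cardinality of
    A elements because idx is injective outside A and c is injective on A.\<close>
  have B: "idx ` ({..<N} - A) = {..<N} - C"
  proof (rule card_subset_eq)
    show "idx ` ({..<N} - A) \<subseteq> {..<N} - C" using idx disj by (auto simp: C_def)
    have "card (idx ` ({..<N} - A)) = N - card A" using card_image[OF idxB] card_Diff_subset[OF fA AN] by simp
    also have "\<dots> = card ({..<N} - C)" using card_Diff_subset[OF _ C] cardC fA by (simp add: C_def)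
    finally show "card (idx ` ({..<N} - A)) = card ({..<N} - C)" .
  qed simp
  \<comment> \<open>The tops of the simple summands and the indices in C are disjoint sets of the
    same size inside N indices.\<close>
  have "card (idx ` A \<union> C) \<le> card {..<N}" using idx AN C by (intro card_mono) auto
  moreover have "card (idx ` A \<union> C) = card (idx ` A) + card C"
    using fA disj AN by (intro card_Un_disjoint) (auto simp: C_def)
  ultimately have two: "2 * card A \<le> N" using card_image[OF idxA] cardC by simp
  define t where "t = card A"
  obtain \<alpha> where \<alpha>: "bij_betw \<alpha> {..<t} A"
    using ex_bij_betw_nat_finite[OF fA] by (auto simp: t_def atLeast0LessThan)
  have \<alpha>A: "\<alpha> j \<in> A" "\<alpha> j < N" if "j < t" for j using \<alpha> AN that by (auto simp: bij_betw_def)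
  have "\<exists>(S :: 'a fg_mod) s. cyclic_gen R (e (idx (\<alpha> j))) J S s" if "j < t" for j
    by (rule simple_exists[OF idx[OF \<alpha>A(2)[OF that]]])
  then obtain S :: "nat \<Rightarrow> 'a fg_mod" and s where S: "\<And>j. j < t \<Longrightarrow> cyclic_gen R (e (idx (\<alpha> j))) J (S j) (s j)" by metis
  have simp: "simple_module R (S j)" if "j < t" for j by (rule cyclic_J_simple[OF S[OF that] idx[OF \<alpha>A(2)[OF that]]])
  have inj: "inj_on (\<lambda>j. c (\<alpha> j)) {..<t}" using comp_inj_on[of \<alpha> "{..<t}" c] \<alpha> cA by (simp add: bij_betw_def comp_def)
  have im: "(\<lambda>j. c (\<alpha> j)) ` {..<t} = C" using \<alpha> by (auto simp: C_def bij_betw_def)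
  have "\<exists>(P :: 'a fg_mod) p h. projective_cover R P p (tau k \<phi> E R (mod_sum {..<t} S)) \<and> left_module R P \<and>
    h \<in> mod_hom R P (ideal_module R (\<Oplus>l\<in>(\<lambda>j. c (\<alpha> j)) ` {..<t}. e l)) \<and>
    bij_betw h (carrier P) (carrier (ideal_module R (\<Oplus>l\<in>(\<lambda>j. c (\<alpha> j)) ` {..<t}. e l)))"
    by (rule semisimple_tau_cover[OF _ _ inj S, where u = "\<lambda>j. u (\<alpha> j)"]) (use idx \<alpha>A cu in auto)
  then obtain P :: "'a fg_mod" and q h where P: "projective_cover R P q (tau k \<phi> E R (mod_sum {..<t} S))" "left_module R P"
    "h \<in> mod_hom R P (ideal_module R (\<Oplus>l\<in>C. e l))" "bij_betw h (carrier P) (carrier (ideal_module R (\<Oplus>l\<in>C. e l)))"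
    unfolding im by blast
  note \<epsilon> = idem_sum[OF C] and f = complementary_idem[OF C]
  have "fg_module R (ideal_module R (\<one> \<ominus> (\<Oplus>l\<in>C. e l)))"
    using projective_ideal_module[OF f(1,2)] by (simp add: projective_module_def)
  from fg_representative_iso[OF this]
  obtain Q :: "'a fg_mod" and g where Q: "left_module R Q" "g \<in> mod_hom R Q (ideal_module R (\<one> \<ominus> (\<Oplus>l\<in>C. e l)))"
    "bij_betw g (carrier Q) (carrier (ideal_module R (\<one> \<ominus> (\<Oplus>l\<in>C. e l))))" by blast
  have "mod_iso R (regular_module R) (mod_prod P Q)" by (rule regular_split[OF \<epsilon>(1,4) P(2-4) Q])
  moreover have "mod_iso R T (mod_prod (mod_sum {..<t} S) Q)"
    by (rule simples_and_projectives_iso[OF lT H(1) \<alpha> AN S xA xB idx idxB B C Q])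
  ultimately show ?thesis using two simp P(1) Q(1) unfolding t_def by blast
qed

theorem theorem1:
  fixes k :: "('k, 'm) ring_scheme" and \<phi> :: "'k \<Rightarrow> 'a" and \<Lambda> :: "('a, 'n) ring_scheme"
    and E :: "('k, 'e) module" and \<iota> :: "'k set \<Rightarrow> 'e" and n :: nat
  assumes algebra: "artin_algebra k \<phi> \<Lambda>"
    and envelope:
      "injective_envelope k (quotient_module (regular_module k) (jacobson_radical k)) \<iota> E"
    and basic: "basic_ring \<Lambda>"
    and connected: "connected_ring \<Lambda>"
    and non_semisimple: "\<not> semisimple_ring \<Lambda>"
    and nakayama: "nakayama \<Lambda>"
    and rad_square_zero:
      "\<And>x y. x \<in> jacobson_radical \<Lambda> \<Longrightarrow> y \<in> jacobson_radical \<Lambda> \<Longrightarrow> x \<otimes>\<^bsub>\<Lambda>\<^esub> y = \<zero>\<^bsub>\<Lambda>\<^esub>"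
    and not_self_injective_local: "\<not> (self_injective \<Lambda> \<and> local_ring \<Lambda>)"
    and n: "n = num_simple_modules \<Lambda>"
  shows
    "(\<forall>M :: ('a, 'b) module.
        fg_module \<Lambda> M \<and> indecomposable_module \<Lambda> M \<longrightarrow> tau_rigid k \<phi> E \<Lambda> M) \<and>
     (\<forall>T :: ('a, 'c) module.
        tau_tilting k \<phi> E \<Lambda> T \<and> basic_module \<Lambda> T \<longrightarrow>
        (\<exists>(t::nat) (S :: nat \<Rightarrow> 'a fg_mod) (P :: 'a fg_mod) p (Q :: 'a fg_mod).
           int t \<le> \<lfloor>real n / 2\<rfloor> \<and>
           (\<forall>j<t. simple_module \<Lambda> (S j)) \<and>
           projective_cover \<Lambda> P p (tau k \<phi> E \<Lambda> (mod_sum {..<t} S)) \<and>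
           left_module \<Lambda> Q \<and>
           mod_iso \<Lambda> (regular_module \<Lambda>) (mod_prod P Q) \<and>
           mod_iso \<Lambda> T (mod_prod (mod_sum {..<t} S) Q)))"
proof -
  interpret ring \<Lambda> using algebra by (simp add: artin_algebra_def)
  have serial: "left_serial \<Lambda>" "left_serial (opp_ring \<Lambda>)" using nakayama by (simp_all add: nakayama_def)
  obtain N e where si: "serial_idem \<Lambda> N e"
    and reg_sum: "internal_direct_sum \<Lambda> (regular_module \<Lambda>) {..<N} (\<lambda>i. carrier (ideal_module \<Lambda> (e i)))"
    by (rule serial_idem_exists[OF basic serial(1)])
  interpret S: serial_idem \<Lambda> N e by (rule si)
  \<comment> \<open>The abstract ideal J of the preceding arguments becomes the radical computed
    from the idempotents, which is the Jacobson radical; this is where the square zero condition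
    enters.\<close>
  interpret I: idem_ring \<Lambda> N e S.radical by (rule S.idem_ring_radical[OF rad_square_zero])
  interpret nak_algebra \<Lambda> N e S.radical k \<phi> E \<iota>
    by (intro nak_algebra.intro nak_algebra_axioms.intro I.nak_ringI[OF S.us serial(2)] algebra envelope)
  have nN: "n = N" using n num_simple_modules_eq by simp
  note nl = no_loop[OF connected not_self_injective_local]
  show ?thesis
  proof (intro conjI allI impI)
    fix M :: "('a, 'b) module"
    assume "fg_module \<Lambda> M \<and> indecomposable_module \<Lambda> M"
    then show "tau_rigid k \<phi> E \<Lambda> M" using indecomposable_tau_rigid[OF nl] by blast
  next
    fix T :: "('a, 'c) module"
    assume "tau_tilting k \<phi> E \<Lambda> T \<and> basic_module \<Lambda> T"
    then obtain t and S :: "nat \<Rightarrow> 'a fg_mod" and P :: "'a fg_mod" and p and Q :: "'a fg_mod"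
      where t: "2 * t \<le> N" and *: "\<forall>j<t. simple_module \<Lambda> (S j)" "projective_cover \<Lambda> P p (tau k \<phi> E \<Lambda> (mod_sum {..<t} S))"
        "left_module \<Lambda> Q" "mod_iso \<Lambda> (regular_module \<Lambda>) (mod_prod P Q)" "mod_iso \<Lambda> T (mod_prod (mod_sum {..<t} S) Q)"
      using tau_tilting_form[OF reg_sum S.ind S.non_iso] by blast
    have "int t \<le> \<lfloor>real n / 2\<rfloor>" using t by (simp add: le_floor_iff nN)
    then show "\<exists>(t::nat) (S :: nat \<Rightarrow> 'a fg_mod) (P :: 'a fg_mod) p (Q :: 'a fg_mod).
           int t \<le> \<lfloor>real n / 2\<rfloor> \<and> (\<forall>j<t. simple_module \<Lambda> (S j)) \<and>
           projective_cover \<Lambda> P p (tau k \<phi> E \<Lambda> (mod_sum {..<t} S)) \<and> left_module \<Lambda> Q \<and>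
           mod_iso \<Lambda> (regular_module \<Lambda>) (mod_prod P Q) \<and> mod_iso \<Lambda> T (mod_prod (mod_sum {..<t} S) Q)"
      using * by blast
  qed
qed

end
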